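(* Let $n\ge1$, $p\in(1,+\infty)$, $s\in(0,1)$, and let $\Omega\subset\mathbb{R}^n$ be a bounded open set. Let $a:\Omega\times\mathbb{R}\times\mathbb{R}^n\to\mathbb{R}^n$ and $F:\Omega\times\mathbb{R}\times\mathbb{R}^n\to\mathbb{R}$ be Carathéodory functions such that: (1) there exists $\beta>0$ with $|a(x,\sigma,\xi)|\le\beta(|\sigma|^{p-1}+|\xi|^{p-1})$; (2) there exists $\alpha>0$ with $a(x,\sigma,\xi)\cdot\xi\ge\alpha|\xi|^p$ for all $\xi\in\mathbb{R}^n$; (3) $(a(x,\sigma,\xi)-a(x,\sigma,\eta))\cdot(\xi-\eta)>0$ for all $\xi\neq\eta$; (4) there exists $f\in L^{p'}(\Omega)$, $p'=p/(p-1)$, with $|F(x,\sigma,\eta)|\le f(x)$. Then there exists $u\in\mathcal{X}^{1,p}(\Omega)$ which is a weak solution of $$-\mathrm{div}(a(x,u,\nabla u))+(-\Delta)^s_p u=F(x,u,\nabla u)\text{ in }\Omega,\qquad u=0\text{ in }\mathbb{R}^n\setminus\Omega,$$ i.e. for every $\varphi\in\mathcal{X}^{1,p}(\Omega)$, $$\int_\Omega a(x,u,\nabla u)\cdot\nabla\varphi\,dx+\iint_{\mathbb{R}^{2n}}\frac{|u(x)-u(y)|^{p-2}(u(x)-u(y))(\varphi(x)-\varphi(y))}{|x-y|^{n+ps}}\,dx\,dy=\int_\Omega F(x,u,\nabla u)\varphi\,dx.$$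
   Context: $\mathcal{X}^{1,p}(\Omega)=\{u\in W^{1,p}(\mathbb{R}^n): u|_\Omega\in W^{1,p}_0(\Omega),\ u=0\text{ a.e. in }\mathbb{R}^n\setminus\Omega\}$, the closure of $C_0^\infty(\Omega)$ in $W^{1,p}(\mathbb{R}^n)$. The fractional $p$-Laplacian $(-\Delta)^s_p$ is taken without normalization constant and understood in the weak sense given in the claim. *)

theory Defs
  imports "HOL-Analysis.Analysis"
begin

definition partial_deriv :: "(real^'n \<Rightarrow> real) \<Rightarrow> 'n \<Rightarrow> real^'n \<Rightarrow> real" where
  "partial_deriv f i x = frechet_derivative f (at x) (axis i 1)"

fun iter_partial :: "'n list \<Rightarrow> (real^'n \<Rightarrow> real) \<Rightarrow> (real^'n \<Rightarrow> real)" where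
  "iter_partial [] f = f"
| "iter_partial (i # is) f = iter_partial is (partial_deriv f i)"

definition smooth_fun :: "(real^'n \<Rightarrow> real) \<Rightarrow> bool" where
  "smooth_fun f \<longleftrightarrow> (\<forall>is x. iter_partial is f differentiable (at x))"

definition test_fun :: "(real^'n) set \<Rightarrow> (real^'n \<Rightarrow> real) \<Rightarrow> bool" where
  "test_fun \<Omega> f \<longleftrightarrow> smooth_fun f \<and> compact (closure {x. f x \<noteq> 0})
      \<and> closure {x. f x \<noteq> 0} \<subseteq> \<Omega>"

definition grad :: "(real^'n \<Rightarrow> real) \<Rightarrow> real^'n \<Rightarrow> real^'n" where
  "grad f x = (\<chi> i. partial_deriv f i x)"

definition Lp :: "real \<Rightarrow> (real^'n \<Rightarrow> real) \<Rightarrow> bool" where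
  "Lp p u \<longleftrightarrow> u \<in> borel_measurable lebesgue \<and> integrable lebesgue (\<lambda>x. \<bar>u x\<bar> powr p)"

definition Lp_vec :: "real \<Rightarrow> (real^'n \<Rightarrow> real^'n) \<Rightarrow> bool" where
  "Lp_vec p g \<longleftrightarrow> g \<in> borel_measurable lebesgue \<and> integrable lebesgue (\<lambda>x. norm (g x) powr p)"

definition weak_grad :: "(real^'n \<Rightarrow> real) \<Rightarrow> (real^'n \<Rightarrow> real^'n) \<Rightarrow> bool" where
  "weak_grad u g \<longleftrightarrow>
     (\<forall>\<phi>. test_fun UNIV \<phi> \<longrightarrow>
        (\<forall>i. integrable lebesgue (\<lambda>x. u x * partial_deriv \<phi> i x)
           \<and> integrable lebesgue (\<lambda>x. g x $ i * \<phi> x)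
           \<and> (LINT x|lebesgue. u x * partial_deriv \<phi> i x) = - (LINT x|lebesgue. g x $ i * \<phi> x)))"

definition W1p :: "real \<Rightarrow> (real^'n \<Rightarrow> real) \<Rightarrow> (real^'n \<Rightarrow> real^'n) \<Rightarrow> bool" where
  "W1p p u g \<longleftrightarrow> Lp p u \<and> Lp_vec p g \<and> weak_grad u g"

definition X1p :: "real \<Rightarrow> (real^'n) set \<Rightarrow> (real^'n \<Rightarrow> real) \<Rightarrow> (real^'n \<Rightarrow> real^'n) \<Rightarrow> bool" where
  "X1p p \<Omega> u g \<longleftrightarrow> W1p p u g \<and>
     (\<exists>\<phi> :: nat \<Rightarrow> real^'n \<Rightarrow> real. (\<forall>k. test_fun \<Omega> (\<phi> k))
        \<and> (\<lambda>k. LINT x|lebesgue. \<bar>\<phi> k x - u x\<bar> powr p) \<longlonglongrightarrow> 0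
        \<and> (\<lambda>k. LINT x|lebesgue. norm (grad (\<phi> k) x - g x) powr p) \<longlonglongrightarrow> 0)"

definition caratheodory :: "(real^'n) set \<Rightarrow> (real^'n \<Rightarrow> real \<Rightarrow> real^'n \<Rightarrow> 'b::euclidean_space) \<Rightarrow> bool" where
  "caratheodory \<Omega> a \<longleftrightarrow>
     (\<forall>\<sigma> \<xi>. set_borel_measurable lebesgue \<Omega> (\<lambda>x. a x \<sigma> \<xi>))
     \<and> (AE x in lebesgue. x \<in> \<Omega> \<longrightarrow> continuous_on UNIV (\<lambda>z. a x (fst z) (snd z)))"

definition frac_integrand :: "real \<Rightarrow> real \<Rightarrow> (real^'n \<Rightarrow> real) \<Rightarrow> (real^'n \<Rightarrow> real) \<Rightarrow> (real^'n) \<times> (real^'n) \<Rightarrow> real" where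
  "frac_integrand p s u \<phi> z = (let x = fst z; y = snd z in
      \<bar>u x - u y\<bar> powr (p - 2) * (u x - u y) * (\<phi> x - \<phi> y)
        / norm (x - y) powr (real CARD('n) + p * s))"

end

theory Submission
  imports Defs "HOL-Complex_Analysis.Great_Picard"
begin

text \<open>
  The solution is a limit of Galerkin approximations \<open>u_m\<close>, which exist by a Brouwer-type argument and
  coercivity and are bounded in \<open>W^{1,p}\<close> by the Poincare inequality. By Rellich, \<open>u_m\<close> converges strongly
  in \<open>L^p\<close> to some \<open>u\<close>; no weak compactness is used, since a Mazur argument based on uniform convexity
  produces test functions converging strongly in \<open>W^{1,p}\<close> to \<open>(u, g)\<close>. Testing with them, the convexity of
  the fractional energy and Fatou give \<open>limsup\<close> of the integral of \<open>a(x, u_m, grad u_m) . (grad u_m - g)\<close>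
  at most 0. By strict monotonicity (Leray and Lions) the gradients then converge almost everywhere, and by
  coercivity their p-th powers are dominated along a subsequence, so the convergence is strong and the limit
  passes through all three integrals. Everything is phrased with integrals of p-th powers and Young's
  inequality, so that neither Hoelder's nor Minkowski's inequality is needed.
\<close>

section \<open>Integrable p-th powers\<close>

text \<open>The obstacle is \<open>F\<close>: it depends on the gradient without any monotonicity,
  so its limit can be identified only once the gradients converge strongly. Until then it enters
  only through \<open>f\<close> times differences of functions, which strong convergence in
  \<open>L^p\<close> makes small. A second obstacle is that the residual of \<open>u_m\<close> is
  known to vanish only against fixed elements of the Galerkin spaces, whereas the argument wants to
  test with \<open>u\<close>. Hence the Mazur sequence is sought among all test functions against
  which the residual vanishes in the limit: every \<open>u_l\<close> is one of them, and midpoints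
  stay in this class. Weak convergence of the gradients is still wanted at one place, against the
  fixed field \<open>a(x, u, g)\<close>; it comes from a second Mazur argument with a linear
  constraint, where closability of the gradient identifies the limit. The nonlocal seminorm is
  controlled by the \<open>W^{1,p}\<close> energy, so the fractional term is a continuous operator
  on the local space, and its convexity allows a comparison of energies where no limit is available
  yet.\<close>

definition LP :: "real \<Rightarrow> 'a measure \<Rightarrow> ('a \<Rightarrow> 'b::euclidean_space) \<Rightarrow> bool" where
  "LP p M f \<longleftrightarrow> f \<in> borel_measurable M \<and> integrable M (\<lambda>x. norm (f x) powr p)"

definition NP :: "real \<Rightarrow> 'a measure \<Rightarrow> ('a \<Rightarrow> 'b::euclidean_space) \<Rightarrow> real" where
  "NP p M f = (\<integral>x. norm (f x) powr p \<partial>M)"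

lemma NP_nonneg [simp]: "0 \<le> NP p M f"
  unfolding NP_def by (rule Bochner_Integration.integral_nonneg) simp

lemma LP_measurable [measurable_dest]: "LP p M f \<Longrightarrow> f \<in> borel_measurable M"
  by (simp add: LP_def)

lemma LP_integrable: "LP p M f \<Longrightarrow> integrable M (\<lambda>x. norm (f x) powr p)"
  by (simp add: LP_def)

lemma NP_cong_AE:
  assumes "f \<in> borel_measurable M" "g \<in> borel_measurable M" "AE x in M. f x = g x"
  shows "NP p M f = NP p M g"
  unfolding NP_def by (rule integral_cong_AE) (use assms in \<open>auto elim!: eventually_mono\<close>)

lemma LP_minorant:
  fixes f :: "'a \<Rightarrow> 'b::euclidean_space"
  assumes "f \<in> borel_measurable M" "integrable M H" "AE x in M. norm (f x) powr p \<le> H x"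
  shows "LP p M f"
proof -
  note [measurable] = assms(1)
  have "integrable M (\<lambda>x. norm (f x) powr p)"
    by (rule Bochner_Integration.integrable_bound[OF assms(2)])
       (use assms(3) in \<open>auto elim!: eventually_mono\<close>)
  with assms show ?thesis by (simp add: LP_def)
qed

text \<open>The sum is at most twice the maximum. The constant is not sharp, but it works for every
  positive exponent and makes \<open>NP\<close> a quasi-norm, which is enough for all limit
  arguments below.\<close>

lemma powr_add_le:
  fixes a b p :: real
  assumes "0 \<le> a" "0 \<le> b" "0 < p"
  shows "(a + b) powr p \<le> 2 powr p * (a powr p + b powr p)"
proof -
  have "(a + b) powr p \<le> (2 * max a b) powr p"
    using assms by (intro powr_mono2) auto
  also have "\<dots> = 2 powr p * (max a b) powr p"
    using assms by (simp add: powr_mult)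
  also have "\<dots> \<le> 2 powr p * (a powr p + b powr p)"
    by (intro mult_left_mono) (auto simp: max_def)
  finally show ?thesis .
qed

lemma norm_add_powr_le:
  fixes a b :: "'b::real_normed_vector"
  assumes "0 < p"
  shows "norm (a + b) powr p \<le> 2 powr p * (norm a powr p + norm b powr p)"
proof -
  have "norm (a + b) powr p \<le> (norm a + norm b) powr p"
    using assms by (intro powr_mono2 norm_triangle_ineq) auto
  also have "\<dots> \<le> 2 powr p * (norm a powr p + norm b powr p)"
    using assms by (intro powr_add_le) auto
  finally show ?thesis .
qed

lemma norm_diff_powr_le:
  fixes a b :: "'b::real_normed_vector"
  assumes "0 < p"
  shows "norm (a - b) powr p \<le> 2 powr p * (norm a powr p + norm b powr p)"
  using norm_add_powr_le[OF assms, of a "- b"] by simp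

lemma LP_add:
  assumes "0 < p" "LP p M f" "LP p M g"
  shows "LP p M (\<lambda>x. f x + g x)" "NP p M (\<lambda>x. f x + g x) \<le> 2 powr p * (NP p M f + NP p M g)"
proof -
  note [measurable] = LP_measurable[OF assms(2)] LP_measurable[OF assms(3)]
  have I: "integrable M (\<lambda>x. 2 powr p * (norm (f x) powr p + norm (g x) powr p))"
    using assms by (auto simp: LP_def)
  show *: "LP p M (\<lambda>x. f x + g x)"
    by (rule LP_minorant[OF _ I]) (auto simp: norm_add_powr_le assms)
  have "NP p M (\<lambda>x. f x + g x) \<le> (\<integral>x. 2 powr p * (norm (f x) powr p + norm (g x) powr p) \<partial>M)"
    unfolding NP_def by (rule integral_mono[OF LP_integrable[OF *] I]) (auto simp: norm_add_powr_le assms)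
  also have "\<dots> = 2 powr p * (NP p M f + NP p M g)"
    using assms by (simp add: NP_def LP_def)
  finally show "NP p M (\<lambda>x. f x + g x) \<le> 2 powr p * (NP p M f + NP p M g)" .
qed

lemma LP_scaleR:
  assumes "LP p M f"
  shows "LP p M (\<lambda>x. c *\<^sub>R f x)" "NP p M (\<lambda>x. c *\<^sub>R f x) = \<bar>c\<bar> powr p * NP p M f"
  using assms by (auto simp: LP_def NP_def powr_mult)

lemma LP_minus: "LP p M f \<Longrightarrow> LP p M (\<lambda>x. - f x)"
  by (auto simp: LP_def)

lemma NP_minus_commute: "NP p M (\<lambda>x. f x - g x) = NP p M (\<lambda>x. g x - f x)"
  by (simp add: NP_def norm_minus_commute)

lemma LP_diff:
  assumes "0 < p" "LP p M f" "LP p M g"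
  shows "LP p M (\<lambda>x. f x - g x)" "NP p M (\<lambda>x. f x - g x) \<le> 2 powr p * (NP p M f + NP p M g)"
proof -
  show "LP p M (\<lambda>x. f x - g x)"
    using LP_add(1)[OF assms(1,2) LP_minus[OF assms(3)]] by simp
  show "NP p M (\<lambda>x. f x - g x) \<le> 2 powr p * (NP p M f + NP p M g)"
    using LP_add(2)[OF assms(1,2) LP_minus[OF assms(3)]] by (simp add: NP_def)
qed

lemma NP_triangle:
  assumes "0 < p" "LP p M f" "LP p M g" "LP p M h"
  shows "NP p M (\<lambda>x. f x - h x) \<le> 2 powr p * (NP p M (\<lambda>x. f x - g x) + NP p M (\<lambda>x. g x - h x))"
  using LP_add(2)[OF assms(1) LP_diff(1)[OF assms(1,2,3)] LP_diff(1)[OF assms(1,3,4)]] by simp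

lemma LP_zero [simp]: "LP p M (\<lambda>x. 0)"
  by (simp add: LP_def)

text \<open>Young's inequality, read as the tangent line of the convex function t powr p at s.\<close>

lemma powr_tangent:
  fixes p s t :: real
  assumes "1 < p" "0 \<le> s" "0 \<le> t"
  shows "s powr p + p * s powr (p - 1) * (t - s) \<le> t powr p"
proof (cases "s = 0")
  case False
  define q where "q = p / (p - 1)"
  have q: "1 < q" "1 / p + 1 / q = 1" using assms by (auto simp: q_def field_simps)
  have "t * s powr (p - 1) \<le> t powr p / p + (s powr (p - 1)) powr q / q"
    using Youngs_inequality[of p q t "s powr (p - 1)"] q assms by auto
  also have "(s powr (p - 1)) powr q = s powr p"
    using assms by (simp add: powr_powr q_def)
  finally have "p * (t * s powr (p - 1)) \<le> t powr p + p / q * s powr p"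
    using assms by (simp add: field_simps)
  moreover have "p / q = p - 1" using assms by (simp add: q_def)
  moreover have "s powr p = s * s powr (p - 1)"
    using assms False by (simp add: powr_mult_base)
  ultimately show ?thesis by (simp add: algebra_simps)
qed (use assms in auto)

text \<open>Two tangent inequalities are chained, one at \<open>m\<close> and one at the midpoint
  \<open>n\<close> of \<open>m\<close> and \<open>t\<close>. Strictness comes from the slope, which
  is strictly larger at \<open>n\<close> than at \<open>m\<close>.\<close>

lemma powr_midpoint_strict_aux:
  fixes p m t :: real
  assumes "1 < p" "0 \<le> m" "m < t"
  shows "m powr p + p * m powr (p - 1) * (t - m) < t powr p"
proof -
  define n where "n = (m + t) / 2"
  have n: "m < n" "n < t" "n - m = (t - m) / 2" "t - n = (t - m) / 2"
    using assms by (auto simp: n_def field_simps)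
  have 1: "n powr p + p * n powr (p - 1) * (t - n) \<le> t powr p"
    "m powr p + p * m powr (p - 1) * (n - m) \<le> n powr p"
    using assms n by (auto intro!: powr_tangent)
  have "m powr (p - 1) < n powr (p - 1)"
    using assms n by (intro powr_less_mono2) auto
  hence "p * m powr (p - 1) * ((t - m) / 2) < p * n powr (p - 1) * ((t - m) / 2)"
    using assms by (intro mult_strict_right_mono mult_strict_left_mono) auto
  moreover have "p * m powr (p - 1) * (t - m) = p * m powr (p - 1) * ((t - m) / 2) + p * m powr (p - 1) * ((t - m) / 2)"
    by simp
  ultimately show ?thesis using 1 unfolding n(3,4) by linarith
qed

text \<open>Tangent inequalities at the midpoint, evaluated at both endpoints, are added: the linear
  terms cancel, and one of the two inequalities is strict.\<close>

lemma powr_midpoint_strict: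
  fixes p s t :: real
  assumes "1 < p" "0 \<le> s" "0 \<le> t" "s \<noteq> t"
  shows "((s + t) / 2) powr p < (s powr p + t powr p) / 2"
proof -
  have *: "((s + t) / 2) powr p < (s powr p + t powr p) / 2" if "0 \<le> s" "s < t" for s t :: real
  proof -
    define m where "m = (s + t) / 2"
    have m: "0 \<le> m" "m < t" "s - m = - (t - m)" using that by (auto simp: m_def field_simps)
    have "s powr p \<ge> m powr p + p * m powr (p - 1) * (s - m)"
      using assms that m by (intro powr_tangent) auto
    moreover have "m powr p + p * m powr (p - 1) * (t - m) < t powr p"
      using assms m by (intro powr_midpoint_strict_aux) auto
    ultimately have "2 * m powr p < s powr p + t powr p"
      using m(3) by (simp add: algebra_simps)
    thus ?thesis by (simp add: m_def)
  qed
  show ?thesis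
    using *[of s t] *[of t s] assms by (cases "s < t") (auto simp: add.commute)
qed

text \<open>If the norms differ, strictness is that of the scalar power. If they agree, the
  parallelogram law puts the midpoint strictly inside the sphere.\<close>

lemma norm_midpoint_powr_strict:
  fixes a b :: "'b::real_inner"
  assumes "1 < p" "a \<noteq> b"
  shows "norm ((1/2) *\<^sub>R (a + b)) powr p < (norm a powr p + norm b powr p) / 2"
proof (cases "norm a = norm b")
  case False
  have "norm ((1/2) *\<^sub>R (a + b)) \<le> (norm a + norm b) / 2"
    using norm_triangle_ineq[of a b] by simp
  hence "norm ((1/2) *\<^sub>R (a + b)) powr p \<le> ((norm a + norm b) / 2) powr p"
    using assms by (intro powr_mono2) auto
  also have "\<dots> < (norm a powr p + norm b powr p) / 2"
    using assms False by (intro powr_midpoint_strict) auto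
  finally show ?thesis .
next
  case True
  have "(norm (a + b))\<^sup>2 + (norm (a - b))\<^sup>2 = 2 * (norm a)\<^sup>2 + 2 * (norm b)\<^sup>2"
    by (simp add: power2_norm_eq_inner algebra_simps inner_commute)
  moreover have "(norm (a - b))\<^sup>2 > 0" using assms by simp
  moreover have "(2 * norm a)\<^sup>2 = 2 * (norm a)\<^sup>2 + 2 * (norm b)\<^sup>2"
    using True by (simp add: power_mult_distrib)
  ultimately have "(norm (a + b))\<^sup>2 < (2 * norm a)\<^sup>2" by linarith
  hence "norm (a + b) < 2 * norm a" by (rule power2_less_imp_less) auto
  hence "norm ((1/2) *\<^sub>R (a + b)) powr p < norm a powr p"
    using assms by (intro powr_less_mono2) auto
  with True show ?thesis by simp
qed

lemma continuous_on_norm_powr [continuous_intros]: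
  fixes f :: "'a::topological_space \<Rightarrow> 'b::real_normed_vector"
  assumes "continuous_on S f" "0 < p"
  shows "continuous_on S (\<lambda>x. norm (f x) powr p)"
  using assms by (intro continuous_on_powr' continuous_intros) auto

text \<open>A soft form of uniform convexity that is valid for every exponent: both sides are homogeneous,
  and on the unit sphere it follows from compactness and strict convexity.\<close>

lemma uniform_convexity:
  fixes p e :: real
  assumes "1 < p" "0 < e"
  obtains C where "0 \<le> C" "\<And>a b :: 'b::euclidean_space.
     norm (a - b) powr p \<le> e * (norm a powr p + norm b powr p)
        + C * ((norm a powr p + norm b powr p) / 2 - norm ((1/2) *\<^sub>R (a + b)) powr p)"
proof -
  define S where "S z = norm (fst z) powr p + norm (snd z) powr p" for z :: "'b \<times> 'b"
  define D where "D z = norm (fst z - snd z) powr p" for z :: "'b \<times> 'b"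
  define B where "B z = S z / 2 - norm ((1/2) *\<^sub>R (fst z + snd z)) powr p" for z :: "'b \<times> 'b"
  have cont: "continuous_on UNIV S" "continuous_on UNIV D" "continuous_on UNIV B"
    unfolding S_def D_def B_def using assms by (intro continuous_intros; simp)+
  \<comment> \<open>Only the points of the sphere where \<open>D\<close> is not already dominated by
    \<open>e * S\<close> need the term \<open>C * B\<close>. On them the two components differ, so
    \<open>B\<close> is positive and, by compactness, bounded away from 0.\<close>
  define K where "K = sphere 0 1 \<inter> {z. e * S z \<le> D z}"
  have "closed {z. e * S z \<le> D z}"
    by (intro closed_Collect_le continuous_intros cont)
  hence "compact K" unfolding K_def by (intro compact_Int_closed) auto
  have S_pos: "S z > 0" if "z \<noteq> 0" for z
  proof (cases "fst z = 0")
    case True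
    hence "snd z \<noteq> 0" using that by (simp add: prod_eq_iff)
    hence "norm (snd z) powr p > 0" by simp
    thus ?thesis by (auto simp: S_def intro: add_nonneg_pos)
  next
    case False
    hence "norm (fst z) powr p > 0" by simp
    thus ?thesis by (auto simp: S_def intro: add_pos_nonneg)
  qed
  have S0: "S z \<ge> 0" for z by (auto simp: S_def)
  have B_pos: "B z > 0" if "fst z \<noteq> snd z" for z
    using norm_midpoint_powr_strict[OF assms(1) that] by (simp add: B_def S_def)
  have B0: "B z \<ge> 0" for z
  proof (cases "fst z = snd z")
    case True
    have "(1/2) *\<^sub>R (snd z + snd z) = snd z"
      by (metis scaleR_half_double)
    thus ?thesis by (simp add: B_def S_def True)
  qed (use B_pos[of z] in auto)
  have B_pos_K: "B z > 0" if "z \<in> K" for z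
  proof (rule B_pos)
    show "fst z \<noteq> snd z"
    proof
      assume "fst z = snd z"
      hence "D z = 0" by (simp add: D_def)
      moreover have "z \<noteq> 0" using that by (auto simp: K_def)
      hence "e * S z > 0" using S_pos assms by simp
      ultimately show False using that by (simp add: K_def)
    qed
  qed
  have "\<exists>C\<ge>0. \<forall>z\<in>K. D z \<le> C * B z"
  proof (cases "K = {}")
    case False
    obtain z0 where z0: "z0 \<in> K" "\<And>z. z \<in> K \<Longrightarrow> B z0 \<le> B z"
      using continuous_attains_inf[OF \<open>compact K\<close> False continuous_on_subset[OF cont(3)]] by auto
    obtain z1 where z1: "z1 \<in> K" "\<And>z. z \<in> K \<Longrightarrow> D z \<le> D z1"
      using continuous_attains_sup[OF \<open>compact K\<close> False continuous_on_subset[OF cont(2)]] by auto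
    have B0p: "B z0 > 0" using B_pos_K z0 by auto
    have D0: "D z1 \<ge> 0" by (simp add: D_def)
    show ?thesis
    proof (intro exI[of _ "D z1 / B z0"] conjI ballI)
      show "0 \<le> D z1 / B z0" using B0p D0 by simp
      fix z assume z: "z \<in> K"
      have "D z1 \<le> D z1 / B z0 * B z"
        using mult_left_mono[OF z0(2)[OF z], of "D z1 / B z0"] B0p D0 by simp
      thus "D z \<le> D z1 / B z0 * B z" using z1(2)[OF z] by linarith
    qed
  qed auto
  then obtain C where C: "C \<ge> 0" "\<And>z. z \<in> K \<Longrightarrow> D z \<le> C * B z" by blast
  have sph: "D z \<le> e * S z + C * B z" if "norm z = 1" for z
  proof (cases "z \<in> K")
    case True
    have "e * S z \<ge> 0" using S0 assms by auto
    thus ?thesis using C(2)[OF True] by simp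
  next
    case False
    hence "D z < e * S z" using that by (auto simp: K_def)
    moreover have "C * B z \<ge> 0" using C B0 by auto
    ultimately show ?thesis by simp
  qed
  have all: "D z \<le> e * S z + C * B z" for z
  proof (cases "z = 0")
    case True thus ?thesis using assms by (simp add: D_def S_def B_def)
  next
    case False
    define t where "t = norm z"
    define y where "y = (1 / t) *\<^sub>R z"
    have t: "t > 0" using False by (simp add: t_def)
    have z: "z = t *\<^sub>R y" and y: "norm y = 1" using t by (auto simp: y_def t_def)
    have "S z = t powr p * S y"
      using t by (simp add: z S_def powr_mult algebra_simps)
    moreover have "D z = t powr p * D y"
      using t by (simp add: z D_def powr_mult flip: scaleR_diff_right)
    moreover have "B z = t powr p * B y"
    proof -
      have "norm ((1/2) *\<^sub>R (fst z + snd z)) powr p = (t * norm ((1/2) *\<^sub>R (fst y + snd y))) powr p"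
        using t by (simp add: z flip: scaleR_add_right)
      also have "\<dots> = t powr p * norm ((1/2) *\<^sub>R (fst y + snd y)) powr p"
        using t by (subst powr_mult) auto
      finally show ?thesis
        using \<open>S z = t powr p * S y\<close> by (simp add: B_def algebra_simps)
    qed
    ultimately show ?thesis
      using mult_left_mono[OF sph[OF y], of "t powr p"] by (simp add: algebra_simps)
  qed
  show ?thesis
    by (rule that[OF C(1)]) (use all in \<open>auto simp: S_def D_def B_def\<close>)
qed

section \<open>Young's inequality with a prescribed small weight, and dual pairings\<close>

lemma young_powr_right:
  fixes p e :: real
  assumes "1 < p" "0 < e"
  obtains C where "0 < C" "\<And>s t. 0 \<le> s \<Longrightarrow> 0 \<le> t \<Longrightarrow> s powr (p - 1) * t \<le> e * s powr p + C * t powr p"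
proof (rule that[of "(1 / e) powr (p - 1)"])
  fix s t :: real assume st: "0 \<le> s" "0 \<le> t"
  have sp: "s * s powr (p - 1) = s powr p" "t * t powr (p - 1) = t powr p"
    using st by (simp_all add: powr_mult_base)
  show "s powr (p - 1) * t \<le> e * s powr p + (1 / e) powr (p - 1) * t powr p"
  \<comment> \<open>The split at \<open>t = e * s\<close> produces the constant: below it the
    product is at most \<open>e * s powr p\<close>, above it \<open>s\<close> is replaced by
    \<open>t / e\<close>, which costs \<open>(1 / e) powr (p - 1)\<close>.\<close>
  proof (cases "t \<le> e * s")
    case True
    have "s powr (p - 1) * t \<le> s powr (p - 1) * (e * s)"
      using True by (intro mult_left_mono) auto
    also have "\<dots> = e * s powr p" using sp by (simp add: algebra_simps)
    finally show ?thesis by (simp add: add_increasing2)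
  next
    case False
    hence "s \<le> t / e" using assms by (simp add: field_simps)
    hence "s powr (p - 1) \<le> (1 / e * t) powr (p - 1)"
      using assms st by (intro powr_mono2) auto
    also have "\<dots> = (1 / e) powr (p - 1) * t powr (p - 1)"
      using assms st by (subst powr_mult) auto
    finally have "s powr (p - 1) * t \<le> (1 / e) powr (p - 1) * t powr (p - 1) * t"
      using st by (intro mult_right_mono) auto
    also have "\<dots> = (1 / e) powr (p - 1) * t powr p" using sp by (simp add: algebra_simps)
    finally show ?thesis using assms by (simp add: add_increasing)
  qed
qed (use assms in auto)

lemma young_powr_left:
  fixes p e :: real
  assumes "1 < p" "0 < e"
  obtains C where "0 < C" "\<And>s t. 0 \<le> s \<Longrightarrow> 0 \<le> t \<Longrightarrow> s powr (p - 1) * t \<le> C * s powr p + e * t powr p"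
proof -
  \<comment> \<open>\<open>d\<close> solves \<open>d powr (p - 1) = e\<close>, so that splitting at
    \<open>s = d * t\<close> puts exactly the weight \<open>e\<close> on the second factor.\<close>
  define d where "d = e powr (1 / (p - 1))"
  have d: "d > 0" "d powr (p - 1) = e" using assms by (auto simp: d_def powr_powr)
  show ?thesis
  proof (rule that[of "1 / d"])
    fix s t :: real assume st: "0 \<le> s" "0 \<le> t"
    have sp: "s * s powr (p - 1) = s powr p" "t * t powr (p - 1) = t powr p"
      using st by (simp_all add: powr_mult_base)
    show "s powr (p - 1) * t \<le> 1 / d * s powr p + e * t powr p"
    proof (cases "s \<le> d * t")
      case True
      have "s powr (p - 1) \<le> (d * t) powr (p - 1)"
        using assms st True by (intro powr_mono2) auto
      also have "\<dots> = e * t powr (p - 1)"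
        using d st by (subst powr_mult) auto
      finally have "s powr (p - 1) * t \<le> e * t powr (p - 1) * t"
        using st by (intro mult_right_mono) auto
      also have "\<dots> = e * t powr p" using sp by (simp add: algebra_simps)
      finally show ?thesis using d by (simp add: add_increasing)
    next
      case False
      hence "t \<le> 1 / d * s" using d by (simp add: field_simps)
      hence "s powr (p - 1) * t \<le> s powr (p - 1) * (1 / d * s)"
        by (intro mult_left_mono) auto
      also have "\<dots> = 1 / d * s powr p" using sp by (simp add: algebra_simps)
      finally show ?thesis using assms by (simp add: add_increasing2)
    qed
  qed (use d in auto)
qed

text \<open>The substitution of \<open>a powr (1 / (p - 1))\<close> for \<open>s\<close> translates
  the power form of Young's inequality into the form with the conjugate exponent
  \<open>p / (p - 1)\<close>.\<close>

lemma conj_powr: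
  fixes p a :: real
  assumes "1 < p" "0 \<le> a"
  shows "(a powr (1 / (p - 1))) powr (p - 1) = a" "(a powr (1 / (p - 1))) powr p = a powr (p / (p - 1))"
    "(a powr (p - 1)) powr (p / (p - 1)) = a powr p"
  using assms by (auto simp: powr_powr)

lemma young_right:
  fixes p e :: real
  assumes "1 < p" "0 < e"
  obtains C where "0 < C" "\<And>a b. 0 \<le> a \<Longrightarrow> 0 \<le> b \<Longrightarrow> a * b \<le> e * a powr (p / (p - 1)) + C * b powr p"
proof -
  obtain C where "0 < C" "\<And>s t. 0 \<le> s \<Longrightarrow> 0 \<le> t \<Longrightarrow> s powr (p - 1) * t \<le> e * s powr p + C * t powr p"
    using young_powr_right[OF assms] by blast
  thus ?thesis using conj_powr[OF assms(1)] by (intro that[of C]) (auto, metis powr_ge_zero)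
qed

lemma young_left:
  fixes p e :: real
  assumes "1 < p" "0 < e"
  obtains C where "0 < C" "\<And>a b. 0 \<le> a \<Longrightarrow> 0 \<le> b \<Longrightarrow> a * b \<le> C * a powr (p / (p - 1)) + e * b powr p"
proof -
  obtain C where "0 < C" "\<And>s t. 0 \<le> s \<Longrightarrow> 0 \<le> t \<Longrightarrow> s powr (p - 1) * t \<le> C * s powr p + e * t powr p"
    using young_powr_left[OF assms] by blast
  thus ?thesis using conj_powr[OF assms(1)] by (intro that[of C]) (auto, metis powr_ge_zero)
qed

lemma LP_pair_norm_integrable:
  assumes "1 < p" "LP (p / (p - 1)) M b" "LP p M f"
  shows "integrable M (\<lambda>x. norm (b x) * norm (f x))"
proof -
  note [measurable] = LP_measurable[OF assms(2)] LP_measurable[OF assms(3)]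
  obtain C where C: "0 < C" "\<And>a b. 0 \<le> a \<Longrightarrow> 0 \<le> b \<Longrightarrow> a * b \<le> 1 * a powr (p / (p - 1)) + C * b powr p"
    using young_right[OF assms(1), of 1] by auto
  have I: "integrable M (\<lambda>x. 1 * norm (b x) powr (p / (p - 1)) + C * norm (f x) powr p)"
    using assms by (auto simp: LP_def)
  show ?thesis
    by (rule Bochner_Integration.integrable_bound[OF I]) (use C in \<open>auto intro!: AE_I2 order_trans[OF _ abs_ge_self]\<close>)
qed

lemma LP_pair_integrable:
  fixes b f :: "'a \<Rightarrow> 'b::euclidean_space"
  assumes "1 < p" "LP (p / (p - 1)) M b" "LP p M f"
  shows "integrable M (\<lambda>x. b x \<bullet> f x)"
proof -
  note [measurable] = LP_measurable[OF assms(2)] LP_measurable[OF assms(3)]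
  show ?thesis
    by (rule Bochner_Integration.integrable_bound[OF LP_pair_norm_integrable[OF assms]])
       (auto simp: Cauchy_Schwarz_ineq2)
qed

text \<open>An integrated Young inequality in the role of Hoelder's. The weights \<open>c\<close>
  and \<open>d\<close> are parameters, because the caller decides which of the two factors carries
  the small one.\<close>

lemma LP_pair_norm_le:
  fixes b :: "'a \<Rightarrow> 'b::euclidean_space" and f :: "'a \<Rightarrow> 'c::euclidean_space"
  assumes "1 < p" "LP (p / (p - 1)) M b" "LP p M f"
    and "\<And>s t. 0 \<le> s \<Longrightarrow> 0 \<le> t \<Longrightarrow> s * t \<le> c * s powr (p / (p - 1)) + d * t powr p"
  shows "(\<integral>x. norm (b x) * norm (f x) \<partial>M) \<le> c * NP (p / (p - 1)) M b + d * NP p M f"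
proof -
  have I: "integrable M (\<lambda>x. c * norm (b x) powr (p / (p - 1)) + d * norm (f x) powr p)"
    using assms by (auto simp: LP_def)
  have "(\<integral>x. norm (b x) * norm (f x) \<partial>M) \<le> (\<integral>x. c * norm (b x) powr (p / (p - 1)) + d * norm (f x) powr p \<partial>M)"
    by (rule integral_mono[OF LP_pair_norm_integrable[OF assms(1-3)] I]) (use assms in auto)
  also have "\<dots> = c * NP (p / (p - 1)) M b + d * NP p M f"
    using assms(2,3) by (simp add: NP_def LP_def)
  finally show ?thesis .
qed

lemma LP_pair_le:
  fixes b f :: "'a \<Rightarrow> 'b::euclidean_space"
  assumes "1 < p" "LP (p / (p - 1)) M b" "LP p M f"
    and "\<And>s t. 0 \<le> s \<Longrightarrow> 0 \<le> t \<Longrightarrow> s * t \<le> c * s powr (p / (p - 1)) + d * t powr p"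
  shows "\<bar>\<integral>x. b x \<bullet> f x \<partial>M\<bar> \<le> c * NP (p / (p - 1)) M b + d * NP p M f"
proof -
  have "\<bar>\<integral>x. b x \<bullet> f x \<partial>M\<bar> \<le> (\<integral>x. \<bar>b x \<bullet> f x\<bar> \<partial>M)" by (rule integral_abs_bound)
  also have "\<dots> \<le> (\<integral>x. norm (b x) * norm (f x) \<partial>M)"
    by (rule integral_mono) (auto simp: Cauchy_Schwarz_ineq2 intro!: LP_pair_norm_integrable LP_pair_integrable assms)
  also have "\<dots> \<le> c * NP (p / (p - 1)) M b + d * NP p M f"
    by (rule LP_pair_norm_le[OF assms])
  finally show ?thesis .
qed

text \<open>The small weight goes on the bounded factor, where it contributes at most half of the
  tolerance; the vanishing factor then absorbs the large constant that Young's inequality returns.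
  Using \<open>B + 1\<close> in the weight covers the case \<open>B = 0\<close>.\<close>

lemma LP_pair_tendsto_right:
  fixes b :: "nat \<Rightarrow> 'a \<Rightarrow> 'b::euclidean_space"
  assumes "1 < p" "\<And>k. LP (p / (p - 1)) M (b k)" "\<And>k. NP (p / (p - 1)) M (b k) \<le> B"
    and "\<And>k. LP p M (f k)" "(\<lambda>k. NP p M (f k)) \<longlonglongrightarrow> 0"
  shows "(\<lambda>k. \<integral>x. norm (b k x) * norm (f k x) \<partial>M) \<longlonglongrightarrow> 0" "(\<lambda>k. \<integral>x. b k x \<bullet> f k x \<partial>M) \<longlonglongrightarrow> 0"
proof -
  have B0: "B \<ge> 0" using assms(3)[of 0] NP_nonneg[of "p / (p - 1)" M "b 0"] by linarith
  show 1: "(\<lambda>k. \<integral>x. norm (b k x) * norm (f k x) \<partial>M) \<longlonglongrightarrow> 0"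
  proof (rule LIMSEQ_I)
    fix r :: real assume "r > 0"
    obtain C where C: "0 < C" "\<And>s t. 0 \<le> s \<Longrightarrow> 0 \<le> t \<Longrightarrow> s * t \<le> (r / (2 * (B + 1))) * s powr (p / (p - 1)) + C * t powr p"
      using young_right[OF assms(1), of "r / (2 * (B + 1))"] \<open>r > 0\<close> B0 by auto
    have "eventually (\<lambda>k. NP p M (f k) < r / (2 * C)) sequentially"
      using order_tendstoD(2)[OF assms(5), of "r / (2 * C)"] \<open>r > 0\<close> C by auto
    then obtain N where N: "\<And>k. k \<ge> N \<Longrightarrow> NP p M (f k) < r / (2 * C)"
      by (auto simp: eventually_sequentially)
    show "\<exists>no. \<forall>n\<ge>no. norm ((\<integral>x. norm (b n x) * norm (f n x) \<partial>M) - 0) < r"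
    proof (intro exI[of _ N] allI impI)
      fix n assume "n \<ge> N"
      have "(\<integral>x. norm (b n x) * norm (f n x) \<partial>M) \<le> (r / (2 * (B + 1))) * NP (p / (p - 1)) M (b n) + C * NP p M (f n)"
        by (rule LP_pair_norm_le[OF assms(1,2,4) C(2)]) auto
      also have "C * NP p M (f n) < C * (r / (2 * C))"
        using N[OF \<open>n \<ge> N\<close>] C by (intro mult_strict_left_mono) auto
      also have "C * (r / (2 * C)) = r / 2" using C by simp
      also have "(r / (2 * (B + 1))) * NP (p / (p - 1)) M (b n) \<le> (r / (2 * (B + 1))) * (B + 1)"
        using assms(3)[of n] \<open>r > 0\<close> B0 by (intro mult_left_mono) auto
      also have "\<dots> = r / 2" using B0 by (simp add: field_simps)
      finally have "(\<integral>x. norm (b n x) * norm (f n x) \<partial>M) < r" by simp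
      moreover have "(\<integral>x. norm (b n x) * norm (f n x) \<partial>M) \<ge> 0" by simp
      ultimately show "norm ((\<integral>x. norm (b n x) * norm (f n x) \<partial>M) - 0) < r"
        unfolding real_norm_def diff_0_right by linarith
    qed
  qed
  show "(\<lambda>k. \<integral>x. b k x \<bullet> f k x \<partial>M) \<longlonglongrightarrow> 0"
  proof (rule Lim_null_comparison[OF always_eventually 1], rule allI)
    fix k
    have "\<bar>\<integral>x. b k x \<bullet> f k x \<partial>M\<bar> \<le> (\<integral>x. \<bar>b k x \<bullet> f k x\<bar> \<partial>M)" by (rule integral_abs_bound)
    also have "\<dots> \<le> (\<integral>x. norm (b k x) * norm (f k x) \<partial>M)"
      by (rule integral_mono) (auto simp: Cauchy_Schwarz_ineq2 intro!: LP_pair_norm_integrable LP_pair_integrable assms)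
    finally show "norm (\<integral>x. b k x \<bullet> f k x \<partial>M) \<le> (\<integral>x. norm (b k x) * norm (f k x) \<partial>M)" by simp
  qed
qed

lemma conj_conj: 
  fixes p :: real assumes "1 < p" shows "(p / (p - 1)) / (p / (p - 1) - 1) = p" "1 < p / (p - 1)"
  using assms by (auto simp: field_simps)

text \<open>The conjugate of the conjugate exponent is \<open>p\<close> again, so the roles of the
  two factors can simply be exchanged.\<close>

lemma LP_pair_tendsto_left:
  fixes b :: "nat \<Rightarrow> 'a \<Rightarrow> 'b::euclidean_space"
  assumes "1 < p" "\<And>k. LP (p / (p - 1)) M (b k)" "(\<lambda>k. NP (p / (p - 1)) M (b k)) \<longlonglongrightarrow> 0"
    and "\<And>k. LP p M (f k)" "\<And>k. NP p M (f k) \<le> B"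
  shows "(\<lambda>k. \<integral>x. b k x \<bullet> f k x \<partial>M) \<longlonglongrightarrow> 0"
  using LP_pair_tendsto_right(2)[of "p / (p - 1)" M f B b] assms conj_conj[OF assms(1)]
  by (simp add: inner_commute)

lemma LP_pair_tendsto:
  fixes b :: "'a \<Rightarrow> 'b::euclidean_space"
  assumes "1 < p" "LP (p / (p - 1)) M b" "\<And>k. LP p M (f k)" "LP p M g" "(\<lambda>k. NP p M (\<lambda>x. f k x - g x)) \<longlonglongrightarrow> 0"
  shows "(\<lambda>k. \<integral>x. b x \<bullet> f k x \<partial>M) \<longlonglongrightarrow> (\<integral>x. b x \<bullet> g x \<partial>M)"
proof -
  have "(\<lambda>k. \<integral>x. b x \<bullet> (f k x - g x) \<partial>M) \<longlonglongrightarrow> 0"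
    by (rule LP_pair_tendsto_right(2)[OF assms(1,2) order_refl]) (use assms in \<open>auto intro!: LP_diff\<close>)
  moreover have "(\<integral>x. b x \<bullet> (f k x - g x) \<partial>M) = (\<integral>x. b x \<bullet> f k x \<partial>M) - (\<integral>x. b x \<bullet> g x \<partial>M)" for k
    using assms by (simp add: inner_diff_right LP_pair_integrable)
  ultimately show ?thesis by (simp add: LIM_zero_iff)
qed

section \<open>Subsequences, domination and completeness\<close>

lemma eventually_subseq_choice:
  assumes "\<And>k. eventually (P k) sequentially"
  obtains r :: "nat \<Rightarrow> nat" where "strict_mono r" "\<And>k. P k (r k)"
proof -
  have "\<exists>r. \<forall>k. P k (r k) \<and> r k < r (Suc k)"
  proof (rule dependent_nat_choice)
    show "\<exists>n. P 0 n"
      using assms[of 0] by (auto simp: eventually_sequentially)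
    fix n k assume "P k n"
    have "eventually (\<lambda>m. P (Suc k) m \<and> n < m) sequentially"
      using assms[of "Suc k"] eventually_gt_at_top[of n] by eventually_elim auto
    thus "\<exists>m. P (Suc k) m \<and> n < m" by (auto simp: eventually_sequentially)
  qed
  thus ?thesis using that by (auto simp: strict_mono_Suc_iff)
qed

text \<open>Urysohn's subsequence principle. Pointwise convergence and domination are available only
  along subsequences; this upgrades their consequences to the whole sequence.\<close>

lemma subseq_principle:
  fixes X :: "nat \<Rightarrow> 'a::metric_space"
  assumes "\<And>r. strict_mono r \<Longrightarrow> \<exists>s. strict_mono (s::nat\<Rightarrow>nat) \<and> (\<lambda>k. X (r (s k))) \<longlonglongrightarrow> L"
  shows "X \<longlonglongrightarrow> L"
proof (rule ccontr)
  assume "\<not> X \<longlonglongrightarrow> L"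
  then obtain e where e: "e > 0" "\<And>N. \<exists>n\<ge>N. dist (X n) L \<ge> e"
    by (auto simp: lim_sequentially not_less)
  have "\<exists>r::nat\<Rightarrow>nat. \<forall>k. dist (X (r k)) L \<ge> e \<and> r k < r (Suc k)"
  proof (rule dependent_nat_choice)
    show "\<exists>n. dist (X n) L \<ge> e" using e by blast
    fix n k :: nat
    show "\<exists>m. dist (X m) L \<ge> e \<and> n < m" using e(2)[of "Suc n"] by (auto simp: Suc_le_eq)
  qed
  then obtain r :: "nat \<Rightarrow> nat" where r: "\<And>k. dist (X (r k)) L \<ge> e" "strict_mono r"
    by (auto simp: strict_mono_Suc_iff)
  obtain s where s: "(\<lambda>k. X (r (s k))) \<longlonglongrightarrow> L" using assms[OF r(2)] by auto
  then obtain N where "\<And>k. k \<ge> N \<Longrightarrow> dist (X (r (s k))) L < e"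
    using e(1) by (auto simp: lim_sequentially)
  with r(1)[of "s N"] show False by (meson linorder_not_le order_refl)
qed

text \<open>The dominating function is the sum of the series of all \<open>D k\<close>, which is
  integrable by monotone convergence. Where the series converges, each term lies below its sum and
  the terms tend to 0.\<close>

lemma integrable_dominated_of_geometric:
  fixes D :: "nat \<Rightarrow> 'a \<Rightarrow> real"
  assumes "\<And>k. integrable M (D k)" "\<And>k x. D k x \<ge> 0" "\<And>k. (\<integral>x. D k x \<partial>M) \<le> (1/2) ^ k"
  obtains H where "integrable M H" "\<And>x. H x \<ge> 0" "AE x in M. (\<forall>k. D k x \<le> H x) \<and> (\<lambda>k. D k x) \<longlonglongrightarrow> 0"
proof -
  have [measurable]: "D k \<in> borel_measurable M" for k using assms(1) by auto
  have "(\<integral>\<^sup>+x. (\<Sum>k. ennreal (D k x)) \<partial>M) = (\<Sum>k. \<integral>\<^sup>+x. ennreal (D k x) \<partial>M)"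
    by (rule nn_integral_suminf) auto
  also have "\<dots> = (\<Sum>k. ennreal (\<integral>x. D k x \<partial>M))"
    using assms by (simp add: nn_integral_eq_integral)
  also have "\<dots> \<le> (\<Sum>k. ennreal ((1/2) ^ k))"
    by (intro suminf_le ennreal_leI assms) auto
  also have "\<dots> = ennreal (\<Sum>k. (1/2) ^ k)"
    by (intro suminf_ennreal2 summable_geometric) auto
  finally have fin: "(\<integral>\<^sup>+x. (\<Sum>k. ennreal (D k x)) \<partial>M) < \<infinity>"
    by (simp add: le_less_trans ennreal_less_top)
  hence "AE x in M. (\<Sum>k. ennreal (D k x)) \<noteq> \<infinity>"
    by (intro nn_integral_PInf_AE) auto
  hence ae: "AE x in M. summable (\<lambda>k. D k x)"
    by eventually_elim (auto intro!: summable_suminf_not_top assms)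
  have int: "integrable M (\<lambda>x. \<Sum>k. D k x)"
  proof (rule integrable_suminf)
    show "AE x in M. summable (\<lambda>k. norm (D k x))" using ae by (simp add: assms(2))
    show "summable (\<lambda>k. \<integral>x. norm (D k x) \<partial>M)"
      by (rule summable_comparison_test[OF _ summable_geometric[of "1/2::real"]])
         (use assms(2,3) in \<open>auto intro!: exI[of _ 0] integral_nonneg_AE\<close>)
  qed (use assms in auto)
  \<comment> \<open>The absolute value makes the bound nonnegative everywhere, also on the null set
    where the series diverges and its formal sum carries no information.\<close>
  have H: "integrable M (\<lambda>x. \<bar>\<Sum>k. D k x\<bar>)" using int by simp
  show ?thesis
  proof (rule that[OF H])
    show "AE x in M. (\<forall>k. D k x \<le> \<bar>\<Sum>k. D k x\<bar>) \<and> (\<lambda>k. D k x) \<longlonglongrightarrow> 0"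
      using ae
    proof eventually_elim
      case (elim x)
      have "D k x \<le> (\<Sum>k. D k x)" for k
        using sum_le_suminf[OF elim, of "{k}"] assms(2) by auto
      with summable_LIMSEQ_zero[OF elim] show ?case by (auto intro: order_trans[OF _ abs_ge_self])
    qed
  qed auto
qed

text \<open>A partial converse of dominated convergence: along a subsequence the integrals decay
  geometrically, and then the series of the functions supplies the majorant.\<close>

lemma L1_dominated_subseq:
  fixes D :: "nat \<Rightarrow> 'a \<Rightarrow> real"
  assumes "\<And>k. integrable M (D k)" "\<And>k x. D k x \<ge> 0" "(\<lambda>k. \<integral>x. D k x \<partial>M) \<longlonglongrightarrow> 0"
  obtains r H where "strict_mono (r :: nat \<Rightarrow> nat)" "integrable M H" "\<And>x. H x \<ge> 0"
     "AE x in M. (\<forall>k. D (r k) x \<le> H x) \<and> (\<lambda>k. D (r k) x) \<longlonglongrightarrow> 0"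
proof -
  have "eventually (\<lambda>n. (\<integral>x. D n x \<partial>M) \<le> (1/2)^k) sequentially" for k
    using order_tendstoD(2)[OF assms(3), of "(1/2)^k"] by (auto elim: eventually_mono)
  then obtain r :: "nat \<Rightarrow> nat" where r: "strict_mono r" "\<And>k. (\<integral>x. D (r k) x \<partial>M) \<le> (1/2)^k"
    by (rule eventually_subseq_choice[of "\<lambda>k n. (\<integral>x. D n x \<partial>M) \<le> (1/2)^k"]) blast
  obtain H where "integrable M H" "\<And>x. H x \<ge> 0" "AE x in M. (\<forall>k. D (r k) x \<le> H x) \<and> (\<lambda>k. D (r k) x) \<longlonglongrightarrow> 0"
    using integrable_dominated_of_geometric[of M "\<lambda>k. D (r k)"] assms r by auto
  thus ?thesis using that r by blast
qed

lemma norm_powr_tendsto_zero_iff: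
  fixes f :: "nat \<Rightarrow> 'b::real_normed_vector"
  assumes "0 < p"
  shows "(\<lambda>k. norm (f k) powr p) \<longlonglongrightarrow> 0 \<longleftrightarrow> f \<longlonglongrightarrow> 0"
proof
  assume *: "(\<lambda>k. norm (f k) powr p) \<longlonglongrightarrow> 0"
  have "(\<lambda>k. (norm (f k) powr p) powr (1 / p)) \<longlonglongrightarrow> 0 powr (1 / p)"
    by (rule tendsto_powr'[OF * tendsto_const]) (use assms in auto)
  hence "(\<lambda>k. norm (f k)) \<longlonglongrightarrow> 0" using assms by (simp add: powr_powr)
  thus "f \<longlonglongrightarrow> 0" by (simp add: tendsto_norm_zero_iff)
next
  assume "f \<longlonglongrightarrow> 0"
  hence "(\<lambda>k. norm (f k)) \<longlonglongrightarrow> 0" by (simp add: tendsto_norm_zero_iff)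
  hence "(\<lambda>k. norm (f k) powr p) \<longlonglongrightarrow> 0 powr p"
    by (rule tendsto_powr'[OF _ tendsto_const]) (use assms in auto)
  thus "(\<lambda>k. norm (f k) powr p) \<longlonglongrightarrow> 0" by simp
qed

lemma LP_dominated_subseq:
  fixes f :: "nat \<Rightarrow> 'a \<Rightarrow> 'b::euclidean_space"
  assumes "0 < p" "\<And>k. LP p M (f k)" "LP p M g" "(\<lambda>k. NP p M (\<lambda>x. f k x - g x)) \<longlonglongrightarrow> 0"
  obtains r H where "strict_mono (r :: nat \<Rightarrow> nat)" "integrable M H" "\<And>x. H x \<ge> 0"
     "AE x in M. (\<forall>k. norm (f (r k) x) powr p \<le> H x) \<and> (\<lambda>k. f (r k) x) \<longlonglongrightarrow> g x"
proof -
  have "(\<lambda>k. \<integral>x. norm (f k x - g x) powr p \<partial>M) \<longlonglongrightarrow> 0" using assms(4) by (simp add: NP_def)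
  then obtain r H where rH: "strict_mono (r :: nat \<Rightarrow> nat)" "integrable M H" "\<And>x. H x \<ge> 0"
     "AE x in M. (\<forall>k. norm (f (r k) x - g x) powr p \<le> H x) \<and> (\<lambda>k. norm (f (r k) x - g x) powr p) \<longlonglongrightarrow> 0"
    using L1_dominated_subseq[of M "\<lambda>k x. norm (f k x - g x) powr p"] LP_integrable[OF LP_diff(1)[OF assms(1) assms(2,3)]]
    by auto
  define H' where "H' x = 2 powr p * (H x + norm (g x) powr p)" for x
  show ?thesis
  proof (rule that[OF rH(1)])
    show "integrable M H'" unfolding H'_def using rH(2) LP_integrable[OF assms(3)] by auto
    show "H' x \<ge> 0" for x unfolding H'_def using rH(3) by auto
    show "AE x in M. (\<forall>k. norm (f (r k) x) powr p \<le> H' x) \<and> (\<lambda>k. f (r k) x) \<longlonglongrightarrow> g x"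
      using rH(4)
    proof eventually_elim
      case (elim x)
      have "norm (f (r k) x) powr p \<le> H' x" for k
      proof -
        have "norm (f (r k) x) powr p \<le> 2 powr p * (norm (f (r k) x - g x) powr p + norm (g x) powr p)"
          using norm_add_powr_le[OF assms(1), of "f (r k) x - g x" "g x"] by simp
        also have "\<dots> \<le> H' x" unfolding H'_def using elim by (intro mult_left_mono add_right_mono) auto
        finally show ?thesis .
      qed
      moreover have "(\<lambda>k. f (r k) x - g x) \<longlonglongrightarrow> 0"
        using elim norm_powr_tendsto_zero_iff[OF assms(1)] by blast
      ultimately show ?case by (auto simp: LIM_zero_iff)
    qed
  qed
qed

lemma LP_fatou:
  fixes f :: "nat \<Rightarrow> 'a \<Rightarrow> 'b::euclidean_space"
  assumes "0 < p" "\<And>k. LP p M (f k)" "\<And>k. NP p M (f k) \<le> B" "g \<in> borel_measurable M"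
    and "AE x in M. (\<lambda>k. f k x) \<longlonglongrightarrow> g x"
  shows "LP p M g" "NP p M g \<le> B"
proof -
  note [measurable] = LP_measurable[OF assms(2)] assms(4)
  have B0: "B \<ge> 0" using assms(3)[of 0] NP_nonneg[of p M "f 0"] by linarith
  have "(\<integral>\<^sup>+x. ennreal (norm (g x) powr p) \<partial>M) = (\<integral>\<^sup>+x. liminf (\<lambda>k. ennreal (norm (f k x) powr p)) \<partial>M)"
  proof (rule nn_integral_cong_AE, use assms(5) in eventually_elim)
    case (elim x)
    have "(\<lambda>k. norm (f k x) powr p) \<longlonglongrightarrow> norm (g x) powr p"
      by (rule tendsto_powr'[OF tendsto_norm[OF elim] tendsto_const]) (use assms in auto)
    hence "(\<lambda>k. ennreal (norm (f k x) powr p)) \<longlonglongrightarrow> ennreal (norm (g x) powr p)" by simp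
    thus ?case using lim_imp_Liminf[OF sequentially_bot] by metis
  qed
  also have "\<dots> \<le> liminf (\<lambda>k. \<integral>\<^sup>+x. ennreal (norm (f k x) powr p) \<partial>M)"
    by (rule nn_integral_liminf) auto
  also have "(\<lambda>k. \<integral>\<^sup>+x. ennreal (norm (f k x) powr p) \<partial>M) = (\<lambda>k. ennreal (NP p M (f k)))"
    using assms(2) by (simp add: NP_def nn_integral_eq_integral LP_integrable)
  also have "liminf (\<lambda>k. ennreal (NP p M (f k))) \<le> liminf (\<lambda>k. ennreal B)"
    by (intro Liminf_mono always_eventually allI ennreal_leI assms)
  also have "\<dots> = ennreal B" by (simp add: Liminf_const)
  finally have *: "(\<integral>\<^sup>+x. ennreal (norm (g x) powr p) \<partial>M) \<le> ennreal B" .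
  have "integrable M (\<lambda>x. norm (g x) powr p)"
    by (rule integrableI_nonneg) (use * in \<open>auto simp: le_less_trans[OF *]\<close>)
  thus "LP p M g" by (simp add: LP_def)
  with * show "NP p M g \<le> B"
    by (simp add: NP_def nn_integral_eq_integral LP_integrable B0)
qed

lemma LP_complete:
  fixes f :: "nat \<Rightarrow> 'a \<Rightarrow> 'b::euclidean_space"
  assumes "0 < p" "\<And>k. LP p M (f k)"
    and Cauchy: "\<And>e. 0 < e \<Longrightarrow> \<exists>N. \<forall>m\<ge>N. \<forall>n\<ge>N. NP p M (\<lambda>x. f m x - f n x) \<le> e"
  obtains g where "LP p M g" "(\<lambda>k. NP p M (\<lambda>x. f k x - g x)) \<longlonglongrightarrow> 0"
proof -
  note [measurable] = LP_measurable[OF assms(2)]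
  \<comment> \<open>Besides the summable factor the threshold contains
    \<open>(1/2) powr (k * p)\<close>, so that even the increments multiplied by
    \<open>2 powr k\<close> have summable energies. Their common majorant \<open>H\<close> then
    forces the increments themselves to decay geometrically at almost every point.\<close>
  define P where "P k N \<longleftrightarrow> (\<forall>m\<ge>N. \<forall>n\<ge>N. NP p M (\<lambda>x. f m x - f n x) \<le> (1/2)^k * (1/2) powr (k * p))" for k N :: nat
  have "eventually (P k) sequentially" for k
  proof -
    have "0 < (1/2)^k * (1/2) powr (k * p)" by simp
    then obtain N where "P k N" using Cauchy unfolding P_def by blast
    thus ?thesis unfolding eventually_sequentially P_def by (meson order_trans)
  qed
  then obtain r :: "nat \<Rightarrow> nat" where r: "strict_mono r" "\<And>k. P k (r k)"
    by (rule eventually_subseq_choice[of P]) blast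
  define D where "D k x = 2 powr (k * p) * norm (f (r (Suc k)) x - f (r k) x) powr p" for k :: nat and x
  have Dint: "integrable M (D k)" for k
    unfolding D_def using LP_integrable[OF LP_diff(1)[OF assms(1) assms(2,2)]] by auto
  have "(\<integral>x. D k x \<partial>M) \<le> (1/2)^k" for k
  proof -
    have "(\<integral>x. D k x \<partial>M) = 2 powr (k * p) * NP p M (\<lambda>x. f (r (Suc k)) x - f (r k) x)"
      by (simp add: D_def NP_def)
    also have "\<dots> \<le> 2 powr (k * p) * ((1/2)^k * (1/2) powr (k * p))"
      using r(2)[of k] strict_mono_less_eq[OF r(1), of k "Suc k"] by (intro mult_left_mono) (auto simp: P_def)
    also have "\<dots> = (1/2)^k * ((2 * (1/2)) powr (k * p))"
      by (subst powr_mult) auto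
    finally show ?thesis by simp
  qed
  then obtain H where H: "integrable M H" "\<And>x. H x \<ge> 0" "AE x in M. (\<forall>k. D k x \<le> H x) \<and> (\<lambda>k. D k x) \<longlonglongrightarrow> 0"
    using integrable_dominated_of_geometric[of M D] Dint by (auto simp: D_def)
  have conv: "AE x in M. convergent (\<lambda>k. f (r k) x)"
    using H(3)
  proof eventually_elim
    case (elim x)
    have b: "norm (f (r (Suc k)) x - f (r k) x) \<le> (H x) powr (1/p) * (1/2)^k" for k
    proof -
      have "(2 powr k * norm (f (r (Suc k)) x - f (r k) x)) powr p = D k x"
        by (simp add: D_def powr_mult powr_powr)
      hence "((2 powr k * norm (f (r (Suc k)) x - f (r k) x)) powr p) powr (1/p) \<le> H x powr (1/p)"
        using elim assms(1) by (intro powr_mono2) (auto simp: D_def)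
      hence "2 powr k * norm (f (r (Suc k)) x - f (r k) x) \<le> H x powr (1/p)"
        using assms(1) by (simp add: powr_powr)
      thus ?thesis by (simp add: field_simps powr_realpow)
    qed
    have "summable (\<lambda>k. f (r (Suc k)) x - f (r k) x)"
      by (rule summable_comparison_test[OF _ summable_mult[OF summable_geometric[of "1/2::real"], of "H x powr (1/p)"]])
         (use b in auto)
    hence "convergent (\<lambda>n. \<Sum>k<n. (f (r (Suc k)) x - f (r k) x))"
      by (simp add: summable_iff_convergent)
    hence "convergent (\<lambda>n. f (r n) x - f (r 0) x)"
      unfolding sum_lessThan_telescope[of "\<lambda>k. f (r k) x"] .
    thus ?case using convergent_add[OF _ convergent_const[of "f (r 0) x"]] by fastforce
  qed
  define g where "g x = lim (\<lambda>k. f (r k) x)" for x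
  have gm[measurable]: "g \<in> borel_measurable M" unfolding g_def by measurable
  have lim: "AE x in M. (\<lambda>k. f (r k) x) \<longlonglongrightarrow> g x"
    using conv by eventually_elim (simp add: g_def convergent_LIMSEQ_iff)
  \<comment> \<open>Fatou's lemma with \<open>n\<close> fixed, along the tail of the subsequence:
    the Cauchy bound survives the limit, and it holds for the whole sequence.\<close>
  have main: "LP p M (\<lambda>x. f n x - g x) \<and> NP p M (\<lambda>x. f n x - g x) \<le> e" if N: "\<forall>m\<ge>N. \<forall>n\<ge>N. NP p M (\<lambda>x. f m x - f n x) \<le> e" "n \<ge> N" for n N e
  proof -
    have rge: "r (k + N) \<ge> N" for k using seq_suble[OF r(1), of "k + N"] by linarith
    have B: "NP p M (\<lambda>x. f n x - f (r (k + N)) x) \<le> e" for k using N rge[of k] by blast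
    have L: "AE x in M. (\<lambda>k. f n x - f (r (k + N)) x) \<longlonglongrightarrow> f n x - g x"
      using lim by eventually_elim (intro tendsto_diff tendsto_const LIMSEQ_ignore_initial_segment)
    have m: "(\<lambda>x. f n x - g x) \<in> borel_measurable M" by measurable
    show ?thesis
      using LP_fatou[OF assms(1) LP_diff(1)[OF assms(1) assms(2,2)] B m L] by blast
  qed
  show ?thesis
  proof (rule that)
    obtain N where N: "\<forall>m\<ge>N. \<forall>n\<ge>N. NP p M (\<lambda>x. f m x - f n x) \<le> 1" using Cauchy[of 1] by auto
    have "LP p M (\<lambda>x. f N x - g x)" using main[OF N] by auto
    from LP_diff(1)[OF assms(1) assms(2)[of N] this] show "LP p M g" by simp
    show "(\<lambda>k. NP p M (\<lambda>x. f k x - g x)) \<longlonglongrightarrow> 0"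
    proof (rule LIMSEQ_I)
      fix e :: real assume "e > 0"
      obtain N where "\<forall>m\<ge>N. \<forall>n\<ge>N. NP p M (\<lambda>x. f m x - f n x) \<le> e / 2" using Cauchy[of "e/2"] \<open>e > 0\<close> by auto
      from main[OF this] \<open>e > 0\<close> show "\<exists>no. \<forall>n\<ge>no. norm (NP p M (\<lambda>x. f n x - g x) - 0) < e"
        by (intro exI[of _ N]) force
    qed
  qed
qed

text \<open>The quasi-triangle inequality, with its factor \<open>2 powr p\<close>, does not yield
  continuity of \<open>NP\<close>. Instead every subsequence has a dominated, pointwise convergent
  further subsequence, along which the energies converge.\<close>

lemma NP_tendsto:
  fixes f :: "nat \<Rightarrow> 'a \<Rightarrow> 'b::euclidean_space"
  assumes "0 < p" "\<And>k. LP p M (f k)" "LP p M g" "(\<lambda>k. NP p M (\<lambda>x. f k x - g x)) \<longlonglongrightarrow> 0"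
  shows "(\<lambda>k. NP p M (f k)) \<longlonglongrightarrow> NP p M g"
proof (rule subseq_principle)
  fix r :: "nat \<Rightarrow> nat" assume r: "strict_mono r"
  note [measurable] = LP_measurable[OF assms(2)] LP_measurable[OF assms(3)]
  have "(\<lambda>k. NP p M (\<lambda>x. f (r k) x - g x)) \<longlonglongrightarrow> 0"
    using LIMSEQ_subseq_LIMSEQ[OF assms(4) r] by (simp add: o_def)
  then obtain s H where sH: "strict_mono (s :: nat \<Rightarrow> nat)" "integrable M H" "\<And>x. H x \<ge> 0"
     "AE x in M. (\<forall>k. norm (f (r (s k)) x) powr p \<le> H x) \<and> (\<lambda>k. f (r (s k)) x) \<longlonglongrightarrow> g x"
    by (rule LP_dominated_subseq[where f = "\<lambda>k. f (r k)", OF assms(1,2,3)]) blast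
  have "(\<lambda>k. \<integral>x. norm (f (r (s k)) x) powr p \<partial>M) \<longlonglongrightarrow> (\<integral>x. norm (g x) powr p \<partial>M)"
  proof (rule integral_dominated_convergence[OF _ _ sH(2)])
    show "AE x in M. (\<lambda>k. norm (f (r (s k)) x) powr p) \<longlonglongrightarrow> norm (g x) powr p"
      using sH(4) by eventually_elim (auto intro!: tendsto_powr' tendsto_norm simp: assms)
    show "AE x in M. norm (norm (f (r (s k)) x) powr p) \<le> H x" for k
      using sH(4) by eventually_elim auto
  qed auto
  thus "\<exists>s. strict_mono s \<and> (\<lambda>k. NP p M (f (r (s k)))) \<longlonglongrightarrow> NP p M g"
    using sH(1) unfolding NP_def by blast
qed

text \<open>Stands in for weak compactness: near-minimisers of the energy over decreasing midpoint-closed sets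
  are Cauchy, by uniform convexity.\<close>

lemma mazur:
  fixes h :: "'i \<Rightarrow> 'a \<Rightarrow> 'b::euclidean_space" and S :: "nat \<Rightarrow> 'i set"
  assumes p: "1 < p" and dec: "\<And>k. S (Suc k) \<subseteq> S k" and ne: "\<And>k. S k \<noteq> {}"
    and LP: "\<And>k i. i \<in> S k \<Longrightarrow> LP p M (h i)" and bd: "\<And>k i. i \<in> S k \<Longrightarrow> NP p M (h i) \<le> B"
    and mid: "\<And>k i j. i \<in> S k \<Longrightarrow> j \<in> S k \<Longrightarrow> \<exists>l\<in>S k. h l = (\<lambda>x. (1/2) *\<^sub>R (h i x + h j x))"
  obtains v g where "\<And>k. v k \<in> S k" "LP p M g" "(\<lambda>k. NP p M (\<lambda>x. h (v k) x - g x)) \<longlonglongrightarrow> 0"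
proof -
  define d where "d k = Inf ((\<lambda>i. NP p M (h i)) ` S k)" for k
  have antimono: "S n \<subseteq> S m" if "m \<le> n" for m n
    using that by (rule lift_Suc_antimono_le[of S, OF dec])
  have bdd: "bdd_below ((\<lambda>i. NP p M (h i)) ` S k)" for k by (rule bdd_belowI[of _ 0]) auto
  have d_le: "d k \<le> NP p M (h i)" if "i \<in> S k" for k i
    unfolding d_def using that bdd by (intro cInf_lower) auto
  have "\<exists>i\<in>S k. NP p M (h i) < d k + 1 / Suc k" for k
    using cInf_lessD[of "(\<lambda>i. NP p M (h i)) ` S k" "d k + 1 / Suc k"] ne by (auto simp: d_def)
  then obtain v where v: "\<And>k. v k \<in> S k" "\<And>k. NP p M (h (v k)) < d k + 1 / Suc k" by metis
  have dmono: "incseq d"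
    unfolding incseq_Suc_iff d_def using dec ne bdd by (auto intro!: cInf_superset_mono)
  have "d k \<le> B" for k using d_le[OF v(1)] bd[OF v(1)] by (rule order_trans)
  then obtain L where L: "d \<longlonglongrightarrow> L" "\<And>k. d k \<le> L" using incseq_convergent[OF dmono] by blast
  \<comment> \<open>This quantity bounds the convexity defect of two late near-minimisers: their
    energies are at most \<open>L + 1 / Suc k\<close>, while the midpoint still lies in
    \<open>S k\<close> and has energy at least \<open>d k\<close>.\<close>
  have lim0: "(\<lambda>k. L + 1 / Suc k - d k) \<longlonglongrightarrow> 0"
    using tendsto_diff[OF tendsto_add[OF tendsto_const[of L] LIMSEQ_inverse_real_of_nat] L(1)] by (simp add: inverse_eq_divide)
  have B0: "B \<ge> 0" using bd[OF v(1)[of 0]] NP_nonneg[of p M "h (v 0)"] by linarith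
  have Cauchy: "\<exists>N. \<forall>m\<ge>N. \<forall>n\<ge>N. NP p M (\<lambda>x. h (v m) x - h (v n) x) \<le> e" if "e > 0" for e
  proof -
    \<comment> \<open>Calibrated so that the first term of the uniform convexity estimate, for two
      energies bounded by \<open>B\<close>, uses at most half of the tolerance.\<close>
    define e' where "e' = e / (4 * (B + 1))"
    have e': "e' > 0" using that B0 by (simp add: e'_def)
    obtain C where C: "0 \<le> C" "\<And>a b :: 'b. norm (a - b) powr p \<le> e' * (norm a powr p + norm b powr p)
        + C * ((norm a powr p + norm b powr p) / 2 - norm ((1/2) *\<^sub>R (a + b)) powr p)"
      using uniform_convexity[OF p e'] by metis
    have "(\<lambda>k. C * (L + 1 / Suc k - d k)) \<longlonglongrightarrow> C * 0" by (intro tendsto_mult lim0 tendsto_const)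
    hence "eventually (\<lambda>k. C * (L + 1 / Suc k - d k) < e / 2) sequentially"
      using that by (intro order_tendstoD(2)) auto
    then obtain N where N: "C * (L + 1 / Suc N - d N) < e / 2" by (auto simp: eventually_sequentially)
    have "NP p M (\<lambda>x. h (v m) x - h (v n) x) \<le> e" if "m \<ge> N" "n \<ge> N" for m n
    proof -
      have vm: "v m \<in> S N" "v n \<in> S N" using v antimono that by blast+
      obtain l where l: "l \<in> S N" "h l = (\<lambda>x. (1/2) *\<^sub>R (h (v m) x + h (v n) x))" using mid[OF vm] by blast
      note I = LP_integrable[OF LP[OF vm(1)]] LP_integrable[OF LP[OF vm(2)]] LP_integrable[OF LP[OF l(1)]]
      have "NP p M (\<lambda>x. h (v m) x - h (v n) x) \<le> (\<integral>x. e' * (norm (h (v m) x) powr p + norm (h (v n) x) powr p)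
        + C * ((norm (h (v m) x) powr p + norm (h (v n) x) powr p) / 2 - norm (h l x) powr p) \<partial>M)"
        unfolding NP_def
      proof (rule integral_mono)
        show "integrable M (\<lambda>x. norm (h (v m) x - h (v n) x) powr p)"
          using LP_integrable[OF LP_diff(1)[OF _ LP[OF vm(1)] LP[OF vm(2)]]] p by simp
      qed (use I C(2) in \<open>auto simp: l(2)\<close>)
      also have "\<dots> = e' * (NP p M (h (v m)) + NP p M (h (v n)))
          + C * ((NP p M (h (v m)) + NP p M (h (v n))) / 2 - NP p M (h l))"
        using I by (simp add: NP_def)
      also have "\<dots> \<le> e' * (2 * B) + C * (L + 1 / Suc N - d N)"
      proof (intro add_mono mult_left_mono)
        have *: "NP p M (h (v k)) \<le> L + 1 / Suc N" if "k \<ge> N" for k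
        proof -
          have "1 / Suc k \<le> 1 / Suc N" using that by (intro divide_left_mono) auto
          thus ?thesis using v(2)[of k] L(2)[of k] by linarith
        qed
        have "(a + b) / 2 - c \<le> x - d'" if "a \<le> x" "b \<le> x" "d' \<le> c" for a b c d' x :: real
        proof -
          have "a + b \<le> x + x" using that(1,2) by (rule add_mono)
          hence "(a + b) / 2 \<le> x" by simp
          thus ?thesis using that(3) by (rule diff_mono)
        qed
        from this[OF *[OF \<open>m \<ge> N\<close>] *[OF \<open>n \<ge> N\<close>] d_le[OF l(1)]]
        show "(NP p M (h (v m)) + NP p M (h (v n))) / 2 - NP p M (h l) \<le> L + 1 / Suc N - d N" .
        show "NP p M (h (v m)) + NP p M (h (v n)) \<le> 2 * B"
          using bd[OF vm(1)] bd[OF vm(2)] by linarith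
      qed (use e' C in auto)
      also have "e' * (2 * B) \<le> e / 2" using B0 \<open>e > 0\<close> by (simp add: e'_def field_simps)
      finally show ?thesis using N by linarith
    qed
    thus ?thesis by blast
  qed
  obtain g where "LP p M g" "(\<lambda>k. NP p M (\<lambda>x. h (v k) x - g x)) \<longlonglongrightarrow> 0"
    using LP_complete[of p M "\<lambda>k. h (v k)", OF _ LP[OF v(1)] Cauchy] p by auto
  thus ?thesis using that v by blast
qed

text \<open>Continuity of superposition operators from \<open>L^p\<close> to its dual exponent.
  Growth of order \<open>p - 1\<close> fits because \<open>(p - 1) * q = p\<close>, so the q-th
  power of the composition is dominated by the p-th power of the argument; continuity follows by
  dominated convergence along subsequences.\<close>

lemma nemytskii:
  fixes h :: "'a \<Rightarrow> 'b::euclidean_space \<Rightarrow> 'c::euclidean_space" and b0 :: "'a \<Rightarrow> real"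
  assumes p: "1 < p" and q: "q = p / (p - 1)"
    and meas: "\<And>f. f \<in> borel_measurable M \<Longrightarrow> (\<lambda>x. h x (f x)) \<in> borel_measurable M"
    and growth: "\<And>x z. norm (h x z) \<le> b0 x + \<beta> * norm z powr (p - 1)"
    and b0: "LP q M b0" "\<And>x. b0 x \<ge> 0" and \<beta>: "\<beta> \<ge> 0"
  shows nemytskii_LP: "LP p M f \<Longrightarrow> LP q M (\<lambda>x. h x (f x))"
    and nemytskii_NP: "LP p M f \<Longrightarrow> NP q M (\<lambda>x. h x (f x)) \<le> 2 powr q * (NP q M b0 + \<beta> powr q * NP p M f)"
    and nemytskii_tendsto: "(\<And>x. continuous_on UNIV (h x)) \<Longrightarrow> (\<And>k. LP p M (fs k)) \<Longrightarrow> LP p M f \<Longrightarrow>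
      (\<lambda>k. NP p M (\<lambda>x. fs k x - f x)) \<longlonglongrightarrow> 0 \<Longrightarrow> (\<lambda>k. NP q M (\<lambda>x. h x (fs k x) - h x (f x))) \<longlonglongrightarrow> 0"
proof -
  have p0: "0 < p" using p by simp
  have q1: "q > 1" using conj_conj(2)[OF p] q by simp
  have bound: "norm (h x z) powr q \<le> 2 powr q * (norm (b0 x) powr q + \<beta> powr q * norm z powr p)" for x z
  proof -
    have "norm (h x z) powr q \<le> (b0 x + \<beta> * norm z powr (p - 1)) powr q"
      using q1 by (intro powr_mono2 growth) auto
    also have "\<dots> \<le> 2 powr q * (b0 x powr q + (\<beta> * norm z powr (p - 1)) powr q)"
      using b0 \<beta> q1 by (intro powr_add_le) auto
    also have "(\<beta> * norm z powr (p - 1)) powr q = \<beta> powr q * norm z powr p"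
      using \<beta> conj_powr(3)[OF p, of "norm z"] by (simp add: powr_mult q)
    finally show ?thesis using b0 by simp
  qed
  have I: "integrable M (\<lambda>x. 2 powr q * (norm (b0 x) powr q + \<beta> powr q * H x))" if "integrable M H" for H
    using that b0 by (auto simp: LP_def)
  show LPh: "LP q M (\<lambda>x. h x (f x))" if f: "LP p M f" for f
    by (rule LP_minorant[OF meas[OF LP_measurable[OF f]] I[OF LP_integrable[OF f]]]) (use bound in auto)
  show "NP q M (\<lambda>x. h x (f x)) \<le> 2 powr q * (NP q M b0 + \<beta> powr q * NP p M f)" if f: "LP p M f"
  proof -
    have "NP q M (\<lambda>x. h x (f x)) \<le> (\<integral>x. 2 powr q * (norm (b0 x) powr q + \<beta> powr q * norm (f x) powr p) \<partial>M)"
      unfolding NP_def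
      by (rule integral_mono[OF LP_integrable[OF LPh[OF f]] I[OF LP_integrable[OF f]]]) (use bound in auto)
    also have "\<dots> = 2 powr q * (NP q M b0 + \<beta> powr q * NP p M f)"
      using f b0 by (simp add: NP_def LP_def)
    finally show ?thesis .
  qed
  assume cont: "\<And>x. continuous_on UNIV (h x)" and fs: "\<And>k. LP p M (fs k)" and f: "LP p M f"
    and lim: "(\<lambda>k. NP p M (\<lambda>x. fs k x - f x)) \<longlonglongrightarrow> 0"
  show "(\<lambda>k. NP q M (\<lambda>x. h x (fs k x) - h x (f x))) \<longlonglongrightarrow> 0"
  proof (rule subseq_principle)
    fix r :: "nat \<Rightarrow> nat" assume r: "strict_mono r"
    note [measurable] = meas[OF LP_measurable[OF f]] meas[OF LP_measurable[OF fs]]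
    have "(\<lambda>k. NP p M (\<lambda>x. fs (r k) x - f x)) \<longlonglongrightarrow> 0"
      using LIMSEQ_subseq_LIMSEQ[OF lim r] by (simp add: o_def)
    then obtain s H where sH: "strict_mono (s :: nat \<Rightarrow> nat)" "integrable M H" "\<And>x. H x \<ge> 0"
       "AE x in M. (\<forall>k. norm (fs (r (s k)) x) powr p \<le> H x) \<and> (\<lambda>k. fs (r (s k)) x) \<longlonglongrightarrow> f x"
      by (rule LP_dominated_subseq[where f = "\<lambda>k. fs (r k)", OF p0 fs f]) blast
    define G where "G x = 2 powr q * (2 powr q * (norm (b0 x) powr q + \<beta> powr q * H x) +
        norm (h x (f x)) powr q)" for x
    have "(\<lambda>k. \<integral>x. norm (h x (fs (r (s k)) x) - h x (f x)) powr q \<partial>M) \<longlonglongrightarrow> (\<integral>x. 0 \<partial>M)"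
    proof (rule integral_dominated_convergence)
      show "integrable M G" unfolding G_def using I[OF sH(2)] LP_integrable[OF LPh[OF f]] by auto
      show "AE x in M. (\<lambda>k. norm (h x (fs (r (s k)) x) - h x (f x)) powr q) \<longlonglongrightarrow> 0"
        using sH(4)
      proof eventually_elim
        case (elim x)
        have "(\<lambda>k. h x (fs (r (s k)) x)) \<longlonglongrightarrow> h x (f x)"
          using continuous_on_tendsto_compose[OF cont[of x], of "\<lambda>k. fs (r (s k)) x" "f x" sequentially] elim by auto
        thus ?case using norm_powr_tendsto_zero_iff[of q "\<lambda>k. h x (fs (r (s k)) x) - h x (f x)"] q1 by (simp add: LIM_zero_iff)
      qed
      show "AE x in M. norm (norm (h x (fs (r (s k)) x) - h x (f x)) powr q) \<le> G x" for k
        using sH(4)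
      proof eventually_elim
        case (elim x)
        have "norm (h x (fs (r (s k)) x) - h x (f x)) powr q \<le> 2 powr q * (norm (h x (fs (r (s k)) x)) powr q + norm (h x (f x)) powr q)"
          using q1 by (intro norm_diff_powr_le) auto
        also have "norm (h x (fs (r (s k)) x)) powr q \<le> 2 powr q * (norm (b0 x) powr q + \<beta> powr q * norm (fs (r (s k)) x) powr p)"
          by (rule bound)
        also have "\<dots> \<le> 2 powr q * (norm (b0 x) powr q + \<beta> powr q * H x)"
          using elim by (intro mult_left_mono add_left_mono) auto
        finally show ?case by (simp add: G_def)
      qed
    qed auto
    thus "\<exists>s. strict_mono s \<and> (\<lambda>k. NP q M (\<lambda>x. h x (fs (r (s k)) x) - h x (f x))) \<longlonglongrightarrow> 0"
      using sH(1) unfolding NP_def by auto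
  qed
qed

section \<open>Zeros of coercive maps on a cube\<close>

text \<open>Kuhn's lemma is stated for grids of dimension \<open>m :: nat\<close>, unlike the library's Brouwer theorem, whose
  dimension is a type and therefore cannot vary with the Galerkin space.\<close>

lemma poincare_miranda:
  fixes K :: "(nat \<Rightarrow> real) \<Rightarrow> nat \<Rightarrow> real"
  assumes R: "R > 0"
    and cont: "\<And>xs x i. (\<And>k j. j < m \<Longrightarrow> \<bar>xs k j\<bar> \<le> R) \<Longrightarrow> (\<And>j. j < m \<Longrightarrow> (\<lambda>k. xs k j) \<longlonglongrightarrow> x j) \<Longrightarrow>
       i < m \<Longrightarrow> (\<lambda>k. K (xs k) i) \<longlonglongrightarrow> K x i"
    and lo: "\<And>x i. (\<And>j. j < m \<Longrightarrow> \<bar>x j\<bar> \<le> R) \<Longrightarrow> i < m \<Longrightarrow> x i = - R \<Longrightarrow> K x i \<le> 0"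
    and hi: "\<And>x i. (\<And>j. j < m \<Longrightarrow> \<bar>x j\<bar> \<le> R) \<Longrightarrow> i < m \<Longrightarrow> x i = R \<Longrightarrow> 0 \<le> K x i"
  obtains x where "\<And>j. j < m \<Longrightarrow> \<bar>x j\<bar> \<le> R" "\<And>i. i < m \<Longrightarrow> K x i = 0"
proof -
  define pt where "pt N q j = - R + 2 * R * (real (q j) / real (Suc N))" for N and q :: "nat \<Rightarrow> nat" and j :: nat
  have pt_bd: "\<bar>pt N q j\<bar> \<le> R" if "q j \<le> Suc N" for N q j
  proof -
    have "0 \<le> real (q j) / real (Suc N)" "real (q j) / real (Suc N) \<le> 1" using that by (auto simp: divide_le_eq)
    from mult_left_mono[OF this(1), of "2 * R"] mult_left_mono[OF this(2), of "2 * R"] R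
    show ?thesis by (auto simp: pt_def abs_le_iff)
  qed
  have "\<exists>q. (\<forall>i<m. q i < Suc N) \<and> (\<forall>i<m. \<exists>r s. (\<forall>j<m. q j \<le> r j \<and> r j \<le> q j + 1) \<and>
      (\<forall>j<m. q j \<le> s j \<and> s j \<le> q j + 1) \<and> K (pt N r) i \<le> 0 \<and> 0 \<le> K (pt N s) i)" for N
  proof -
    \<comment> \<open>On two opposite faces the label is prescribed, as Kuhn's lemma demands, and
      elsewhere it records the sign of \<open>K\<close>. The boundary hypotheses on \<open>K\<close>
      ensure that the prescribed labels are consistent with the sign as well.\<close>
    define label where "label q i = (if q i = Suc N then 1 else if q i = 0 then 0
       else if K (pt N q) i \<ge> 0 then 1 else (0::nat))" for q and i :: nat
    obtain q where q: "\<forall>i<m. q i < Suc N"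
       "\<forall>i<m. \<exists>r s. (\<forall>j<m. q j \<le> r j \<and> r j \<le> q j + 1) \<and> (\<forall>j<m. q j \<le> s j \<and> s j \<le> q j + 1) \<and> label r i \<noteq> label s i"
      by (rule kuhn_lemma[of "Suc N" m label]) (auto simp: label_def)
    have le: "K (pt N r) i \<le> 0" if "label r i = 0" "i < m" "\<forall>j<m. q j \<le> r j \<and> r j \<le> q j + 1" for r i
    proof (cases "r i = 0")
      case True
      hence "pt N r i = - R" by (simp add: pt_def)
      moreover have "\<bar>pt N r j\<bar> \<le> R" if "j < m" for j
        using that \<open>\<forall>j<m. q j \<le> r j \<and> r j \<le> q j + 1\<close> q(1) by (intro pt_bd) fastforce
      ultimately show ?thesis using lo[of "pt N r" i] that by auto
    qed (use that in \<open>auto simp: label_def split: if_splits\<close>)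
    have ge: "0 \<le> K (pt N r) i" if "label r i \<noteq> 0" "i < m" "\<forall>j<m. q j \<le> r j \<and> r j \<le> q j + 1" for r i
    proof (cases "r i = Suc N")
      case True
      hence "pt N r i = R" by (simp add: pt_def)
      moreover have "\<bar>pt N r j\<bar> \<le> R" if "j < m" for j
        using that \<open>\<forall>j<m. q j \<le> r j \<and> r j \<le> q j + 1\<close> q(1) by (intro pt_bd) fastforce
      ultimately show ?thesis using hi[of "pt N r" i] that by auto
    qed (use that in \<open>auto simp: label_def split: if_splits\<close>)
    have "\<exists>r s. (\<forall>j<m. q j \<le> r j \<and> r j \<le> q j + 1) \<and>
      (\<forall>j<m. q j \<le> s j \<and> s j \<le> q j + 1) \<and> K (pt N r) i \<le> 0 \<and> 0 \<le> K (pt N s) i" if im: "i < m" for i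
    proof -
      obtain r s where rs: "\<forall>j<m. q j \<le> r j \<and> r j \<le> q j + 1" "\<forall>j<m. q j \<le> s j \<and> s j \<le> q j + 1" "label r i \<noteq> label s i"
        using q(2)[THEN spec, THEN mp, OF im] by (elim exE conjE) (rule that)
      show ?thesis
      proof (cases "label r i = 0")
        case True
        hence "label s i \<noteq> 0" using rs(3) by simp
        with le[OF True im rs(1)] ge[OF this im rs(2)] rs show ?thesis by blast
      next
        case False
        hence "label s i = 0" using rs(3) by (auto simp: label_def split: if_splits)
        with ge[OF False im rs(1)] le[OF this im rs(2)] rs show ?thesis by blast
      qed
    qed
    thus ?thesis using q(1) by blast
  qed
  then obtain q where q: "\<And>N i. i < m \<Longrightarrow> q N i < Suc N"
    and rs_ex: "\<And>N i. i < m \<Longrightarrow> \<exists>r s. (\<forall>j<m. q N j \<le> r j \<and> r j \<le> q N j + 1) \<and>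
      (\<forall>j<m. q N j \<le> s j \<and> s j \<le> q N j + 1) \<and> K (pt N r) i \<le> 0 \<and> 0 \<le> K (pt N s) i"
    by metis
  define Q where "Q N i r s \<longleftrightarrow> (\<forall>j<m. q N j \<le> r j \<and> r j \<le> q N j + 1) \<and>
      (\<forall>j<m. q N j \<le> s j \<and> s j \<le> q N j + 1) \<and> K (pt N r) i \<le> 0 \<and> 0 \<le> K (pt N s) i" for N i r s
  define rs where "rs N i = (SOME z. Q N i (fst z) (snd z))" for N i
  have "Q N i (fst (rs N i)) (snd (rs N i))" if "i < m" for N i
  proof -
    have "\<exists>r s. Q N i r s" unfolding Q_def by (rule rs_ex[OF that])
    then obtain r s where "Q N i r s" by blast
    hence "Q N i (fst (r, s)) (snd (r, s))" by simp
    thus ?thesis unfolding rs_def by (rule someI)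
  qed
  then obtain r s where "\<And>N i. i < m \<Longrightarrow> Q N i (r N i) (s N i)"
    by (rule that[of "\<lambda>N i. fst (rs N i)" "\<lambda>N i. snd (rs N i)"])
  hence r: "\<And>N i j. i < m \<Longrightarrow> j < m \<Longrightarrow> q N j \<le> r N i j \<and> r N i j \<le> q N j + 1"
    and s: "\<And>N i j. i < m \<Longrightarrow> j < m \<Longrightarrow> q N j \<le> s N i j \<and> s N i j \<le> q N j + 1"
    and Kr: "\<And>N i. i < m \<Longrightarrow> K (pt N (r N i)) i \<le> 0" and Ks: "\<And>N i. i < m \<Longrightarrow> 0 \<le> K (pt N (s N i)) i"
    unfolding Q_def by simp_all
  have "\<exists>k :: nat \<Rightarrow> nat. strict_mono k \<and> (\<forall>i<m. \<exists>l. (\<lambda>n. pt (k n) (q (k n)) i) \<longlonglongrightarrow> l)"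
  proof (rule function_convergent_subsequence[of "{..<m}" "\<lambda>N. pt N (q N)" R])
    show "norm (pt N (q N) i) \<le> R" if "i \<in> {..<m}" for N i
      using pt_bd[of "q N" i N] q[of i N] that by simp
  qed auto
  then obtain k :: "nat \<Rightarrow> nat" where k: "strict_mono k"
      "\<And>i. i < m \<Longrightarrow> \<exists>l. (\<lambda>n. pt (k n) (q (k n)) i) \<longlonglongrightarrow> l" by blast
  then obtain x where x: "\<And>i. i < m \<Longrightarrow> (\<lambda>n. pt (k n) (q (k n)) i) \<longlonglongrightarrow> x i" by metis
  \<comment> \<open>Corners of one cell differ in each coordinate by at most the mesh width
    \<open>2 * R / Suc N\<close>. Hence all corners selected from the cells share the limit of the
    base corners.\<close>
  have near: "(\<lambda>n. pt (k n) (t (k n)) j) \<longlonglongrightarrow> x j" if "j < m" "\<And>N. q N j \<le> t N j \<and> t N j \<le> q N j + 1" for t j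
  proof -
    have z: "(\<lambda>n. 2 * R * (1 / real (Suc (k n)))) \<longlonglongrightarrow> 2 * R * 0"
      using LIMSEQ_subseq_LIMSEQ[OF LIMSEQ_inverse_real_of_nat k(1)]
      by (intro tendsto_mult tendsto_const) (simp add: o_def inverse_eq_divide)
    have "(\<lambda>n. pt (k n) (t (k n)) j - pt (k n) (q (k n)) j) \<longlonglongrightarrow> 0"
    proof (rule Lim_null_comparison[OF always_eventually])
      show "\<forall>n. norm (pt (k n) (t (k n)) j - pt (k n) (q (k n)) j) \<le> 2 * R * (1 / real (Suc (k n)))"
      proof
        fix n
        have "pt (k n) (t (k n)) j - pt (k n) (q (k n)) j = 2 * R * ((real (t (k n) j) - real (q (k n) j)) / real (Suc (k n)))"
          by (simp add: pt_def diff_divide_distrib right_diff_distrib)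
        moreover have "0 \<le> real (t (k n) j) - real (q (k n) j)" "real (t (k n) j) - real (q (k n) j) \<le> 1"
          using that(2)[of "k n"] by auto
        ultimately show "norm (pt (k n) (t (k n)) j - pt (k n) (q (k n)) j) \<le> 2 * R * (1 / real (Suc (k n)))"
          using R by (auto simp: abs_mult intro!: divide_right_mono)
      qed
    qed (use z in simp)
    from tendsto_add[OF this x[OF that(1)]] show ?thesis by simp
  qed
  have bdx: "\<bar>x j\<bar> \<le> R" if "j < m" for j
  proof (rule tendsto_upperbound)
    show "(\<lambda>n. \<bar>pt (k n) (q (k n)) j\<bar>) \<longlonglongrightarrow> \<bar>x j\<bar>" by (intro tendsto_rabs x that)
    show "\<forall>\<^sub>F n in sequentially. \<bar>pt (k n) (q (k n)) j\<bar> \<le> R"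
      using pt_bd q[OF that] by (intro always_eventually allI) (simp add: less_imp_le)
  qed auto
  show ?thesis
  proof (rule that[OF bdx])
    fix i assume i: "i < m"
    have "(\<lambda>n. K (pt (k n) (r (k n) i)) i) \<longlonglongrightarrow> K x i"
    proof (rule cont[OF _ _ i])
      show "\<bar>pt (k n) (r (k n) i) j\<bar> \<le> R" if "j < m" for n j
        using r[OF i that, of "k n"] q[OF that, of "k n"] by (intro pt_bd) linarith
      show "(\<lambda>n. pt (k n) (r (k n) i) j) \<longlonglongrightarrow> x j" if "j < m" for j
        using near[of j "\<lambda>N. r N i"] r[OF i that] that by auto
    qed
    hence "K x i \<le> 0" by (rule tendsto_upperbound) (use Kr[OF i] in auto)
    moreover have "(\<lambda>n. K (pt (k n) (s (k n) i)) i) \<longlonglongrightarrow> K x i"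
    proof (rule cont[OF _ _ i])
      show "\<bar>pt (k n) (s (k n) i) j\<bar> \<le> R" if "j < m" for n j
        using s[OF i that, of "k n"] q[OF that, of "k n"] by (intro pt_bd) linarith
      show "(\<lambda>n. pt (k n) (s (k n) i) j) \<longlonglongrightarrow> x j" if "j < m" for j
        using near[of j "\<lambda>N. s N i"] s[OF i that] that by auto
    qed
    hence "0 \<le> K x i" by (rule tendsto_lowerbound) (use Ks[OF i] in auto)
    ultimately show "K x i = 0" by simp
  qed
qed

text \<open>The map \<open>x - clip (x - G x)\<close> has the right boundary signs for any
  \<open>G\<close>. At its zero every product \<open>G x i * x i\<close> is at most 0, since a
  coordinate is either strictly inside, where clipping is inactive and \<open>G x i = 0\<close>, or
  on a face, where \<open>G\<close> points outward or vanishes in the opposite sense. Coercivity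
  excludes the faces, so all coordinates are of the first kind.\<close>

lemma coercive_zero:
  fixes G :: "(nat \<Rightarrow> real) \<Rightarrow> nat \<Rightarrow> real"
  assumes R: "R > 0"
    and cont: "\<And>xs x i. (\<And>k j. j < m \<Longrightarrow> \<bar>xs k j\<bar> \<le> R) \<Longrightarrow> (\<And>j. j < m \<Longrightarrow> (\<lambda>k. xs k j) \<longlonglongrightarrow> x j) \<Longrightarrow>
       i < m \<Longrightarrow> (\<lambda>k. G (xs k) i) \<longlonglongrightarrow> G x i"
    and coercive: "\<And>x i. (\<And>j. j < m \<Longrightarrow> \<bar>x j\<bar> \<le> R) \<Longrightarrow> i < m \<Longrightarrow> \<bar>x i\<bar> = R \<Longrightarrow> 0 < (\<Sum>j<m. G x j * x j)"
  obtains x where "\<And>i. i < m \<Longrightarrow> G x i = 0"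
proof -
  define clip where "clip t = max (- R) (min R t)" for t
  obtain x where x: "\<And>j. j < m \<Longrightarrow> \<bar>x j\<bar> \<le> R" "\<And>i. i < m \<Longrightarrow> x i - clip (x i - G x i) = 0"
  proof (rule poincare_miranda[of R m "\<lambda>x i. x i - clip (x i - G x i)"])
    fix xs x i assume *: "\<And>k j. j < m \<Longrightarrow> \<bar>xs k j\<bar> \<le> R" "\<And>j. j < m \<Longrightarrow> (\<lambda>k. xs k j) \<longlonglongrightarrow> x j" "i < m"
    show "(\<lambda>k. xs k i - clip (xs k i - G (xs k) i)) \<longlonglongrightarrow> x i - clip (x i - G x i)"
      unfolding clip_def using cont[of xs x i] * by (intro tendsto_intros) auto
  qed (use R in \<open>auto simp: clip_def\<close>)
  have "G x i * x i \<le> 0" if "i < m" for i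
    using x[OF that] R by (auto simp: clip_def max_def min_def abs_if mult_le_0_iff split: if_splits)
  hence "(\<Sum>j<m. G x j * x j) \<le> 0" by (intro sum_nonpos) auto
  hence *: "\<bar>x i\<bar> \<noteq> R" if "i < m" for i using coercive[OF x(1) that] by force
  have "G x i = 0" if "i < m" for i
  proof -
    have "x i < R" "- R < x i" using *[OF that] x(1)[OF that] by (auto simp: abs_if split: if_splits)
    thus ?thesis using x(2)[OF that] R by (auto simp: clip_def max_def min_def split: if_splits)
  qed
  thus ?thesis using that by blast
qed

section \<open>Test functions\<close>

lemma smooth_fun_differentiable: "smooth_fun f \<Longrightarrow> f differentiable (at x)"
  unfolding smooth_fun_def using iter_partial.simps(1) by metis

lemma smooth_fun_partial: "smooth_fun f \<Longrightarrow> smooth_fun (partial_deriv f i)"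
  unfolding smooth_fun_def using iter_partial.simps(2) by metis

lemma smooth_fun_has_derivative:
  fixes f :: "real^'n \<Rightarrow> real"
  assumes "smooth_fun f"
  shows "(f has_derivative (\<lambda>h. grad f x \<bullet> h)) (at x)"
proof -
  let ?L = "frechet_derivative f (at x)"
  have D: "(f has_derivative ?L) (at x)"
    using smooth_fun_differentiable[OF assms] frechet_derivative_works by blast
  have lin: "linear ?L" using D has_derivative_linear by blast
  have "?L h = grad f x \<bullet> h" for h
  proof -
    have "?L h = ?L (\<Sum>i\<in>UNIV. (h $ i) *\<^sub>R axis i 1)"
      using basis_expansion[of h] by (simp add: scalar_mult_eq_scaleR)
    also have "\<dots> = (\<Sum>i\<in>UNIV. (h $ i) * ?L (axis i 1))"
      by (simp add: linear_sum[OF lin] linear_cmul[OF lin])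
    also have "\<dots> = grad f x \<bullet> h"
      by (simp add: grad_def partial_deriv_def inner_vec_def mult.commute)
    finally show ?thesis .
  qed
  hence "?L = (\<lambda>h. grad f x \<bullet> h)" by auto
  with D show ?thesis by simp
qed

lemma smooth_fun_continuous: "smooth_fun f \<Longrightarrow> continuous_on S f"
  using smooth_fun_differentiable differentiable_imp_continuous_within
  by (intro continuous_at_imp_continuous_on ballI) blast

lemma partial_deriv_eq_grad: "partial_deriv f i x = grad f x $ i"
  by (simp add: grad_def)

lemma smooth_fun_grad_continuous:
  fixes f :: "real^'n \<Rightarrow> real"
  assumes "smooth_fun f"
  shows "continuous_on S (grad f)"
proof -
  have "continuous_on S (\<lambda>x. partial_deriv f i x)" for i
    using smooth_fun_continuous[OF smooth_fun_partial[OF assms]] .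
  thus ?thesis unfolding grad_def by (intro continuous_on_vec_lambda)
qed

lemma partial_deriv_lincomb:
  fixes f g :: "real^'n \<Rightarrow> real"
  assumes "\<And>x. f differentiable (at x)" "\<And>x. g differentiable (at x)"
  shows "partial_deriv (\<lambda>x. c * f x + d * g x) i = (\<lambda>x. c * partial_deriv f i x + d * partial_deriv g i x)"
proof
  fix x
  have "((\<lambda>x. c * f x + d * g x) has_derivative
     (\<lambda>h. c * frechet_derivative f (at x) h + d * frechet_derivative g (at x) h)) (at x)"
    using assms[of x] unfolding frechet_derivative_works by (auto intro!: derivative_eq_intros)
  hence "frechet_derivative (\<lambda>x. c * f x + d * g x) (at x) =
     (\<lambda>h. c * frechet_derivative f (at x) h + d * frechet_derivative g (at x) h)"
    by (rule frechet_derivative_at[symmetric])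
  thus "partial_deriv (\<lambda>x. c * f x + d * g x) i x = c * partial_deriv f i x + d * partial_deriv g i x"
    by (simp add: partial_deriv_def)
qed

lemma smooth_fun_lincomb:
  fixes f g :: "real^'n \<Rightarrow> real"
  assumes "smooth_fun f" "smooth_fun g"
  shows "smooth_fun (\<lambda>x. c * f x + d * g x)"
proof -
  have "iter_partial is (\<lambda>x. c * f x + d * g x) = (\<lambda>x. c * iter_partial is f x + d * iter_partial is g x)" for "is"
    using assms
  proof (induction "is" arbitrary: f g)
    case (Cons i "is")
    have "partial_deriv (\<lambda>x. c * f x + d * g x) i = (\<lambda>x. c * partial_deriv f i x + d * partial_deriv g i x)"
      using Cons.prems by (intro partial_deriv_lincomb smooth_fun_differentiable)
    thus ?case
      using Cons.IH[of "partial_deriv f i" "partial_deriv g i"] Cons.prems by (simp add: smooth_fun_partial)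
  qed auto
  thus ?thesis using assms unfolding smooth_fun_def by (auto intro!: derivative_intros)
qed

lemma grad_lincomb:
  fixes f g :: "real^'n \<Rightarrow> real"
  assumes "smooth_fun f" "smooth_fun g"
  shows "grad (\<lambda>x. c * f x + d * g x) x = c *\<^sub>R grad f x + d *\<^sub>R grad g x"
  using partial_deriv_lincomb[of f g c d] assms
  by (simp add: grad_def vec_eq_iff smooth_fun_differentiable)

lemma test_fun_smooth: "test_fun \<Omega> f \<Longrightarrow> smooth_fun f"
  by (simp add: test_fun_def)

lemma test_fun_lincomb:
  fixes f g :: "real^'n \<Rightarrow> real"
  assumes "test_fun \<Omega> f" "test_fun \<Omega> g"
  shows "test_fun \<Omega> (\<lambda>x. c * f x + d * g x)"
proof -
  have sub: "{x. c * f x + d * g x \<noteq> 0} \<subseteq> {x. f x \<noteq> 0} \<union> {x. g x \<noteq> 0}" by auto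
  hence *: "closure {x. c * f x + d * g x \<noteq> 0} \<subseteq> closure {x. f x \<noteq> 0} \<union> closure {x. g x \<noteq> 0}"
    using closure_mono[OF sub] by (simp add: closure_Un)
  moreover have "compact (closure {x. f x \<noteq> 0} \<union> closure {x. g x \<noteq> 0})"
    using assms by (auto simp: test_fun_def intro: compact_Un)
  ultimately have "compact ((closure {x. f x \<noteq> 0} \<union> closure {x. g x \<noteq> 0}) \<inter> closure {x. c * f x + d * g x \<noteq> 0})"
    by (intro compact_Int_closed) auto
  hence "compact (closure {x. c * f x + d * g x \<noteq> 0})" using * by (simp add: Int_absorb1)
  thus ?thesis using * assms by (auto simp: test_fun_def smooth_fun_lincomb)
qed

lemma smooth_fun_zero: "smooth_fun (\<lambda>x :: real^'n. 0)"
proof -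
  have p0: "partial_deriv (\<lambda>x :: real^'n. 0) i = (\<lambda>x. 0)" for i
    by (rule ext) (simp add: partial_deriv_def flip: frechet_derivative_at[OF has_derivative_const])
  have "iter_partial is (\<lambda>x :: real^'n. 0) = (\<lambda>x. 0)" for "is"
    by (induction "is") (simp_all add: p0)
  thus ?thesis by (simp add: smooth_fun_def)
qed

lemma test_fun_zero: "test_fun \<Omega> (\<lambda>x :: real^'n. 0)"
  by (simp add: test_fun_def smooth_fun_zero)

text \<open>Function and gradient are bundled into one map, so that the \<open>W^{1,p}\<close>
  energy is, up to constants, a single \<open>L^p\<close> energy and uniform convexity and
  completeness apply to both components at once.\<close>

definition jet :: "(real^'n \<Rightarrow> real) \<Rightarrow> real^'n \<Rightarrow> real \<times> (real^'n)" where
  "jet f x = (f x, grad f x)"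

lemma jet_lincomb:
  assumes "smooth_fun f" "smooth_fun g"
  shows "jet (\<lambda>x. c * f x + d * g x) x = c *\<^sub>R jet f x + d *\<^sub>R jet g x"
  using assms by (simp add: jet_def grad_lincomb)

lemma jet_zero: "jet (\<lambda>x. 0) = (\<lambda>x. 0)"
  using jet_lincomb[OF smooth_fun_zero smooth_fun_zero, of 0 0] by (auto simp: fun_eq_iff)

lemma test_fun_sum:
  fixes f :: "nat \<Rightarrow> real^'n \<Rightarrow> real"
  assumes "\<And>i. i < m \<Longrightarrow> test_fun \<Omega> (f i)"
  shows "test_fun \<Omega> (\<lambda>x. \<Sum>i<m. c i * f i x) \<and> (\<forall>x. jet (\<lambda>x. \<Sum>i<m. c i * f i x) x = (\<Sum>i<m. c i *\<^sub>R jet (f i) x))"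
  using assms
proof (induction m)
  case 0
  show ?case by (simp add: test_fun_zero jet_zero)
next
  case (Suc m)
  have IH: "test_fun \<Omega> (\<lambda>x. \<Sum>i<m. c i * f i x)" "\<And>x. jet (\<lambda>x. \<Sum>i<m. c i * f i x) x = (\<Sum>i<m. c i *\<^sub>R jet (f i) x)"
    using Suc.IH Suc.prems by auto
  have f: "test_fun \<Omega> (f m)" using Suc.prems by auto
  show ?case
    using test_fun_lincomb[OF IH(1) f, of 1 "c m"] jet_lincomb[OF test_fun_smooth[OF IH(1)] test_fun_smooth[OF f], of 1 "c m"]
    by (simp add: IH(2))
qed

lemma test_fun_midpoint:
  assumes "test_fun \<Omega> f" "test_fun \<Omega> g"
  shows "test_fun \<Omega> (\<lambda>x. 1/2 * f x + 1/2 * g x)"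
    "jet (\<lambda>x. 1/2 * f x + 1/2 * g x) = (\<lambda>x. (1/2) *\<^sub>R (jet f x + jet g x))"
  using test_fun_lincomb[OF assms, of "1/2" "1/2"] jet_lincomb[OF assms[THEN test_fun_smooth], of "1/2" "1/2"]
  by (auto simp: scaleR_add_right fun_eq_iff)

lemma test_fun_diff:
  assumes "test_fun \<Omega> f" "test_fun \<Omega> g"
  shows "test_fun \<Omega> (\<lambda>x. f x - g x)" "jet (\<lambda>x. f x - g x) = (\<lambda>x. jet f x - jet g x)"
  using test_fun_lincomb[OF assms, of 1 "-1"] jet_lincomb[OF assms[THEN test_fun_smooth], of 1 "-1"]
  by auto

text \<open>The complement of the closed support is open, so \<open>f\<close> vanishes near the
  point and uniqueness of the derivative makes the gradient vanish too.\<close>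

lemma jet_eq_0_outside:
  fixes f :: "real^'n \<Rightarrow> real"
  assumes "smooth_fun f" "x \<notin> closure {x. f x \<noteq> 0}"
  shows "jet f x = 0"
proof -
  let ?U = "- closure {x. f x \<noteq> 0}"
  have U: "open ?U" "x \<in> ?U" using assms by auto
  have z: "f y = 0" if "y \<in> ?U" for y using that closure_subset[of "{x. f x \<noteq> 0}"] by auto
  have "((\<lambda>_. 0) has_derivative (\<lambda>h. grad f x \<bullet> h)) (at x)"
    by (rule has_derivative_transform_within_open[OF smooth_fun_has_derivative[OF assms(1)] U]) (rule z)
  hence "(\<lambda>h. grad f x \<bullet> h) = (\<lambda>h. 0)" by (rule has_derivative_unique) simp
  hence "grad f x \<bullet> grad f x = 0" by meson
  thus ?thesis using z[OF U(2)] by (simp add: jet_def prod_eq_iff)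
qed

lemma test_fun_jet_outside:
  assumes "test_fun \<Omega> f" "x \<notin> \<Omega>"
  shows "jet f x = 0" "f x = 0" "grad f x = 0"
proof -
  show "jet f x = 0" using assms by (intro jet_eq_0_outside) (auto simp: test_fun_def)
  thus "f x = 0" "grad f x = 0" by (auto simp: jet_def prod_eq_iff)
qed

lemma test_fun_jet_continuous: "test_fun \<Omega> f \<Longrightarrow> continuous_on S (jet f)"
  unfolding jet_def[abs_def]
  by (intro continuous_intros smooth_fun_continuous smooth_fun_grad_continuous test_fun_smooth)

section \<open>Integrability of functions with bounded support\<close>

lemma continuous_borel_lebesgue:
  fixes g :: "'a::euclidean_space \<Rightarrow> 'b::euclidean_space"
  assumes "continuous_on UNIV g"
  shows "g \<in> borel_measurable lborel" "g \<in> borel_measurable borel" "g \<in> borel_measurable lebesgue"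
proof -
  show "g \<in> borel_measurable borel" using assms by (rule borel_measurable_continuous_onI)
  thus "g \<in> borel_measurable lborel" by simp
  thus "g \<in> borel_measurable lebesgue" by (rule measurable_completion)
qed

lemma integrable_lborel_of_bounded_support:
  fixes g :: "'a::euclidean_space \<Rightarrow> 'b::euclidean_space"
  assumes "g \<in> borel_measurable borel" "\<And>x. norm (g x) \<le> B" "\<And>x. x \<notin> cball a R \<Longrightarrow> g x = 0"
  shows "integrable lborel g"
proof (rule Bochner_Integration.integrable_bound)
  show "integrable lborel (\<lambda>x. B * indicator (cball a R) x)"
    using emeasure_compact_finite[of "cball a R"] by (intro integrable_mult_right integrable_real_indicator) (use emeasure_lborel_cball_finite in auto)
  show "AE x in lborel. norm (g x) \<le> norm (B * indicator (cball a R) x)"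
    using assms(2,3) by (intro AE_I2) (force split: split_indicator intro: order_trans[OF _ abs_ge_self])
qed (use assms in auto)

lemma continuous_compact_support_bounded:
  fixes g :: "'a::euclidean_space \<Rightarrow> 'b::euclidean_space"
  assumes "continuous_on UNIV g" "\<And>x. x \<notin> K \<Longrightarrow> g x = 0" "compact K"
  obtains B R where "0 \<le> B" "\<And>x. norm (g x) \<le> B" "0 \<le> R" "K \<subseteq> cball 0 R"
proof -
  have "compact (g ` K)" using assms by (intro compact_continuous_image continuous_on_subset[OF assms(1)]) auto
  then obtain B where B: "\<And>y. y \<in> g ` K \<Longrightarrow> norm y \<le> B" "B > 0" using compact_imp_bounded bounded_pos by metis
  obtain R where R: "\<And>y. y \<in> K \<Longrightarrow> norm y \<le> R" "R > 0" using compact_imp_bounded[OF assms(3)] bounded_pos by metis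
  show ?thesis
  proof (rule that[of B R])
    show "norm (g x) \<le> B" for x using B assms(2)[of x] by (cases "x \<in> K") auto
  qed (use B R in auto)
qed

text \<open>Both measures are treated because translations and Fubini's theorem are applied over
  \<open>lborel\<close>, while the function spaces live over its completion.\<close>

lemma LP_continuous_compact_support:
  fixes g :: "'a::euclidean_space \<Rightarrow> 'b::euclidean_space"
  assumes "continuous_on UNIV g" "\<And>x. x \<notin> K \<Longrightarrow> g x = 0" "compact K" "0 < p"
  shows "LP p lebesgue g" "LP p lborel g" "NP p lebesgue g = NP p lborel g"
proof -
  note [measurable] = continuous_borel_lebesgue[OF assms(1)]
  obtain B R where BR: "0 \<le> B" "\<And>x. norm (g x) \<le> B" "0 \<le> R" "K \<subseteq> cball 0 R"
    using continuous_compact_support_bounded[OF assms(1-3)] by metis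
  have I: "integrable lborel (\<lambda>x. norm (g x) powr p)"
  proof (rule integrable_lborel_of_bounded_support)
    show "norm (norm (g x) powr p) \<le> B powr p" for x using BR assms by (auto intro!: powr_mono2)
    show "norm (g x) powr p = 0" if "x \<notin> cball 0 R" for x
    proof -
      have "x \<notin> K" using that BR(4) by blast
      thus ?thesis by (simp add: assms(2))
    qed
  qed auto
  thus "LP p lborel g" by (simp add: LP_def)
  show "LP p lebesgue g" unfolding LP_def using I by (subst integrable_completion) auto
  show "NP p lebesgue g = NP p lborel g" unfolding NP_def by (rule integral_completion) auto
qed

lemma test_fun_LP:
  assumes "test_fun \<Omega> f" "0 < p"
  shows "LP p lebesgue (jet f)" "LP p lebesgue f" "LP p lebesgue (grad f)"
    "NP p lebesgue f = NP p lborel f" "NP p lebesgue (grad f) = NP p lborel (grad f)"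
proof -
  let ?K = "closure {x. f x \<noteq> 0}"
  have K: "compact ?K" using assms by (simp add: test_fun_def)
  have z: "jet f x = 0" if "x \<notin> ?K" for x using jet_eq_0_outside[OF test_fun_smooth[OF assms(1)] that] .
  have z': "f x = 0" "grad f x = 0" if "x \<notin> ?K" for x using z[OF that] by (simp_all add: jet_def prod_eq_iff)
  show "LP p lebesgue (jet f)" "LP p lebesgue f" "LP p lebesgue (grad f)"
    "NP p lebesgue f = NP p lborel f" "NP p lebesgue (grad f) = NP p lborel (grad f)"
    using LP_continuous_compact_support[OF test_fun_jet_continuous[OF assms(1)] z K assms(2)]
      LP_continuous_compact_support[OF smooth_fun_continuous[OF test_fun_smooth[OF assms(1)]] z'(1) K assms(2)]
      LP_continuous_compact_support[OF smooth_fun_grad_continuous[OF test_fun_smooth[OF assms(1)]] z'(2) K assms(2)]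
    by auto
qed

text \<open>Discrete Jensen inequality: the tangent inequalities at the arithmetic mean are summed,
  and their linear terms cancel.\<close>

lemma powr_sum_le:
  fixes a :: "'i \<Rightarrow> real"
  assumes p: "1 < p" and "finite I" and "\<And>i. i \<in> I \<Longrightarrow> 0 \<le> a i"
  shows "(\<Sum>i\<in>I. a i) powr p \<le> real (card I) powr (p - 1) * (\<Sum>i\<in>I. a i powr p)"
proof (cases "I = {}")
  case False
  define n where "n = real (card I)"
  have n: "n > 0" using False assms by (simp add: n_def card_gt_0_iff)
  define m where "m = (\<Sum>i\<in>I. a i) / n"
  have S0: "(\<Sum>i\<in>I. a i) \<ge> 0" using assms by (intro sum_nonneg) auto
  have m: "m \<ge> 0" "(\<Sum>i\<in>I. a i) = n * m" using n S0 by (auto simp: m_def)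
  have "n * m powr p = (\<Sum>i\<in>I. m powr p + p * m powr (p - 1) * (a i - m))"
    by (simp add: sum.distrib sum_subtractf m(2) n_def[symmetric] flip: sum_distrib_left)
  also have "\<dots> \<le> (\<Sum>i\<in>I. a i powr p)"
    using assms m by (intro sum_mono powr_tangent) auto
  finally have "n powr (p - 1) * (n * m powr p) \<le> n powr (p - 1) * (\<Sum>i\<in>I. a i powr p)"
    by (intro mult_left_mono) auto
  moreover have "n powr (p - 1) * (n * m powr p) = (n * m) powr p"
    using n m by (simp add: powr_mult powr_diff)
  ultimately show ?thesis by (simp add: m(2) n_def)
qed (use assms in auto)

section \<open>Translations, integration by parts and the Poincare inequality\<close>

lemma integral_lborel_translation:
  fixes f :: "'a::euclidean_space \<Rightarrow> real"
  assumes [measurable]: "f \<in> borel_measurable borel"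
  shows "(\<integral>x. f (x + h) \<partial>lborel) = (\<integral>x. f x \<partial>lborel)" "integrable lborel (\<lambda>x. f (x + h)) \<longleftrightarrow> integrable lborel f"
proof -
  have d: "distr lborel borel ((+) h) = lborel" by (rule lborel_distr_plus)
  have "(\<integral>x. f (h + x) \<partial>lborel) = (\<integral>x. f x \<partial>distr lborel borel ((+) h))"
    by (subst integral_distr) auto
  thus "(\<integral>x. f (x + h) \<partial>lborel) = (\<integral>x. f x \<partial>lborel)" by (simp add: d add.commute)
  have "integrable lborel (\<lambda>x. f (h + x)) \<longleftrightarrow> integrable (distr lborel borel ((+) h)) f"
    by (subst integrable_distr_eq) auto
  thus "integrable lborel (\<lambda>x. f (x + h)) \<longleftrightarrow> integrable lborel f" by (simp add: d add.commute)
qed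

text \<open>Prepared for dominated convergence: the mean value inequality supplies a bound
  independent of \<open>k\<close>, and since all steps are at most \<open>norm h\<close> long, all
  quotients vanish outside one ball.\<close>

lemma difference_quotient:
  fixes f :: "'a::euclidean_space \<Rightarrow> real" and G :: "'a \<Rightarrow> 'a"
  assumes der: "\<And>x. (f has_derivative (\<lambda>h. G x \<bullet> h)) (at x)" and bd: "\<And>x. norm (G x) \<le> B"
    and supp: "\<And>x. x \<notin> cball 0 R \<Longrightarrow> f x = 0"
  defines "dq \<equiv> \<lambda>h k x. real (Suc k) * (f (x + (1 / real (Suc k)) *\<^sub>R h) - f x)"
  shows difference_quotient_bound: "\<bar>dq h k x\<bar> \<le> B * norm h"
    and difference_quotient_supp: "x \<notin> cball 0 (R + norm h) \<Longrightarrow> dq h k x = 0"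
    and difference_quotient_tendsto: "(\<lambda>k. dq h k x) \<longlonglongrightarrow> G x \<bullet> h"
proof -
  have B0: "B \<ge> 0" using bd[of 0] norm_ge_zero order_trans by blast
  have lip: "\<bar>f y - f x\<bar> \<le> B * norm (y - x)" for x y
  proof -
    have "norm (f y - f x) \<le> B * norm (y - x)"
    proof (rule differentiable_bound[OF convex_UNIV])
      fix z :: 'a
      show "(f has_derivative (\<lambda>h. G z \<bullet> h)) (at z within UNIV)" using der by simp
      show "onorm (\<lambda>h. G z \<bullet> h) \<le> B"
      proof (rule onorm_bound[OF B0])
        fix h
        have "\<bar>G z \<bullet> h\<bar> \<le> norm (G z) * norm h" by (rule Cauchy_Schwarz_ineq2)
        also have "\<dots> \<le> B * norm h" by (intro mult_right_mono bd) auto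
        finally show "norm (G z \<bullet> h) \<le> B * norm h" by simp
      qed
    qed auto
    thus ?thesis by simp
  qed
  show "\<bar>dq h k x\<bar> \<le> B * norm h"
  proof -
    have "\<bar>dq h k x\<bar> = real (Suc k) * \<bar>f (x + (1 / real (Suc k)) *\<^sub>R h) - f x\<bar>" by (simp add: dq_def abs_mult)
    also have "\<dots> \<le> real (Suc k) * (B * norm ((1 / real (Suc k)) *\<^sub>R h))"
      using lip[of "x + (1 / real (Suc k)) *\<^sub>R h" x] by (intro mult_left_mono) auto
    also have "\<dots> = B * norm h" by simp
    finally show ?thesis .
  qed
  show "dq h k x = 0" if "x \<notin> cball 0 (R + norm h)"
  proof -
    have x: "norm x > R + norm h" using that by simp
    have "norm ((1 / real (Suc k)) *\<^sub>R h) \<le> norm h"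
      by (simp add: divide_le_eq mult_le_cancel_left1 mult_left_le)
    hence "norm (x + (1 / real (Suc k)) *\<^sub>R h) > R"
      using x norm_triangle_ineq4[of "x + (1 / real (Suc k)) *\<^sub>R h" "(1 / real (Suc k)) *\<^sub>R h"] by simp
    moreover have "norm x > R" using x norm_ge_zero[of h] by linarith
    ultimately show ?thesis using supp[of x] supp[of "x + (1 / real (Suc k)) *\<^sub>R h"] by (simp add: dq_def)
  qed
  show "(\<lambda>k. dq h k x) \<longlonglongrightarrow> G x \<bullet> h"
  proof -
    have line: "((\<lambda>t. x + t *\<^sub>R h) has_derivative (\<lambda>t. t *\<^sub>R h)) (at (0::real))"
      by (auto intro!: derivative_eq_intros)
    have "((f \<circ> (\<lambda>t. x + t *\<^sub>R h)) has_derivative ((\<lambda>h. G x \<bullet> h) \<circ> (\<lambda>t. t *\<^sub>R h))) (at (0::real))"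
      by (rule diff_chain_at[OF line]) (use der in simp)
    hence "((\<lambda>t. f (x + t *\<^sub>R h)) has_derivative (\<lambda>t. t * (G x \<bullet> h))) (at 0)"
      by (simp add: o_def)
    moreover have "(\<lambda>t. t * (G x \<bullet> h)) = (*) (G x \<bullet> h)" by (auto simp: mult.commute)
    ultimately have "((\<lambda>t. f (x + t *\<^sub>R h)) has_real_derivative (G x \<bullet> h)) (at 0)"
      by (simp add: has_field_derivative_def)
    hence "(\<lambda>t. (f (x + t *\<^sub>R h) - f x) / t) \<midarrow>0\<rightarrow> G x \<bullet> h"
      by (simp add: DERIV_def)
    moreover have "filterlim (\<lambda>k. 1 / real (Suc k)) (at 0) sequentially"
      unfolding filterlim_at using LIMSEQ_inverse_real_of_nat by (simp add: inverse_eq_divide)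
    ultimately have "(\<lambda>k. (f (x + (1 / real (Suc k)) *\<^sub>R h) - f x) / (1 / real (Suc k))) \<longlonglongrightarrow> G x \<bullet> h"
      by (rule filterlim_compose)
    thus ?thesis by (simp add: dq_def field_simps)
  qed
qed

text \<open>This class contains the test functions and is stable under multiplication of a test
  function by a merely continuously differentiable one, such as a polynomial. Integration by parts
  thus avoids Leibniz formulas for iterated derivatives.\<close>

definition C1c :: "('a::euclidean_space \<Rightarrow> real) \<Rightarrow> ('a \<Rightarrow> 'a) \<Rightarrow> bool" where
  "C1c f G \<longleftrightarrow> (\<forall>x. (f has_derivative (\<lambda>h. G x \<bullet> h)) (at x)) \<and> continuous_on UNIV G
     \<and> (\<exists>B R. (\<forall>x. norm (G x) \<le> B) \<and> (\<forall>x. x \<notin> cball 0 R \<longrightarrow> f x = 0 \<and> G x = 0))"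

lemma C1cE:
  assumes "C1c f G"
  obtains B R where "\<And>x. (f has_derivative (\<lambda>h. G x \<bullet> h)) (at x)" "continuous_on UNIV G"
    "\<And>x. norm (G x) \<le> B" "\<And>x. x \<notin> cball 0 R \<Longrightarrow> f x = 0" "\<And>x. x \<notin> cball 0 R \<Longrightarrow> G x = 0"
  using assms unfolding C1c_def by blast

lemma C1c_continuous: "C1c f G \<Longrightarrow> continuous_on UNIV f"
  unfolding C1c_def using has_derivative_continuous by (intro continuous_at_imp_continuous_on ballI) blast

lemma test_fun_C1c:
  assumes "test_fun \<Omega> f"
  shows "C1c f (grad f)"
proof -
  let ?K = "closure {x. f x \<noteq> 0}"
  have K: "compact ?K" using assms by (simp add: test_fun_def)
  have z: "jet f x = 0" if "x \<notin> ?K" for x using jet_eq_0_outside[OF test_fun_smooth[OF assms(1)] that] .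
  have z': "f x = 0" "grad f x = 0" if "x \<notin> ?K" for x using z[OF that] by (simp_all add: jet_def prod_eq_iff)
  obtain B R where B: "\<And>x. norm (grad f x) \<le> B" and R: "?K \<subseteq> cball 0 R"
    using continuous_compact_support_bounded[OF smooth_fun_grad_continuous[OF test_fun_smooth[OF assms]] z'(2) K] by metis
  have "f x = 0 \<and> grad f x = 0" if "x \<notin> cball 0 R" for x using that z'[of x] R by blast
  with B have "\<exists>B R. (\<forall>x. norm (grad f x) \<le> B) \<and> (\<forall>x. x \<notin> cball 0 R \<longrightarrow> f x = 0 \<and> grad f x = 0)" by blast
  thus ?thesis
    unfolding C1c_def
    by (intro conjI allI smooth_fun_has_derivative[OF test_fun_smooth[OF assms]] smooth_fun_grad_continuous[OF test_fun_smooth[OF assms]])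
qed

text \<open>Every difference quotient has integral 0 by translation invariance of the measure, and
  dominated convergence carries this over to the directional derivative.\<close>

lemma integral_gradient_eq_0:
  fixes f :: "'a::euclidean_space \<Rightarrow> real"
  assumes "C1c f G"
  shows "(\<integral>x. G x \<bullet> h \<partial>lborel) = 0"
proof -
  obtain B R where der: "\<And>x. (f has_derivative (\<lambda>h. G x \<bullet> h)) (at x)" and G: "continuous_on UNIV G"
    and bd: "\<And>x. norm (G x) \<le> B" and supp: "\<And>x. x \<notin> cball 0 R \<Longrightarrow> f x = 0"
    by (rule C1cE[OF assms]) (rule that, assumption+)
  have [measurable]: "f \<in> borel_measurable borel" "G \<in> borel_measurable borel"
    using C1c_continuous[OF assms] G by (auto intro: borel_measurable_continuous_onI)
  have fint: "integrable lborel f"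
  proof -
    obtain B' R' where "\<And>x. norm (f x) \<le> B'"
      using continuous_compact_support_bounded[OF C1c_continuous[OF assms] supp compact_cball] by metis
    thus ?thesis using supp by (intro integrable_lborel_of_bounded_support[of _ B' 0 R]) auto
  qed
  define dq where "dq h k x = real (Suc k) * (f (x + (1 / real (Suc k)) *\<^sub>R h) - f x)" for h k x
  have dq: "\<bar>dq h k x\<bar> \<le> B * norm h" "x \<notin> cball 0 (R + norm h) \<Longrightarrow> dq h k x = 0" "(\<lambda>k. dq h k x) \<longlonglongrightarrow> G x \<bullet> h" for h k x
    unfolding dq_def using difference_quotient[of f G B R] der bd supp by blast+
  have B0: "B \<ge> 0" using bd[of 0] norm_ge_zero order_trans by blast
  have "(\<lambda>k. \<integral>x. dq h k x \<partial>lborel) \<longlonglongrightarrow> (\<integral>x. G x \<bullet> h \<partial>lborel)"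
  proof (rule integral_dominated_convergence)
    show "integrable lborel (\<lambda>x. B * norm h * indicator (cball 0 (R + norm h)) x)"
      by (intro integrable_mult_right integrable_real_indicator) (use emeasure_lborel_cball_finite in auto)
    show "AE x in lborel. norm (dq h k x) \<le> B * norm h * indicator (cball 0 (R + norm h)) x" for k
      using dq(1,2) by (intro AE_I2) (auto split: split_indicator)
    show "AE x in lborel. (\<lambda>k. dq h k x) \<longlonglongrightarrow> G x \<bullet> h" using dq(3) by auto
    show "(\<lambda>x. dq h k x) \<in> borel_measurable lborel" for k unfolding dq_def by measurable
  qed auto
  moreover have "(\<integral>x. dq h k x \<partial>lborel) = 0" for k
    unfolding dq_def using integral_lborel_translation[of f] fint by simp
  ultimately show ?thesis by (simp add: LIMSEQ_const_iff)
qed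

text \<open>Splitting the shift by \<open>h\<close> into \<open>n\<close> equal steps and using convexity bounds the left-hand side by the
  difference quotient with step \<open>h / n\<close>; then let \<open>n\<close> tend to infinity.\<close>

lemma translation_estimate:
  fixes f :: "'a::euclidean_space \<Rightarrow> real"
  assumes "C1c f G" and p: "1 < p"
  shows "NP p lborel (\<lambda>x. f (x + h) - f x) \<le> norm h powr p * NP p lborel G"
    and "integrable lborel (\<lambda>x. \<bar>f (x + h) - f x\<bar> powr p)"
proof -
  obtain B R where der: "\<And>x. (f has_derivative (\<lambda>h. G x \<bullet> h)) (at x)" and G: "continuous_on UNIV G"
    and bd: "\<And>x. norm (G x) \<le> B"
    and supp: "\<And>x. x \<notin> cball 0 R \<Longrightarrow> f x = 0" "\<And>x. x \<notin> cball 0 R \<Longrightarrow> G x = 0"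
    by (rule C1cE[OF assms(1)]) (rule that, assumption+)
  have [measurable]: "f \<in> borel_measurable borel" "G \<in> borel_measurable borel"
    using C1c_continuous[OF assms(1)] G by (auto intro: borel_measurable_continuous_onI)
  define dq where "dq h k x = real (Suc k) * (f (x + (1 / real (Suc k)) *\<^sub>R h) - f x)" for h k x
  have dq: "\<bar>dq h k x\<bar> \<le> B * norm h" "x \<notin> cball 0 (R + norm h) \<Longrightarrow> dq h k x = 0" "(\<lambda>k. dq h k x) \<longlonglongrightarrow> G x \<bullet> h" for h k x
    unfolding dq_def using difference_quotient[of f G B R] der bd supp(1) by blast+
  have B0: "B \<ge> 0" using bd[of 0] norm_ge_zero order_trans by blast
  have lim: "(\<lambda>k. \<integral>x. \<bar>dq h k x\<bar> powr p \<partial>lborel) \<longlonglongrightarrow> (\<integral>x. \<bar>G x \<bullet> h\<bar> powr p \<partial>lborel)"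
  proof (rule integral_dominated_convergence)
    show "integrable lborel (\<lambda>x. (B * norm h) powr p * indicator (cball 0 (R + norm h)) x)"
      by (intro integrable_mult_right integrable_real_indicator) (use emeasure_lborel_cball_finite in auto)
    show "AE x in lborel. norm (\<bar>dq h k x\<bar> powr p) \<le> (B * norm h) powr p * indicator (cball 0 (R + norm h)) x" for k
      using dq(1,2) p by (intro AE_I2) (auto split: split_indicator intro!: powr_mono2)
    show "AE x in lborel. (\<lambda>k. \<bar>dq h k x\<bar> powr p) \<longlonglongrightarrow> \<bar>G x \<bullet> h\<bar> powr p"
      using dq(3) p by (intro AE_I2 tendsto_powr' tendsto_rabs tendsto_const) auto
    show "(\<lambda>x. \<bar>dq h k x\<bar> powr p) \<in> borel_measurable lborel" for k unfolding dq_def by measurable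
  qed auto
  have dint: "integrable lborel (\<lambda>x. \<bar>f (x + t) - f x\<bar> powr p)" for t
  proof -
    obtain B' where B': "\<And>x. norm (f x) \<le> B'"
      using continuous_compact_support_bounded[OF C1c_continuous[OF assms(1)] supp(1) compact_cball] by metis
    show ?thesis
    proof (rule integrable_lborel_of_bounded_support)
    show "norm (\<bar>f (x + t) - f x\<bar> powr p) \<le> (B' + B') powr p" for x
    proof -
      have "\<bar>f (x + t) - f x\<bar> \<le> B' + B'" using B'[of "x + t"] B'[of x] by (simp add: abs_le_iff)
      thus ?thesis using p by (simp add: powr_mono2)
    qed
    show "\<bar>f (x + t) - f x\<bar> powr p = 0" if "x \<notin> cball 0 (R + norm t)" for x
    proof -
      have x: "norm x > R + norm t" using that by simp
      hence "norm (x + t) > R" using norm_triangle_ineq4[of "x + t" t] by simp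
      moreover have "norm x > R" using x norm_ge_zero[of t] by linarith
      ultimately show ?thesis using supp(1)[of x] supp(1)[of "x + t"] by simp
    qed
    qed auto
  qed
  show "integrable lborel (\<lambda>x. \<bar>f (x + h) - f x\<bar> powr p)" by (rule dint)
  have "NP p lborel (\<lambda>x. f (x + h) - f x) \<le> (\<integral>x. \<bar>dq h k x\<bar> powr p \<partial>lborel)" for k
  proof -
    define n where "n = Suc k"
    define t where "t = (1 / real n) *\<^sub>R h"
    have n: "n > 0" by (simp add: n_def)
    have nt: "real n *\<^sub>R t = h" using n by (simp add: t_def)
    have tel: "f (x + h) - f x = (\<Sum>j<n. f ((x + real j *\<^sub>R t) + t) - f (x + real j *\<^sub>R t))" for x
      using sum_lessThan_telescope[of "\<lambda>j. f (x + real j *\<^sub>R t)" n] by (simp add: nt algebra_simps)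
    have I: "integrable lborel (\<lambda>x. \<bar>f ((x + real j *\<^sub>R t) + t) - f (x + real j *\<^sub>R t)\<bar> powr p)" for j
      using integral_lborel_translation(2)[of "\<lambda>x. \<bar>f (x + t) - f x\<bar> powr p" "real j *\<^sub>R t"] dint by simp
    have "NP p lborel (\<lambda>x. f (x + h) - f x) \<le> (\<integral>x. real n powr (p - 1) *
         (\<Sum>j<n. \<bar>f ((x + real j *\<^sub>R t) + t) - f (x + real j *\<^sub>R t)\<bar> powr p) \<partial>lborel)"
      unfolding NP_def
    proof (rule integral_mono)
      fix x
      have "norm (f (x + h) - f x) powr p \<le> (\<Sum>j<n. \<bar>f ((x + real j *\<^sub>R t) + t) - f (x + real j *\<^sub>R t)\<bar>) powr p"
        unfolding tel using p by (intro powr_mono2) auto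
      also have "\<dots> \<le> real n powr (p - 1) * (\<Sum>j<n. \<bar>f ((x + real j *\<^sub>R t) + t) - f (x + real j *\<^sub>R t)\<bar> powr p)"
        using powr_sum_le[OF p, of "{..<n}"] by simp
      finally show "norm (f (x + h) - f x) powr p \<le> real n powr (p - 1) * (\<Sum>j<n. \<bar>f ((x + real j *\<^sub>R t) + t) - f (x + real j *\<^sub>R t)\<bar> powr p)" .
    qed (use dint I in auto)
    also have "\<dots> = real n powr (p - 1) * (\<Sum>j<n. \<integral>x. \<bar>f ((x + real j *\<^sub>R t) + t) - f (x + real j *\<^sub>R t)\<bar> powr p \<partial>lborel)"
      using I by simp
    also have "\<dots> = real n powr (p - 1) * (real n * (\<integral>x. \<bar>f (x + t) - f x\<bar> powr p \<partial>lborel))"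
      using integral_lborel_translation(1)[of "\<lambda>x. \<bar>f (x + t) - f x\<bar> powr p"] by simp
    \<comment> \<open>The factor from Jensen's inequality and the number of equal summands combine
      to \<open>n powr p\<close>, which is exactly the p-th power of the factor in front of the
      difference quotient.\<close>
    also have "\<dots> = real n powr p * (\<integral>x. \<bar>f (x + t) - f x\<bar> powr p \<partial>lborel)"
      using n by (simp add: powr_diff)
    also have "\<dots> = (\<integral>x. \<bar>dq h k x\<bar> powr p \<partial>lborel)"
      by (simp add: dq_def t_def n_def abs_mult powr_mult)
    finally show ?thesis .
  qed
  hence "NP p lborel (\<lambda>x. f (x + h) - f x) \<le> (\<integral>x. \<bar>G x \<bullet> h\<bar> powr p \<partial>lborel)"
    by (intro LIMSEQ_le_const[OF lim]) auto
  also have "\<dots> \<le> (\<integral>x. norm h powr p * norm (G x) powr p \<partial>lborel)"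
  proof (rule integral_mono)
    have le: "\<bar>G x \<bullet> h\<bar> powr p \<le> norm h powr p * norm (G x) powr p" for x
    proof -
      have "\<bar>G x \<bullet> h\<bar> powr p \<le> (norm (G x) * norm h) powr p"
        using p Cauchy_Schwarz_ineq2[of "G x" h] by (intro powr_mono2) auto
      thus ?thesis by (simp add: powr_mult mult.commute)
    qed
    show "integrable lborel (\<lambda>x. norm h powr p * norm (G x) powr p)"
      by (intro integrable_mult_right LP_integrable LP_continuous_compact_support(2)[OF G _ compact_cball[of 0 R]] supp(2)) (use p in auto)
    thus "integrable lborel (\<lambda>x. \<bar>G x \<bullet> h\<bar> powr p)"
      by (rule Bochner_Integration.integrable_bound) (use le in auto)
    show "\<bar>G x \<bullet> h\<bar> powr p \<le> norm h powr p * norm (G x) powr p" for x by (rule le)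
  qed
  also have "\<dots> = norm h powr p * NP p lborel G" by (simp add: NP_def)
  finally show "NP p lborel (\<lambda>x. f (x + h) - f x) \<le> norm h powr p * NP p lborel G" .
qed

text \<open>A shift by more than the diameter \<open>2 * R\<close> separates the function from its
  translate, so the difference has exactly twice the energy of \<open>v\<close>. The translation
  estimate bounds it by the gradient, and the length \<open>2 * R + 1\<close> of the shift is the
  origin of the constant.\<close>

lemma poincare_inequality:
  fixes v :: "real^'n \<Rightarrow> real"
  assumes "test_fun \<Omega> v" "1 < p" "\<Omega> \<subseteq> cball 0 R" "0 \<le> R"
  shows "NP p lebesgue v \<le> (2 * R + 1) powr p * NP p lebesgue (grad v)"
proof -
  have p0: "0 < p" using assms by simp
  have vm: "v \<in> borel_measurable borel" using continuous_borel_lebesgue[OF smooth_fun_continuous[OF test_fun_smooth[OF assms(1)]]] by blast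
  define h where "h = (2 * R + 1) *\<^sub>R axis (undefined :: 'n) (1 :: real)"
  have h: "norm h = 2 * R + 1" using assms by (simp add: h_def)
  have vz: "v x = 0" if "norm x > R" for x using test_fun_jet_outside(2)[OF assms(1)] assms(3) that by force
  have vI: "integrable lborel (\<lambda>x. \<bar>v x\<bar> powr p)"
    using LP_continuous_compact_support(2)[OF smooth_fun_continuous[OF test_fun_smooth[OF assms(1)]], of "cball 0 R" p] vz p0
    by (auto simp: LP_def)
  have I2: "integrable lborel (\<lambda>x. \<bar>v (x + h)\<bar> powr p)"
    using integral_lborel_translation(2)[of "\<lambda>x. \<bar>v x\<bar> powr p" h] vI vm by simp
  have "\<bar>v (x + h) - v x\<bar> powr p = \<bar>v (x + h)\<bar> powr p + \<bar>v x\<bar> powr p" for x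
  proof (cases "norm x > R")
    case True
    thus ?thesis using vz p0 by simp
  next
    case False
    hence "norm (x + h) > R" using h norm_triangle_ineq4[of "x + h" x] by simp
    thus ?thesis using vz p0 by simp
  qed
  hence "NP p lborel (\<lambda>x. v (x + h) - v x) = (\<integral>x. \<bar>v (x + h)\<bar> powr p \<partial>lborel) + (\<integral>x. \<bar>v x\<bar> powr p \<partial>lborel)"
    using vI I2 by (simp add: NP_def)
  also have "\<dots> = 2 * NP p lborel v"
    using integral_lborel_translation(1)[of "\<lambda>x. \<bar>v x\<bar> powr p" h] vm by (simp add: NP_def)
  finally have "2 * NP p lborel v \<le> (2 * R + 1) powr p * NP p lborel (grad v)"
    using translation_estimate(1)[OF test_fun_C1c[OF assms(1)] assms(2), of h] h by simp
  moreover have "NP p lborel v \<ge> 0" by simp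
  ultimately have "NP p lborel v \<le> (2 * R + 1) powr p * NP p lborel (grad v)" by linarith
  thus ?thesis using test_fun_LP(4,5)[OF assms(1) p0] by simp
qed

text \<open>The product of \<open>v\<close> with the second function has bounded support, so its
  gradient integrates to 0. The second function is only continuously differentiable, which covers
  test functions in the weak gradient and polynomials in the closability proof alike.\<close>

lemma integration_by_parts:
  fixes v :: "real^'n \<Rightarrow> real"
  assumes "test_fun \<Omega> v" and der: "\<And>x. (\<psi> has_derivative (\<lambda>h. G x \<bullet> h)) (at x)" and G: "continuous_on UNIV G"
  shows "integrable lborel (\<lambda>x. v x * G x $ i)" "integrable lborel (\<lambda>x. grad v x $ i * \<psi> x)"
    "(\<integral>x. v x * G x $ i \<partial>lborel) = - (\<integral>x. grad v x $ i * \<psi> x \<partial>lborel)"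
proof -
  have v: "C1c v (grad v)" by (rule test_fun_C1c[OF assms(1)])
  then obtain R where supp: "\<And>x. x \<notin> cball 0 R \<Longrightarrow> v x = 0 \<and> grad v x = 0"
    unfolding C1c_def by blast
  have \<psi>: "continuous_on UNIV \<psi>" using der by (auto intro!: continuous_at_imp_continuous_on has_derivative_continuous)
  have cv: "continuous_on UNIV v" "continuous_on UNIV (grad v)"
    using C1c_continuous[OF v] v by (auto simp: C1c_def)
  define H where "H x = v x *\<^sub>R G x + \<psi> x *\<^sub>R grad v x" for x
  have Hc: "continuous_on UNIV H" unfolding H_def by (intro continuous_intros cv G \<psi>)
  have "C1c (\<lambda>x. v x * \<psi> x) H"
  proof -
    have Hz: "H x = 0" if "x \<notin> cball 0 R" for x using supp[OF that] by (simp add: H_def)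
    obtain B' where B': "\<And>x. norm (H x) \<le> B'"
      using continuous_compact_support_bounded[OF Hc Hz compact_cball] by metis
    have "\<forall>x. x \<notin> cball 0 R \<longrightarrow> v x * \<psi> x = 0 \<and> H x = 0" using supp by (simp add: H_def)
    with B' have "\<exists>B R. (\<forall>x. norm (H x) \<le> B) \<and> (\<forall>x. x \<notin> cball 0 R \<longrightarrow> v x * \<psi> x = 0 \<and> H x = 0)" by blast
    moreover have "((\<lambda>x. v x * \<psi> x) has_derivative (\<lambda>h. H x \<bullet> h)) (at x)" for x
    proof -
      have "(v has_derivative (\<lambda>h. grad v x \<bullet> h)) (at x)" using v by (simp add: C1c_def)
      from has_derivative_mult[OF this der] show ?thesis
        by (simp add: H_def inner_add_left algebra_simps)
    qed
    ultimately show ?thesis unfolding C1c_def using Hc by (intro conjI allI)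
  qed
  hence "(\<integral>x. H x \<bullet> axis i 1 \<partial>lborel) = 0" by (rule integral_gradient_eq_0)
  moreover have Hi: "H x \<bullet> axis i 1 = v x * G x $ i + grad v x $ i * \<psi> x" for x
    by (simp add: H_def inner_axis)
  moreover have comp: "continuous_on UNIV (\<lambda>x. G x $ i)" "continuous_on UNIV (\<lambda>x. grad v x $ i)"
    using G cv by (auto intro: continuous_on_component)
  have 1: "integrable lborel g" if g: "continuous_on UNIV g" "\<And>x. x \<notin> cball 0 R \<Longrightarrow> g x = 0" for g :: "real^'n \<Rightarrow> real"
  proof -
    obtain B' where "\<And>x. norm (g x) \<le> B'"
      using continuous_compact_support_bounded[OF g compact_cball] by metis
    thus ?thesis using g by (intro integrable_lborel_of_bounded_support[of g B' 0 R]) (auto intro: borel_measurable_continuous_onI)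
  qed
  show 2: "integrable lborel (\<lambda>x. v x * G x $ i)" "integrable lborel (\<lambda>x. grad v x $ i * \<psi> x)"
    using supp by (auto intro!: 1 continuous_intros cv comp \<psi>)
  ultimately show "(\<integral>x. v x * G x $ i \<partial>lborel) = - (\<integral>x. grad v x $ i * \<psi> x \<partial>lborel)"
    by simp
qed

lemma norm_Pair_powr:
  assumes "0 < p"
  shows "norm a powr p \<le> norm (a, b) powr p" "norm b powr p \<le> norm (a, b) powr p"
    "norm (a, b) powr p \<le> 2 powr p * (norm a powr p + norm b powr p)"
proof -
  show "norm a powr p \<le> norm (a, b) powr p" "norm b powr p \<le> norm (a, b) powr p"
    using assms by (auto intro!: powr_mono2 simp: norm_Pair real_le_rsqrt)
  have "(a, b) = (a, 0) + (0, b)" by simp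
  hence "norm (a, b) powr p \<le> 2 powr p * (norm (a, 0 :: 'b) powr p + norm (0 :: 'a, b) powr p)"
    using norm_add_powr_le[OF assms] by metis
  thus "norm (a, b) powr p \<le> 2 powr p * (norm a powr p + norm b powr p)" by (simp add: norm_Pair)
qed

lemma LP_Pair:
  fixes f :: "'a \<Rightarrow> 'b::euclidean_space" and g :: "'a \<Rightarrow> 'c::euclidean_space"
  assumes "0 < p"
  shows "LP p M (\<lambda>x. (f x, g x)) \<longleftrightarrow> LP p M f \<and> LP p M g" (is "?L \<longleftrightarrow> ?R")
    and "LP p M (\<lambda>x. (f x, g x)) \<Longrightarrow> NP p M f \<le> NP p M (\<lambda>x. (f x, g x))"
    and "LP p M (\<lambda>x. (f x, g x)) \<Longrightarrow> NP p M g \<le> NP p M (\<lambda>x. (f x, g x))"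
    and "LP p M (\<lambda>x. (f x, g x)) \<Longrightarrow> NP p M (\<lambda>x. (f x, g x)) \<le> 2 powr p * (NP p M f + NP p M g)"
proof -
  have LR: "LP p M f \<and> LP p M g" if L: ?L
  proof -
    have "f = (\<lambda>x. fst (f x, g x))" "g = (\<lambda>x. snd (f x, g x))" by auto
    hence m: "f \<in> borel_measurable M" "g \<in> borel_measurable M"
      using measurable_compose[OF LP_measurable[OF L] borel_measurable_continuous_onI[OF continuous_on_fst[OF continuous_on_id]]]
        measurable_compose[OF LP_measurable[OF L] borel_measurable_continuous_onI[OF continuous_on_snd[OF continuous_on_id]]]
      by auto
    show ?thesis
      using norm_Pair_powr(1,2)[OF assms]
      by (intro conjI LP_minorant[OF m(1) LP_integrable[OF L]] LP_minorant[OF m(2) LP_integrable[OF L]] AE_I2)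
  qed
  have RL: ?L if R: "LP p M f" "LP p M g"
  proof (rule LP_minorant)
    show "integrable M (\<lambda>x. 2 powr p * (norm (f x) powr p + norm (g x) powr p))" using R by (auto simp: LP_def)
    show "(\<lambda>x. (f x, g x)) \<in> borel_measurable M" using R by (auto simp: LP_def intro: borel_measurable_Pair)
  qed (intro AE_I2 norm_Pair_powr(3)[OF assms])
  show "?L \<longleftrightarrow> ?R" using LR RL by blast
  assume L: ?L
  note LR[OF L]
  note I = LP_integrable[OF L] LP_integrable[OF conjunct1[OF this]] LP_integrable[OF conjunct2[OF this]]
  show "NP p M f \<le> NP p M (\<lambda>x. (f x, g x))" "NP p M g \<le> NP p M (\<lambda>x. (f x, g x))"
    unfolding NP_def by (intro integral_mono I norm_Pair_powr[OF assms])+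
  have "NP p M (\<lambda>x. (f x, g x)) \<le> (\<integral>x. 2 powr p * (norm (f x) powr p + norm (g x) powr p) \<partial>M)"
    unfolding NP_def by (intro integral_mono norm_Pair_powr[OF assms]) (use I in auto)
  also have "\<dots> = 2 powr p * (NP p M f + NP p M g)" using I by (simp add: NP_def)
  finally show "NP p M (\<lambda>x. (f x, g x)) \<le> 2 powr p * (NP p M f + NP p M g)" .
qed

section \<open>The space X1p and the fractional seminorm\<close>

lemma LP_fst_snd:
  fixes w :: "'a \<Rightarrow> 'b::euclidean_space \<times> 'c::euclidean_space"
  assumes "0 < p" "LP p M w"
  shows "LP p M (\<lambda>x. fst (w x))" "LP p M (\<lambda>x. snd (w x))"
    "NP p M (\<lambda>x. fst (w x)) \<le> NP p M w" "NP p M (\<lambda>x. snd (w x)) \<le> NP p M w"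
  using LP_Pair(1,2,3)[OF assms(1), of M "\<lambda>x. fst (w x)" "\<lambda>x. snd (w x)"] assms(2) by auto

text \<open>Integration by parts gives the weak gradient identity for each \<open>v k\<close>. It
  survives the limit because a fixed test function and its derivatives belong to the dual exponent
  and pair continuously with \<open>L^p\<close> convergence.\<close>

lemma X1pI:
  fixes v :: "nat \<Rightarrow> real^'n \<Rightarrow> real"
  assumes p: "1 < p" and v: "\<And>k. test_fun \<Omega> (v k)" and w: "LP p lebesgue (\<lambda>x. (u x, g x))"
    and lim: "(\<lambda>k. NP p lebesgue (\<lambda>x. jet (v k) x - (u x, g x))) \<longlonglongrightarrow> 0"
  shows "X1p p \<Omega> u g"
proof -
  have p0: "0 < p" using p by simp
  have q0: "0 < p / (p - 1)" using p by simp
  note LPv = test_fun_LP(1-3)[OF v p0]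
  have u: "LP p lebesgue u" and g: "LP p lebesgue g" using w LP_Pair(1)[OF p0] by blast+
  have d: "(\<lambda>x. jet (v k) x - (u x, g x)) = (\<lambda>x. (v k x - u x, grad (v k) x - g x))" for k
    by (simp add: jet_def)
  have L: "LP p lebesgue (\<lambda>x. (v k x - u x, grad (v k) x - g x))" for k
    using LP_diff(1)[OF p0 LPv(1) w] unfolding d .
  have lu: "(\<lambda>k. NP p lebesgue (\<lambda>x. v k x - u x)) \<longlonglongrightarrow> 0"
    by (rule tendsto_sandwich[OF _ _ tendsto_const lim[unfolded d]]) (use LP_Pair(2)[OF p0 L] in auto)
  have lg: "(\<lambda>k. NP p lebesgue (\<lambda>x. grad (v k) x - g x)) \<longlonglongrightarrow> 0"
    by (rule tendsto_sandwich[OF _ _ tendsto_const lim[unfolded d]]) (use LP_Pair(3)[OF p0 L] in auto)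
  have "weak_grad u g"
    unfolding weak_grad_def
  proof (intro allI impI)
    fix \<phi> :: "real^'n \<Rightarrow> real" and i assume \<phi>: "test_fun UNIV \<phi>"
    have sm: "smooth_fun \<phi>" using \<phi> by (rule test_fun_smooth)
    let ?K = "closure {x. \<phi> x \<noteq> 0}"
    have K: "compact ?K" using \<phi> by (simp add: test_fun_def)
    have z: "\<phi> x = 0" "grad \<phi> x = 0" if "x \<notin> ?K" for x
      using jet_eq_0_outside[OF sm that] by (simp_all add: jet_def prod_eq_iff)
    have cp: "continuous_on UNIV (\<lambda>x. partial_deriv \<phi> i x)"
      by (rule smooth_fun_continuous[OF smooth_fun_partial[OF sm]])
    have c\<phi>: "continuous_on UNIV \<phi>" by (rule smooth_fun_continuous[OF sm])
    have 1: "LP (p / (p - 1)) lebesgue (\<lambda>x. partial_deriv \<phi> i x)"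
    proof (rule LP_continuous_compact_support(1)[OF cp _ K q0])
      show "partial_deriv \<phi> i x = 0" if "x \<notin> ?K" for x using z(2)[OF that] by (simp add: partial_deriv_eq_grad)
    qed
    have 2: "LP (p / (p - 1)) lebesgue (\<lambda>x. \<phi> x *\<^sub>R (axis i 1 :: real^'n))"
    proof (rule LP_continuous_compact_support(1)[OF _ _ K q0])
      show "\<phi> x *\<^sub>R (axis i 1 :: real^'n) = 0" if "x \<notin> ?K" for x using z(1)[OF that] by simp
    qed (intro continuous_intros c\<phi>)
    have "integrable lebesgue (\<lambda>x. partial_deriv \<phi> i x \<bullet> u x)"
      by (rule LP_pair_integrable[OF p 1 u])
    hence A: "integrable lebesgue (\<lambda>x. u x * partial_deriv \<phi> i x)" by (simp add: mult.commute)
    have "integrable lebesgue (\<lambda>x. (\<phi> x *\<^sub>R (axis i 1 :: real^'n)) \<bullet> g x)"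
      by (rule LP_pair_integrable[OF p 2 g])
    hence B: "integrable lebesgue (\<lambda>x. g x $ i * \<phi> x)" by (simp add: inner_axis' mult.commute)
    have "(\<lambda>k. \<integral>x. partial_deriv \<phi> i x \<bullet> v k x \<partial>lebesgue) \<longlonglongrightarrow> (\<integral>x. partial_deriv \<phi> i x \<bullet> u x \<partial>lebesgue)"
      by (rule LP_pair_tendsto[OF p 1 LPv(2) u lu])
    hence LA: "(\<lambda>k. \<integral>x. v k x * partial_deriv \<phi> i x \<partial>lebesgue) \<longlonglongrightarrow> (\<integral>x. u x * partial_deriv \<phi> i x \<partial>lebesgue)"
      by (simp add: mult.commute)
    have "(\<lambda>k. \<integral>x. (\<phi> x *\<^sub>R (axis i 1 :: real^'n)) \<bullet> grad (v k) x \<partial>lebesgue) \<longlonglongrightarrow> (\<integral>x. (\<phi> x *\<^sub>R (axis i 1 :: real^'n)) \<bullet> g x \<partial>lebesgue)"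
      by (rule LP_pair_tendsto[OF p 2 LPv(3) g lg])
    hence LB: "(\<lambda>k. \<integral>x. grad (v k) x $ i * \<phi> x \<partial>lebesgue) \<longlonglongrightarrow> (\<integral>x. g x $ i * \<phi> x \<partial>lebesgue)"
      by (simp add: inner_axis' mult.commute)
    have "(\<integral>x. v k x * partial_deriv \<phi> i x \<partial>lebesgue) = - (\<integral>x. grad (v k) x $ i * \<phi> x \<partial>lebesgue)" for k
    proof -
      have [measurable]: "v k \<in> borel_measurable borel" "\<phi> \<in> borel_measurable borel"
        "(\<lambda>x. partial_deriv \<phi> i x) \<in> borel_measurable borel" "(\<lambda>x. partial_deriv (v k) i x) \<in> borel_measurable borel"
        using cp c\<phi> smooth_fun_continuous[OF test_fun_smooth[OF v]]
          smooth_fun_continuous[OF smooth_fun_partial[OF test_fun_smooth[OF v]]]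
        by (auto intro!: borel_measurable_continuous_onI)
      show ?thesis
        using integration_by_parts(3)[OF v smooth_fun_has_derivative[OF sm] smooth_fun_grad_continuous[OF sm], of k i]
        by (simp add: integral_completion partial_deriv_eq_grad[symmetric])
    qed
    hence "(\<integral>x. u x * partial_deriv \<phi> i x \<partial>lebesgue) = - (\<integral>x. g x $ i * \<phi> x \<partial>lebesgue)"
      using LIMSEQ_unique[OF LA] tendsto_minus[OF LB] by simp
    with A B show "integrable lebesgue (\<lambda>x. u x * partial_deriv \<phi> i x) \<and> integrable lebesgue (\<lambda>x. g x $ i * \<phi> x) \<and>
        (\<integral>x. u x * partial_deriv \<phi> i x \<partial>lebesgue) = - (\<integral>x. g x $ i * \<phi> x \<partial>lebesgue)" by blast
  qed
  moreover have "Lp p u" "Lp_vec p g" using u g by (auto simp: Lp_def Lp_vec_def LP_def)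
  moreover have "\<exists>\<phi>. (\<forall>k. test_fun \<Omega> (\<phi> k))
        \<and> (\<lambda>k. LINT x|lebesgue. \<bar>\<phi> k x - u x\<bar> powr p) \<longlonglongrightarrow> 0
        \<and> (\<lambda>k. LINT x|lebesgue. norm (grad (\<phi> k) x - g x) powr p) \<longlonglongrightarrow> 0"
    using v lu lg unfolding NP_def by (intro exI[of _ v]) simp
  ultimately show ?thesis unfolding X1p_def W1p_def by blast
qed

lemma X1pD:
  fixes u :: "real^'n \<Rightarrow> real"
  assumes p: "1 < p" and X: "X1p p \<Omega> u g"
  shows "LP p lebesgue (\<lambda>x. (u x, g x))"
    and "\<exists>v. (\<forall>k. test_fun \<Omega> (v k)) \<and> (\<lambda>k. NP p lebesgue (\<lambda>x. jet (v k) x - (u x, g x))) \<longlonglongrightarrow> 0"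
proof -
  have p0: "0 < p" using p by simp
  have u: "LP p lebesgue u" and g: "LP p lebesgue g" using X by (auto simp: X1p_def W1p_def Lp_def Lp_vec_def LP_def)
  show w: "LP p lebesgue (\<lambda>x. (u x, g x))" using u g LP_Pair(1)[OF p0] by blast
  obtain v where v: "\<And>k. test_fun \<Omega> (v k)" and lu: "(\<lambda>k. NP p lebesgue (\<lambda>x. v k x - u x)) \<longlonglongrightarrow> 0"
    and lg: "(\<lambda>k. NP p lebesgue (\<lambda>x. grad (v k) x - g x)) \<longlonglongrightarrow> 0"
    using X unfolding X1p_def NP_def real_norm_def by blast
  note LPv = test_fun_LP(1-3)[OF v p0]
  have d: "(\<lambda>x. jet (v k) x - (u x, g x)) = (\<lambda>x. (v k x - u x, grad (v k) x - g x))" for k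
    by (simp add: jet_def)
  have L: "LP p lebesgue (\<lambda>x. (v k x - u x, grad (v k) x - g x))" for k
    using LP_diff(1)[OF p0 LPv(1) w] unfolding d .
  have "(\<lambda>k. 2 powr p * (NP p lebesgue (\<lambda>x. v k x - u x) + NP p lebesgue (\<lambda>x. grad (v k) x - g x))) \<longlonglongrightarrow> 2 powr p * (0 + 0)"
    by (intro tendsto_intros lu lg)
  hence R: "(\<lambda>k. 2 powr p * (NP p lebesgue (\<lambda>x. v k x - u x) + NP p lebesgue (\<lambda>x. grad (v k) x - g x))) \<longlonglongrightarrow> 0" by simp
  have "(\<lambda>k. NP p lebesgue (\<lambda>x. jet (v k) x - (u x, g x))) \<longlonglongrightarrow> 0"
    unfolding d by (rule tendsto_sandwich[OF _ _ tendsto_const R]) (use LP_Pair(4)[OF p0 L] in auto)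
  with v show "\<exists>v. (\<forall>k. test_fun \<Omega> (v k)) \<and> (\<lambda>k. NP p lebesgue (\<lambda>x. jet (v k) x - (u x, g x))) \<longlonglongrightarrow> 0" by blast
qed

lemma X1p_test_fun:
  fixes v :: "real^'n \<Rightarrow> real"
  assumes p: "1 < p" and v: "test_fun \<Omega> v"
  shows "X1p p \<Omega> v (grad v)"
  by (rule X1pI[OF p, of \<Omega> "\<lambda>_. v"]) (use v test_fun_LP(1)[OF v] p in \<open>auto simp: jet_def[abs_def] NP_def\<close>)

lemma X1p_diff:
  fixes u :: "real^'n \<Rightarrow> real"
  assumes p: "1 < p" and X: "X1p p \<Omega> u g" "X1p p \<Omega> u' g'"
  shows "X1p p \<Omega> (\<lambda>x. u x - u' x) (\<lambda>x. g x - g' x)"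
proof -
  have p0: "0 < p" using p by simp
  obtain v where v: "\<And>k. test_fun \<Omega> (v k)" "(\<lambda>k. NP p lebesgue (\<lambda>x. jet (v k) x - (u x, g x))) \<longlonglongrightarrow> 0"
    using X1pD(2)[OF p X(1)] by blast
  obtain v' where v': "\<And>k. test_fun \<Omega> (v' k)" "(\<lambda>k. NP p lebesgue (\<lambda>x. jet (v' k) x - (u' x, g' x))) \<longlonglongrightarrow> 0"
    using X1pD(2)[OF p X(2)] by blast
  note w = X1pD(1)[OF p X(1)] X1pD(1)[OF p X(2)]
  show ?thesis
  proof (rule X1pI[OF p, of \<Omega> "\<lambda>k x. v k x - v' k x"])
    show "test_fun \<Omega> (\<lambda>x. v k x - v' k x)" for k using test_fun_diff v v' by blast
    show "LP p lebesgue (\<lambda>x. (u x - u' x, g x - g' x))"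
      using LP_diff(1)[OF p0 w] by simp
    have e: "(\<lambda>x. jet (\<lambda>x. v k x - v' k x) x - (u x - u' x, g x - g' x)) =
       (\<lambda>x. (jet (v k) x - (u x, g x)) - (jet (v' k) x - (u' x, g' x)))" for k
      using test_fun_diff(2)[OF v(1) v'(1)] by (auto simp: fun_eq_iff)
    have "(\<lambda>k. 2 powr p * (NP p lebesgue (\<lambda>x. jet (v k) x - (u x, g x)) + NP p lebesgue (\<lambda>x. jet (v' k) x - (u' x, g' x)))) \<longlonglongrightarrow> 2 powr p * (0 + 0)"
      by (intro tendsto_intros v v')
    hence R: "(\<lambda>k. 2 powr p * (NP p lebesgue (\<lambda>x. jet (v k) x - (u x, g x)) + NP p lebesgue (\<lambda>x. jet (v' k) x - (u' x, g' x)))) \<longlonglongrightarrow> 0"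
      by simp
    show "(\<lambda>k. NP p lebesgue (\<lambda>x. jet (\<lambda>x. v k x - v' k x) x - (u x - u' x, g x - g' x))) \<longlonglongrightarrow> 0"
      unfolding e
      by (rule tendsto_sandwich[OF _ _ tendsto_const R])
         (auto intro!: always_eventually LP_diff(2)[OF p0] LP_diff(1)[OF p0] w test_fun_LP(1)[OF v(1) p0] test_fun_LP(1)[OF v'(1) p0])
  qed
qed

section \<open>The product of completed measures and the fractional kernel\<close>

lemma sigma_finite_lebesgue: "sigma_finite_measure (lebesgue :: 'a::euclidean_space measure)"
proof
  obtain A :: "'a set set" where A: "countable A" "A \<subseteq> sets lborel" "\<Union>A = space lborel" "\<forall>a\<in>A. emeasure lborel a \<noteq> \<infinity>"
    using lborel.sigma_finite_countable by blast
  show "\<exists>A :: 'a set set. countable A \<and> A \<subseteq> sets lebesgue \<and> \<Union> A = space lebesgue \<and> (\<forall>a\<in>A. emeasure lebesgue a \<noteq> \<infinity>)"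
    using A by (intro exI[of _ A]) auto
qed

lemma lebesgue_id_measurable: "(\<lambda>x. x) \<in> lebesgue \<rightarrow>\<^sub>M (borel :: 'a::euclidean_space measure)"
  by (rule measurable_completion) simp

lemma measurable_fst_snd_lebesgue:
  "fst \<in> borel_measurable (lebesgue \<Otimes>\<^sub>M lebesgue :: ('a::euclidean_space \<times> 'a) measure)"
  "snd \<in> borel_measurable (lebesgue \<Otimes>\<^sub>M lebesgue :: ('a::euclidean_space \<times> 'a) measure)"
  by (rule measurable_compose[OF measurable_fst lebesgue_id_measurable] measurable_compose[OF measurable_snd lebesgue_id_measurable])+

lemma measurable_lborel_pair_lebesgue:
  fixes f :: "('a::euclidean_space \<times> 'a) \<Rightarrow> 'b"
  assumes "f \<in> measurable (lborel \<Otimes>\<^sub>M lborel) N"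
  shows "f \<in> measurable (lebesgue \<Otimes>\<^sub>M lebesgue) N"
proof -
  have "(\<lambda>z :: 'a \<times> 'a. (fst z, snd z)) \<in> measurable (lebesgue \<Otimes>\<^sub>M lebesgue) (lborel \<Otimes>\<^sub>M (lborel :: 'a measure))"
    using measurable_fst_snd_lebesgue[where 'a='a] by (intro measurable_Pair) auto
  from measurable_compose[OF this assms] show ?thesis by simp
qed

text \<open>The double integral of the equation runs over a product of two completions. Integrands
  made from continuous functions are moved to the Borel product, where translations and the exchange
  of integrals are carried out.\<close>

lemma nn_integral_lebesgue_pair:
  fixes f :: "('a::euclidean_space \<times> 'a) \<Rightarrow> ennreal"
  assumes "f \<in> borel_measurable (lborel \<Otimes>\<^sub>M lborel)"
  shows "(\<integral>\<^sup>+z. f z \<partial>(lebesgue \<Otimes>\<^sub>M lebesgue)) = (\<integral>\<^sup>+x. \<integral>\<^sup>+y. f (x, y) \<partial>lborel \<partial>lborel)"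
  using sigma_finite_measure.nn_integral_fst[OF sigma_finite_lebesgue measurable_lborel_pair_lebesgue[OF assms]]
  by (simp add: nn_integral_completion)

lemma nn_integral_lborel_translation:
  fixes f :: "'a::euclidean_space \<Rightarrow> ennreal"
  assumes [measurable]: "f \<in> borel_measurable borel"
  shows "(\<integral>\<^sup>+x. f (t + x) \<partial>lborel) = (\<integral>\<^sup>+x. f x \<partial>lborel)"
proof -
  have "(\<integral>\<^sup>+x. f (t + x) \<partial>lborel) = (\<integral>\<^sup>+x. f x \<partial>distr lborel borel ((+) t))"
    by (subst nn_integral_distr) auto
  thus ?thesis by (simp add: lborel_distr_plus)
qed

text \<open>A null set of points spoils only the pairs in a cross
  \<open>(N \<times> UNIV) \<union> (UNIV \<times> N)\<close>, which is null for the
  product.\<close>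

lemma AE_pair_lebesgue:
  fixes P :: "'a::euclidean_space \<Rightarrow> bool"
  assumes "AE x in lebesgue. P x"
  shows "AE z in (lebesgue \<Otimes>\<^sub>M lebesgue). P (fst z) \<and> P (snd z)"
proof -
  interpret sigma_finite_measure "lebesgue :: 'a measure" by (rule sigma_finite_lebesgue)
  obtain N where "{x \<in> space lebesgue. \<not> P x} \<subseteq> N" "emeasure lebesgue N = 0" "N \<in> sets (lebesgue :: 'a measure)"
    using assms by (rule AE_E)
  hence N: "N \<in> null_sets (lebesgue :: 'a measure)" "{x. \<not> P x} \<subseteq> N" by (auto intro: null_setsI)
  have "N \<times> UNIV \<in> null_sets (lebesgue \<Otimes>\<^sub>M (lebesgue :: 'a measure))"
    "UNIV \<times> N \<in> null_sets ((lebesgue :: 'a measure) \<Otimes>\<^sub>M lebesgue)"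
    using N(1) by (auto simp: null_sets_def emeasure_pair_measure_Times sets.top[of "lebesgue :: 'a measure", simplified])
  hence "(N \<times> UNIV) \<union> (UNIV \<times> N) \<in> null_sets (lebesgue \<Otimes>\<^sub>M (lebesgue :: 'a measure))" by (rule null_sets.Un)
  thus ?thesis by (rule AE_I') (use N(2) in auto)
qed

text \<open>With the singular kernel moved into the measure, the Gagliardo seminorm becomes the
  plain \<open>L^p\<close> energy of the increments \<open>incr u\<close>, so that all facts about
  \<open>LP\<close> and \<open>NP\<close> apply to it. On the diagonal the kernel is
  \<open>1 / 0 = 0\<close>.\<close>

definition frac_measure :: "real \<Rightarrow> real \<Rightarrow> ((real^'n) \<times> (real^'n)) measure" where
  "frac_measure p s = density (lebesgue \<Otimes>\<^sub>M lebesgue)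
     (\<lambda>z. ennreal (1 / norm (fst z - snd z) powr (real CARD('n) + p * s)))"

definition incr :: "('a \<Rightarrow> real) \<Rightarrow> 'a \<times> 'a \<Rightarrow> real" where
  "incr u z = u (fst z) - u (snd z)"

lemma sets_frac_measure [measurable_cong]: "sets (frac_measure p s) = sets (lebesgue \<Otimes>\<^sub>M lebesgue)"
  by (simp add: frac_measure_def)

lemma frac_kernel_measurable [measurable]:
  "(\<lambda>z. 1 / norm (fst z - snd z) powr c) \<in> borel_measurable (lebesgue \<Otimes>\<^sub>M (lebesgue :: 'a::euclidean_space measure))"
  using measurable_fst_snd_lebesgue by measurable

lemma incr_measurable:
  assumes "u \<in> borel_measurable lebesgue"
  shows "incr u \<in> borel_measurable (frac_measure p s)"
    "incr u \<in> borel_measurable (lebesgue \<Otimes>\<^sub>M (lebesgue :: (real^'n) measure))"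
proof -
  show *: "incr u \<in> borel_measurable (lebesgue \<Otimes>\<^sub>M (lebesgue :: (real^'n) measure))"
    unfolding incr_def[abs_def]
    by (intro borel_measurable_diff measurable_compose[OF measurable_fst assms] measurable_compose[OF measurable_snd assms])
  thus "incr u \<in> borel_measurable (frac_measure p s)"
    by (simp add: measurable_cong_sets[OF sets_frac_measure refl])
qed

lemma AE_frac_measure:
  fixes P :: "real^'n \<Rightarrow> bool"
  assumes "AE x in lebesgue. P x"
  shows "AE z in frac_measure p s. P (fst z) \<and> P (snd z)"
  unfolding frac_measure_def
  by (subst AE_density) (use AE_pair_lebesgue[OF assms] in \<open>auto elim: eventually_mono\<close>)

text \<open>The two series run over the dyadic shells inside and outside the unit ball.\<close>

lemma frac_kernel_finite:
  assumes p: "1 < p" and s: "0 < s" "s < 1"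
  shows "(\<integral>\<^sup>+h. ennreal (min (norm h powr p) 1 / norm (h :: real^'n) powr (real CARD('n) + p * s)) \<partial>lborel) < \<infinity>"
proof -
  define n where "n = real CARD('n)"
  define N where "N = n + p * s"
  have n: "n > 0" by (simp add: n_def)
  have N: "N > 0" using n p s by (simp add: N_def add_pos_pos)
  define V where "V = unit_ball_vol n"
  have V: "V \<ge> 0" using n by (simp add: V_def)
  \<comment> \<open>On the j-th inner shell the numerator is at most \<open>2 powr (- j * p)\<close>
    and the denominator at least \<open>2 powr (- (j + 1) * N)\<close>; taking the full ball in
    place of the shell loses only a constant in the volume. Together with the volume this gives the
    ratio \<open>2 powr (- (p - p * s))\<close>, and for the outer shells in \<open>B\<close> the
    ratio \<open>2 powr (- (p * s))\<close>. Convergence at 0 thus uses \<open>s < 1\<close>,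
    convergence at infinity \<open>0 < s\<close>.\<close>
  define A where "A j h = ennreal (2 powr (N - real j * (p - N)) * indicator (cball 0 (2 powr (- real j))) h)" for j and h :: "real^'n"
  define B where "B j h = ennreal (2 powr (- real j * N) * indicator (cball 0 (2 powr (real j + 1))) h)" for j and h :: "real^'n"
  have [measurable]: "A j \<in> borel_measurable lborel" "B j \<in> borel_measurable lborel" for j
    unfolding A_def B_def
    by (intro measurable_compose[OF _ measurable_ennreal] borel_measurable_times borel_measurable_const borel_measurable_indicator; simp)+
  have le: "ennreal (min (norm h powr p) 1 / norm h powr N) \<le> (\<Sum>j. A j h) + (\<Sum>j. B j h)" for h :: "real^'n"
  proof (cases "h = 0")
    case False
    define r where "r = norm h"
    have r: "r > 0" using False by (simp add: r_def)
    have r2: "r = 2 powr (log 2 r)" using r by simp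
    show ?thesis
    proof (cases "r \<le> 1")
      case True
      define j where "j = nat \<lfloor>- log 2 r\<rfloor>"
      have "- log 2 r \<ge> 0" using True r by simp
      hence j: "real j \<le> - log 2 r" "- log 2 r < real j + 1" unfolding j_def by linarith+
      have 1: "r \<le> 2 powr (- real j)" by (subst r2) (use j in auto)
      have 2: "2 powr (- real j - 1) \<le> r" by (subst r2) (use j in auto)
      have "min (r powr p) 1 / r powr N \<le> (2 powr (- real j)) powr p / (2 powr (- real j - 1)) powr N"
      proof (rule frac_le)
        have "r powr p \<le> (2 powr (- real j)) powr p" using 1 r p by (intro powr_mono2) auto
        thus "min (r powr p) 1 \<le> (2 powr (- real j)) powr p" by linarith
        show "(2 powr (- real j - 1)) powr N \<le> r powr N" using 2 r N by (intro powr_mono2) auto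
      qed auto
      also have "\<dots> = 2 powr (N - real j * (p - N))"
        by (simp add: powr_powr algebra_simps flip: powr_diff)
      finally have "ennreal (min (r powr p) 1 / r powr N) \<le> A j h"
        unfolding A_def using 1 by (intro ennreal_leI) (simp add: r_def)
      also have "\<dots> \<le> (\<Sum>j. A j h)" using sum_le_suminf[of "\<lambda>j. A j h" "{j}"] by simp
      finally show ?thesis by (simp add: r_def add_increasing2)
    next
      case False
      define j where "j = nat \<lfloor>log 2 r\<rfloor>"
      have "log 2 r \<ge> 0" using False r by simp
      hence j: "real j \<le> log 2 r" "log 2 r < real j + 1" unfolding j_def by linarith+
      have 1: "r \<le> 2 powr (real j + 1)" by (subst r2) (use j in auto)
      have 2: "2 powr (real j) \<le> r" by (subst r2) (use j in auto)
      have "min (r powr p) 1 / r powr N \<le> 1 / (2 powr (real j)) powr N"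
      proof (rule frac_le)
        show "(2 powr (real j)) powr N \<le> r powr N" using 2 r N by (intro powr_mono2) auto
      qed auto
      also have "\<dots> = 2 powr (- real j * N)"
        by (simp add: powr_powr powr_minus divide_inverse)
      finally have "ennreal (min (r powr p) 1 / r powr N) \<le> B j h"
        unfolding B_def using 1 by (intro ennreal_leI) (simp add: r_def)
      also have "\<dots> \<le> (\<Sum>j. B j h)" using sum_le_suminf[of "\<lambda>j. B j h" "{j}"] by simp
      finally show ?thesis by (simp add: r_def add_increasing)
    qed
  qed (use p in auto)
  have vol: "emeasure lborel (cball (0 :: real^'n) (2 powr t)) = ennreal (V * 2 powr (t * n))" for t
    by (subst emeasure_cball) (auto simp: V_def n_def powr_powr mult.commute simp flip: powr_realpow)
  have IA: "(\<integral>\<^sup>+h. A j h \<partial>lborel) = ennreal (2 powr N * V * (2 powr (- (p - p * s))) ^ j)" for j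
  proof -
    have "(\<integral>\<^sup>+h. A j h \<partial>lborel) = ennreal (2 powr (N - real j * (p - N))) * emeasure lborel (cball (0 :: real^'n) (2 powr (- real j)))"
      unfolding A_def by (subst ennreal_mult) (auto simp: ennreal_indicator nn_integral_cmult_indicator)
    also have "\<dots> = ennreal (2 powr (N - real j * (p - N)) * (V * 2 powr (- real j * n)))"
      using V by (simp add: vol ennreal_mult)
    also have "2 powr (N - real j * (p - N)) * (V * 2 powr (- real j * n)) = V * 2 powr (N - real j * (p - N) + - real j * n)"
      by (subst powr_add) simp
    also have "N - real j * (p - N) + - real j * n = N + (- (p - p * s)) * real j"
      by (simp add: N_def algebra_simps)
    also have "2 powr (N + (- (p - p * s)) * real j) = 2 powr N * (2 powr (- (p - p * s))) ^ j"
      by (simp add: powr_add powr_powr flip: powr_realpow)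
    finally show ?thesis by (simp add: mult_ac)
  qed
  have IB: "(\<integral>\<^sup>+h. B j h \<partial>lborel) = ennreal (2 powr n * V * (2 powr (- (p * s))) ^ j)" for j
  proof -
    have "(\<integral>\<^sup>+h. B j h \<partial>lborel) = ennreal (2 powr (- real j * N)) * emeasure lborel (cball (0 :: real^'n) (2 powr (real j + 1)))"
      unfolding B_def by (subst ennreal_mult) (auto simp: ennreal_indicator nn_integral_cmult_indicator)
    also have "\<dots> = ennreal (2 powr (- real j * N) * (V * 2 powr ((real j + 1) * n)))"
      using V by (simp add: vol ennreal_mult)
    also have "2 powr (- real j * N) * (V * 2 powr ((real j + 1) * n)) = V * 2 powr (- real j * N + (real j + 1) * n)"
      by (subst powr_add) simp
    also have "- real j * N + (real j + 1) * n = n + (- (p * s)) * real j"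
      by (simp add: N_def algebra_simps)
    also have "2 powr (n + (- (p * s)) * real j) = 2 powr n * 2 powr ((- (p * s)) * real j)"
      by (rule powr_add)
    also have "2 powr ((- (p * s)) * real j) = (2 powr (- (p * s))) ^ j"
      by (simp add: powr_powr flip: powr_realpow)
    finally show ?thesis by (simp add: mult_ac)
  qed
  have "0 < p * s" "p * s < p" using p s by auto
  hence "2 powr (- (p - p * s)) < (2::real) powr 0" "2 powr (- (p * s)) < (2::real) powr 0"
    by (auto intro!: powr_less_mono simp del: powr_zero_eq_one)
  hence sm: "summable (\<lambda>j. c * (2 powr (- (p - p * s))) ^ j)" "summable (\<lambda>j. c * (2 powr (- (p * s))) ^ j)" for c :: real
    by (auto intro!: summable_mult summable_geometric)
  have "(\<integral>\<^sup>+h. ennreal (min (norm h powr p) 1 / norm (h :: real^'n) powr N) \<partial>lborel) \<le> (\<integral>\<^sup>+h. (\<Sum>j. A j h) + (\<Sum>j. B j h) \<partial>lborel)"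
    by (intro nn_integral_mono le)
  also have "\<dots> = (\<Sum>j. \<integral>\<^sup>+h. A j h \<partial>lborel) + (\<Sum>j. \<integral>\<^sup>+h. B j h \<partial>lborel)"
    by (simp add: nn_integral_add nn_integral_suminf)
  also have "\<dots> < \<infinity>"
    using V sm by (simp add: IA IB suminf_ennreal2)
  finally show ?thesis by (simp add: N_def n_def)
qed

text \<open>After the substitution \<open>y = x + h\<close> and an exchange of integrals, the
  seminorm integrates the energy of \<open>v (x + h) - v x\<close> against the kernel in
  \<open>h\<close>. That energy is bounded by the gradient times \<open>norm h powr p\<close>, which
  helps for small shifts, and by a multiple of the energy of \<open>v\<close>, which helps for large
  ones; the minimum of the two is integrable against the kernel. The constant does not depend on the
  domain.\<close>

lemma frac_bound_test_fun:
  assumes p: "1 < p" and s: "0 < s" "s < 1"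
  shows "\<exists>C\<ge>0. \<forall>\<Omega> (v :: real^'n \<Rightarrow> real). test_fun \<Omega> v \<longrightarrow> LP p (frac_measure p s) (incr v)
     \<and> NP p (frac_measure p s) (incr v) \<le> C * NP p lebesgue (jet v)"
proof -
  define N where "N = real CARD('n) + p * s"
  define \<kappa> where "\<kappa> = (\<integral>\<^sup>+h. ennreal (min (norm h powr p) 1 / norm (h :: real^'n) powr N) \<partial>lborel)"
  have \<kappa>: "\<kappa> < \<infinity>" using frac_kernel_finite[OF p s] unfolding \<kappa>_def N_def .
  have p0: "0 < p" using p by simp
  show ?thesis
  proof (intro exI[of _ "2 * 2 powr p * enn2real \<kappa>"] conjI allI impI)
    show "0 \<le> 2 * 2 powr p * enn2real \<kappa>" by simp
    fix \<Omega> and v :: "real^'n \<Rightarrow> real" assume v: "test_fun \<Omega> v"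
    define J where "J = NP p lebesgue (jet v)"
    have J: "J \<ge> 0" by (simp add: J_def)
    have vc: "continuous_on UNIV v" by (rule smooth_fun_continuous[OF test_fun_smooth[OF v]])
    note [measurable] = continuous_borel_lebesgue[OF vc]
    have jv: "jet v = (\<lambda>x. (v x, grad v x))" by (simp add: jet_def[abs_def])
    have JL: "NP p lborel v \<le> J" "NP p lborel (grad v) \<le> J"
      using LP_Pair(2,3)[OF p0 test_fun_LP(1)[OF v p0, unfolded jv]] test_fun_LP(4,5)[OF v p0] by (simp_all add: J_def jv)
    define \<Phi> where "\<Phi> z = ennreal (\<bar>v (fst z) - v (snd z)\<bar> powr p / norm (fst z - snd z) powr N)" for z :: "(real^'n) \<times> (real^'n)"
    have \<Phi>m: "\<Phi> \<in> borel_measurable (lborel \<Otimes>\<^sub>M lborel)" unfolding \<Phi>_def by measurable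
    have est: "NP p lborel (\<lambda>x. v (x + h) - v x) \<le> 2 * 2 powr p * J * min (norm h powr p) 1" for h
    proof -
      have "NP p lborel (\<lambda>x. v (x + h) - v x) \<le> norm h powr p * J"
        using translation_estimate(1)[OF test_fun_C1c[OF v] p, of h] mult_left_mono[OF JL(2), of "norm h powr p"] by simp
      also have "\<dots> \<le> 2 * 2 powr p * J * (norm h powr p)"
      proof -
        have "1 \<le> 2 * 2 powr p" using ge_one_powr_ge_zero[of 2 p] p0 by simp
        from mult_right_mono[OF this, of "norm h powr p * J"] J show ?thesis by (simp add: mult_ac)
      qed
      finally have 1: "NP p lborel (\<lambda>x. v (x + h) - v x) \<le> 2 * 2 powr p * J * (norm h powr p)" .
      have LPv: "LP p lborel v"
      proof (rule LP_continuous_compact_support(2)[OF vc _ _ p0])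
        show "v x = 0" if "x \<notin> closure {x. v x \<noteq> 0}" for x
          using jet_eq_0_outside[OF test_fun_smooth[OF v] that] by (simp add: jet_def prod_eq_iff)
      qed (use v in \<open>simp add: test_fun_def\<close>)
      have LPt: "LP p lborel (\<lambda>x. v (x + h))" "NP p lborel (\<lambda>x. v (x + h)) = NP p lborel v"
        using integral_lborel_translation[of "\<lambda>x. \<bar>v x\<bar> powr p" h] LPv by (auto simp: LP_def NP_def)
      have "NP p lborel (\<lambda>x. v (x + h) - v x) \<le> 2 powr p * (NP p lborel v + NP p lborel v)"
        using LP_diff(2)[OF p0 LPt(1) LPv] LPt(2) by simp
      also have "\<dots> \<le> 2 powr p * (J + J)" using JL by (intro mult_left_mono add_mono) auto
      finally have "NP p lborel (\<lambda>x. v (x + h) - v x) \<le> 2 * 2 powr p * J" by simp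
      with 1 show ?thesis by (auto simp: min_def)
    qed
    have "(\<integral>\<^sup>+z. ennreal (norm (incr v z) powr p) \<partial>frac_measure p s) =
       (\<integral>\<^sup>+z. ennreal (1 / norm (fst z - snd z) powr N) * ennreal (norm (incr v z) powr p) \<partial>(lebesgue \<Otimes>\<^sub>M lebesgue))"
      unfolding frac_measure_def N_def
      by (subst nn_integral_density) (use incr_measurable(2)[of v] in auto)
    also have "\<dots> = (\<integral>\<^sup>+z. \<Phi> z \<partial>(lebesgue \<Otimes>\<^sub>M lebesgue))"
      by (simp add: \<Phi>_def incr_def flip: ennreal_mult)
    also have "\<dots> = (\<integral>\<^sup>+x. \<integral>\<^sup>+y. \<Phi> (x, y) \<partial>lborel \<partial>lborel)"
      by (rule nn_integral_lebesgue_pair[OF \<Phi>m])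
    also have "\<dots> = (\<integral>\<^sup>+x. \<integral>\<^sup>+h. \<Phi> (x, x + h) \<partial>lborel \<partial>lborel)"
    proof (rule nn_integral_cong)
      fix x
      have "(\<lambda>y. \<Phi> (x, y)) \<in> borel_measurable borel" unfolding \<Phi>_def by measurable
      from nn_integral_lborel_translation[OF this, of x]
      show "(\<integral>\<^sup>+y. \<Phi> (x, y) \<partial>lborel) = (\<integral>\<^sup>+h. \<Phi> (x, x + h) \<partial>lborel)" by simp
    qed
    also have "\<dots> = (\<integral>\<^sup>+h. \<integral>\<^sup>+x. \<Phi> (x, x + h) \<partial>lborel \<partial>lborel)"
      by (rule lborel_pair.Fubini'[symmetric]) (unfold \<Phi>_def, measurable)
    also have "\<dots> \<le> (\<integral>\<^sup>+h. ennreal (2 * 2 powr p * J) * ennreal (min (norm h powr p) 1 / norm (h :: real^'n) powr N) \<partial>lborel)"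
    proof (rule nn_integral_mono)
      fix h :: "real^'n"
      have "(\<integral>\<^sup>+x. \<Phi> (x, x + h) \<partial>lborel) = (\<integral>\<^sup>+x. ennreal (1 / norm h powr N) * ennreal (\<bar>v (x + h) - v x\<bar> powr p) \<partial>lborel)"
        by (simp add: \<Phi>_def abs_minus_commute flip: ennreal_mult)
      also have "\<dots> = ennreal (1 / norm h powr N) * ennreal (NP p lborel (\<lambda>x. v (x + h) - v x))"
        using translation_estimate(2)[OF test_fun_C1c[OF v] p, of h]
        by (subst nn_integral_cmult) (auto simp: NP_def nn_integral_eq_integral)
      also have "\<dots> \<le> ennreal (1 / norm h powr N) * ennreal (2 * 2 powr p * J * min (norm h powr p) 1)"
        by (intro mult_left_mono ennreal_leI est) auto
      also have "\<dots> = ennreal (2 * 2 powr p * J) * ennreal (min (norm h powr p) 1 / norm h powr N)"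
        using J by (simp add: mult_ac flip: ennreal_mult)
      finally show "(\<integral>\<^sup>+x. \<Phi> (x, x + h) \<partial>lborel) \<le> ennreal (2 * 2 powr p * J) * ennreal (min (norm h powr p) 1 / norm h powr N)" .
    qed
    also have "\<dots> = ennreal (2 * 2 powr p * J) * \<kappa>"
      unfolding \<kappa>_def by (rule nn_integral_cmult) measurable
    also have "\<dots> = ennreal (2 * 2 powr p * enn2real \<kappa> * J)"
      using \<kappa> J by (cases \<kappa>) (auto simp: mult_ac simp flip: ennreal_mult)
    finally have *: "(\<integral>\<^sup>+z. ennreal (norm (incr v z) powr p) \<partial>frac_measure p s) \<le> ennreal (2 * 2 powr p * enn2real \<kappa> * J)" .
    have m: "incr v \<in> borel_measurable (frac_measure p s)" by (rule incr_measurable) simp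
    have I: "integrable (frac_measure p s) (\<lambda>z. norm (incr v z) powr p)"
      by (rule integrableI_nonneg) (use m le_less_trans[OF * ennreal_less_top] in auto)
    have "NP p (frac_measure p s) (incr v) \<le> 2 * 2 powr p * enn2real \<kappa> * J"
      using * I J by (simp add: NP_def nn_integral_eq_integral)
    thus "LP p (frac_measure p s) (incr v)" "NP p (frac_measure p s) (incr v) \<le> 2 * 2 powr p * enn2real \<kappa> * NP p lebesgue (jet v)"
      using m I by (simp_all add: LP_def J_def)
  qed
qed

text \<open>Increments of the approximating test functions converge almost everywhere along a
  subsequence, so the bound passes to the limit by Fatou's lemma.\<close>

lemma frac_bound:
  assumes p: "1 < p" and s: "0 < s" "s < 1"
  shows "\<exists>C\<ge>0. \<forall>\<Omega> (u :: real^'n \<Rightarrow> real) g. X1p p \<Omega> u g \<longrightarrow> LP p (frac_measure p s) (incr u)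
     \<and> NP p (frac_measure p s) (incr u) \<le> C * NP p lebesgue (\<lambda>x. (u x, g x))"
proof -
  have p0: "0 < p" using p by simp
  obtain C where C: "0 \<le> C" "\<And>\<Omega> (v :: real^'n \<Rightarrow> real). test_fun \<Omega> v \<Longrightarrow> LP p (frac_measure p s) (incr v)
     \<and> NP p (frac_measure p s) (incr v) \<le> C * NP p lebesgue (jet v)"
    using frac_bound_test_fun[OF p s] by blast
  show ?thesis
  proof (intro exI[of _ C] conjI allI impI C(1))
    fix \<Omega> and u :: "real^'n \<Rightarrow> real" and g assume X: "X1p p \<Omega> u g"
    note w = X1pD(1)[OF p X]
    obtain v where v: "\<And>k. test_fun \<Omega> (v k)" "(\<lambda>k. NP p lebesgue (\<lambda>x. jet (v k) x - (u x, g x))) \<longlonglongrightarrow> 0"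
      using X1pD(2)[OF p X] by blast
    obtain r H where r: "strict_mono (r :: nat \<Rightarrow> nat)" "integrable lebesgue H" "\<And>x. H x \<ge> 0"
      "AE x in lebesgue. (\<forall>k. norm (jet (v (r k)) x) powr p \<le> H x) \<and> (\<lambda>k. jet (v (r k)) x) \<longlonglongrightarrow> (u x, g x)"
      using LP_dominated_subseq[OF p0 test_fun_LP(1)[OF v(1) p0] w v(2)] by blast
    have "AE x in lebesgue. (\<lambda>k. v (r k) x) \<longlonglongrightarrow> u x"
      using r(4)
    proof eventually_elim
      case (elim x)
      hence "(\<lambda>k. fst (jet (v (r k)) x)) \<longlonglongrightarrow> fst (u x, g x)" by (intro tendsto_fst) (rule conjunct2)
      thus ?case by (simp add: jet_def)
    qed
    hence ae: "AE z in frac_measure p s. (\<lambda>k. incr (v (r k)) z) \<longlonglongrightarrow> incr u z"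
      by (rule AE_mp[OF AE_frac_measure AE_I2[OF impI]]) (auto simp: incr_def intro!: tendsto_diff)
    have lim: "(\<lambda>k. C * NP p lebesgue (jet (v (r k)))) \<longlonglongrightarrow> C * NP p lebesgue (\<lambda>x. (u x, g x))"
      using LIMSEQ_subseq_LIMSEQ[OF NP_tendsto[OF p0 test_fun_LP(1)[OF v(1) p0] w v(2)] r(1)]
      by (intro tendsto_mult tendsto_const) (simp add: o_def)
    have m: "incr u \<in> borel_measurable (frac_measure p s)"
      using LP_Pair(1)[OF p0] w by (intro incr_measurable) (auto simp: LP_def)
    \<comment> \<open>Fatou's lemma is stated for one bound valid along the whole sequence, whereas
      the right-hand sides here merely converge. Hence the slack \<open>e\<close> and the late start
      of the sequence.\<close>
    have step: "LP p (frac_measure p s) (incr u) \<and> NP p (frac_measure p s) (incr u) \<le> C * NP p lebesgue (\<lambda>x. (u x, g x)) + e"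
      if "e > 0" for e
    proof -
      have "eventually (\<lambda>k. C * NP p lebesgue (jet (v (r k))) < C * NP p lebesgue (\<lambda>x. (u x, g x)) + e) sequentially"
        using that by (intro order_tendstoD(2)[OF lim]) auto
      then obtain K where K: "\<And>k. k \<ge> K \<Longrightarrow> C * NP p lebesgue (jet (v (r k))) < C * NP p lebesgue (\<lambda>x. (u x, g x)) + e"
        by (auto simp: eventually_sequentially)
      have B: "NP p (frac_measure p s) (incr (v (r (k + K)))) \<le> C * NP p lebesgue (\<lambda>x. (u x, g x)) + e" for k
        using C(2)[OF v(1), of "r (k + K)"] K[of "k + K"] by simp
      have L: "AE z in frac_measure p s. (\<lambda>k. incr (v (r (k + K))) z) \<longlonglongrightarrow> incr u z"
        using ae by eventually_elim (rule LIMSEQ_ignore_initial_segment)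
      show ?thesis using LP_fatou[OF p0 _ B m L] C(2)[OF v(1)] by blast
    qed
    show "LP p (frac_measure p s) (incr u)" "NP p (frac_measure p s) (incr u) \<le> C * NP p lebesgue (\<lambda>x. (u x, g x))"
      using step[of 1] step by (auto intro: field_le_epsilon)
  qed
qed

lemma X1p_incr_LP:
  fixes u :: "real^'n \<Rightarrow> real"
  assumes "1 < p" "0 < s" "s < 1" "X1p p \<Omega> u g"
  shows "LP p (frac_measure p s) (incr u)"
  using frac_bound[OF assms(1-3)] assms(4) by blast

text \<open>Increments depend linearly on the function and the space is closed under differences, so
  continuity is the seminorm bound applied to \<open>us k - u\<close>.\<close>

lemma X1p_incr_tendsto:
  fixes u :: "real^'n \<Rightarrow> real"
  assumes "1 < p" "0 < s" "s < 1" and X: "X1p p \<Omega> u g" "\<And>k. X1p p \<Omega> (us k) (gs k)"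
    and lim: "(\<lambda>k. NP p lebesgue (\<lambda>x. (us k x, gs k x) - (u x, g x))) \<longlonglongrightarrow> 0"
  shows "(\<lambda>k. NP p (frac_measure p s) (\<lambda>z. incr (us k) z - incr u z)) \<longlonglongrightarrow> 0"
proof -
  obtain C where C: "\<And>\<Omega> (u :: real^'n \<Rightarrow> real) g. X1p p \<Omega> u g \<Longrightarrow> LP p (frac_measure p s) (incr u)
     \<and> NP p (frac_measure p s) (incr u) \<le> C * NP p lebesgue (\<lambda>x. (u x, g x))"
    using frac_bound[OF assms(1-3)] by blast
  have e: "(\<lambda>z. incr (us k) z - incr u z) = incr (\<lambda>x. us k x - u x)" for k by (auto simp: incr_def)
  have "(\<lambda>k. NP p (frac_measure p s) (incr (\<lambda>x. us k x - u x))) \<longlonglongrightarrow> 0"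
  proof (rule Lim_null_comparison[OF always_eventually[OF allI]])
    show "norm (NP p (frac_measure p s) (incr (\<lambda>x. us k x - u x))) \<le> C * NP p lebesgue (\<lambda>x. (us k x, gs k x) - (u x, g x))" for k
      using C X1p_diff[OF assms(1) X(2)[of k] X(1)] by (simp add: abs_of_nonneg)
    show "(\<lambda>k. C * NP p lebesgue (\<lambda>x. (us k x, gs k x) - (u x, g x))) \<longlonglongrightarrow> 0"
      using tendsto_mult[OF tendsto_const lim, of C] by simp
  qed
  thus ?thesis unfolding e .
qed

section \<open>Rellich compactness\<close>

text \<open>The tangent inequality at the mean value is integrated over \<open>A\<close>; its linear
  term integrates to 0.\<close>

lemma jensen_powr:
  fixes f :: "'a \<Rightarrow> real"
  assumes p: "1 < p" and A: "A \<in> sets M" "emeasure M A < \<infinity>" "0 < measure M A" and f: "\<And>x. 0 \<le> f x"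
    and I: "integrable M (\<lambda>x. indicator A x * f x)" "integrable M (\<lambda>x. indicator A x * f x powr p)"
  shows "((\<integral>x. indicator A x * f x \<partial>M) / measure M A) powr p \<le> (\<integral>x. indicator A x * f x powr p \<partial>M) / measure M A"
proof -
  define \<mu> where "\<mu> = measure M A"
  define m where "m = (\<integral>x. indicator A x * f x \<partial>M) / \<mu>"
  have \<mu>: "\<mu> > 0" using A by (simp add: \<mu>_def)
  have "(\<integral>x. indicator A x * f x \<partial>M) \<ge> 0" by (rule Bochner_Integration.integral_nonneg) (simp add: f)
  hence m: "m \<ge> 0" using \<mu> by (simp add: m_def)
  have IA: "integrable M (indicator A :: 'a \<Rightarrow> real)" using A by simp
  have eq: "indicator A x * (m powr p + p * m powr (p - 1) * (f x - m)) =
      (m powr p - p * m powr (p - 1) * m) * indicator A x + p * m powr (p - 1) * (indicator A x * f x)" for x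
    by (simp add: algebra_simps)
  have "(\<integral>x. indicator A x * (m powr p + p * m powr (p - 1) * (f x - m)) \<partial>M) \<le> (\<integral>x. indicator A x * f x powr p \<partial>M)"
  proof (rule integral_mono)
    show "integrable M (\<lambda>x. indicator A x * (m powr p + p * m powr (p - 1) * (f x - m)))"
      unfolding eq using IA I(1) by auto
  qed (use I(2) powr_tangent[OF p m f] in \<open>auto intro!: mult_left_mono\<close>)
  also have "(\<integral>x. indicator A x * (m powr p + p * m powr (p - 1) * (f x - m)) \<partial>M) =
      (m powr p - p * m powr (p - 1) * m) * \<mu> + p * m powr (p - 1) * (m * \<mu>)"
    unfolding eq using IA I(1) \<mu> A by (simp add: m_def \<mu>_def)
  finally have "m powr p * \<mu> \<le> (\<integral>x. indicator A x * f x powr p \<partial>M)" by (simp add: algebra_simps)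
  thus ?thesis using \<mu> by (simp add: m_def \<mu>_def pos_le_divide_eq)
qed

text \<open>The index of the half-open dyadic cube of side \<open>1 / 2 ^ k\<close> that contains
  the point. Integer vectors form a countable index set, which makes piecewise constant functions
  measurable as compositions with \<open>cell\<close> and permits a diagonal sequence over all cubes
  of all levels.\<close>

definition cell :: "nat \<Rightarrow> real^'n \<Rightarrow> int^'n" where
  "cell k x = (\<chi> i. \<lfloor>2 ^ k * x $ i\<rfloor>)"

definition cube :: "nat \<Rightarrow> int^'n \<Rightarrow> (real^'n) set" where
  "cube k z = {y. cell k y = z}"

definition cube_avg :: "(real^'n \<Rightarrow> real) \<Rightarrow> nat \<Rightarrow> int^'n \<Rightarrow> real" where
  "cube_avg v k z = (\<integral>y. indicator (cube k z) y * v y \<partial>lborel) / measure lborel (cube k z)"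

lemma cube_borel [measurable]: "cube k z \<in> sets (borel :: (real^'n) measure)"
proof -
  have "cube k z = (\<Inter>i. {y. real_of_int (z $ i) \<le> 2 ^ k * y $ i} \<inter> {y. 2 ^ k * y $ i < real_of_int (z $ i) + 1})"
    by (auto simp: cube_def cell_def vec_eq_iff floor_eq_iff)
  also have "\<dots> \<in> sets borel"
    by (intro sets.finite_INT sets.Int borel_closed borel_open closed_Collect_le open_Collect_less continuous_intros) auto
  finally show ?thesis .
qed

lemma cell_measurable [measurable]: "cell k \<in> measurable borel (count_space (UNIV :: (int^'n) set))"
  by (subst measurable_count_space_eq2_countable) (use cube_borel[of k] in \<open>auto simp: cube_def vimage_def\<close>)

lemma cube_diameter:
  fixes x y :: "real^'n"
  assumes "x \<in> cube k z" "y \<in> cube k z"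
  shows "norm (x - y) \<le> real CARD('n) / 2 ^ k"
proof -
  have "\<bar>(x - y) $ i\<bar> \<le> 1 / 2 ^ k" for i
  proof -
    have "\<lfloor>2 ^ k * x $ i\<rfloor> = \<lfloor>2 ^ k * y $ i\<rfloor>" using assms by (auto simp: cube_def cell_def vec_eq_iff)
    hence "\<bar>2 ^ k * x $ i - 2 ^ k * y $ i\<bar> \<le> 1" by linarith
    hence "2 ^ k * \<bar>x $ i - y $ i\<bar> \<le> 1" by (simp add: abs_mult flip: right_diff_distrib)
    thus ?thesis by (simp add: field_simps)
  qed
  hence "(\<Sum>i\<in>UNIV. \<bar>(x - y) $ i\<bar>) \<le> (\<Sum>i\<in>(UNIV :: 'n set). 1 / 2 ^ k)" by (intro sum_mono)
  thus ?thesis using norm_le_l1_cart[of "x - y"] by simp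
qed

text \<open>The cube contains the open box of the same side length and lies in a ball by the
  diameter bound. The lower bound is what controls the division in the averages.\<close>

lemma cube_measure:
  shows "emeasure lborel (cube k z :: (real^'n) set) < \<infinity>"
    and "(1 / 2 ^ k) ^ CARD('n) \<le> measure lborel (cube k z :: (real^'n) set)"
proof -
  define l where "l = ((\<chi> i. real_of_int (z $ i) / 2 ^ k) :: real^'n)"
  define u where "u = ((\<chi> i. (real_of_int (z $ i) + 1) / 2 ^ k) :: real^'n)"
  have ul: "(u - l) \<bullet> b = 1 / 2 ^ k" if "b \<in> Basis" for b
    using that by (auto simp: Basis_vec_def inner_axis u_def l_def diff_divide_distrib[symmetric])
  hence le: "l \<bullet> b \<le> u \<bullet> b" if "b \<in> Basis" for b
    using that by (simp add: inner_diff_left) (metis diff_ge_0_iff_ge divide_nonneg_nonneg zero_le_one zero_le_numeral zero_le_power)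
  have "box l u \<subseteq> cube k z"
  proof
    fix y assume "y \<in> box l u"
    hence "real_of_int (z $ i) / 2 ^ k < y $ i" "y $ i < (real_of_int (z $ i) + 1) / 2 ^ k" for i
      by (auto simp: mem_box_cart l_def u_def)
    hence "real_of_int (z $ i) \<le> 2 ^ k * y $ i" "2 ^ k * y $ i < real_of_int (z $ i) + 1" for i
      by (auto simp: field_simps less_imp_le)
    thus "y \<in> cube k z" by (auto simp: cube_def cell_def vec_eq_iff floor_eq_iff)
  qed
  hence "emeasure lborel (box l u) \<le> emeasure lborel (cube k z)" by (intro emeasure_mono) auto
  moreover have "emeasure lborel (box l u) = ennreal ((1 / 2 ^ k) ^ CARD('n))"
    by (subst emeasure_lborel_box[OF le]) (auto simp: ul)
  ultimately have ge: "ennreal ((1 / 2 ^ k) ^ CARD('n)) \<le> emeasure lborel (cube k z)" by simp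
  hence "cube k z \<noteq> ({} :: (real^'n) set)" by (auto simp: power_one_over)
  then obtain x :: "real^'n" where "x \<in> cube k z" by blast
  hence "cube k z \<subseteq> cball x (real CARD('n) / 2 ^ k)" using cube_diameter by (auto simp: dist_norm)
  hence "emeasure lborel (cube k z) \<le> emeasure lborel (cball x (real CARD('n) / 2 ^ k))" by (intro emeasure_mono) auto
  thus fin: "emeasure lborel (cube k z :: (real^'n) set) < \<infinity>" using emeasure_lborel_cball_finite by (rule le_less_trans)
  show "(1 / 2 ^ k) ^ CARD('n) \<le> measure lborel (cube k z :: (real^'n) set)"
    using ge fin by (subst (asm) emeasure_eq_ennreal_measure) auto
qed

text \<open>By Jensen's inequality the deviation from the mean is controlled by the average of
  \<open>v x - v y\<close> over the cube of \<open>x\<close>. That cube lies in the ball of radius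
  \<open>\<rho> k\<close> around \<open>x\<close>, so the average becomes an integral over shifts,
  to which the translation estimate applies. Dividing by the volume of the cube costs
  \<open>(2 ^ k) ^ CARD('n)\<close>; the volume of the ball of shifts cancels this, and the gain
  \<open>\<rho> k powr p\<close> remains.\<close>

lemma cube_approximation:
  fixes v :: "real^'n \<Rightarrow> real"
  assumes v: "test_fun \<Omega> v" and p: "1 < p"
  defines "\<rho> \<equiv> \<lambda>k :: nat. real CARD('n) / 2 ^ k"
  shows "LP p lborel (\<lambda>x. v x - cube_avg v k (cell k x))" (is ?A)
    and "NP p lborel (\<lambda>x. v x - cube_avg v k (cell k x))
       \<le> unit_ball_vol (real CARD('n)) * real CARD('n) ^ CARD('n) * \<rho> k powr p * NP p lborel (grad v)" (is ?B)
    and "\<bar>cube_avg v k z\<bar> powr p \<le> (2 ^ k) ^ CARD('n) * NP p lborel v" (is ?C)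
proof -
  have p0: "0 < p" using p by simp
  have vc: "continuous_on UNIV v" by (rule smooth_fun_continuous[OF test_fun_smooth[OF v]])
  note [measurable] = continuous_borel_lebesgue[OF vc]
  have vz: "v x = 0" if "x \<notin> closure {x. v x \<noteq> 0}" for x
    using jet_eq_0_outside[OF test_fun_smooth[OF v] that] by (simp add: jet_def prod_eq_iff)
  have K: "compact (closure {x. v x \<noteq> 0})" using v by (simp add: test_fun_def)
  obtain Bd where Bd: "\<And>x. norm (v x) \<le> Bd" and Bd0: "0 \<le> Bd"
    using continuous_compact_support_bounded[OF vc vz K] by metis
  have LPv: "LP p lborel v" by (rule LP_continuous_compact_support(2)[OF vc vz K p0])
  have int: "integrable lborel (\<lambda>y. indicator (cube k z) y * f y)"
    if "f \<in> borel_measurable borel" "\<And>y. norm (f y) \<le> C" for f :: "real^'n \<Rightarrow> real" and C z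
  proof -
    have C: "C \<ge> 0" using that(2)[of 0] norm_ge_zero order_trans by blast
    have "(\<lambda>y. indicator (cube k z) y * f y) \<in> borel_measurable borel" using that(1) by measurable
    moreover have "(0::real) < (1 / 2 ^ k) ^ CARD('n)" by simp
    hence "0 < measure lborel (cube k z :: (real^'n) set)" using cube_measure(2) by (rule less_le_trans)
    hence "cube k z \<noteq> ({} :: (real^'n) set)" by auto
    then obtain x :: "real^'n" where x: "x \<in> cube k z" by blast
    moreover have "indicator (cube k z) y * f y = 0" if "y \<notin> cball x (real CARD('n) / 2 ^ k)" for y
      using cube_diameter[OF x, of y] that by (auto simp: dist_norm split: split_indicator)
    ultimately show ?thesis
      using that(2) C by (intro integrable_lborel_of_bounded_support[of _ C x "real CARD('n) / 2 ^ k"]) (auto split: split_indicator)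
  qed
  have \<mu>: "measure lborel (cube k z :: (real^'n) set) > 0" for z
    using cube_measure(2)[of k z] by (rule less_le_trans[rotated]) simp
  have \<mu>': "1 / measure lborel (cube k z :: (real^'n) set) \<le> (2 ^ k) ^ CARD('n)" for z
    using cube_measure(2)[of k z] \<mu>[of z] by (simp add: field_simps power_one_over)
  have jen: "\<bar>(\<integral>y. indicator (cube k z) y * f y \<partial>lborel) / measure lborel (cube k z)\<bar> powr p
     \<le> (2 ^ k) ^ CARD('n) * (\<integral>y. indicator (cube k z) y * \<bar>f y\<bar> powr p \<partial>lborel)"
    if f: "f \<in> borel_measurable borel" "\<And>y. norm (f y) \<le> C" for f :: "real^'n \<Rightarrow> real" and C z
  proof -
    note [measurable] = f(1)
    have "\<bar>(\<integral>y. indicator (cube k z) y * f y \<partial>lborel)\<bar> \<le> (\<integral>y. indicator (cube k z) y * \<bar>f y\<bar> \<partial>lborel)"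
      using integral_abs_bound[of lborel "\<lambda>y. indicator (cube k z) y * f y"] by (simp add: abs_mult)
    hence "\<bar>(\<integral>y. indicator (cube k z) y * f y \<partial>lborel) / measure lborel (cube k z)\<bar> powr p \<le>
       ((\<integral>y. indicator (cube k z) y * \<bar>f y\<bar> \<partial>lborel) / measure lborel (cube k z)) powr p"
      using p by (intro powr_mono2) (auto simp: abs_divide intro!: divide_right_mono)
    also have "\<dots> \<le> (\<integral>y. indicator (cube k z) y * \<bar>f y\<bar> powr p \<partial>lborel) / measure lborel (cube k z)"
    proof (rule jensen_powr[OF p _ cube_measure(1) \<mu>])
      show "integrable lborel (\<lambda>y. indicator (cube k z) y * \<bar>f y\<bar>)" by (rule int[of _ C]) (use f in auto)
      show "integrable lborel (\<lambda>y. indicator (cube k z) y * \<bar>f y\<bar> powr p)"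
        by (rule int[of _ "C powr p"]) (use f p in \<open>auto intro!: powr_mono2\<close>)
    qed auto
    also have "\<dots> = 1 / measure lborel (cube k z) * (\<integral>y. indicator (cube k z) y * \<bar>f y\<bar> powr p \<partial>lborel)" by simp
    also have "\<dots> \<le> (2 ^ k) ^ CARD('n) * (\<integral>y. indicator (cube k z) y * \<bar>f y\<bar> powr p \<partial>lborel)"
      by (intro mult_right_mono \<mu>') simp
    finally show ?thesis .
  qed
  show ?C
  proof -
    have "\<bar>cube_avg v k z\<bar> powr p \<le> (2 ^ k) ^ CARD('n) * (\<integral>y. indicator (cube k z) y * \<bar>v y\<bar> powr p \<partial>lborel)"
      unfolding cube_avg_def by (rule jen[of v Bd]) (use Bd in auto)
    also have "\<dots> \<le> (2 ^ k) ^ CARD('n) * NP p lborel v"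
      unfolding NP_def
    proof (intro mult_left_mono integral_mono)
      show "integrable lborel (\<lambda>y. indicator (cube k z) y * \<bar>v y\<bar> powr p)"
        by (rule int[of _ "Bd powr p"]) (use Bd p in \<open>auto intro!: powr_mono2\<close>)
    qed (use LP_integrable[OF LPv] in \<open>auto split: split_indicator\<close>)
    finally show ?thesis .
  qed
  have [measurable]: "cball (0 :: real^'n) t \<in> sets borel" for t by simp
  define N where "N x = ennreal (\<bar>v x - cube_avg v k (cell k x)\<bar> powr p)" for x
  have avm[measurable]: "(\<lambda>x. cube_avg v k (cell k x)) \<in> borel_measurable borel"
    by (rule measurable_compose[OF cell_measurable]) simp
  have ptw: "N x \<le> ennreal ((2 ^ k) ^ CARD('n)) * (\<integral>\<^sup>+h. indicator (cball 0 (\<rho> k)) h * ennreal (\<bar>v (x + h) - v x\<bar> powr p) \<partial>lborel)" for x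
  proof -
    let ?Q = "cube k (cell k x)"
    have xQ: "x \<in> ?Q" by (simp add: cube_def)
    have Bd2: "norm (v x - v y) \<le> Bd + Bd" for y using Bd[of x] Bd[of y] by (simp add: abs_le_iff)
    have "(\<integral>y. indicator ?Q y * (v x - v y) \<partial>lborel) = v x * measure lborel ?Q - (\<integral>y. indicator ?Q y * v y \<partial>lborel)"
    proof -
      have "(\<integral>y. indicator ?Q y * (v x - v y) \<partial>lborel) = (\<integral>y. indicator ?Q y * v x - indicator ?Q y * v y \<partial>lborel)"
        by (simp add: right_diff_distrib)
      also have "\<dots> = (\<integral>y. indicator ?Q y * v x \<partial>lborel) - (\<integral>y. indicator ?Q y * v y \<partial>lborel)"
        by (intro Bochner_Integration.integral_diff int[of _ "norm (v x)"] int[of _ Bd]) (use Bd in auto)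
      finally show ?thesis by simp
    qed
    hence "v x - cube_avg v k (cell k x) = (\<integral>y. indicator ?Q y * (v x - v y) \<partial>lborel) / measure lborel ?Q"
      using \<mu>[of "cell k x"] by (simp add: cube_avg_def field_simps)
    hence "\<bar>v x - cube_avg v k (cell k x)\<bar> powr p \<le> (2 ^ k) ^ CARD('n) * (\<integral>y. indicator ?Q y * \<bar>v x - v y\<bar> powr p \<partial>lborel)"
      using jen[of "\<lambda>y. v x - v y" "Bd + Bd" "cell k x"] Bd2 by simp
    hence "N x \<le> ennreal ((2 ^ k) ^ CARD('n)) * ennreal (\<integral>y. indicator ?Q y * \<bar>v x - v y\<bar> powr p \<partial>lborel)"
      unfolding N_def by (subst ennreal_mult[symmetric]) (auto intro: ennreal_leI)
    also have "ennreal (\<integral>y. indicator ?Q y * \<bar>v x - v y\<bar> powr p \<partial>lborel) = (\<integral>\<^sup>+y. ennreal (indicator ?Q y * \<bar>v x - v y\<bar> powr p) \<partial>lborel)"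
    proof (rule nn_integral_eq_integral[symmetric])
      show "integrable lborel (\<lambda>y. indicator ?Q y * \<bar>v x - v y\<bar> powr p)"
        by (rule int[of _ "(Bd + Bd) powr p"]) (use Bd2 p in \<open>auto intro!: powr_mono2\<close>)
    qed auto
    also have "\<dots> \<le> (\<integral>\<^sup>+y. indicator (cball 0 (\<rho> k)) (y - x) * ennreal (\<bar>v y - v x\<bar> powr p) \<partial>lborel)"
    proof (rule nn_integral_mono)
      fix y
      show "ennreal (indicator ?Q y * \<bar>v x - v y\<bar> powr p) \<le> indicator (cball 0 (\<rho> k)) (y - x) * ennreal (\<bar>v y - v x\<bar> powr p)"
        using cube_diameter[OF xQ, of y] by (auto simp: \<rho>_def abs_minus_commute norm_minus_commute split: split_indicator)
    qed
    also have "\<dots> = (\<integral>\<^sup>+h. indicator (cball 0 (\<rho> k)) h * ennreal (\<bar>v (x + h) - v x\<bar> powr p) \<partial>lborel)"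
    proof (subst nn_integral_lborel_translation[of _ x, symmetric])
      have [measurable]: "(\<lambda>y. indicator (cball 0 (\<rho> k)) (y - x) :: ennreal) \<in> borel_measurable borel"
        by (rule measurable_compose[of "\<lambda>y. y - x" borel borel "indicator (cball 0 (\<rho> k))"]) (auto intro!: borel_measurable_indicator)
      show "(\<lambda>y. indicator (cball 0 (\<rho> k)) (y - x) * ennreal (\<bar>v y - v x\<bar> powr p)) \<in> borel_measurable borel"
        by measurable
    qed auto
    finally show ?thesis by (simp add: mult_left_mono)
  qed
  let ?G = "NP p lborel (grad v)"
  define I0 where "I0 = (\<integral>\<^sup>+x. \<integral>\<^sup>+h. indicator (cball 0 (\<rho> k)) h * ennreal (\<bar>v (x + h) - v x\<bar> powr p) \<partial>lborel \<partial>lborel)"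
  have "(\<integral>\<^sup>+x. N x \<partial>lborel) \<le> (\<integral>\<^sup>+x. ennreal ((2 ^ k) ^ CARD('n)) * (\<integral>\<^sup>+h. indicator (cball 0 (\<rho> k)) h * ennreal (\<bar>v (x + h) - v x\<bar> powr p) \<partial>lborel) \<partial>lborel)"
    by (intro nn_integral_mono ptw)
  also have "\<dots> = ennreal ((2 ^ k) ^ CARD('n)) * I0"
    unfolding I0_def by (rule nn_integral_cmult) measurable
  finally have N_le: "(\<integral>\<^sup>+x. N x \<partial>lborel) \<le> ennreal ((2 ^ k) ^ CARD('n)) * I0" .
  have "I0 = (\<integral>\<^sup>+x. \<integral>\<^sup>+h. indicator (cball 0 (\<rho> k)) h * ennreal (\<bar>v (x + h) - v x\<bar> powr p) \<partial>lborel \<partial>lborel)"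
    by (rule I0_def)
  also have "\<dots> = (\<integral>\<^sup>+h. \<integral>\<^sup>+x. indicator (cball 0 (\<rho> k)) h * ennreal (\<bar>v (x + h) - v x\<bar> powr p) \<partial>lborel \<partial>lborel)"
    by (rule lborel_pair.Fubini'[symmetric]) measurable
  also have "\<dots> \<le> (\<integral>\<^sup>+h. ennreal (\<rho> k powr p * ?G) * indicator (cball 0 (\<rho> k)) (h :: real^'n) \<partial>lborel)"
  proof (rule nn_integral_mono)
    fix h :: "real^'n"
    have "(\<integral>\<^sup>+x. ennreal (\<bar>v (x + h) - v x\<bar> powr p) \<partial>lborel) = ennreal (NP p lborel (\<lambda>x. v (x + h) - v x))"
      using translation_estimate(2)[OF test_fun_C1c[OF v] p, of h] by (simp add: NP_def nn_integral_eq_integral)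
    also have "\<dots> \<le> ennreal (norm h powr p * ?G)"
      by (intro ennreal_leI translation_estimate(1)[OF test_fun_C1c[OF v] p])
    finally have 1: "(\<integral>\<^sup>+x. ennreal (\<bar>v (x + h) - v x\<bar> powr p) \<partial>lborel) \<le> ennreal (norm h powr p * ?G)" .
    show "(\<integral>\<^sup>+x. indicator (cball 0 (\<rho> k)) h * ennreal (\<bar>v (x + h) - v x\<bar> powr p) \<partial>lborel) \<le>
        ennreal (\<rho> k powr p * ?G) * indicator (cball 0 (\<rho> k)) h"
    proof (cases "h \<in> cball 0 (\<rho> k)")
      case True
      have "ennreal (norm h powr p * ?G) \<le> ennreal (\<rho> k powr p * ?G)"
        using True p by (intro ennreal_leI mult_right_mono powr_mono2) auto
      from order_trans[OF 1 this] True show ?thesis by simp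
    qed simp
  qed
  also have "\<dots> = ennreal (\<rho> k powr p * ?G) * emeasure lborel (cball (0 :: real^'n) (\<rho> k))"
    by (rule nn_integral_cmult_indicator) simp
  also have "emeasure lborel (cball (0 :: real^'n) (\<rho> k)) = ennreal (unit_ball_vol (real CARD('n)) * \<rho> k ^ CARD('n))"
    by (subst emeasure_cball) (auto simp: \<rho>_def)
  finally have I0_le: "I0 \<le> ennreal (\<rho> k powr p * ?G) * ennreal (unit_ball_vol (real CARD('n)) * \<rho> k ^ CARD('n))" .
  have "(\<integral>\<^sup>+x. N x \<partial>lborel) \<le> ennreal ((2 ^ k) ^ CARD('n)) * (ennreal (\<rho> k powr p * ?G) * ennreal (unit_ball_vol (real CARD('n)) * \<rho> k ^ CARD('n)))"
    by (rule order_trans[OF N_le mult_left_mono[OF I0_le]]) simp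
  also have "ennreal ((2 ^ k) ^ CARD('n)) * (ennreal (\<rho> k powr p * ?G) * ennreal (unit_ball_vol (real CARD('n)) * \<rho> k ^ CARD('n)))
     = ennreal ((2 ^ k) ^ CARD('n) * (\<rho> k powr p * ?G * (unit_ball_vol (real CARD('n)) * \<rho> k ^ CARD('n))))"
    by (subst ennreal_mult[symmetric], auto simp: \<rho>_def)+
  also have "(2 ^ k) ^ CARD('n) * (\<rho> k powr p * ?G * (unit_ball_vol (real CARD('n)) * \<rho> k ^ CARD('n))) =
      unit_ball_vol (real CARD('n)) * real CARD('n) ^ CARD('n) * \<rho> k powr p * ?G"
  proof -
    have "(2 ^ k) ^ CARD('n) * \<rho> k ^ CARD('n) = real CARD('n) ^ CARD('n)"
      by (simp add: \<rho>_def flip: power_mult_distrib)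
    thus ?thesis by (simp add: mult_ac)
  qed
  finally have *: "(\<integral>\<^sup>+x. N x \<partial>lborel) \<le> ennreal (unit_ball_vol (real CARD('n)) * real CARD('n) ^ CARD('n) * \<rho> k powr p * ?G)" .
  have I: "integrable lborel (\<lambda>x. norm (v x - cube_avg v k (cell k x)) powr p)"
    by (rule integrableI_nonneg) (use le_less_trans[OF * ennreal_less_top] in \<open>auto simp: N_def\<close>)
  thus ?A by (simp add: LP_def)
  show ?B using * I by (simp add: NP_def N_def nn_integral_eq_integral)
qed

text \<open>For each level the averages over countably many cubes are bounded numbers, so one
  diagonal sequence makes all of them converge. The averages approximate the functions at a rate
  governed by the gradient bound alone, uniformly in the sequence, hence the functions themselves
  form a Cauchy sequence.\<close>

lemma rellich:
  fixes v :: "nat \<Rightarrow> real^'n \<Rightarrow> real"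
  assumes v: "\<And>m. test_fun \<Omega> (v m)" and p: "1 < p" and \<Omega>: "bounded \<Omega>"
    and G: "\<And>m. NP p lebesgue (grad (v m)) \<le> G"
  shows "\<exists>r u. strict_mono (r :: nat \<Rightarrow> nat) \<and> LP p lebesgue u \<and> (\<lambda>m. NP p lebesgue (\<lambda>x. v (r m) x - u x)) \<longlonglongrightarrow> 0"
proof -
  have p0: "0 < p" using p by simp
  have G0: "G \<ge> 0" using G[of 0] NP_nonneg order_trans by blast
  obtain R where R: "\<Omega> \<subseteq> cball 0 R" "0 \<le> R"
    using \<Omega> by (metis bounded_subset_cball less_eq_real_def bounded_pos mem_cball_0 subsetI)
  define \<rho> where "\<rho> k = real CARD('n) / 2 ^ k" for k :: nat
  define P where "P = (2 * R + 1) powr p * G"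
  have P0: "P \<ge> 0" using G0 by (simp add: P_def)
  have NPv: "NP p lborel (v m) \<le> P" for m
    using poincare_inequality[OF v p R, of m] mult_left_mono[OF G[of m], of "(2 * R + 1) powr p"] test_fun_LP(4)[OF v p0, of m]
    by (simp add: P_def)
  have LPv: "LP p lborel (v m)" for m
    using test_fun_LP(2)[OF v p0, of m] continuous_borel_lebesgue[OF smooth_fun_continuous[OF test_fun_smooth[OF v]], of m]
    by (simp add: LP_def integrable_completion)
  define b where "b k = ((2 ^ k) ^ CARD('n) * P) powr (1 / p) + 1" for k :: nat
  have b: "b k > 0" for k by (simp add: b_def add_nonneg_pos)
  have avb: "\<bar>cube_avg (v m) k z\<bar> \<le> b k" for m k z
  proof -
    have "\<bar>cube_avg (v m) k z\<bar> powr p \<le> (2 ^ k) ^ CARD('n) * NP p lborel (v m)" by (rule cube_approximation(3)[OF v p])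
    also have "\<dots> \<le> (2 ^ k) ^ CARD('n) * P" by (intro mult_left_mono NPv) auto
    finally have "(\<bar>cube_avg (v m) k z\<bar> powr p) powr (1 / p) \<le> ((2 ^ k) ^ CARD('n) * P) powr (1 / p)"
      using p by (intro powr_mono2) auto
    thus ?thesis using p by (simp add: powr_powr b_def)
  qed
  \<comment> \<open>The diagonal argument asks for one bound for all indices, whereas averages of
    level \<open>k\<close> are only bounded by \<open>b k\<close>; hence the normalisation. The
    summand 1 in \<open>b\<close> keeps the divisor positive.\<close>
  define F where "F m kz = cube_avg (v m) (fst kz) (snd kz) / b (fst kz)" for m and kz :: "nat \<times> (int^'n)"
  have "\<exists>r :: nat \<Rightarrow> nat. strict_mono r \<and> (\<forall>kz. \<exists>l. (\<lambda>m. F (r m) kz) \<longlonglongrightarrow> l)"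
  proof (rule function_convergent_subsequence[of "UNIV :: (nat \<times> (int^'n)) set" F 1])
    show "norm (F m kz) \<le> 1" for m kz using avb[of m "fst kz" "snd kz"] b[of "fst kz"] by (simp add: F_def)
  qed auto
  then obtain r :: "nat \<Rightarrow> nat" where r: "strict_mono r" "\<And>kz. \<exists>l. (\<lambda>m. F (r m) kz) \<longlonglongrightarrow> l" by blast
  have "\<exists>l. (\<lambda>m. cube_avg (v (r m)) k z) \<longlonglongrightarrow> l" for k z
  proof -
    obtain l where "(\<lambda>m. F (r m) (k, z)) \<longlonglongrightarrow> l" using r(2) by blast
    hence "(\<lambda>m. b k * F (r m) (k, z)) \<longlonglongrightarrow> b k * l" by (intro tendsto_mult tendsto_const)
    thus ?thesis using b[of k] by (auto simp: F_def)
  qed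
  then obtain L where L: "\<And>k z. (\<lambda>m. cube_avg (v (r m)) k z) \<longlonglongrightarrow> L k z" by metis
  define A where "A m k x = cube_avg (v (r m)) k (cell k x)" for m k and x :: "real^'n"
  define B where "B k x = L k (cell k x)" for k and x :: "real^'n"
  have [measurable]: "A m k \<in> borel_measurable borel" "B k \<in> borel_measurable borel" for m k
    unfolding A_def B_def by (rule measurable_compose[OF cell_measurable]; simp)+
  \<comment> \<open>A cube meeting the domain stays within \<open>\<rho> k\<close> of it. The
    averages of one level therefore live on a common ball, and bounded pointwise convergence becomes
    convergence in \<open>L^p\<close>.\<close>
  have Abd: "\<bar>A m k x\<bar> \<le> b k * indicator (cball 0 (R + \<rho> k)) x" for m k x
  proof (cases "x \<in> cball 0 (R + \<rho> k)")
    case False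
    have "indicator (cube k (cell k x)) y * v (r m) y = 0" for y
    proof (cases "y \<in> cube k (cell k x)")
      case True
      have "norm (x - y) \<le> \<rho> k" unfolding \<rho>_def by (rule cube_diameter[OF _ True]) (simp add: cube_def)
      hence "norm y > R" using False norm_triangle_ineq2[of x y] by simp
      hence "y \<notin> \<Omega>" using R by auto
      thus ?thesis using test_fun_jet_outside(2)[OF v] by simp
    qed simp
    hence "(\<lambda>y. indicator (cube k (cell k x)) y * v (r m) y) = (\<lambda>y. 0)" by blast
    thus ?thesis using False by (simp add: A_def cube_avg_def)
  qed (use avb in \<open>simp add: A_def\<close>)
  have AB: "(\<lambda>m. A m k x) \<longlonglongrightarrow> B k x" for k x using L by (simp add: A_def B_def)
  have Bbd: "\<bar>B k x\<bar> \<le> b k * indicator (cball 0 (R + \<rho> k)) x" for k x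
    by (rule LIMSEQ_le_const2[OF tendsto_rabs[OF AB]]) (use Abd in auto)
  have Ib: "integrable lborel (\<lambda>x. c * indicator (cball (0 :: real^'n) t) x)" for c t :: real
    by (intro integrable_mult_right integrable_real_indicator) (use emeasure_lborel_cball_finite in auto)
  have LPb: "LP p lborel f" if "f \<in> borel_measurable borel" "\<And>x. \<bar>f x\<bar> \<le> c * indicator (cball 0 t) x" for f :: "real^'n \<Rightarrow> real" and c t
  proof (rule LP_minorant[OF _ Ib[of "c powr p" t]])
    show "AE x in lborel. norm (f x) powr p \<le> c powr p * indicator (cball 0 t) x"
    proof (rule AE_I2)
      fix x show "norm (f x) powr p \<le> c powr p * indicator (cball 0 t) x"
        using that(2)[of x] p by (cases "x \<in> cball 0 t") (auto intro!: powr_mono2)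
    qed
  qed (use that in auto)
  have LPA: "LP p lborel (A m k)" and LPB: "LP p lborel (B k)" for m k
    by (rule LPb[OF _ Abd] LPb[OF _ Bbd]; simp)+
  have lim: "(\<lambda>m. NP p lborel (\<lambda>x. A m k x - B k x)) \<longlonglongrightarrow> 0" for k
  proof -
    have "(\<lambda>m. \<integral>x. norm (A m k x - B k x) powr p \<partial>lborel) \<longlonglongrightarrow> (\<integral>x. 0 \<partial>(lborel :: (real^'n) measure))"
    proof (rule integral_dominated_convergence[OF _ _ Ib[of "(2 * b k) powr p" "R + \<rho> k"]])
      show "AE x in lborel. (\<lambda>m. norm (A m k x - B k x) powr p) \<longlonglongrightarrow> 0"
        using AB by (intro AE_I2) (simp only: norm_powr_tendsto_zero_iff[OF p0] LIM_zero_iff)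
      show "AE x in lborel. norm (norm (A m k x - B k x) powr p) \<le> (2 * b k) powr p * indicator (cball 0 (R + \<rho> k)) x" for m
      proof (rule AE_I2)
        fix x
        show "norm (norm (A m k x - B k x) powr p) \<le> (2 * b k) powr p * indicator (cball 0 (R + \<rho> k)) x"
        proof (cases "x \<in> cball 0 (R + \<rho> k)")
          case True
          hence "\<bar>A m k x - B k x\<bar> \<le> 2 * b k" using Abd[of m k x] Bbd[of k x] by (simp add: abs_le_iff)
          thus ?thesis using True p by (auto intro!: powr_mono2)
        next
          case False
          thus ?thesis using Abd[of m k x] Bbd[of k x] by simp
        qed
      qed
    qed auto
    thus ?thesis by (simp add: NP_def)
  qed
  define e where "e k = unit_ball_vol (real CARD('n)) * real CARD('n) ^ CARD('n) * \<rho> k powr p * G" for k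
  have vA: "NP p lborel (\<lambda>x. v (r m) x - A m k x) \<le> e k" for m k
  proof -
    have "NP p lborel (\<lambda>x. v (r m) x - A m k x) \<le> unit_ball_vol (real CARD('n)) * real CARD('n) ^ CARD('n) * \<rho> k powr p * NP p lborel (grad (v (r m)))"
      unfolding A_def \<rho>_def by (rule cube_approximation(2)[OF v p])
    also have "\<dots> \<le> e k"
      unfolding e_def using G[of "r m"] test_fun_LP(5)[OF v p0, of "r m"] by (intro mult_left_mono) auto
    finally show ?thesis .
  qed
  have elim: "e \<longlonglongrightarrow> 0"
  proof -
    have "(\<lambda>k. real CARD('n) * (1/2) ^ k) \<longlonglongrightarrow> real CARD('n) * 0"
      by (intro tendsto_mult tendsto_const LIMSEQ_power_zero) simp
    moreover have "\<rho> = (\<lambda>k. real CARD('n) * (1/2) ^ k)" by (simp add: fun_eq_iff \<rho>_def power_one_over)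
    ultimately have "\<rho> \<longlonglongrightarrow> 0" by simp
    hence "(\<lambda>k. norm (\<rho> k) powr p) \<longlonglongrightarrow> 0" using norm_powr_tendsto_zero_iff[OF p0] by blast
    hence "(\<lambda>k. \<rho> k powr p) \<longlonglongrightarrow> 0" by (simp add: \<rho>_def)
    from tendsto_mult[OF tendsto_mult[OF tendsto_const this] tendsto_const, of "unit_ball_vol (real CARD('n)) * real CARD('n) ^ CARD('n)" G]
    show ?thesis by (simp add: e_def[abs_def])
  qed
  define c where "c = 2 powr p"
  have c: "c \<ge> 1" unfolding c_def using ge_one_powr_ge_zero[of 2 p] p0 by simp
  have tri: "NP p lborel (\<lambda>x. f x - h x) \<le> c * (NP p lborel (\<lambda>x. f x - g x) + NP p lborel (\<lambda>x. g x - h x))"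
    if "LP p lborel f" "LP p lborel g" "LP p lborel h" for f g h :: "real^'n \<Rightarrow> real"
    unfolding c_def by (rule NP_triangle[OF p0 that])
  have "\<exists>N. \<forall>m\<ge>N. \<forall>n\<ge>N. NP p lborel (\<lambda>x. v (r m) x - v (r n) x) \<le> \<epsilon>" if "\<epsilon> > 0" for \<epsilon>
  proof -
    \<comment> \<open>The chain from \<open>v (r m)\<close> over \<open>A m k\<close>,
      \<open>B k\<close> and \<open>A n k\<close> to \<open>v (r n)\<close> applies the
      quasi-triangle inequality three times, which explains \<open>c^3\<close>. The approximation
      error occurs at both ends; the convergence errors of \<open>m\<close> and \<open>n\<close>
      share the other half of the tolerance.\<close>
    have "(\<lambda>k. 2 * c^3 * e k) \<longlonglongrightarrow> 2 * c^3 * 0" by (intro tendsto_mult tendsto_const elim)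
    hence "eventually (\<lambda>k. 2 * c^3 * e k < \<epsilon> / 2) sequentially" using that by (intro order_tendstoD(2)) auto
    then obtain k where k: "2 * c^3 * e k < \<epsilon> / 2" by (auto simp: eventually_sequentially)
    define a where "a m = NP p lborel (\<lambda>x. A m k x - B k x)" for m
    have "(\<lambda>m. c^3 * a m) \<longlonglongrightarrow> c^3 * 0" unfolding a_def by (intro tendsto_mult tendsto_const lim)
    hence "eventually (\<lambda>m. c^3 * a m < \<epsilon> / 4) sequentially" using that by (intro order_tendstoD(2)) auto
    then obtain N where N: "\<And>m. m \<ge> N \<Longrightarrow> c^3 * a m < \<epsilon> / 4" by (auto simp: eventually_sequentially)
    have "NP p lborel (\<lambda>x. v (r m) x - v (r n) x) \<le> \<epsilon>" if mn: "m \<ge> N" "n \<ge> N" for m n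
    proof -
      have e0: "0 \<le> e k" using vA[of 0 k] NP_nonneg order_trans by blast
      have a0: "0 \<le> a m" "0 \<le> a n" by (simp_all add: a_def)
      have 1: "NP p lborel (\<lambda>x. v (r m) x - v (r n) x) \<le> c * (NP p lborel (\<lambda>x. v (r m) x - A m k x) + NP p lborel (\<lambda>x. A m k x - v (r n) x))"
        by (rule tri[OF LPv LPA LPv])
      have 2: "NP p lborel (\<lambda>x. A m k x - v (r n) x) \<le> c * (a m + NP p lborel (\<lambda>x. B k x - v (r n) x))"
        unfolding a_def by (rule tri[OF LPA LPB LPv])
      have 3: "NP p lborel (\<lambda>x. B k x - v (r n) x) \<le> c * (a n + NP p lborel (\<lambda>x. A n k x - v (r n) x))"
        unfolding a_def using tri[of "B k" "A n k" "v (r n)", OF LPB LPA LPv] NP_minus_commute[of p lborel "B k" "A n k"] by simp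
      have 4: "NP p lborel (\<lambda>x. A n k x - v (r n) x) \<le> e k"
        using vA[of n k] NP_minus_commute[of p lborel "A n k" "v (r n)"] by simp
      have "NP p lborel (\<lambda>x. B k x - v (r n) x) \<le> c * (a n + e k)"
        using 3 4 c mult_left_mono[of _ _ c] by (smt (verit) add_left_mono)
      hence "NP p lborel (\<lambda>x. A m k x - v (r n) x) \<le> c * (a m + c * (a n + e k))"
        using 2 c mult_left_mono[of _ _ c] by (smt (verit) add_left_mono)
      hence "NP p lborel (\<lambda>x. v (r m) x - v (r n) x) \<le> c * (e k + c * (a m + c * (a n + e k)))"
        using 1 vA[of m k] c mult_left_mono[of _ _ c] by (smt (verit) add_mono)
      also have "\<dots> = c * e k + c^2 * a m + c^3 * a n + c^3 * e k" by (simp add: power2_eq_square power3_eq_cube algebra_simps)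
      also have "\<dots> \<le> c^3 * e k + c^3 * a m + c^3 * a n + c^3 * e k"
      proof -
        have "c \<le> c^3" "c^2 \<le> c^3" using c power_increasing[of 1 3 c] power_increasing[of 2 3 c] by auto
        thus ?thesis using e0 a0 by (intro add_mono mult_right_mono) auto
      qed
      finally show ?thesis using k N[OF mn(1)] N[OF mn(2)] by linarith
    qed
    thus ?thesis by blast
  qed
  hence "\<exists>u. LP p lborel u \<and> (\<lambda>m. NP p lborel (\<lambda>x. v (r m) x - u x)) \<longlonglongrightarrow> 0"
  proof (rule LP_complete[where f = "\<lambda>m. v (r m)", OF p0 LPv])
    fix g assume "LP p lborel g" "(\<lambda>k. NP p lborel (\<lambda>x. v (r k) x - g x)) \<longlonglongrightarrow> 0"
    thus ?thesis by blast
  qed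
  then obtain u where u: "LP p lborel u" "(\<lambda>m. NP p lborel (\<lambda>x. v (r m) x - u x)) \<longlonglongrightarrow> 0" by blast
  have um[measurable]: "u \<in> borel_measurable borel" using LP_measurable[OF u(1)] by simp
  have vm[measurable]: "v m \<in> borel_measurable borel" for m using LP_measurable[OF LPv] by simp
  have "integrable lborel (\<lambda>x. norm (u x) powr p)" by (rule LP_integrable[OF u(1)])
  hence "integrable lebesgue (\<lambda>x. norm (u x) powr p)" by (subst integrable_completion) auto
  moreover have "u \<in> borel_measurable lebesgue" by (rule measurable_completion) simp
  ultimately have "LP p lebesgue u" unfolding LP_def by blast
  moreover have "NP p lebesgue (\<lambda>x. v (r m) x - u x) = NP p lborel (\<lambda>x. v (r m) x - u x)" for m
    unfolding NP_def by (rule integral_completion) measurable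
  hence "(\<lambda>m. NP p lebesgue (\<lambda>x. v (r m) x - u x)) \<longlonglongrightarrow> 0" using u(2) by simp
  ultimately show ?thesis using r(1) by (intro exI[of _ r] exI[of _ u] conjI)
qed

section \<open>Closability of the gradient and separability\<close>

lemma has_derivative_imp_continuous_on:
  assumes "\<And>x. (f has_derivative f' x) (at x)"
  shows "continuous_on S f"
  by (intro continuous_at_imp_continuous_on ballI has_derivative_continuous[OF assms])

lemma real_polynomial_function_C1:
  fixes \<psi> :: "'a::euclidean_space \<Rightarrow> real"
  assumes "real_polynomial_function \<psi>"
  shows "\<exists>G. continuous_on UNIV G \<and> (\<forall>x. (\<psi> has_derivative (\<lambda>h. G x \<bullet> h)) (at x))"
  using assms
proof (induction rule: real_polynomial_function.induct)
  case (linear f)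
  \<comment> \<open>For a linear functional the adjoint evaluated at 1 is its Riesz representative,
    hence the constant gradient.\<close>
  have "f h = adjoint f 1 \<bullet> h" for h
    using adjoint_works[OF bounded_linear.linear[OF linear], of h 1] by (simp add: inner_commute)
  moreover have "(f has_derivative f) (at x)" for x by (rule bounded_linear_imp_has_derivative[OF linear])
  ultimately have "\<forall>x. (f has_derivative (\<lambda>h. adjoint f 1 \<bullet> h)) (at x)" by (metis (no_types, lifting) ext)
  thus ?case by (intro exI[of _ "\<lambda>_. adjoint f 1"] conjI continuous_on_const)
next
  case (const c)
  show ?case by (rule exI[of _ "\<lambda>_. 0"]) simp
next
  case (add f g)
  then obtain F G where "continuous_on UNIV F" "\<forall>x. (f has_derivative (\<lambda>h. F x \<bullet> h)) (at x)"
    "continuous_on UNIV G" "\<forall>x. (g has_derivative (\<lambda>h. G x \<bullet> h)) (at x)" by blast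
  thus ?case
    by (intro exI[of _ "\<lambda>x. F x + G x"]) (auto intro!: continuous_intros derivative_eq_intros simp: inner_add_left)
next
  case (mult f g)
  then obtain F G where FG: "continuous_on UNIV F" "\<forall>x. (f has_derivative (\<lambda>h. F x \<bullet> h)) (at x)"
    "continuous_on UNIV G" "\<forall>x. (g has_derivative (\<lambda>h. G x \<bullet> h)) (at x)" by blast
  have c: "continuous_on UNIV f" "continuous_on UNIV g"
    by (rule has_derivative_imp_continuous_on[OF FG(2)[rule_format]], rule has_derivative_imp_continuous_on[OF FG(4)[rule_format]])
  have "((\<lambda>x. f x * g x) has_derivative (\<lambda>h. (f x *\<^sub>R G x + g x *\<^sub>R F x) \<bullet> h)) (at x)" for x
    using has_derivative_mult[OF FG(2)[rule_format, of x] FG(4)[rule_format, of x]]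
    by (simp add: inner_add_left algebra_simps)
  thus ?case
    by (intro exI[of _ "\<lambda>x. f x *\<^sub>R G x + g x *\<^sub>R F x"]) (auto intro!: continuous_intros FG c)
qed

text \<open>Orthogonality extends from polynomials to continuous functions by the Stone-Weierstrass
  theorem on the ball that carries \<open>f\<close>, and from there to the indicator of
  \<open>T\<close>, which is the pointwise limit of the continuous functions
  \<open>max 0 (1 - j * infdist x T)\<close>.\<close>

lemma integral_closed_eq_0:
  fixes f :: "'a::euclidean_space \<Rightarrow> real"
  assumes I: "integrable lebesgue f" and supp: "\<And>x. x \<notin> cball 0 R \<Longrightarrow> f x = 0"
    and orth: "\<And>\<psi>. real_polynomial_function \<psi> \<Longrightarrow> (\<integral>x. \<psi> x * f x \<partial>lebesgue) = 0"
    and T: "closed T"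
  shows "(\<integral>x. indicator T x * f x \<partial>lebesgue) = 0"
proof (cases "T = {}")
  case False
  note [measurable] = borel_measurable_integrable[OF I]
  have int: "integrable lebesgue (\<lambda>x. \<psi> x * f x)" if c: "continuous_on UNIV \<psi>" for \<psi> :: "'a \<Rightarrow> real"
  proof -
    have "compact (\<psi> ` cball 0 R)" by (intro compact_continuous_image continuous_on_subset[OF c]) auto
    hence "\<exists>B. \<forall>x\<in>cball 0 R. \<bar>\<psi> x\<bar> \<le> B" using compact_imp_bounded[of "\<psi> ` cball 0 R"] by (auto simp: bounded_iff)
    then obtain B where B: "\<And>x. x \<in> cball 0 R \<Longrightarrow> \<bar>\<psi> x\<bar> \<le> B" by blast
    note [measurable] = continuous_borel_lebesgue(3)[OF c]
    show ?thesis
    proof (rule Bochner_Integration.integrable_bound)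
      show "integrable lebesgue (\<lambda>x. B * \<bar>f x\<bar>)" using I by auto
      show "AE x in lebesgue. norm (\<psi> x * f x) \<le> norm (B * \<bar>f x\<bar>)"
      proof (rule AE_I2)
        fix x
        show "norm (\<psi> x * f x) \<le> norm (B * \<bar>f x\<bar>)"
        proof (cases "x \<in> cball 0 R")
          case True
          thus ?thesis using B[OF True] by (auto simp: abs_mult intro!: mult_right_mono)
        qed (use supp in simp)
      qed
    qed measurable
  qed
  have contz: "(\<integral>x. \<psi> x * f x \<partial>lebesgue) = 0" if c: "continuous_on UNIV \<psi>" for \<psi> :: "'a \<Rightarrow> real"
  proof -
    define Nf where "Nf = (\<integral>x. \<bar>f x\<bar> \<partial>lebesgue)"
    have Nf: "Nf \<ge> 0" unfolding Nf_def by simp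
    have "\<bar>\<integral>x. \<psi> x * f x \<partial>lebesgue\<bar> \<le> 0 + e" if e: "e > 0" for e
    proof -
      define d where "d = e / (Nf + 1)"
      have d: "d > 0" using e Nf by (simp add: d_def)
      obtain P where P: "real_polynomial_function P" "\<And>x. x \<in> cball 0 R \<Longrightarrow> \<bar>\<psi> x - P x\<bar> < d"
        by (rule Stone_Weierstrass_real_polynomial_function[OF compact_cball[of 0 R] continuous_on_subset[OF c subset_UNIV] d]) blast
      obtain G where "\<forall>x. (P has_derivative (\<lambda>h. G x \<bullet> h)) (at x)" using real_polynomial_function_C1[OF P(1)] by blast
      hence Pc: "continuous_on UNIV P" by (intro has_derivative_imp_continuous_on) (rule spec)
      have "(\<integral>x. \<psi> x * f x \<partial>lebesgue) = (\<integral>x. \<psi> x * f x \<partial>lebesgue) - (\<integral>x. P x * f x \<partial>lebesgue)"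
        using orth[OF P(1)] by simp
      also have "\<dots> = (\<integral>x. \<psi> x * f x - P x * f x \<partial>lebesgue)" using int[OF c] int[OF Pc] by simp
      finally have "\<bar>\<integral>x. \<psi> x * f x \<partial>lebesgue\<bar> \<le> (\<integral>x. \<bar>\<psi> x * f x - P x * f x\<bar> \<partial>lebesgue)"
        using integral_abs_bound by metis
      also have "\<dots> \<le> (\<integral>x. d * \<bar>f x\<bar> \<partial>lebesgue)"
      proof (rule integral_mono)
        show "integrable lebesgue (\<lambda>x. \<bar>\<psi> x * f x - P x * f x\<bar>)" using int[OF c] int[OF Pc] by auto
        show "integrable lebesgue (\<lambda>x. d * \<bar>f x\<bar>)" using I by auto
        fix x
        show "\<bar>\<psi> x * f x - P x * f x\<bar> \<le> d * \<bar>f x\<bar>"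
        proof (cases "x \<in> cball 0 R")
          case True
          have "\<bar>\<psi> x * f x - P x * f x\<bar> = \<bar>\<psi> x - P x\<bar> * \<bar>f x\<bar>" by (simp flip: left_diff_distrib abs_mult)
          thus ?thesis using P(2)[OF True] by (simp add: mult_right_mono)
        qed (use supp in simp)
      qed
      also have "\<dots> = d * Nf" by (simp add: Nf_def)
      also have "\<dots> \<le> e" using e Nf by (simp add: d_def field_simps)
      finally show ?thesis by simp
    qed
    hence "\<bar>\<integral>x. \<psi> x * f x \<partial>lebesgue\<bar> \<le> 0" by (rule field_le_epsilon)
    thus ?thesis by simp
  qed
  define \<psi> where "\<psi> j x = max 0 (1 - real j * infdist x T)" for j and x :: 'a
  have \<psi>c: "continuous_on UNIV (\<psi> j)" for j unfolding \<psi>_def by (intro continuous_intros)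
  have \<psi>b: "0 \<le> \<psi> j x" "\<psi> j x \<le> 1" for j x using infdist_nonneg[of x T] by (auto simp: \<psi>_def)
  have lim: "(\<lambda>j. \<psi> j x) \<longlonglongrightarrow> indicator T x" for x
  proof (cases "x \<in> T")
    case True
    thus ?thesis by (simp add: \<psi>_def)
  next
    case False
    have d: "infdist x T > 0" using False T \<open>T \<noteq> {}\<close> by (metis in_closed_iff_infdist_zero infdist_nonneg less_eq_real_def)
    obtain J :: nat where J: "1 / infdist x T < real J" using reals_Archimedean2 by blast
    have "\<psi> j x = 0" if "j \<ge> J" for j
    proof -
      have "1 / infdist x T \<le> real j" using J that by simp
      hence "1 \<le> real j * infdist x T" using d by (simp add: field_simps)
      thus ?thesis by (simp add: \<psi>_def)
    qed
    hence "eventually (\<lambda>j. \<psi> j x = 0) sequentially" by (auto simp: eventually_sequentially)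
    hence "(\<lambda>j. \<psi> j x) \<longlonglongrightarrow> 0" by (rule tendsto_eventually)
    thus ?thesis using False by simp
  qed
  have [measurable]: "T \<in> sets lebesgue" using T by (simp add: lebesgue_closedin)
  have "(\<lambda>j. \<integral>x. \<psi> j x * f x \<partial>lebesgue) \<longlonglongrightarrow> (\<integral>x. indicator T x * f x \<partial>lebesgue)"
  proof (rule integral_dominated_convergence)
    show "integrable lebesgue (\<lambda>x. \<bar>f x\<bar>)" using I by auto
    show "AE x in lebesgue. (\<lambda>j. \<psi> j x * f x) \<longlonglongrightarrow> indicator T x * f x"
      by (intro AE_I2 tendsto_mult lim tendsto_const)
    show "AE x in lebesgue. norm (\<psi> j x * f x) \<le> \<bar>f x\<bar>" for j
      using \<psi>b by (intro AE_I2) (simp add: abs_mult mult_left_le_one_le)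
    show "(\<lambda>x. \<psi> j x * f x) \<in> borel_measurable lebesgue" for j using int[OF \<psi>c] by blast
  qed measurable
  thus ?thesis by (simp add: contz[OF \<psi>c] LIMSEQ_const_iff)
qed simp

text \<open>The positivity set of \<open>f\<close> is exhausted up to any tolerance by closed sets.
  The integral of the positive function \<open>f\<close> over such a closed set is 0, so the closed
  set is null and the positivity set is smaller than every tolerance.\<close>

lemma AE_le_0_of_poly_orthogonal:
  fixes f :: "'a::euclidean_space \<Rightarrow> real"
  assumes I: "integrable lebesgue f" and supp: "\<And>x. x \<notin> cball 0 R \<Longrightarrow> f x = 0"
    and orth: "\<And>\<psi>. real_polynomial_function \<psi> \<Longrightarrow> (\<integral>x. \<psi> x * f x \<partial>lebesgue) = 0"
  shows "AE x in lebesgue. f x \<le> 0"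
proof -
  note [measurable] = borel_measurable_integrable[OF I]
  define S where "S = {x. f x > 0}"
  have "{x \<in> space lebesgue. 0 < f x} \<in> sets lebesgue" by measurable
  hence S: "S \<in> sets lebesgue" by (simp add: S_def)
  have le: "emeasure lebesgue S \<le> ennreal e" if e: "e > 0" for e
  proof -
    obtain T where T: "closed T" "T \<subseteq> S" "S - T \<in> lmeasurable" "emeasure lebesgue (S - T) < ennreal e"
      using sets_lebesgue_inner_closed[OF S e] by blast
    have Tm[measurable]: "T \<in> sets lebesgue" using T by (simp add: lebesgue_closedin)
    have IT: "integrable lebesgue (\<lambda>x. indicator T x * f x)"
      using integrable_real_mult_indicator[OF Tm I] by (simp add: mult.commute)
    have nn: "0 \<le> indicator T x * f x" for x
      using T(2) by (auto simp: S_def less_imp_le split: split_indicator)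
    have "AE x in lebesgue. indicator T x * f x = 0"
      using integral_closed_eq_0[OF I supp orth T(1)] integral_nonneg_eq_0_iff_AE[OF IT] nn by blast
    hence "AE x in lebesgue. x \<notin> T"
      by eventually_elim (use T(2) in \<open>auto simp: S_def split: split_indicator_asm\<close>)
    hence "emeasure lebesgue T = 0" using AE_iff_measurable[OF Tm, of "\<lambda>x. x \<notin> T"] by simp
    moreover have "emeasure lebesgue S \<le> emeasure lebesgue T + emeasure lebesgue (S - T)"
      using emeasure_subadditive[of T lebesgue "S - T"] Tm S T(2) by (simp add: Un_absorb1)
    ultimately have "emeasure lebesgue S \<le> emeasure lebesgue (S - T)" by simp
    thus ?thesis using T(4) by (meson less_imp_le order_trans)
  qed
  have "emeasure lebesgue S \<le> 0"
  proof (rule ennreal_le_epsilon)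
    fix e :: real assume "0 < e"
    from le[OF this] show "emeasure lebesgue S \<le> 0 + ennreal e" by simp
  qed
  hence "S \<in> null_sets lebesgue" using S by (auto intro: null_setsI)
  thus ?thesis by (rule AE_I') (auto simp: S_def)
qed

lemma AE_eq_0_of_poly_orthogonal:
  fixes f :: "'a::euclidean_space \<Rightarrow> real"
  assumes I: "integrable lebesgue f" and supp: "\<And>x. x \<notin> cball 0 R \<Longrightarrow> f x = 0"
    and orth: "\<And>\<psi>. real_polynomial_function \<psi> \<Longrightarrow> (\<integral>x. \<psi> x * f x \<partial>lebesgue) = 0"
  shows "AE x in lebesgue. f x = 0"
proof -
  have "AE x in lebesgue. f x \<le> 0" by (rule AE_le_0_of_poly_orthogonal[OF assms])
  moreover have "AE x in lebesgue. - f x \<le> 0"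
    by (rule AE_le_0_of_poly_orthogonal[of _ R]) (use assms in auto)
  ultimately show ?thesis by eventually_elim simp
qed

text \<open>Integrating by parts against polynomials, which are dense in the continuous functions on a ball, avoids
  the construction of smooth bump functions.\<close>

lemma grad_closable:
  fixes z :: "nat \<Rightarrow> real^'n \<Rightarrow> real"
  assumes z: "\<And>k. test_fun \<Omega> (z k)" and p: "1 < p" and \<Omega>: "bounded \<Omega>" and h: "LP p lebesgue h"
    and lim0: "(\<lambda>k. NP p lebesgue (z k)) \<longlonglongrightarrow> 0" and limh: "(\<lambda>k. NP p lebesgue (\<lambda>x. grad (z k) x - h x)) \<longlonglongrightarrow> 0"
  shows "AE x in lebesgue. h x = 0"
proof -
  have p0: "0 < p" and q0: "0 < p / (p - 1)" using p by auto
  obtain R0 where R0: "\<Omega> \<subseteq> cball 0 R0" using \<Omega> unfolding bounded_iff by (metis mem_cball_0 subsetI)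
  \<comment> \<open>The cutoff makes polynomials admissible in the pairing and leaves the integrals
    against \<open>z k\<close> unchanged, because \<open>z k\<close> vanishes outside the ball.
    Letting the radius grow afterwards shows that \<open>h\<close> vanishes outside the domain as
    well.\<close>
  have ae: "AE x in lebesgue. indicator (cball 0 R) x * h x $ i = 0" if R: "R \<ge> R0" for R i
  proof (rule AE_eq_0_of_poly_orthogonal[of _ R])
    have B: "LP (p / (p - 1)) lebesgue (\<lambda>x. indicator (cball 0 R) x *\<^sub>R g x)" if g: "continuous_on UNIV g" for g :: "real^'n \<Rightarrow> 'b::euclidean_space"
    proof -
      have "compact (g ` cball 0 R)" by (intro compact_continuous_image continuous_on_subset[OF g]) auto
      hence "\<exists>C. \<forall>x\<in>cball 0 R. norm (g x) \<le> C" using compact_imp_bounded[of "g ` cball 0 R"] by (auto simp: bounded_iff)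
      then obtain C where C: "\<And>x. x \<in> cball 0 R \<Longrightarrow> norm (g x) \<le> C" by blast
      show ?thesis
      proof (rule LP_minorant)
        show "(\<lambda>x. indicator (cball 0 R) x *\<^sub>R g x) \<in> borel_measurable lebesgue"
          by (intro borel_measurable_scaleR borel_measurable_indicator continuous_borel_lebesgue(3)[OF g]) simp
        show "integrable lebesgue (\<lambda>x. C powr (p / (p - 1)) * indicator (cball (0 :: real^'n) R) x)"
          by (intro integrable_mult_right integrable_real_indicator) (use emeasure_lborel_cball_finite in auto)
        show "AE x in lebesgue. norm (indicator (cball 0 R) x *\<^sub>R g x) powr (p / (p - 1)) \<le> C powr (p / (p - 1)) * indicator (cball 0 R) x"
        proof (rule AE_I2)
          fix x
          show "norm (indicator (cball 0 R) x *\<^sub>R g x) powr (p / (p - 1)) \<le> C powr (p / (p - 1)) * indicator (cball 0 R) x"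
            using C[of x] q0 by (cases "x \<in> cball 0 R") (auto intro!: powr_mono2)
        qed
      qed
    qed
    show "integrable lebesgue (\<lambda>x. indicator (cball 0 R) x * h x $ i)"
      using LP_pair_integrable[OF p B[of "\<lambda>_. axis i 1"] h] by (simp add: inner_axis')
    show "indicator (cball 0 R) x * h x $ i = 0" if "x \<notin> cball 0 R" for x using that by simp
    fix \<psi> :: "real^'n \<Rightarrow> real" assume \<psi>: "real_polynomial_function \<psi>"
    obtain G where G: "continuous_on UNIV G" and der: "\<And>x. (\<psi> has_derivative (\<lambda>h. G x \<bullet> h)) (at x)"
      using real_polynomial_function_C1[OF \<psi>] by blast
    have \<psi>c: "continuous_on UNIV \<psi>" by (rule has_derivative_imp_continuous_on[OF der])
    have Gi: "continuous_on UNIV (\<lambda>x. G x $ i)" using G by (rule continuous_on_component)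
    have "(\<lambda>k. \<integral>x. (indicator (cball 0 R) x *\<^sub>R (\<psi> x *\<^sub>R axis i 1)) \<bullet> grad (z k) x \<partial>lebesgue)
        \<longlonglongrightarrow> (\<integral>x. (indicator (cball 0 R) x *\<^sub>R (\<psi> x *\<^sub>R axis i 1)) \<bullet> h x \<partial>lebesgue)"
      by (rule LP_pair_tendsto[OF p B test_fun_LP(3)[OF z p0] h limh]) (intro continuous_intros \<psi>c)
    moreover have "(\<lambda>k. \<integral>x. (indicator (cball 0 R) x *\<^sub>R G x $ i) \<bullet> z k x \<partial>lebesgue)
        \<longlonglongrightarrow> (\<integral>x. (indicator (cball 0 R) x *\<^sub>R G x $ i) \<bullet> 0 \<partial>lebesgue)"
      by (rule LP_pair_tendsto[OF p B[OF Gi] test_fun_LP(2)[OF z p0] LP_zero]) (use lim0 in simp)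
    moreover have "(\<integral>x. (indicator (cball 0 R) x *\<^sub>R (\<psi> x *\<^sub>R axis i 1)) \<bullet> grad (z k) x \<partial>lebesgue)
       = - (\<integral>x. (indicator (cball 0 R) x *\<^sub>R G x $ i) \<bullet> z k x \<partial>lebesgue)" for k
    proof -
      have zz: "z k x = 0" "grad (z k) x = 0" if "x \<notin> cball 0 R" for x
      proof -
        have "x \<notin> \<Omega>" using that R R0 by auto
        thus "z k x = 0" "grad (z k) x = 0" using test_fun_jet_outside[OF z] by auto
      qed
      have e1: "(\<lambda>x. (indicator (cball 0 R) x *\<^sub>R (\<psi> x *\<^sub>R axis i 1)) \<bullet> grad (z k) x) = (\<lambda>x. grad (z k) x $ i * \<psi> x)"
        using zz by (auto simp: inner_axis' fun_eq_iff split: split_indicator)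
      have e2: "(\<lambda>x. (indicator (cball 0 R) x *\<^sub>R G x $ i) \<bullet> z k x) = (\<lambda>x. z k x * G x $ i)"
        using zz by (auto simp: fun_eq_iff split: split_indicator)
      have m: "continuous_on UNIV (\<lambda>x. grad (z k) x $ i * \<psi> x)" "continuous_on UNIV (\<lambda>x. z k x * G x $ i)"
        by (intro continuous_intros continuous_on_component smooth_fun_grad_continuous smooth_fun_continuous test_fun_smooth[OF z] \<psi>c Gi)+
      show ?thesis
        unfolding e1 e2 integral_completion[OF continuous_borel_lebesgue(1)[OF m(1)]] integral_completion[OF continuous_borel_lebesgue(1)[OF m(2)]]
        using integration_by_parts(3)[OF z der G, of k i] by simp
    qed
    ultimately have "(\<integral>x. (indicator (cball 0 R) x *\<^sub>R (\<psi> x *\<^sub>R axis i 1)) \<bullet> h x \<partial>lebesgue) = 0"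
      using LIMSEQ_unique tendsto_minus[of "\<lambda>k. \<integral>x. (indicator (cball 0 R) x *\<^sub>R G x $ i) \<bullet> z k x \<partial>lebesgue" 0 sequentially] by fastforce
    thus "(\<integral>x. \<psi> x * (indicator (cball 0 R) x * h x $ i) \<partial>lebesgue) = 0"
      by (simp add: inner_axis' mult_ac)
  qed
  have "AE x in lebesgue. \<forall>n :: nat. \<forall>i. indicator (cball 0 (max R0 (real n))) x * h x $ i = 0"
    unfolding AE_all_countable by (intro allI ae) simp
  thus ?thesis
  proof eventually_elim
    case (elim x)
    obtain n where "norm x \<le> real n" using real_arch_simple by blast
    hence "x \<in> cball 0 (max R0 (real n))" by simp
    hence "h x $ i = 0" for i using elim by (metis indicator_simps(1) mult_1)
    thus ?case by (simp add: vec_eq_iff)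
  qed
qed

text \<open>A test function is encoded by rounded values of its jet on a finite net; for each modulus of
  continuity there are countably many codes, and functions with the same code are uniformly close.\<close>

lemma test_fun_separable:
  fixes \<Omega> :: "(real^'n) set"
  assumes \<Omega>: "bounded \<Omega>" and p: "1 < p"
  shows "\<exists>w :: nat \<Rightarrow> real^'n \<Rightarrow> real. (\<forall>j. test_fun \<Omega> (w j)) \<and>
    (\<forall>\<phi> e. test_fun \<Omega> \<phi> \<longrightarrow> 0 < e \<longrightarrow> (\<exists>j. NP p lebesgue (\<lambda>x. jet (w j) x - jet \<phi> x) < e))"
proof -
  have p0: "0 < p" using p by simp
  obtain R where R: "\<Omega> \<subseteq> cball 0 R" using \<Omega> unfolding bounded_iff by (metis mem_cball_0 subsetI)
  let ?K = "cball (0 :: real^'n) R"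
  obtain D :: "(real \<times> (real^'n)) set" where D: "countable D" "\<And>X. open X \<Longrightarrow> X \<noteq> {} \<Longrightarrow> \<exists>d\<in>D. d \<in> X"
    by (rule countable_dense_setE) blast
  have "\<exists>P :: (real^'n) set. finite P \<and> ?K \<subseteq> (\<Union>x\<in>P. ball x (1 / Suc k))" for k
    using compact_cball[of "0 :: real^'n" R, unfolded compact_eq_totally_bounded]
    by (elim conjE allE[of _ "1 / real (Suc k)"]) simp
  then obtain P where P: "\<And>k. finite (P k)" "\<And>k. ?K \<subseteq> (\<Union>x\<in>P k. ball x (1 / Suc k))" by metis
  define rnd where "rnd l y = (SOME d. d \<in> D \<and> dist y d < 1 / Suc l)" for l :: nat and y :: "real \<times> (real^'n)"
  have rnd: "rnd l y \<in> D" "dist y (rnd l y) < 1 / Suc l" for l y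
  proof -
    have "\<exists>d. d \<in> D \<and> dist y d < 1 / Suc l" using D(2)[of "ball y (1 / Suc l)"] by auto
    from someI_ex[OF this] show "rnd l y \<in> D" "dist y (rnd l y) < 1 / Suc l" by (auto simp: rnd_def)
  qed
  define T where "T k l = {\<phi>. test_fun \<Omega> \<phi> \<and> (\<forall>x y. dist x y < 1 / Suc k \<longrightarrow> dist (jet \<phi> x) (jet \<phi> y) < 1 / Suc l)}" for k l :: nat
  \<comment> \<open>Restriction to the net turns a code into an element of a product of a finite set
    with values in the countable set \<open>D\<close>, so only countably many codes occur.\<close>
  define code where "code k l \<phi> = restrict (\<lambda>x. rnd l (jet \<phi> x)) (P k)" for k l :: nat and \<phi> :: "real^'n \<Rightarrow> real"
  have cc: "countable (code k l ` T k l)" for k l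
  proof (rule countable_subset)
    show "code k l ` T k l \<subseteq> Pi\<^sub>E (P k) (\<lambda>_. D)" by (auto simp: code_def intro!: rnd(1))
    show "countable (Pi\<^sub>E (P k) (\<lambda>_. D))" by (rule countable_PiE[OF P(1) D(1)])
  qed
  \<comment> \<open>One representative is kept for each code that actually occurs, so the countable
    set consists of test functions in the given domain.\<close>
  define W where "W = (\<Union>k l. inv_into (T k l) (code k l) ` code k l ` T k l)"
  have cW: "countable W" unfolding W_def by (intro countable_UN countable_image cc) auto
  have WT: "test_fun \<Omega> \<phi>" if "\<phi> \<in> W" for \<phi>
  proof -
    obtain k l c where "c \<in> code k l ` T k l" "\<phi> = inv_into (T k l) (code k l) c"
      using \<open>\<phi> \<in> W\<close> unfolding W_def by blast
    hence "\<phi> \<in> T k l" using inv_into_into by metis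
    thus ?thesis by (simp add: T_def)
  qed
  have "(\<lambda>x. 0) \<in> T 0 0" by (simp add: T_def test_fun_zero jet_zero)
  hence "inv_into (T 0 0) (code 0 0) (code 0 0 (\<lambda>x. 0)) \<in> W" unfolding W_def by (intro UN_I[of 0] imageI UNIV_I)
  hence Wne: "W \<noteq> {}" by blast
  define w where "w = from_nat_into W"
  have w: "test_fun \<Omega> (w j)" for j using from_nat_into[OF Wne, of j] WT by (simp add: w_def)
  have "\<exists>j. NP p lebesgue (\<lambda>x. jet (w j) x - jet \<phi> x) < e" if \<phi>: "test_fun \<Omega> \<phi>" and e: "e > 0" for \<phi> e
  proof -
    define V where "V = measure lborel ?K"
    have V: "V \<ge> 0" by (simp add: V_def)
    have "(\<lambda>l. norm (4 / real (Suc l)) powr p) \<longlonglongrightarrow> 0"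
      using tendsto_mult[OF tendsto_const[of "4::real"] LIMSEQ_inverse_real_of_nat] norm_powr_tendsto_zero_iff[OF p0, of "\<lambda>l. 4 / real (Suc l)"]
      by (simp add: divide_inverse)
    from tendsto_mult[OF this tendsto_const[of V]] have "(\<lambda>l. (4 / real (Suc l)) powr p * V) \<longlonglongrightarrow> 0" by simp
    hence "eventually (\<lambda>l. (4 / real (Suc l)) powr p * V < e) sequentially" using e by (rule order_tendstoD(2))
    then obtain l :: nat where l: "(4 / real (Suc l)) powr p * V < e" by (auto simp: eventually_sequentially)
    have "uniformly_continuous_on UNIV (jet \<phi>)"
    proof -
      have "compact (cball (0 :: real^'n) (R + 1))" by simp
      hence "uniformly_continuous_on (cball 0 (R + 1)) (jet \<phi>)"
        by (intro compact_uniformly_continuous test_fun_jet_continuous[OF \<phi>])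
      show ?thesis
        unfolding uniformly_continuous_on_def
      proof (intro allI impI)
        fix e :: real assume "e > 0"
        then obtain d where d: "d > 0" "\<And>x y. x \<in> cball 0 (R + 1) \<Longrightarrow> y \<in> cball 0 (R + 1) \<Longrightarrow> dist y x < d \<Longrightarrow> dist (jet \<phi> y) (jet \<phi> x) < e"
          using \<open>uniformly_continuous_on (cball 0 (R + 1)) (jet \<phi>)\<close> unfolding uniformly_continuous_on_def by blast
        show "\<exists>d>0. \<forall>x\<in>UNIV. \<forall>x'\<in>UNIV. dist x' x < d \<longrightarrow> dist (jet \<phi> x') (jet \<phi> x) < e"
        proof (intro exI[of _ "min d 1"] conjI ballI impI)
          show "0 < min d 1" using d by simp
          fix x x' :: "real^'n" assume xx: "dist x' x < min d 1"
          show "dist (jet \<phi> x') (jet \<phi> x) < e"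
          proof (cases "x \<in> \<Omega> \<or> x' \<in> \<Omega>")
            case True
            hence n: "norm x \<le> R \<or> norm x' \<le> R" using R by auto
            have "norm x' \<le> norm x + 1" "norm x \<le> norm x' + 1"
              using xx norm_triangle_ineq2[of x x'] norm_triangle_ineq2[of x' x] by (auto simp: dist_norm norm_minus_commute)
            hence "x \<in> cball 0 (R + 1)" "x' \<in> cball 0 (R + 1)" using n by auto
            thus ?thesis using d(2) xx by simp
          next
            case False
            thus ?thesis using test_fun_jet_outside(1)[OF \<phi>] \<open>e > 0\<close> by simp
          qed
        qed
      qed
    qed
    then obtain d where d: "d > 0" "\<And>x y. dist x y < d \<Longrightarrow> dist (jet \<phi> x) (jet \<phi> y) < 1 / Suc l"
      unfolding uniformly_continuous_on_def by (metis UNIV_I of_nat_0_less_iff zero_less_Suc zero_less_divide_1_iff)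
    obtain k where "inverse (real (Suc k)) < d" using reals_Archimedean[OF d(1)] by blast
    hence \<phi>T: "\<phi> \<in> T k l" using \<phi> d(2) by (auto simp: T_def inverse_eq_divide)
    define \<psi> where "\<psi> = inv_into (T k l) (code k l) (code k l \<phi>)"
    have \<psi>T: "\<psi> \<in> T k l" and ceq: "code k l \<psi> = code k l \<phi>"
      unfolding \<psi>_def by (rule inv_into_into[OF imageI[OF \<phi>T]], rule f_inv_into_f[OF imageI[OF \<phi>T]])
    have "\<psi> \<in> W" unfolding W_def \<psi>_def using \<phi>T by blast
    then obtain j where j: "w j = \<psi>" unfolding w_def using from_nat_into_surj[OF cW] by metis
    have \<psi>t: "test_fun \<Omega> \<psi>" using \<psi>T by (simp add: T_def)
    \<comment> \<open>The factor 4 counts the two roundings at the net point and the two moduli of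
      continuity between that point and \<open>x\<close>, each below
      \<open>1 / Suc l\<close>.\<close>
    have close: "norm (jet \<psi> x - jet \<phi> x) \<le> 4 / Suc l" if x: "x \<in> ?K" for x
    proof -
      obtain y where y: "y \<in> P k" "dist y x < 1 / Suc k" using P(2)[of k] x by auto
      have eq: "rnd l (jet \<psi> y) = rnd l (jet \<phi> y)" using fun_cong[OF ceq, of y] y by (simp add: code_def)
      have 1: "dist (jet \<psi> y) (jet \<phi> y) < 1 / Suc l + 1 / Suc l"
        by (rule le_less_trans[OF dist_triangle2 add_strict_mono[OF rnd(2)[of "jet \<psi> y" l, unfolded eq] rnd(2)[of "jet \<phi> y" l]]])
      have 2: "dist (jet \<psi> x) (jet \<psi> y) < 1 / Suc l" "dist (jet \<phi> y) (jet \<phi> x) < 1 / Suc l"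
        using \<psi>T \<phi>T y(2) by (auto simp: T_def dist_commute)
      have "dist (jet \<psi> x) (jet \<phi> x) \<le> dist (jet \<psi> x) (jet \<psi> y) + dist (jet \<psi> y) (jet \<phi> y) + dist (jet \<phi> y) (jet \<phi> x)"
        using dist_triangle[of "jet \<psi> x" "jet \<phi> x" "jet \<phi> y"] dist_triangle[of "jet \<psi> x" "jet \<phi> y" "jet \<psi> y"] by linarith
      also have "\<dots> \<le> 4 * (1 / Suc l)" using 1 2 by linarith
      finally show ?thesis by (simp add: dist_norm)
    qed
    have "NP p lebesgue (\<lambda>x. jet \<psi> x - jet \<phi> x) \<le> (\<integral>x. (4 / real (Suc l)) powr p * indicator ?K x \<partial>lebesgue)"
      unfolding NP_def
    proof (rule integral_mono)
      show "integrable lebesgue (\<lambda>x. norm (jet \<psi> x - jet \<phi> x) powr p)"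
        by (rule LP_integrable[OF LP_diff(1)[OF p0 test_fun_LP(1)[OF \<psi>t p0] test_fun_LP(1)[OF \<phi> p0]]])
      show "integrable lebesgue (\<lambda>x. (4 / real (Suc l)) powr p * indicator ?K x)"
        by (intro integrable_mult_right integrable_real_indicator) (use emeasure_lborel_cball_finite in auto)
      fix x
      show "norm (jet \<psi> x - jet \<phi> x) powr p \<le> (4 / real (Suc l)) powr p * indicator ?K x"
      proof (cases "x \<in> ?K")
        case True
        thus ?thesis using close[OF True] p by (auto intro!: powr_mono2)
      next
        case False
        hence "x \<notin> \<Omega>" using R by auto
        thus ?thesis using test_fun_jet_outside(1)[OF \<psi>t] test_fun_jet_outside(1)[OF \<phi>] by simp
      qed
    qed
    also have "\<dots> = (4 / real (Suc l)) powr p * V" by (simp add: V_def)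
    finally show ?thesis using l j by (intro exI[of _ j]) simp
  qed
  thus ?thesis using w by blast
qed

section \<open>Pointwise estimates for the operators\<close>

text \<open>For a simple function in the second slot, only finitely many measurable sections
  \<open>h x z\<close> are glued together. Continuity in the second variable then carries
  measurability through pointwise approximation.\<close>

lemma caratheodory_measurable:
  fixes h :: "'a \<Rightarrow> 'b::euclidean_space \<Rightarrow> 'c::euclidean_space"
  assumes meas: "\<And>z. (\<lambda>x. h x z) \<in> borel_measurable M" and cont: "\<And>x. continuous_on UNIV (h x)"
    and u: "u \<in> borel_measurable M"
  shows "(\<lambda>x. h x (u x)) \<in> borel_measurable M"
proof -
  obtain s where s: "\<And>i. simple_function M (s i)" "\<And>x. x \<in> space M \<Longrightarrow> (\<lambda>i. s i x) \<longlonglongrightarrow> u x"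
    using borel_measurable_implies_sequence_metric[OF u, of 0] by blast
  have "(\<lambda>x. h x (s i x)) \<in> borel_measurable M" for i
  proof (rule measurable_compose_countable'[where f = "\<lambda>z x. h x z" and I = "s i ` space M"])
    show "s i \<in> measurable M (count_space (s i ` space M))"
      using s(1)[of i] by (subst measurable_count_space_eq2) (auto simp: simple_function_def)
    show "countable (s i ` space M)" using s(1)[of i] by (intro countable_finite) (simp add: simple_function_def)
  qed (rule meas)
  moreover have "(\<lambda>i. h x (s i x)) \<longlonglongrightarrow> h x (u x)" if "x \<in> space M" for x
    using continuous_on_tendsto_compose[OF cont s(2)[OF that]] by auto
  ultimately show ?thesis by (rule borel_measurable_LIMSEQ_metric)
qed

text \<open>The derivative of the convex function \<open>\<bar>t\<bar> powr p / p\<close>; it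
  vanishes at 0 for every \<open>p\<close>.\<close>

definition signed_powr :: "real \<Rightarrow> real \<Rightarrow> real" where
  "signed_powr p t = \<bar>t\<bar> powr (p - 2) * t"

lemma abs_signed_powr: "\<bar>signed_powr p t\<bar> = \<bar>t\<bar> powr (p - 1)"
proof (cases "t = 0")
  case False
  hence "\<bar>t\<bar> powr (p - 2) * \<bar>t\<bar> = \<bar>t\<bar> powr (p - 2 + 1)" by (subst powr_add) simp
  thus ?thesis by (simp add: signed_powr_def abs_mult algebra_simps)
qed (simp add: signed_powr_def)

lemma signed_powr_mult_self: "signed_powr p t * t = \<bar>t\<bar> powr p"
proof (cases "t = 0")
  case False
  have "signed_powr p t * t = \<bar>t\<bar> powr (p - 2) * \<bar>t\<bar>\<^sup>2" by (simp add: signed_powr_def power2_eq_square)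
  also have "\<dots> = \<bar>t\<bar> powr (p - 2 + 2)" using False by (subst powr_add) simp
  finally show ?thesis by simp
qed (simp add: signed_powr_def)

text \<open>For \<open>p < 2\<close> the first factor is unbounded near 0. Continuity there rests on
  the absolute value of the product being \<open>\<bar>t\<bar> powr (p - 1)\<close>, a positive
  power.\<close>

lemma signed_powr_continuous:
  assumes "1 < p"
  shows "continuous_on UNIV (signed_powr p)"
proof (intro continuous_at_imp_continuous_on ballI)
  fix t :: real
  show "isCont (signed_powr p) t"
  proof (cases "t = 0")
    case True
    have "((\<lambda>x. norm (x :: real) powr (p - 1)) \<longlongrightarrow> norm (0 :: real) powr (p - 1)) (at 0)"
      using assms by (intro tendsto_powr' tendsto_intros) auto
    hence "((\<lambda>x. norm (x :: real) powr (p - 1)) \<longlongrightarrow> 0) (at 0)" by simp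
    hence "(signed_powr p \<longlongrightarrow> 0) (at 0)"
      by (rule Lim_null_comparison[rotated]) (simp add: abs_signed_powr)
    thus ?thesis using True by (simp add: isCont_def signed_powr_def)
  next
    case False
    thus ?thesis unfolding signed_powr_def[abs_def] by (intro continuous_intros) auto
  qed
qed

text \<open>The subgradient inequality of \<open>\<bar>t\<bar> powr p / p\<close>. It replaces the
  nonlocal term, whose limit is not yet accessible, by a difference of energies, to which Fatou's
  lemma applies.\<close>

lemma signed_powr_convexity:
  assumes "1 < p"
  shows "(\<bar>t\<bar> powr p - \<bar>r\<bar> powr p) / p \<le> signed_powr p t * (t - r)"
proof -
  have "\<bar>t\<bar> powr p + p * \<bar>t\<bar> powr (p - 1) * (\<bar>r\<bar> - \<bar>t\<bar>) \<le> \<bar>r\<bar> powr p"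
    using assms by (intro powr_tangent) auto
  moreover have "signed_powr p t * r \<le> \<bar>t\<bar> powr (p - 1) * \<bar>r\<bar>"
    using abs_ge_self[of "signed_powr p t * r"] by (simp add: abs_mult abs_signed_powr)
  moreover have "\<bar>t\<bar> powr (p - 1) * \<bar>t\<bar> = \<bar>t\<bar> powr p"
    using powr_mult_base[of "\<bar>t\<bar>" "p - 1"] by (simp add: mult.commute)
  ultimately have "\<bar>t\<bar> powr p - \<bar>r\<bar> powr p \<le> p * (\<bar>t\<bar> powr p - \<bar>t\<bar> powr (p - 1) * \<bar>r\<bar>)"
    by (simp add: algebra_simps)
  also have "\<dots> \<le> p * (signed_powr p t * (t - r))"
    using \<open>signed_powr p t * r \<le> _\<close> assms signed_powr_mult_self[of p t] by (intro mult_left_mono) (auto simp: right_diff_distrib)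
  finally show ?thesis using assms by (simp add: pos_divide_le_eq mult.commute)
qed

text \<open>Convexity without a loss of constants. It keeps the constraint sets of the Mazur
  argument closed under midpoints, where the factor of the quasi-triangle inequality would be
  fatal.\<close>

lemma NP_midpoint:
  assumes "1 < p" "LP p M f" "LP p M g"
  shows "NP p M (\<lambda>x. (1/2) *\<^sub>R (f x + g x)) \<le> (NP p M f + NP p M g) / 2"
proof -
  have p0: "0 < p" using assms by simp
  note L = LP_scaleR(1)[OF LP_add(1)[OF p0 assms(2,3)], of "1/2"]
  have "NP p M (\<lambda>x. (1/2) *\<^sub>R (f x + g x)) \<le> (\<integral>x. (norm (f x) powr p + norm (g x) powr p) / 2 \<partial>M)"
    unfolding NP_def
  proof (rule integral_mono[OF LP_integrable[OF L]])
    show "integrable M (\<lambda>x. (norm (f x) powr p + norm (g x) powr p) / 2)" using assms by (auto simp: LP_def)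
    fix x
    show "norm ((1/2) *\<^sub>R (f x + g x)) powr p \<le> (norm (f x) powr p + norm (g x) powr p) / 2"
    proof (cases "f x = g x")
      case True
      have "(1/2) *\<^sub>R (g x + g x) = g x" by (metis scaleR_half_double)
      thus ?thesis by (simp only: True) simp
    next
      case False
      show ?thesis by (rule less_imp_le[OF norm_midpoint_powr_strict[OF assms(1) False]])
    qed
  qed
  also have "\<dots> = (NP p M f + NP p M g) / 2" using assms by (simp add: NP_def LP_def)
  finally show ?thesis .
qed

section \<open>Lower semicontinuity and strict monotonicity along sequences\<close>

lemma frequently_subseq:
  assumes "frequently P sequentially"
  obtains r :: "nat \<Rightarrow> nat" where "strict_mono r" "\<And>k. P (r k)"
proof -
  have *: "\<exists>m>n. P m" for n :: nat
    using assms unfolding frequently_sequentially by (metis Suc_le_eq)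
  have "\<exists>r. \<forall>k. P (r k) \<and> r k < r (Suc k)"
    by (rule dependent_nat_choice) (use * in blast)+
  thus ?thesis using that by (auto simp: strict_mono_Suc_iff)
qed

text \<open>Lower semicontinuity in epsilon form: a subsequence violating it would contradict
  Fatou's lemma.\<close>

lemma NP_eventually_ge:
  fixes f :: "nat \<Rightarrow> 'a \<Rightarrow> 'b::euclidean_space"
  assumes "0 < p" "\<And>k. LP p M (f k)" "g \<in> borel_measurable M" "AE x in M. (\<lambda>k. f k x) \<longlonglongrightarrow> g x" "e > 0"
  shows "eventually (\<lambda>k. NP p M g - e \<le> NP p M (f k)) sequentially"
proof (rule ccontr)
  assume "\<not> ?thesis"
  hence "frequently (\<lambda>k. NP p M (f k) < NP p M g - e) sequentially"
    by (simp add: not_eventually not_le)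
  then obtain r :: "nat \<Rightarrow> nat" where r: "strict_mono r" "\<And>k. NP p M (f (r k)) < NP p M g - e"
    by (rule frequently_subseq) blast
  have "AE x in M. (\<lambda>k. f (r k) x) \<longlonglongrightarrow> g x"
    using assms(4) by eventually_elim (use LIMSEQ_subseq_LIMSEQ[OF _ r(1)] in \<open>auto simp: o_def\<close>)
  from LP_fatou(2)[OF assms(1) assms(2) less_imp_le[OF r(2)] assms(3) this] assms(5) show False by simp
qed

text \<open>Monotonicity along the segment from \<open>\<eta>\<close> to \<open>\<xi> k\<close> reduces the claim to a sphere around \<open>\<eta>\<close>, where
  compactness applies; no boundedness of \<open>\<xi>\<close> is needed.\<close>

lemma monotone_limit:
  fixes h :: "real \<times> 'b::euclidean_space \<Rightarrow> 'b"
  assumes cont: "continuous_on UNIV h"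
    and mono: "\<And>\<sigma> \<xi> \<eta>. \<xi> \<noteq> \<eta> \<Longrightarrow> (h (\<sigma>, \<xi>) - h (\<sigma>, \<eta>)) \<bullet> (\<xi> - \<eta>) > 0"
    and \<sigma>: "\<sigma> \<longlonglongrightarrow> \<sigma>0" and D: "(\<lambda>k. (h (\<sigma> k, \<xi> k) - h (\<sigma> k, \<eta>)) \<bullet> (\<xi> k - \<eta>)) \<longlonglongrightarrow> 0"
  shows "\<xi> \<longlonglongrightarrow> \<eta>"
proof (rule ccontr)
  assume "\<not> \<xi> \<longlonglongrightarrow> \<eta>"
  then obtain \<delta> where \<delta>: "\<delta> > 0" "\<not> eventually (\<lambda>k. dist (\<xi> k) \<eta> < \<delta>) sequentially"
    unfolding tendsto_iff by blast
  hence "frequently (\<lambda>k. \<delta> \<le> norm (\<xi> k - \<eta>)) sequentially" by (simp add: not_eventually not_less dist_norm)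
  then obtain r :: "nat \<Rightarrow> nat" where r: "strict_mono r" "\<And>k. \<delta> \<le> norm (\<xi> (r k) - \<eta>)"
    by (rule frequently_subseq) blast
  define t where "t k = \<delta> / norm (\<xi> (r k) - \<eta>)" for k
  define \<zeta> where "\<zeta> k = \<eta> + t k *\<^sub>R (\<xi> (r k) - \<eta>)" for k
  have n: "norm (\<xi> (r k) - \<eta>) > 0" for k using r(2)[of k] \<delta>(1) by linarith
  have t: "0 < t k" "t k \<le> 1" for k using r(2)[of k] n[of k] \<delta>(1) by (auto simp: t_def)
  have \<zeta>s: "\<zeta> k \<in> sphere \<eta> \<delta>" for k using n[of k] \<delta>(1) by (simp add: \<zeta>_def dist_norm t_def)
  then obtain l q where lq: "l \<in> sphere \<eta> \<delta>" "strict_mono q" "(\<zeta> \<circ> q) \<longlonglongrightarrow> l"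
    using compact_sphere[of \<eta> \<delta>] unfolding compact_def by blast
  define Dz where "Dz \<sigma> \<xi> = (h (\<sigma>, \<xi>) - h (\<sigma>, \<eta>)) \<bullet> (\<xi> - \<eta>)" for \<sigma> \<xi>
  have Dz0: "Dz \<sigma> \<xi> \<ge> 0" for \<sigma> \<xi> using mono[of \<xi> \<eta> \<sigma>] by (cases "\<xi> = \<eta>") (auto simp: Dz_def)
  have le: "Dz (\<sigma> (r k)) (\<zeta> k) \<le> Dz (\<sigma> (r k)) (\<xi> (r k))" for k
  proof (cases "t k = 1")
    case True
    thus ?thesis by (simp add: \<zeta>_def)
  next
    case False
    hence t1: "t k < 1" using t(2)[of k] by simp
    let ?s = "\<sigma> (r k)" and ?x = "\<xi> (r k)"
    have xz: "?x - \<zeta> k = (1 - t k) *\<^sub>R (?x - \<eta>)" by (simp add: \<zeta>_def scaleR_left_diff_distrib)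
    have "?x \<noteq> \<zeta> k" using xz n[of k] t1 by auto
    hence "(h (?s, ?x) - h (?s, \<zeta> k)) \<bullet> (?x - \<zeta> k) > 0" by (rule mono)
    hence "(h (?s, ?x) - h (?s, \<zeta> k)) \<bullet> (?x - \<eta>) > 0" using t1 by (simp add: xz zero_less_mult_iff)
    hence 1: "(h (?s, \<zeta> k) - h (?s, \<eta>)) \<bullet> (?x - \<eta>) \<le> Dz ?s ?x"
      by (simp add: Dz_def inner_diff_left)
    have "Dz ?s (\<zeta> k) = t k * ((h (?s, \<zeta> k) - h (?s, \<eta>)) \<bullet> (?x - \<eta>))" by (simp add: Dz_def \<zeta>_def)
    moreover from this have "(h (?s, \<zeta> k) - h (?s, \<eta>)) \<bullet> (?x - \<eta>) \<ge> 0"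
      using Dz0[of ?s "\<zeta> k"] t(1)[of k] by (simp add: zero_le_mult_iff)
    ultimately have "Dz ?s (\<zeta> k) \<le> (h (?s, \<zeta> k) - h (?s, \<eta>)) \<bullet> (?x - \<eta>)"
      using t[of k] by (simp add: mult_left_le_one_le)
    with 1 show ?thesis by simp
  qed
  have rq: "strict_mono (r \<circ> q)" using r(1) lq(2) by (rule strict_mono_o)
  have lim0: "(\<lambda>k. Dz (\<sigma> (r (q k))) (\<zeta> (q k))) \<longlonglongrightarrow> 0"
  proof (rule tendsto_sandwich[OF _ _ tendsto_const])
    show "(\<lambda>k. Dz (\<sigma> (r (q k))) (\<xi> (r (q k)))) \<longlonglongrightarrow> 0"
      using LIMSEQ_subseq_LIMSEQ[OF D rq] by (simp add: o_def Dz_def)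
  qed (use le Dz0 in auto)
  have s: "(\<lambda>k. \<sigma> (r (q k))) \<longlonglongrightarrow> \<sigma>0" using LIMSEQ_subseq_LIMSEQ[OF \<sigma> rq] by (simp add: o_def)
  have z: "(\<lambda>k. \<zeta> (q k)) \<longlonglongrightarrow> l" using lq(3) by (simp add: o_def)
  have "(\<lambda>k. Dz (\<sigma> (r (q k))) (\<zeta> (q k))) \<longlonglongrightarrow> Dz \<sigma>0 l"
    unfolding Dz_def
    by (intro tendsto_intros z continuous_on_tendsto_compose[OF cont] tendsto_Pair s) auto
  hence "Dz \<sigma>0 l = 0" using lim0 LIMSEQ_unique by blast
  moreover have "l \<noteq> \<eta>" using lq(1) \<delta>(1) by auto
  ultimately show False using mono[of l \<eta> \<sigma>0] by (simp add: Dz_def)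
qed

text \<open>Coercivity bounds \<open>norm \<xi> powr p\<close> by
  \<open>h (\<sigma>, \<xi>) \<bullet> \<xi>\<close>, which is the monotonicity expression plus
  cross terms with \<open>\<eta>\<close>, and Young's inequality absorbs the latter. The bound turns
  an integrable majorant for the monotonicity expression into one for the p-th powers of the
  gradients. The constant is chosen before \<open>h\<close>, so that it is the same for the
  coefficients at all points \<open>x\<close>.\<close>

lemma gradient_growth_bound:
  fixes p \<alpha> \<beta> :: real
  assumes p: "1 < p" and \<alpha>: "0 < \<alpha>" and \<beta>: "0 \<le> \<beta>"
  shows "\<exists>C\<ge>0. \<forall>h :: real \<times> 'b::euclidean_space \<Rightarrow> 'b.
     (\<forall>\<sigma> \<xi>. norm (h (\<sigma>, \<xi>)) \<le> \<beta> * (\<bar>\<sigma>\<bar> powr (p - 1) + norm \<xi> powr (p - 1))) \<longrightarrow>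
     (\<forall>\<sigma> \<xi>. \<alpha> * norm \<xi> powr p \<le> h (\<sigma>, \<xi>) \<bullet> \<xi>) \<longrightarrow>
     (\<forall>\<sigma> \<xi> \<eta>. 0 \<le> (h (\<sigma>, \<xi>) - h (\<sigma>, \<eta>)) \<bullet> (\<xi> - \<eta>)) \<longrightarrow>
     (\<forall>\<sigma> \<xi> \<eta>. norm \<xi> powr p \<le> C * ((h (\<sigma>, \<xi>) - h (\<sigma>, \<eta>)) \<bullet> (\<xi> - \<eta>) + \<bar>\<sigma>\<bar> powr p + norm \<eta> powr p))"
proof -
  \<comment> \<open>The cross terms leave \<open>3 * \<beta> * e\<close> in front of
    \<open>norm \<xi> powr p\<close>, once from \<open>A\<close> and twice from \<open>B\<close>
    below. This choice keeps it below three quarters of \<open>\<alpha>\<close>.\<close>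
  define e where "e = \<alpha> / (4 * (\<beta> + 1))"
  have e: "e > 0" using \<alpha> \<beta> by (simp add: e_def)
  obtain C1 where C1: "0 < C1" "\<And>s t. 0 \<le> s \<Longrightarrow> 0 \<le> t \<Longrightarrow> s powr (p - 1) * t \<le> e * s powr p + C1 * t powr p"
    using young_powr_right[OF p e] by blast
  obtain C2 where C2: "0 < C2" "\<And>s t. 0 \<le> s \<Longrightarrow> 0 \<le> t \<Longrightarrow> s powr (p - 1) * t \<le> C2 * s powr p + e * t powr p"
    using young_powr_left[OF p e] by blast
  define K where "K = 1 + \<beta> * (e + 2 * C1 + 2 * C2 + e)"
  have K: "K \<ge> 1" unfolding K_def using e C1(1) C2(1) \<beta> by simp
  show ?thesis
  proof (intro exI[of _ "4 * K / \<alpha>"] conjI allI impI)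
    show "0 \<le> 4 * K / \<alpha>" using K \<alpha> by simp
    fix h :: "real \<times> 'b \<Rightarrow> 'b" and \<sigma> :: real and \<xi> \<eta> :: 'b
    assume G: "\<forall>\<sigma> \<xi>. norm (h (\<sigma>, \<xi>)) \<le> \<beta> * (\<bar>\<sigma>\<bar> powr (p - 1) + norm \<xi> powr (p - 1))"
      and Co: "\<forall>\<sigma> \<xi>. \<alpha> * norm \<xi> powr p \<le> h (\<sigma>, \<xi>) \<bullet> \<xi>"
      and Mo: "\<forall>\<sigma> \<xi> \<eta>. 0 \<le> (h (\<sigma>, \<xi>) - h (\<sigma>, \<eta>)) \<bullet> (\<xi> - \<eta>)"
    define S X Y where "S = \<bar>\<sigma>\<bar> powr p" and "X = norm \<xi> powr p" and "Y = norm \<eta> powr p"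
    have pos: "S \<ge> 0" "X \<ge> 0" "Y \<ge> 0" by (simp_all add: S_def X_def Y_def)
    define D where "D = (h (\<sigma>, \<xi>) - h (\<sigma>, \<eta>)) \<bullet> (\<xi> - \<eta>)"
    have eq: "h (\<sigma>, \<xi>) \<bullet> \<xi> = D + h (\<sigma>, \<xi>) \<bullet> \<eta> + h (\<sigma>, \<eta>) \<bullet> \<xi> - h (\<sigma>, \<eta>) \<bullet> \<eta>"
      by (simp add: D_def inner_diff_left inner_diff_right)
    have A: "h (\<sigma>, \<xi>) \<bullet> \<eta> \<le> \<beta> * (e * S + e * X + 2 * C1 * Y)"
    proof -
      have "h (\<sigma>, \<xi>) \<bullet> \<eta> \<le> norm (h (\<sigma>, \<xi>)) * norm \<eta>" by (rule norm_cauchy_schwarz)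
      also have "\<dots> \<le> \<beta> * (\<bar>\<sigma>\<bar> powr (p - 1) + norm \<xi> powr (p - 1)) * norm \<eta>" using G by (intro mult_right_mono) auto
      also have "\<dots> = \<beta> * (\<bar>\<sigma>\<bar> powr (p - 1) * norm \<eta> + norm \<xi> powr (p - 1) * norm \<eta>)" by (simp add: algebra_simps)
      also have "\<dots> \<le> \<beta> * ((e * S + C1 * Y) + (e * X + C1 * Y))"
        unfolding S_def X_def Y_def using \<beta> by (intro mult_left_mono add_mono C1(2)) auto
      finally show ?thesis by (simp add: algebra_simps)
    qed
    have B: "h (\<sigma>, \<eta>) \<bullet> \<xi> \<le> \<beta> * (C2 * S + C2 * Y + 2 * e * X)"
    proof -
      have "h (\<sigma>, \<eta>) \<bullet> \<xi> \<le> norm (h (\<sigma>, \<eta>)) * norm \<xi>" by (rule norm_cauchy_schwarz)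
      also have "\<dots> \<le> \<beta> * (\<bar>\<sigma>\<bar> powr (p - 1) + norm \<eta> powr (p - 1)) * norm \<xi>" using G by (intro mult_right_mono) auto
      also have "\<dots> = \<beta> * (\<bar>\<sigma>\<bar> powr (p - 1) * norm \<xi> + norm \<eta> powr (p - 1) * norm \<xi>)" by (simp add: algebra_simps)
      also have "\<dots> \<le> \<beta> * ((C2 * S + e * X) + (C2 * Y + e * X))"
        unfolding S_def X_def Y_def using \<beta> by (intro mult_left_mono add_mono C2(2)) auto
      finally show ?thesis by (simp add: algebra_simps)
    qed
    have Cc: "- (h (\<sigma>, \<eta>) \<bullet> \<eta>) \<le> 0" using Co[rule_format, of \<eta> \<sigma>] \<alpha> by (smt (verit) mult_nonneg_nonneg powr_ge_zero)
    have small: "3 * (\<beta> * e) * X \<le> 3 / 4 * \<alpha> * X"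
    proof -
      have "\<beta> * e \<le> \<alpha> / 4" unfolding e_def using \<alpha> \<beta> by (simp add: field_simps)
      thus ?thesis using pos by (intro mult_right_mono) auto
    qed
    have D0: "\<alpha> * X \<le> D + \<beta> * (e * S + e * X + 2 * C1 * Y) + \<beta> * (C2 * S + C2 * Y + 2 * e * X)"
      using Co[rule_format, of \<xi> \<sigma>] eq A B Cc unfolding X_def by linarith
    have "\<alpha> / 4 * X \<le> D + \<beta> * (e + C2) * S + \<beta> * (2 * C1 + C2) * Y"
      using D0 small by (simp add: algebra_simps)
    also have "\<dots> \<le> K * D + K * S + K * Y"
    proof (intro add_mono mult_right_mono)
      have D: "0 \<le> D" using Mo by (simp add: D_def)
      show "D \<le> K * D" using mult_right_mono[OF K D] by simp
      have "\<beta> * (e + C2) \<le> \<beta> * (e + 2 * C1 + 2 * C2 + e)" "\<beta> * (2 * C1 + C2) \<le> \<beta> * (e + 2 * C1 + 2 * C2 + e)"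
        using e C1(1) C2(1) \<beta> by (auto intro!: mult_left_mono)
      thus "\<beta> * (e + C2) \<le> K" "\<beta> * (2 * C1 + C2) \<le> K" by (auto simp: K_def)
    qed (use pos in auto)
    finally have "\<alpha> * X \<le> 4 * K * (D + S + Y)" by (simp add: algebra_simps)
    hence "X \<le> 4 * K / \<alpha> * (D + S + Y)" using \<alpha> by (simp add: field_simps)
    thus "norm \<xi> powr p \<le> 4 * K / \<alpha> * ((h (\<sigma>, \<xi>) - h (\<sigma>, \<eta>)) \<bullet> (\<xi> - \<eta>) + \<bar>\<sigma>\<bar> powr p + norm \<eta> powr p)"
      by (simp add: X_def D_def S_def Y_def)
  qed
qed

section \<open>The weak formulation and its Galerkin approximation\<close>

lemma NP_zero [simp]: "NP p M (\<lambda>x. 0) = 0"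
  by (simp add: NP_def)

text \<open>The coefficients are cut off outside a set \<open>E\<close> of full measure in \<open>\<Omega>\<close>, so that all structure conditions
  hold at every point. Elements of the space are handled as pairs \<open>w = (u, g)\<close> of a function and its gradient.\<close>

locale leray_lions =
  fixes \<Omega> E :: "(real^'n) set" and p s \<alpha> \<beta> :: real
    and a :: "real^'n \<Rightarrow> real \<times> (real^'n) \<Rightarrow> real^'n" and F :: "real^'n \<Rightarrow> real \<times> (real^'n) \<Rightarrow> real"
    and f :: "real^'n \<Rightarrow> real"
  assumes p: "1 < p" and s: "0 < s" "s < 1" and bounded_\<Omega>: "bounded \<Omega>"
    and AE_E: "AE x in lebesgue. x \<in> \<Omega> \<longrightarrow> x \<in> E"
    and a_meas: "\<And>z. (\<lambda>x. a x z) \<in> borel_measurable lebesgue"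
    and a_cont: "\<And>x. continuous_on UNIV (a x)"
    and \<alpha>: "0 < \<alpha>" and \<beta>: "0 \<le> \<beta>"
    and a_growth: "\<And>x \<sigma> \<xi>. norm (a x (\<sigma>, \<xi>)) \<le> \<beta> * (\<bar>\<sigma>\<bar> powr (p - 1) + norm \<xi> powr (p - 1))"
    and a_coercive: "\<And>x \<sigma> \<xi>. x \<in> E \<Longrightarrow> \<alpha> * norm \<xi> powr p \<le> a x (\<sigma>, \<xi>) \<bullet> \<xi>"
    and a_mono: "\<And>x \<sigma> \<xi> \<eta>. x \<in> E \<Longrightarrow> \<xi> \<noteq> \<eta> \<Longrightarrow> 0 < (a x (\<sigma>, \<xi>) - a x (\<sigma>, \<eta>)) \<bullet> (\<xi> - \<eta>)"
    and a_out: "\<And>x z. x \<notin> E \<Longrightarrow> a x z = 0"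
    and F_meas: "\<And>z. (\<lambda>x. F x z) \<in> borel_measurable lebesgue"
    and F_cont: "\<And>x. continuous_on UNIV (F x)"
    and F_bound: "\<And>x z. \<bar>F x z\<bar> \<le> f x"
    and f_LP: "LP (p / (p - 1)) lebesgue f"
begin

lemma p0: "0 < p" using p by simp

abbreviation "q \<equiv> p / (p - 1)"
abbreviation "\<nu> \<equiv> frac_measure p s :: ((real^'n) \<times> (real^'n)) measure"

text \<open>All local terms of the equation in one vector: the inner product with a pair of test
  function and gradient gives the diffusion term minus the right-hand side.\<close>

definition b :: "real^'n \<Rightarrow> real \<times> (real^'n) \<Rightarrow> real \<times> (real^'n)" where
  "b x z = (- F x z, a x z)"

definition XW :: "(real^'n \<Rightarrow> real \<times> (real^'n)) \<Rightarrow> bool" where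
  "XW w \<longleftrightarrow> X1p p \<Omega> (\<lambda>x. fst (w x)) (\<lambda>x. snd (w x))"

definition wincr :: "(real^'n \<Rightarrow> real \<times> (real^'n)) \<Rightarrow> (real^'n) \<times> (real^'n) \<Rightarrow> real" where
  "wincr w = incr (\<lambda>x. fst (w x))"

text \<open>The residual of the weak equation at \<open>w\<close>, tested with
  \<open>\<phi>\<close>; a solution makes it vanish for all \<open>\<phi>\<close>. The real product
  in the nonlocal integral is written as an inner product, so that one set of pairing lemmas serves
  both integrals.\<close>

definition pairing :: "(real^'n \<Rightarrow> real \<times> (real^'n)) \<Rightarrow> (real^'n \<Rightarrow> real \<times> (real^'n)) \<Rightarrow> real" where
  "pairing w \<phi> = (\<integral>x. b x (w x) \<bullet> \<phi> x \<partial>lebesgue) + (\<integral>z. signed_powr p (wincr w z) \<bullet> wincr \<phi> z \<partial>\<nu>)"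

lemma f_nonneg: "0 \<le> f x"
  using F_bound[of x 0] by linarith

lemma b_meas: "w \<in> borel_measurable lebesgue \<Longrightarrow> (\<lambda>x. b x (w x)) \<in> borel_measurable lebesgue"
  unfolding b_def
  by (rule borel_measurable_Pair[OF borel_measurable_uminus[OF caratheodory_measurable[OF F_meas F_cont]] caratheodory_measurable[OF a_meas a_cont]])

lemma b_cont: "continuous_on UNIV (b x)"
  unfolding b_def[abs_def] by (intro continuous_intros a_cont F_cont)

lemma a_growth': "norm (a x z) \<le> 2 * \<beta> * norm z powr (p - 1)"
proof (cases z)
  case (Pair \<sigma> \<xi>)
  have p1: "0 < p - 1" using p by simp
  have "norm (a x z) \<le> \<beta> * (norm \<sigma> powr (p - 1) + norm \<xi> powr (p - 1))" using a_growth by (simp add: Pair)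
  also have "\<dots> \<le> \<beta> * (norm z powr (p - 1) + norm z powr (p - 1))"
    unfolding Pair using \<beta> by (intro mult_left_mono add_mono norm_Pair_powr[OF p1])
  finally show ?thesis by simp
qed

lemma b_growth: "norm (b x z) \<le> f x + 2 * \<beta> * norm z powr (p - 1)"
proof -
  have "norm (b x z) \<le> \<bar>F x z\<bar> + norm (a x z)" unfolding b_def using norm_Pair_le[of "- F x z" "a x z"] by simp
  with F_bound[of x z] a_growth'[of x z] show ?thesis by linarith
qed

lemma b_nemytskii:
  shows "LP p lebesgue w \<Longrightarrow> LP q lebesgue (\<lambda>x. b x (w x))"
    and "LP p lebesgue w \<Longrightarrow> NP q lebesgue (\<lambda>x. b x (w x)) \<le> 2 powr q * (NP q lebesgue (f) + (2 * \<beta>) powr q * NP p lebesgue w)"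
    and "(\<And>k. LP p lebesgue (ws k)) \<Longrightarrow> LP p lebesgue w \<Longrightarrow> (\<lambda>k. NP p lebesgue (\<lambda>x. ws k x - w x)) \<longlonglongrightarrow> 0 \<Longrightarrow>
      (\<lambda>k. NP q lebesgue (\<lambda>x. b x (ws k x) - b x (w x))) \<longlonglongrightarrow> 0"
  using nemytskii[where h = "b" and M = lebesgue and ?b0.0 = "f" and \<beta> = "(2 * \<beta>)" and q = q, OF p refl]
    b_meas b_growth b_cont f_LP f_nonneg \<beta> by simp_all


lemma a_nemytskii_meas: "w \<in> borel_measurable lebesgue \<Longrightarrow> (\<lambda>x. a x (w x)) \<in> borel_measurable lebesgue"
  by (rule caratheodory_measurable[OF a_meas a_cont])

lemma a_nemytskii:
  shows "LP p lebesgue w \<Longrightarrow> LP q lebesgue (\<lambda>x. a x (w x))"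
    and "LP p lebesgue w \<Longrightarrow> NP q lebesgue (\<lambda>x. a x (w x)) \<le> 2 powr q * ((2 * \<beta>) powr q * NP p lebesgue w)"
    and "(\<And>k. LP p lebesgue (ws k)) \<Longrightarrow> LP p lebesgue w \<Longrightarrow> (\<lambda>k. NP p lebesgue (\<lambda>x. ws k x - w x)) \<longlonglongrightarrow> 0 \<Longrightarrow>
      (\<lambda>k. NP q lebesgue (\<lambda>x. a x (ws k x) - a x (w x))) \<longlonglongrightarrow> 0"
  using nemytskii[where h = "a" and M = lebesgue and ?b0.0 = "\<lambda>_. 0 :: real" and \<beta> = "(2 * \<beta>)" and q = q, OF p refl]
    a_nemytskii_meas a_growth' a_cont   \<beta> by simp_all


lemma J_meas: "U \<in> borel_measurable M \<Longrightarrow> (\<lambda>z. signed_powr p (U z)) \<in> borel_measurable M"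
  by (rule measurable_compose[OF _ borel_measurable_continuous_onI[OF signed_powr_continuous[OF p]]])

lemma J_growth: "norm (signed_powr p t) \<le> (0::real) + 1 * norm t powr (p - 1)"
  by (simp add: abs_signed_powr)

text \<open>With the kernel inside the measure, the fractional operator acts on increments as a
  superposition operator with growth \<open>p - 1\<close>. The continuity theorem for the local
  coefficients thus covers it too.\<close>

lemma J_nemytskii:
  shows "LP p \<nu> w \<Longrightarrow> LP q \<nu> (\<lambda>x. signed_powr p (w x))"
    and "LP p \<nu> w \<Longrightarrow> NP q \<nu> (\<lambda>x. signed_powr p (w x)) \<le> 2 powr q * (1 powr q * NP p \<nu> w)"
    and "(\<And>k. LP p \<nu> (ws k)) \<Longrightarrow> LP p \<nu> w \<Longrightarrow> (\<lambda>k. NP p \<nu> (\<lambda>x. ws k x - w x)) \<longlonglongrightarrow> 0 \<Longrightarrow>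
      (\<lambda>k. NP q \<nu> (\<lambda>x. signed_powr p (ws k x) - signed_powr p (w x))) \<longlonglongrightarrow> 0"
proof -
  note N = nemytskii[where h = "\<lambda>_. signed_powr p" and M = \<nu> and ?b0.0 = "\<lambda>_. 0 :: real" and \<beta> = 1 and q = q,
      OF p refl J_meas J_growth LP_zero order_refl zero_le_one]
  show "LP p \<nu> w \<Longrightarrow> LP q \<nu> (\<lambda>x. signed_powr p (w x))" by (rule N(1))
  show "LP p \<nu> w \<Longrightarrow> NP q \<nu> (\<lambda>x. signed_powr p (w x)) \<le> 2 powr q * (1 powr q * NP p \<nu> w)"
    using N(2)[of w] by (simp only: NP_zero add_0)
  show "(\<And>k. LP p \<nu> (ws k)) \<Longrightarrow> LP p \<nu> w \<Longrightarrow> (\<lambda>k. NP p \<nu> (\<lambda>x. ws k x - w x)) \<longlonglongrightarrow> 0 \<Longrightarrow>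
      (\<lambda>k. NP q \<nu> (\<lambda>x. signed_powr p (ws k x) - signed_powr p (w x))) \<longlonglongrightarrow> 0"
    by (rule N(3)[OF _ signed_powr_continuous[OF p]])
qed


lemma XW_LP: "XW w \<Longrightarrow> LP p lebesgue w"
  unfolding XW_def using X1pD(1)[OF p, of \<Omega> "\<lambda>x. fst (w x)" "\<lambda>x. snd (w x)"] by simp

lemma XW_incr: "XW w \<Longrightarrow> LP p \<nu> (wincr w)"
  unfolding XW_def wincr_def by (rule X1p_incr_LP[OF p s])

lemma XW_incr_tendsto:
  assumes "XW w" "\<And>k. XW (ws k)" "(\<lambda>k. NP p lebesgue (\<lambda>x. ws k x - w x)) \<longlonglongrightarrow> 0"
  shows "(\<lambda>k. NP p \<nu> (\<lambda>z. wincr (ws k) z - wincr w z)) \<longlonglongrightarrow> 0"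
  unfolding wincr_def by (rule X1p_incr_tendsto[OF p s assms(1,2)[unfolded XW_def]]) (use assms(3) in simp)

lemma XW_jet:
  assumes "test_fun \<Omega> v"
  shows "XW (jet v)"
  unfolding XW_def using X1p_test_fun[OF p assms] by (simp add: jet_def)

lemma pairing_tendsto_right:
  assumes w: "XW w" and \<phi>: "XW \<phi>" "\<And>k. XW (\<phi>s k)" "(\<lambda>k. NP p lebesgue (\<lambda>x. \<phi>s k x - \<phi> x)) \<longlonglongrightarrow> 0"
  shows "(\<lambda>k. pairing w (\<phi>s k)) \<longlonglongrightarrow> pairing w \<phi>"
  unfolding pairing_def
  by (intro tendsto_add LP_pair_tendsto[OF p b_nemytskii(1)[OF XW_LP[OF w]] XW_LP[OF \<phi>(2)] XW_LP[OF \<phi>(1)] \<phi>(3)]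
      LP_pair_tendsto[OF p J_nemytskii(1)[OF XW_incr[OF w]] XW_incr[OF \<phi>(2)] XW_incr[OF \<phi>(1)] XW_incr_tendsto[OF \<phi>]])

text \<open>Strong continuity of the whole operator. It is applied twice: for continuity of the
  Galerkin system in its coefficients, and for the final passage to the limit.\<close>

lemma pairing_tendsto_left:
  assumes w: "XW w" "\<And>k. XW (ws k)" "(\<lambda>k. NP p lebesgue (\<lambda>x. ws k x - w x)) \<longlonglongrightarrow> 0" and \<phi>: "XW \<phi>"
  shows "(\<lambda>k. pairing (ws k) \<phi>) \<longlonglongrightarrow> pairing w \<phi>"
proof -
  have q0: "0 < q" using p by simp
  have L: "(\<lambda>k. \<integral>x. h (ws' k) x \<bullet> g x \<partial>M) \<longlonglongrightarrow> (\<integral>x. h w' x \<bullet> g x \<partial>M)"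
    if "LP q M (h w')" "\<And>k. LP q M (h (ws' k))" "(\<lambda>k. NP q M (\<lambda>x. h (ws' k) x - h w' x)) \<longlonglongrightarrow> 0" "LP p M g"
    for h :: "'x \<Rightarrow> 'y \<Rightarrow> 'z::euclidean_space" and w' ws' M g
  proof -
    have "(\<lambda>k. \<integral>x. (h (ws' k) x - h w' x) \<bullet> g x \<partial>M) \<longlonglongrightarrow> 0"
      by (rule LP_pair_tendsto_left[OF p _ that(3) that(4) order_refl]) (intro LP_diff(1)[OF q0] that)
    moreover have "(\<integral>x. (h (ws' k) x - h w' x) \<bullet> g x \<partial>M) = (\<integral>x. h (ws' k) x \<bullet> g x \<partial>M) - (\<integral>x. h w' x \<bullet> g x \<partial>M)" for k
      using LP_pair_integrable[OF p that(2,4)] LP_pair_integrable[OF p that(1,4)] by (simp add: inner_diff_left)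
    ultimately show ?thesis by (simp add: LIM_zero_iff)
  qed
  show ?thesis
    unfolding pairing_def
  proof (intro tendsto_add)
    show "(\<lambda>k. \<integral>x. b x (ws k x) \<bullet> \<phi> x \<partial>lebesgue) \<longlonglongrightarrow> (\<integral>x. b x (w x) \<bullet> \<phi> x \<partial>lebesgue)"
      by (rule L[of lebesgue "\<lambda>w x. b x (w x)" w ws \<phi>, OF b_nemytskii(1)[OF XW_LP[OF w(1)]] b_nemytskii(1)[OF XW_LP[OF w(2)]]
            b_nemytskii(3)[OF XW_LP[OF w(2)] XW_LP[OF w(1)] w(3)] XW_LP[OF \<phi>]])
    show "(\<lambda>k. \<integral>z. signed_powr p (wincr (ws k) z) \<bullet> wincr \<phi> z \<partial>\<nu>) \<longlonglongrightarrow> (\<integral>z. signed_powr p (wincr w z) \<bullet> wincr \<phi> z \<partial>\<nu>)"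
      by (rule L[of \<nu> "\<lambda>w z. signed_powr p (wincr w z)" w ws "wincr \<phi>", OF J_nemytskii(1)[OF XW_incr[OF w(1)]] J_nemytskii(1)[OF XW_incr[OF w(2)]]
            J_nemytskii(3)[OF XW_incr[OF w(2)] XW_incr[OF w(1)] XW_incr_tendsto[OF w]] XW_incr[OF \<phi>]])
  qed
qed

lemma pairing_lincomb:
  assumes w: "XW w" and \<phi>: "XW \<phi>" and \<psi>: "XW \<psi>"
  shows "pairing w (\<lambda>x. c *\<^sub>R \<phi> x + d *\<^sub>R \<psi> x) = c * pairing w \<phi> + d * pairing w \<psi>"
proof -
  note I = LP_pair_integrable[OF p b_nemytskii(1)[OF XW_LP[OF w]] XW_LP[OF \<phi>]] LP_pair_integrable[OF p b_nemytskii(1)[OF XW_LP[OF w]] XW_LP[OF \<psi>]]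
    LP_pair_integrable[OF p J_nemytskii(1)[OF XW_incr[OF w]] XW_incr[OF \<phi>]] LP_pair_integrable[OF p J_nemytskii(1)[OF XW_incr[OF w]] XW_incr[OF \<psi>]]
  have "wincr (\<lambda>x. c *\<^sub>R \<phi> x + d *\<^sub>R \<psi> x) z = c * wincr \<phi> z + d * wincr \<psi> z" for z
    by (simp add: wincr_def incr_def algebra_simps)
  hence "pairing w (\<lambda>x. c *\<^sub>R \<phi> x + d *\<^sub>R \<psi> x) =
      (\<integral>x. c * (b x (w x) \<bullet> \<phi> x) + d * (b x (w x) \<bullet> \<psi> x) \<partial>lebesgue)
      + (\<integral>z. c * (signed_powr p (wincr w z) \<bullet> wincr \<phi> z) + d * (signed_powr p (wincr w z) \<bullet> wincr \<psi> z) \<partial>\<nu>)"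
    unfolding pairing_def by (simp add: inner_add_right algebra_simps)
  also have "\<dots> = c * pairing w \<phi> + d * pairing w \<psi>"
    unfolding pairing_def using I by (simp add: algebra_simps)
  finally show ?thesis .
qed

lemma pairing_jet_lincomb:
  assumes "XW w" "test_fun \<Omega> \<phi>" "test_fun \<Omega> \<psi>"
  shows "pairing w (jet (\<lambda>x. c * \<phi> x + d * \<psi> x)) = c * pairing w (jet \<phi>) + d * pairing w (jet \<psi>)"
proof -
  have "jet (\<lambda>x. c * \<phi> x + d * \<psi> x) = (\<lambda>x. c *\<^sub>R jet \<phi> x + d *\<^sub>R jet \<psi> x)"
    using jet_lincomb[OF assms(2,3)[THEN test_fun_smooth]] by blast
  thus ?thesis using pairing_lincomb[OF assms(1) assms(2,3)[THEN XW_jet]] by simp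
qed

lemma pairing_jet_zero: "XW w \<Longrightarrow> pairing w (jet (\<lambda>x. 0)) = 0"
  using pairing_jet_lincomb[OF _ test_fun_zero test_fun_zero, of w 0 0] by simp

lemma pairing_jet_sum:
  fixes \<omega> :: "nat \<Rightarrow> real^'n \<Rightarrow> real"
  assumes w: "XW w" and "\<And>i. test_fun \<Omega> (\<omega> i)"
  shows "pairing w (jet (\<lambda>x. \<Sum>i<m. c i * \<omega> i x)) = (\<Sum>i<m. c i * pairing w (jet (\<omega> i)))"
proof (induction m)
  case 0
  show ?case using pairing_jet_zero[OF w] by simp
next
  case (Suc m)
  have t: "test_fun \<Omega> (\<lambda>x. \<Sum>i<m. c i * \<omega> i x)" using test_fun_sum[of m \<Omega> \<omega> c] assms(2) by blast
  show ?case using pairing_jet_lincomb[OF w t assms(2), of 1 "c m" m] Suc.IH by simp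
qed

lemma test_fun_norm_bounds:
  "\<exists>P\<ge>0. \<forall>v. test_fun \<Omega> v \<longrightarrow> NP p lebesgue v \<le> P * NP p lebesgue (grad v)"
proof -
  obtain B where B: "B > 0" "\<forall>x\<in>\<Omega>. norm x \<le> B" using bounded_\<Omega> unfolding bounded_pos by blast
  hence "\<Omega> \<subseteq> cball 0 B" by auto
  thus ?thesis using poincare_inequality[OF _ p, of \<Omega> _ B] B(1)
    by (intro exI[of _ "(2 * B + 1) powr p"]) auto
qed

text \<open>The contribution of \<open>F\<close> is absorbed by Young's and Poincare's inequalities
  at the price of half of \<open>\<alpha>\<close> and a constant. The nonlocal part is nonnegative
  on the diagonal.\<close>

lemma pairing_coercive:
  "\<exists>C\<ge>0. \<forall>v. test_fun \<Omega> v \<longrightarrow> \<alpha> / 2 * NP p lebesgue (grad v) - C \<le> pairing (jet v) (jet v)"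
proof -
  obtain P where P: "P \<ge> 0" "\<And>v. test_fun \<Omega> v \<Longrightarrow> NP p lebesgue v \<le> P * NP p lebesgue (grad v)"
    using test_fun_norm_bounds by blast
  \<comment> \<open>Makes \<open>e * P\<close> at most \<open>\<alpha> / 2\<close>, where
    \<open>P\<close> is the Poincare constant; the summand 1 covers \<open>P = 0\<close>.\<close>
  define e where "e = \<alpha> / (2 * (P + 1))"
  have e: "e > 0" using \<alpha> P(1) by (simp add: e_def)
  obtain C where C: "0 < C" "\<And>a b. 0 \<le> a \<Longrightarrow> 0 \<le> b \<Longrightarrow> a * b \<le> C * a powr q + e * b powr p"
    using young_left[OF p e] by blast
  show ?thesis
  proof (intro exI[of _ "C * NP q lebesgue f"] conjI allI impI)
    show "0 \<le> C * NP q lebesgue f" using C(1) by simp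
    fix v assume v: "test_fun \<Omega> v"
    note LPv = test_fun_LP[OF v p0]
    let ?G = "NP p lebesgue (grad v)"
    note w = XW_jet[OF v]
    have "(\<integral>x. \<alpha> * norm (grad v x) powr p - norm (f x) * norm (v x) \<partial>lebesgue) \<le> (\<integral>x. b x (jet v x) \<bullet> jet v x \<partial>lebesgue)"
    proof (rule integral_mono_AE)
      show "integrable lebesgue (\<lambda>x. \<alpha> * norm (grad v x) powr p - norm (f x) * norm (v x))"
        using LP_integrable[OF LPv(3)] LP_pair_norm_integrable[OF p f_LP LPv(2)] by auto
      show "integrable lebesgue (\<lambda>x. b x (jet v x) \<bullet> jet v x)"
        by (rule LP_pair_integrable[OF p b_nemytskii(1)[OF XW_LP[OF w]] XW_LP[OF w]])
      show "AE x in lebesgue. \<alpha> * norm (grad v x) powr p - norm (f x) * norm (v x) \<le> b x (jet v x) \<bullet> jet v x"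
        using AE_E
      proof eventually_elim
        case (elim x)
        have e1: "b x (jet v x) \<bullet> jet v x = - F x (jet v x) * v x + a x (jet v x) \<bullet> grad v x"
          by (simp add: b_def jet_def)
        have "F x (jet v x) * v x \<le> \<bar>F x (jet v x)\<bar> * \<bar>v x\<bar>" by (metis abs_ge_self abs_mult)
        also have "\<dots> \<le> norm (f x) * norm (v x)" using F_bound[of x "jet v x"] f_nonneg[of x] by (intro mult_mono) auto
        finally have e2: "F x (jet v x) * v x \<le> norm (f x) * norm (v x)" .
        have e3: "\<alpha> * norm (grad v x) powr p \<le> a x (jet v x) \<bullet> grad v x"
        proof (cases "x \<in> \<Omega>")
          case True
          thus ?thesis using a_coercive[of x "grad v x" "v x"] elim by (simp add: jet_def)
        next
          case False
          thus ?thesis using test_fun_jet_outside(3)[OF v False] by simp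
        qed
        show ?case using e1 e2 e3 by linarith
      qed
    qed
    moreover have "(\<integral>x. \<alpha> * norm (grad v x) powr p - norm (f x) * norm (v x) \<partial>lebesgue) =
        \<alpha> * ?G - (\<integral>x. norm (f x) * norm (v x) \<partial>lebesgue)"
      using LP_integrable[OF LPv(3)] LP_pair_norm_integrable[OF p f_LP LPv(2)] by (simp add: NP_def)
    moreover have "(\<integral>x. norm (f x) * norm (v x) \<partial>lebesgue) \<le> C * NP q lebesgue f + e * NP p lebesgue v"
      by (rule LP_pair_norm_le[OF p f_LP LPv(2) C(2)])
    moreover have "e * NP p lebesgue v \<le> \<alpha> / 2 * ?G"
    proof -
      have "e * NP p lebesgue v \<le> e * (P * ?G)" using P(2)[OF v] e by (intro mult_left_mono) auto
      also have "\<dots> = (e * P) * ?G" by simp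
      also have "\<dots> \<le> \<alpha> / 2 * ?G"
        using \<alpha> P(1) by (intro mult_right_mono) (auto simp: e_def field_simps)
      finally show ?thesis .
    qed
    moreover have "0 \<le> (\<integral>z. signed_powr p (wincr (jet v) z) \<bullet> wincr (jet v) z \<partial>\<nu>)"
      by (rule Bochner_Integration.integral_nonneg) (simp add: signed_powr_mult_self)
    ultimately show "\<alpha> / 2 * ?G - C * NP q lebesgue f \<le> pairing (jet v) (jet v)"
      unfolding pairing_def by (simp add: field_simps)
  qed
qed

text \<open>The regularisation \<open>e * c j\<close> makes the finite-dimensional system coercive without assuming that the
  \<open>\<omega> j\<close> are linearly independent; it vanishes in the limit.\<close>

lemma galerkin_solution:
  fixes \<omega> :: "nat \<Rightarrow> real^'n \<Rightarrow> real"
  assumes \<omega>: "\<And>j. test_fun \<Omega> (\<omega> j)" and e: "0 < e"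
  shows "\<exists>c. \<forall>j<m. pairing (jet (\<lambda>x. \<Sum>i<m. c i * \<omega> i x)) (jet (\<omega> j)) + e * c j = 0"
proof -
  define u where "u c x = (\<Sum>i<m. c i * \<omega> i x)" for c and x :: "real^'n"
  have u: "test_fun \<Omega> (u c)" and ju: "jet (u c) x = (\<Sum>i<m. c i *\<^sub>R jet (\<omega> i) x)" for c x
    using test_fun_sum[of m \<Omega> \<omega> c] \<omega> unfolding u_def by blast+
  obtain C where C: "C \<ge> 0" "\<And>v. test_fun \<Omega> v \<Longrightarrow> \<alpha> / 2 * NP p lebesgue (grad v) - C \<le> pairing (jet v) (jet v)"
    using pairing_coercive by blast
  \<comment> \<open>On a face of the cube the regularisation contributes at least
    \<open>e * R\<^sup>2 = C + 1\<close>, which outweighs the defect \<open>C\<close> in the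
    coercivity estimate.\<close>
  define R where "R = sqrt ((C + 1) / e)"
  have R: "R > 0" "e * R\<^sup>2 = C + 1" using C(1) e by (auto simp: R_def)
  obtain c where "\<And>j. j < m \<Longrightarrow> pairing (jet (u c)) (jet (\<omega> j)) + e * c j = 0"
  proof (rule coercive_zero[of R m "\<lambda>c j. pairing (jet (u c)) (jet (\<omega> j)) + e * c j", OF R(1)])
    fix cs :: "nat \<Rightarrow> nat \<Rightarrow> real" and c and j :: nat
    assume cs: "\<And>j. j < m \<Longrightarrow> (\<lambda>k. cs k j) \<longlonglongrightarrow> c j" and j: "j < m"
    have "(\<lambda>k. NP p lebesgue (\<lambda>x. jet (u (cs k)) x - jet (u c) x)) \<longlonglongrightarrow> 0"
    proof (rule Lim_null_comparison[OF always_eventually[OF allI]])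
      fix k
      have "NP p lebesgue (\<lambda>x. jet (u (cs k)) x - jet (u c) x) \<le>
         (\<integral>x. real m powr (p - 1) * (\<Sum>i<m. \<bar>cs k i - c i\<bar> powr p * norm (jet (\<omega> i) x) powr p) \<partial>lebesgue)"
        unfolding NP_def
      proof (rule integral_mono)
        show "integrable lebesgue (\<lambda>x. norm (jet (u (cs k)) x - jet (u c) x) powr p)"
          by (rule LP_integrable[OF LP_diff(1)[OF p0 test_fun_LP(1)[OF u p0] test_fun_LP(1)[OF u p0]]])
        show "integrable lebesgue (\<lambda>x. real m powr (p - 1) * (\<Sum>i<m. \<bar>cs k i - c i\<bar> powr p * norm (jet (\<omega> i) x) powr p))"
          using LP_integrable[OF test_fun_LP(1)[OF \<omega> p0]] by auto
        fix x
        have "norm (jet (u (cs k)) x - jet (u c) x) = norm (\<Sum>i<m. (cs k i - c i) *\<^sub>R jet (\<omega> i) x)"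
          by (simp add: ju scaleR_left_diff_distrib sum_subtractf)
        also have "\<dots> \<le> (\<Sum>i<m. \<bar>cs k i - c i\<bar> * norm (jet (\<omega> i) x))"
          using norm_sum[of "\<lambda>i. (cs k i - c i) *\<^sub>R jet (\<omega> i) x" "{..<m}"] by simp
        finally have "norm (jet (u (cs k)) x - jet (u c) x) powr p \<le> (\<Sum>i<m. \<bar>cs k i - c i\<bar> * norm (jet (\<omega> i) x)) powr p"
          using p0 by (intro powr_mono2) auto
        also have "\<dots> \<le> real m powr (p - 1) * (\<Sum>i<m. (\<bar>cs k i - c i\<bar> * norm (jet (\<omega> i) x)) powr p)"
          using powr_sum_le[OF p, of "{..<m}"] by simp
        finally show "norm (jet (u (cs k)) x - jet (u c) x) powr p \<le> real m powr (p - 1) * (\<Sum>i<m. \<bar>cs k i - c i\<bar> powr p * norm (jet (\<omega> i) x) powr p)"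
          by (simp add: powr_mult)
      qed
      also have "\<dots> = real m powr (p - 1) * (\<Sum>i<m. \<bar>cs k i - c i\<bar> powr p * NP p lebesgue (jet (\<omega> i)))"
        using LP_integrable[OF test_fun_LP(1)[OF \<omega> p0]] by (simp add: NP_def)
      finally show "norm (NP p lebesgue (\<lambda>x. jet (u (cs k)) x - jet (u c) x)) \<le>
          real m powr (p - 1) * (\<Sum>i<m. \<bar>cs k i - c i\<bar> powr p * NP p lebesgue (jet (\<omega> i)))"
        by simp
    next
      have "(\<lambda>k. \<bar>cs k i - c i\<bar> powr p) \<longlonglongrightarrow> 0" if "i < m" for i
        using norm_powr_tendsto_zero_iff[OF p0, of "\<lambda>k. cs k i - c i"] cs[OF that] by (simp add: LIM_zero_iff)
      hence "(\<lambda>k. real m powr (p - 1) * (\<Sum>i<m. \<bar>cs k i - c i\<bar> powr p * NP p lebesgue (jet (\<omega> i)))) \<longlonglongrightarrow>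
         real m powr (p - 1) * (\<Sum>i<m. 0 * NP p lebesgue (jet (\<omega> i)))"
        by (intro tendsto_mult tendsto_sum tendsto_const) auto
      thus "(\<lambda>k. real m powr (p - 1) * (\<Sum>i<m. \<bar>cs k i - c i\<bar> powr p * NP p lebesgue (jet (\<omega> i)))) \<longlonglongrightarrow> 0" by simp
    qed
    thus "(\<lambda>k. pairing (jet (u (cs k))) (jet (\<omega> j)) + e * cs k j) \<longlonglongrightarrow> pairing (jet (u c)) (jet (\<omega> j)) + e * c j"
      by (intro tendsto_add tendsto_mult tendsto_const cs[OF j] pairing_tendsto_left XW_jet u \<omega>)
  next
    fix c and i :: nat assume i: "i < m" "\<bar>c i\<bar> = R"
    have "(\<Sum>j<m. (pairing (jet (u c)) (jet (\<omega> j)) + e * c j) * c j) =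
       (\<Sum>j<m. c j * pairing (jet (u c)) (jet (\<omega> j))) + e * (\<Sum>j<m. (c j)\<^sup>2)"
      by (simp add: algebra_simps sum.distrib sum_distrib_left power2_eq_square)
    also have "(\<Sum>j<m. c j * pairing (jet (u c)) (jet (\<omega> j))) = pairing (jet (u c)) (jet (u c))"
      using pairing_jet_sum[OF XW_jet[OF u] \<omega>, where c = c and m = m] by (simp add: u_def[abs_def])
    finally have eq: "(\<Sum>j<m. (pairing (jet (u c)) (jet (\<omega> j)) + e * c j) * c j) =
       pairing (jet (u c)) (jet (u c)) + e * (\<Sum>j<m. (c j)\<^sup>2)" .
    have "R\<^sup>2 = (c i)\<^sup>2" using i(2) by (metis power2_abs)
    also have "\<dots> \<le> (\<Sum>j<m. (c j)\<^sup>2)" using i(1) by (intro member_le_sum) auto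
    finally have "e * R\<^sup>2 \<le> e * (\<Sum>j<m. (c j)\<^sup>2)" using e by (intro mult_left_mono) auto
    moreover have "- C \<le> pairing (jet (u c)) (jet (u c))"
    proof -
      have "0 \<le> \<alpha> / 2 * NP p lebesgue (grad (u c))" using \<alpha> by simp
      thus ?thesis using C(2)[OF u, of c] by linarith
    qed
    ultimately show "0 < (\<Sum>j<m. (pairing (jet (u c)) (jet (\<omega> j)) + e * c j) * c j)"
      unfolding eq using R(2) by linarith
  qed blast
  thus ?thesis unfolding u_def[abs_def] by blast
qed

text \<open>Testing the regularised system with its own solution gives the residual
  \<open>- e m\<close> times the squared length of the coefficient vector. This yields the sign, the
  gradient bound and, by coercivity, a bound \<open>C\<close> for \<open>e m\<close> times that
  squared length. Hence the residual against each \<open>\<omega> j\<close> is at most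
  \<open>sqrt (C * e m)\<close>. Each \<open>u l\<close> is a finite combination of the
  \<open>\<omega> j\<close>, so its pairings vanish in the limit too.\<close>

lemma galerkin_sequence:
  fixes \<omega> :: "nat \<Rightarrow> real^'n \<Rightarrow> real"
  assumes \<omega>: "\<And>j. test_fun \<Omega> (\<omega> j)"
  shows "\<exists>u G. (\<forall>m. test_fun \<Omega> (u m)) \<and> (\<forall>m. NP p lebesgue (grad (u m)) \<le> G) \<and> (\<forall>m. pairing (jet (u m)) (jet (u m)) \<le> 0)
     \<and> (\<forall>j. (\<lambda>m. pairing (jet (u m)) (jet (\<omega> j))) \<longlonglongrightarrow> 0) \<and> (\<forall>l. (\<lambda>m. pairing (jet (u m)) (jet (u l))) \<longlonglongrightarrow> 0)"
proof -
  obtain C where C: "C \<ge> 0" "\<And>v. test_fun \<Omega> v \<Longrightarrow> \<alpha> / 2 * NP p lebesgue (grad v) - C \<le> pairing (jet v) (jet v)"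
    using pairing_coercive by blast
  define e where "e m = inverse (real (Suc m))" for m
  have e: "e m > 0" for m by (simp add: e_def)
  have "\<forall>m. \<exists>c. \<forall>j<m. pairing (jet (\<lambda>x. \<Sum>i<m. c i * \<omega> i x)) (jet (\<omega> j)) + e m * c j = 0"
    by (intro allI galerkin_solution[OF \<omega> e])
  from choice[OF this] obtain c where "\<forall>m. \<forall>j<m. pairing (jet (\<lambda>x. \<Sum>i<m. c m i * \<omega> i x)) (jet (\<omega> j)) + e m * c m j = 0" ..
  hence c: "pairing (jet (\<lambda>x. \<Sum>i<m. c m i * \<omega> i x)) (jet (\<omega> j)) + e m * c m j = 0" if "j < m" for m j
    using that by blast
  define u where "u m x = (\<Sum>i<m. c m i * \<omega> i x)" for m and x :: "real^'n"
  have u: "test_fun \<Omega> (u m)" for m using test_fun_sum[of m \<Omega> \<omega> "c m"] \<omega> unfolding u_def by blast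
  have cj: "pairing (jet (u m)) (jet (\<omega> j)) = - e m * c m j" if "j < m" for m j
    using c[OF that] by (simp add: u_def[abs_def])
  have uu: "pairing (jet (u m)) (jet (u m)) = - e m * (\<Sum>j<m. (c m j)\<^sup>2)" for m
  proof -
    have "pairing (jet (u m)) (jet (u m)) = (\<Sum>j<m. c m j * pairing (jet (u m)) (jet (\<omega> j)))"
      using pairing_jet_sum[OF XW_jet[OF u] \<omega>, where c = "c m" and m = m] by (simp add: u_def[abs_def])
    also have "\<dots> = (\<Sum>j<m. c m j * (- e m * c m j))" using cj by (intro sum.cong) auto
    also have "\<dots> = - e m * (\<Sum>j<m. (c m j)\<^sup>2)" by (simp add: sum_distrib_left power2_eq_square algebra_simps)
    finally show ?thesis .
  qed
  have uu0: "pairing (jet (u m)) (jet (u m)) \<le> 0" for m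
    unfolding uu using e[of m] by (simp add: sum_nonneg)
  have G: "NP p lebesgue (grad (u m)) \<le> 2 * C / \<alpha>" for m
    using C(2)[OF u, of m] uu0[of m] \<alpha> by (simp add: field_simps)
  have small: "e m * (\<Sum>j<m. (c m j)\<^sup>2) \<le> C" for m
  proof -
    have "0 \<le> \<alpha> / 2 * NP p lebesgue (grad (u m))" using \<alpha> by simp
    thus ?thesis using C(2)[OF u, of m] uu[of m] by linarith
  qed
  have lim: "(\<lambda>m. pairing (jet (u m)) (jet (\<omega> j))) \<longlonglongrightarrow> 0" for j
  proof (rule Lim_null_comparison)
    show "eventually (\<lambda>m. norm (pairing (jet (u m)) (jet (\<omega> j))) \<le> sqrt (C * e m)) sequentially"
      using eventually_gt_at_top[of j]
    proof eventually_elim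
      case (elim m)
      have "(c m j)\<^sup>2 \<le> (\<Sum>j<m. (c m j)\<^sup>2)" using elim by (intro member_le_sum) auto
      hence "e m * (c m j)\<^sup>2 \<le> C" using mult_left_mono[of _ _ "e m"] e[of m] small[of m] by (meson less_imp_le order_trans)
      hence "e m * (e m * (c m j)\<^sup>2) \<le> e m * C" using e[of m] by (intro mult_left_mono) auto
      hence "(e m * c m j)\<^sup>2 \<le> C * e m" by (simp add: power2_eq_square algebra_simps)
      hence "\<bar>e m * c m j\<bar> \<le> sqrt (C * e m)" by (rule real_le_rsqrt[of "\<bar>e m * c m j\<bar>", simplified])
      thus ?case using cj[OF elim] by simp
    qed
    have "e \<longlonglongrightarrow> 0" unfolding e_def by (rule LIMSEQ_inverse_real_of_nat)
    hence "(\<lambda>m. sqrt (C * e m)) \<longlonglongrightarrow> sqrt (C * 0)" by (intro tendsto_intros)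
    thus "(\<lambda>m. sqrt (C * e m)) \<longlonglongrightarrow> 0" by simp
  qed
  have "(\<lambda>m. pairing (jet (u m)) (jet (u l))) \<longlonglongrightarrow> 0" for l
  proof -
    have "(\<lambda>m. \<Sum>i<l. c l i * pairing (jet (u m)) (jet (\<omega> i))) \<longlonglongrightarrow> (\<Sum>i<l. c l i * 0)"
      by (intro tendsto_sum tendsto_mult tendsto_const lim)
    moreover have "pairing (jet (u m)) (jet (u l)) = (\<Sum>i<l. c l i * pairing (jet (u m)) (jet (\<omega> i)))" for m
      using pairing_jet_sum[OF XW_jet[OF u] \<omega>, where c = "c l" and m = l] by (simp add: u_def[abs_def])
    ultimately show ?thesis by simp
  qed
  thus ?thesis using u G uu0 lim by (intro exI[of _ u] exI[of _ "2 * C / \<alpha>"]) blast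
qed

end

section \<open>Weak convergence of the gradients\<close>

lemma NP_eq_0_AE:
  assumes "LP p M f" "NP p M f = 0"
  shows "AE x in M. f x = 0"
proof -
  have "AE x in M. norm (f x) powr p = 0"
    using assms integral_nonneg_eq_0_iff_AE[OF LP_integrable[OF assms(1)]] by (simp add: NP_def)
  thus ?thesis by eventually_elim simp
qed

lemma LP_limit_unique:
  assumes p: "0 < p" and "\<And>k. LP p M (f k)" "LP p M g" "LP p M h"
    and "(\<lambda>k. NP p M (\<lambda>x. f k x - g x)) \<longlonglongrightarrow> 0" "(\<lambda>k. NP p M (\<lambda>x. f k x - h x)) \<longlonglongrightarrow> 0"
  shows "AE x in M. g x = h x"
proof -
  have "(\<lambda>k. 2 powr p * (NP p M (\<lambda>x. f k x - g x) + NP p M (\<lambda>x. f k x - h x))) \<longlonglongrightarrow> 2 powr p * (0 + 0)"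
    by (intro tendsto_intros assms)
  moreover have "NP p M (\<lambda>x. g x - h x) \<le> 2 powr p * (NP p M (\<lambda>x. f k x - g x) + NP p M (\<lambda>x. f k x - h x))" for k
    using NP_triangle[OF p assms(3) assms(2)[of k] assms(4)] NP_minus_commute[of p M g "f k"] by simp
  ultimately have "NP p M (\<lambda>x. g x - h x) \<le> 2 powr p * (0 + 0)"
    by (intro LIMSEQ_le_const[of _ "2 powr p * (0 + 0)"] exI[of _ 0] allI impI)
  hence "NP p M (\<lambda>x. g x - h x) = 0" using NP_nonneg[of p M "\<lambda>x. g x - h x"] by simp
  from NP_eq_0_AE[OF LP_diff(1)[OF p assms(3,4)] this] show ?thesis by eventually_elim simp
qed

context leray_lions
begin

text \<open>All constraints in \<open>S k\<close> survive midpoints, and closeness to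
  \<open>u0\<close> up to \<open>1 / Suc k\<close> forces the function part of the limit to be
  \<open>u0\<close>. The property \<open>Q\<close> is a parameter because the argument is run twice:
  with vanishing residuals to obtain the limit, and with a lower bound on a linear functional to
  identify weak limits of gradients.\<close>

lemma mazur_jets:
  assumes u: "\<And>m. test_fun \<Omega> (u m)" and C: "\<And>m. NP p lebesgue (jet (u m)) \<le> C" and u0: "LP p lebesgue u0"
    and lim: "(\<lambda>m. NP p lebesgue (\<lambda>x. u m x - u0 x)) \<longlonglongrightarrow> 0"
    and Q: "\<And>v v'. test_fun \<Omega> v \<Longrightarrow> test_fun \<Omega> v' \<Longrightarrow> Q v \<Longrightarrow> Q v' \<Longrightarrow> Q (\<lambda>x. 1/2 * v x + 1/2 * v' x)"
    and fr: "frequently (\<lambda>m. Q (u m)) sequentially"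
  shows "\<exists>v w. (\<forall>k. test_fun \<Omega> (v k)) \<and> (\<forall>k. Q (v k)) \<and> LP p lebesgue w \<and>
     (\<lambda>k. NP p lebesgue (\<lambda>x. jet (v k) x - w x)) \<longlonglongrightarrow> 0 \<and> (AE x in lebesgue. fst (w x) = u0 x)"
proof -
  define S where "S k = {v. test_fun \<Omega> v \<and> Q v \<and> NP p lebesgue (jet v) \<le> C \<and> NP p lebesgue (\<lambda>x. v x - u0 x) \<le> inverse (real (Suc k))}" for k
  have ex: "\<exists>v g. (\<forall>k. v k \<in> S k) \<and> LP p lebesgue g \<and> (\<lambda>k. NP p lebesgue (\<lambda>x. jet (v k) x - g x)) \<longlonglongrightarrow> 0"
  proof (rule mazur[OF p, of S lebesgue jet C])
    fix k
    have "inverse (real (Suc (Suc k))) \<le> inverse (real (Suc k))" by (intro le_imp_inverse_le) auto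
    from order_trans[OF _ this] show "S (Suc k) \<subseteq> S k" unfolding S_def by blast
    have "eventually (\<lambda>m. NP p lebesgue (\<lambda>x. u m x - u0 x) < inverse (real (Suc k))) sequentially"
      by (rule order_tendstoD(2)[OF lim]) simp
    from frequently_eventually_frequently[OF fr this]
    obtain m where "Q (u m)" "NP p lebesgue (\<lambda>x. u m x - u0 x) < inverse (real (Suc k))" by (blast dest: frequently_ex)
    hence "u m \<in> S k" using u C by (simp add: S_def)
    thus "S k \<noteq> {}" by blast
  next
    fix k v assume "v \<in> S k"
    thus "LP p lebesgue (jet v)" "NP p lebesgue (jet v) \<le> C" using test_fun_LP(1)[OF _ p0] by (auto simp: S_def)
  next
    fix k v v' assume v: "v \<in> S k" "v' \<in> S k"
    hence t: "test_fun \<Omega> v" "test_fun \<Omega> v'" by (auto simp: S_def)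
    let ?m = "\<lambda>x. 1/2 * v x + 1/2 * v' x"
    have "NP p lebesgue (jet ?m) \<le> (NP p lebesgue (jet v) + NP p lebesgue (jet v')) / 2"
      unfolding test_fun_midpoint(2)[OF t] by (rule NP_midpoint[OF p test_fun_LP(1)[OF t(1) p0] test_fun_LP(1)[OF t(2) p0]])
    hence 1: "NP p lebesgue (jet ?m) \<le> C" using v by (auto simp: S_def)
    have e: "(\<lambda>x. ?m x - u0 x) = (\<lambda>x. (1/2) *\<^sub>R ((v x - u0 x) + (v' x - u0 x)))" by (auto simp: field_simps)
    have "NP p lebesgue (\<lambda>x. ?m x - u0 x) \<le> (NP p lebesgue (\<lambda>x. v x - u0 x) + NP p lebesgue (\<lambda>x. v' x - u0 x)) / 2"
      unfolding e by (rule NP_midpoint[OF p LP_diff(1)[OF p0 test_fun_LP(2)[OF t(1) p0] u0] LP_diff(1)[OF p0 test_fun_LP(2)[OF t(2) p0] u0]])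
    moreover have "(a' + b') / 2 \<le> c" if "a' \<le> c" "b' \<le> c" for a' b' c :: real using that by simp
    ultimately have 2: "NP p lebesgue (\<lambda>x. ?m x - u0 x) \<le> inverse (real (Suc k))"
      using v unfolding S_def mem_Collect_eq by (meson order_trans)
    have "?m \<in> S k" using 1 2 test_fun_midpoint(1)[OF t] Q[OF t] v unfolding S_def by blast
    thus "\<exists>l\<in>S k. jet l = (\<lambda>x. (1 / 2) *\<^sub>R (jet v x + jet v' x))" using test_fun_midpoint(2)[OF t] by blast
  qed blast
  then obtain v w where v: "\<And>k. v k \<in> S k" and w: "LP p lebesgue w" and vw: "(\<lambda>k. NP p lebesgue (\<lambda>x. jet (v k) x - w x)) \<longlonglongrightarrow> 0"
    by blast
  have t: "test_fun \<Omega> (v k)" and Qv: "Q (v k)" and small: "NP p lebesgue (\<lambda>x. v k x - u0 x) \<le> inverse (real (Suc k))" for k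
    using v[of k] by (auto simp: S_def)
  have "AE x in lebesgue. fst (w x) = u0 x"
  proof (rule LP_limit_unique[OF p0 test_fun_LP(2)[OF t p0] LP_fst_snd(1)[OF p0 w] u0])
    show "(\<lambda>k. NP p lebesgue (\<lambda>x. v k x - fst (w x))) \<longlonglongrightarrow> 0"
    proof (rule tendsto_sandwich[OF _ _ tendsto_const vw])
      show "\<forall>\<^sub>F k in sequentially. NP p lebesgue (\<lambda>x. v k x - fst (w x)) \<le> NP p lebesgue (\<lambda>x. jet (v k) x - w x)"
        using LP_fst_snd(3)[OF p0 LP_diff(1)[OF p0 test_fun_LP(1)[OF t p0] w]] by (intro always_eventually allI) (simp add: jet_def)
    qed simp
    show "(\<lambda>k. NP p lebesgue (\<lambda>x. v k x - u0 x)) \<longlonglongrightarrow> 0"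
      by (rule tendsto_sandwich[OF _ _ tendsto_const LIMSEQ_inverse_real_of_nat]) (use small in auto)
  qed
  thus ?thesis using t Qv w vw by blast
qed

lemma XW_of_limit:
  assumes "\<And>k. test_fun \<Omega> (v k)" "LP p lebesgue w" "(\<lambda>k. NP p lebesgue (\<lambda>x. jet (v k) x - w x)) \<longlonglongrightarrow> 0"
  shows "XW w"
  unfolding XW_def by (rule X1pI[OF p assms(1)]) (use assms(2,3) in simp_all)

text \<open>Otherwise the lower bound on the integral would be an additional convex constraint in the Mazur argument
  and yield a second gradient of the same limit, which closability excludes.\<close>

lemma grad_weak_upper:
  fixes \<theta> :: "real^'n \<Rightarrow> real^'n"
  assumes u: "\<And>m. test_fun \<Omega> (u m)" and C: "\<And>m. NP p lebesgue (jet (u m)) \<le> C" and w: "LP p lebesgue w"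
    and v: "\<And>k. test_fun \<Omega> (v k)" "(\<lambda>k. NP p lebesgue (\<lambda>x. jet (v k) x - w x)) \<longlonglongrightarrow> 0"
    and lim: "(\<lambda>m. NP p lebesgue (\<lambda>x. u m x - fst (w x))) \<longlonglongrightarrow> 0"
    and \<theta>: "LP q lebesgue \<theta>" and e: "0 < e"
  shows "eventually (\<lambda>m. (\<integral>x. \<theta> x \<bullet> grad (u m) x \<partial>lebesgue) < (\<integral>x. \<theta> x \<bullet> snd (w x) \<partial>lebesgue) + e) sequentially"
proof (rule ccontr)
  define L where "L = (\<integral>x. \<theta> x \<bullet> snd (w x) \<partial>lebesgue)"
  define Q where "Q v \<longleftrightarrow> L + e \<le> (\<integral>x. \<theta> x \<bullet> grad v x \<partial>lebesgue)" for v
  assume "\<not> ?thesis"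
  hence fr: "frequently (\<lambda>m. Q (u m)) sequentially" by (simp add: not_eventually not_less Q_def L_def)
  have Qmid: "Q (\<lambda>x. 1/2 * v x + 1/2 * v' x)" if t: "test_fun \<Omega> v" "test_fun \<Omega> v'" and "Q v" "Q v'" for v v'
  proof -
    have g: "grad (\<lambda>x. 1/2 * v x + 1/2 * v' x) x = (1/2) *\<^sub>R grad v x + (1/2) *\<^sub>R grad v' x" for x
      by (rule grad_lincomb[OF t[THEN test_fun_smooth]])
    have "(\<integral>x. \<theta> x \<bullet> grad (\<lambda>x. 1/2 * v x + 1/2 * v' x) x \<partial>lebesgue) =
        (1/2) * (\<integral>x. \<theta> x \<bullet> grad v x \<partial>lebesgue) + (1/2) * (\<integral>x. \<theta> x \<bullet> grad v' x \<partial>lebesgue)"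
      unfolding g using LP_pair_integrable[OF p \<theta> test_fun_LP(3)[OF t(1) p0]] LP_pair_integrable[OF p \<theta> test_fun_LP(3)[OF t(2) p0]]
      by (simp add: inner_add_right)
    thus ?thesis using that(3,4) unfolding Q_def by simp
  qed
  obtain v' w' where v': "\<And>k. test_fun \<Omega> (v' k)" "\<And>k. Q (v' k)" and w': "LP p lebesgue w'"
    and vw': "(\<lambda>k. NP p lebesgue (\<lambda>x. jet (v' k) x - w' x)) \<longlonglongrightarrow> 0" and fw': "AE x in lebesgue. fst (w' x) = fst (w x)"
    using mazur_jets[OF u C LP_fst_snd(1)[OF p0 w] lim Qmid fr] by blast
  \<comment> \<open>The two approximating sequences have limits with the same function part, so
    their difference tends to 0 in \<open>L^p\<close> while its gradients converge to the difference
    of the limiting gradients. This is the situation of \<open>grad_closable\<close>.\<close>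
  define z where "z k x = v' k x - v k x" for k x
  have z: "test_fun \<Omega> (z k)" "jet (z k) = (\<lambda>x. jet (v' k) x - jet (v k) x)" for k
    unfolding z_def using test_fun_diff[OF v'(1) v(1)] by blast+
  note LPj = test_fun_LP(1)[OF v(1) p0] test_fun_LP(1)[OF v'(1) p0]
  have "(\<lambda>k. 2 powr p * (NP p lebesgue (\<lambda>x. jet (v' k) x - w' x) + NP p lebesgue (\<lambda>x. jet (v k) x - w x))) \<longlonglongrightarrow> 2 powr p * (0 + 0)"
    by (intro tendsto_intros v vw')
  hence zero: "(\<lambda>k. 2 powr p * (NP p lebesgue (\<lambda>x. jet (v' k) x - w' x) + NP p lebesgue (\<lambda>x. jet (v k) x - w x))) \<longlonglongrightarrow> 0" by simp
  have LPz: "LP p lebesgue (\<lambda>x. jet (z k) x - (w' x - w x))" for k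
    unfolding z(2) by (intro LP_diff(1)[OF p0] LPj w w')
  have zw: "(\<lambda>k. NP p lebesgue (\<lambda>x. jet (z k) x - (w' x - w x))) \<longlonglongrightarrow> 0"
  proof (rule tendsto_sandwich[OF _ _ tendsto_const zero])
    have e1: "(\<lambda>x. jet (z k) x - (w' x - w x)) = (\<lambda>x. (jet (v' k) x - w' x) - (jet (v k) x - w x))" for k
      by (simp add: z(2) algebra_simps)
    show "\<forall>\<^sub>F k in sequentially. NP p lebesgue (\<lambda>x. jet (z k) x - (w' x - w x)) \<le>
       2 powr p * (NP p lebesgue (\<lambda>x. jet (v' k) x - w' x) + NP p lebesgue (\<lambda>x. jet (v k) x - w x))"
      unfolding e1 by (intro always_eventually allI LP_diff(2)[OF p0] LP_diff(1)[OF p0] LPj w w')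
  qed simp
  have "AE x in lebesgue. snd (w' x) - snd (w x) = 0"
  proof (rule grad_closable[OF z(1) p bounded_\<Omega>])
    show "LP p lebesgue (\<lambda>x. snd (w' x) - snd (w x))"
      by (intro LP_diff(1)[OF p0] LP_fst_snd(2)[OF p0] w w')
    show "(\<lambda>k. NP p lebesgue (\<lambda>x. grad (z k) x - (snd (w' x) - snd (w x)))) \<longlonglongrightarrow> 0"
    proof (rule tendsto_sandwich[OF _ _ tendsto_const zw])
      show "\<forall>\<^sub>F k in sequentially. NP p lebesgue (\<lambda>x. grad (z k) x - (snd (w' x) - snd (w x))) \<le> NP p lebesgue (\<lambda>x. jet (z k) x - (w' x - w x))"
        using LP_fst_snd(4)[OF p0 LPz] by (intro always_eventually allI) (simp add: jet_def)
    qed simp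
    show "(\<lambda>k. NP p lebesgue (z k)) \<longlonglongrightarrow> 0"
    proof (rule tendsto_sandwich[OF _ _ tendsto_const zw])
      have "NP p lebesgue (z k) = NP p lebesgue (\<lambda>x. fst (jet (z k) x - (w' x - w x)))" for k
      proof (rule NP_cong_AE)
        show "AE x in lebesgue. z k x = fst (jet (z k) x - (w' x - w x))"
          using fw' by eventually_elim (simp add: jet_def)
        show "z k \<in> borel_measurable lebesgue" by (rule LP_measurable[OF test_fun_LP(2)[OF z(1) p0]])
        show "(\<lambda>x. fst (jet (z k) x - (w' x - w x))) \<in> borel_measurable lebesgue"
          by (rule LP_measurable[OF LP_fst_snd(1)[OF p0 LPz]])
      qed
      thus "\<forall>\<^sub>F k in sequentially. NP p lebesgue (z k) \<le> NP p lebesgue (\<lambda>x. jet (z k) x - (w' x - w x))"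
        using LP_fst_snd(3)[OF p0 LPz] by (intro always_eventually allI) simp
    qed simp
  qed
  hence same: "AE x in lebesgue. snd (w' x) = snd (w x)" by eventually_elim simp
  have "(\<lambda>k. \<integral>x. \<theta> x \<bullet> grad (v' k) x \<partial>lebesgue) \<longlonglongrightarrow> (\<integral>x. \<theta> x \<bullet> snd (w' x) \<partial>lebesgue)"
  proof (rule LP_pair_tendsto[OF p \<theta> test_fun_LP(3)[OF v'(1) p0] LP_fst_snd(2)[OF p0 w']])
    show "(\<lambda>k. NP p lebesgue (\<lambda>x. grad (v' k) x - snd (w' x))) \<longlonglongrightarrow> 0"
    proof (rule tendsto_sandwich[OF _ _ tendsto_const vw'])
      show "\<forall>\<^sub>F k in sequentially. NP p lebesgue (\<lambda>x. grad (v' k) x - snd (w' x)) \<le> NP p lebesgue (\<lambda>x. jet (v' k) x - w' x)"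
        using LP_fst_snd(4)[OF p0 LP_diff(1)[OF p0 LPj(2) w']] by (intro always_eventually allI) (simp add: jet_def)
    qed simp
  qed
  hence "L + e \<le> (\<integral>x. \<theta> x \<bullet> snd (w' x) \<partial>lebesgue)"
    by (rule tendsto_lowerbound) (use v'(2) in \<open>auto simp: Q_def\<close>)
  also have "(\<integral>x. \<theta> x \<bullet> snd (w' x) \<partial>lebesgue) = L"
    unfolding L_def
  proof (rule integral_cong_AE)
    show "(\<lambda>x. \<theta> x \<bullet> snd (w' x)) \<in> borel_measurable lebesgue"
      using LP_pair_integrable[OF p \<theta> LP_fst_snd(2)[OF p0 w']] by (rule borel_measurable_integrable)
    show "(\<lambda>x. \<theta> x \<bullet> snd (w x)) \<in> borel_measurable lebesgue"
      using LP_pair_integrable[OF p \<theta> LP_fst_snd(2)[OF p0 w]] by (rule borel_measurable_integrable)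
    show "AE x in lebesgue. \<theta> x \<bullet> snd (w' x) = \<theta> x \<bullet> snd (w x)" using same by eventually_elim simp
  qed
  finally show False using e by simp
qed

lemma grad_weak_tendsto:
  fixes \<theta> :: "real^'n \<Rightarrow> real^'n"
  assumes u: "\<And>m. test_fun \<Omega> (u m)" and C: "\<And>m. NP p lebesgue (jet (u m)) \<le> C" and w: "LP p lebesgue w"
    and v: "\<And>k. test_fun \<Omega> (v k)" "(\<lambda>k. NP p lebesgue (\<lambda>x. jet (v k) x - w x)) \<longlonglongrightarrow> 0"
    and lim: "(\<lambda>m. NP p lebesgue (\<lambda>x. u m x - fst (w x))) \<longlonglongrightarrow> 0"
    and \<theta>: "LP q lebesgue \<theta>"
  shows "(\<lambda>m. \<integral>x. \<theta> x \<bullet> grad (u m) x \<partial>lebesgue) \<longlonglongrightarrow> (\<integral>x. \<theta> x \<bullet> snd (w x) \<partial>lebesgue)"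
proof (rule LIMSEQ_I)
  fix e :: real assume e: "0 < e"
  have "eventually (\<lambda>m. \<bar>(\<integral>x. \<theta> x \<bullet> grad (u m) x \<partial>lebesgue) - (\<integral>x. \<theta> x \<bullet> snd (w x) \<partial>lebesgue)\<bar> < e) sequentially"
    using grad_weak_upper[OF u C w v lim \<theta> e] grad_weak_upper[OF u C w v lim LP_minus[OF \<theta>] e]
    by eventually_elim (simp add: abs_less_iff)
  thus "\<exists>no. \<forall>n\<ge>no. norm ((\<integral>x. \<theta> x \<bullet> grad (u n) x \<partial>lebesgue) - (\<integral>x. \<theta> x \<bullet> snd (w x) \<partial>lebesgue)) < e"
    by (simp add: eventually_sequentially)
qed

text \<open>The limit is replaced by a nearby \<open>v k\<close>, against which the residual is
  known to vanish asymptotically; the error is small since the fields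
  \<open>a(x, u_m, grad u_m)\<close> are bounded in the dual exponent. In the residual against
  \<open>u_m - v k\<close> the \<open>F\<close> term is controlled by \<open>f\<close> and distances
  to the limit function, and convexity bounds the nonlocal term from below by an energy difference,
  where Fatou's lemma handles \<open>u_m\<close> and continuity handles \<open>v k\<close>.\<close>

lemma energy_limsup:
  assumes u: "\<And>m. test_fun \<Omega> (u m)" and C: "\<And>m. NP p lebesgue (jet (u m)) \<le> C" and w: "LP p lebesgue w"
    and v: "\<And>k. test_fun \<Omega> (v k)" "(\<lambda>k. NP p lebesgue (\<lambda>x. jet (v k) x - w x)) \<longlonglongrightarrow> 0"
    and lim: "(\<lambda>m. NP p lebesgue (\<lambda>x. u m x - fst (w x))) \<longlonglongrightarrow> 0"
    and ae: "AE x in lebesgue. (\<lambda>m. u m x) \<longlonglongrightarrow> fst (w x)"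
    and uu: "\<And>m. pairing (jet (u m)) (jet (u m)) \<le> 0"
    and uv: "\<And>k. (\<lambda>m. pairing (jet (u m)) (jet (v k))) \<longlonglongrightarrow> 0"
    and \<eta>: "0 < \<eta>"
  shows "eventually (\<lambda>m. (\<integral>x. a x (jet (u m) x) \<bullet> (grad (u m) x - snd (w x)) \<partial>lebesgue) < \<eta>) sequentially"
proof -
  have C0: "C \<ge> 0" using C[of 0] NP_nonneg order_trans by blast
  have W: "XW w" by (rule XW_of_limit[OF v(1) w v(2)])
  define B where "B = 2 powr q * ((2 * \<beta>) powr q * C)"
  have B0: "B \<ge> 0" unfolding B_def using C0 by simp
  have aLP: "LP q lebesgue (\<lambda>x. a x (jet (u m) x))" for m by (rule a_nemytskii(1)[OF test_fun_LP(1)[OF u p0]])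
  have aB: "NP q lebesgue (\<lambda>x. a x (jet (u m) x)) \<le> B" for m
  proof -
    have "NP q lebesgue (\<lambda>x. a x (jet (u m) x)) \<le> 2 powr q * ((2 * \<beta>) powr q * NP p lebesgue (jet (u m)))"
      by (rule a_nemytskii(2)[OF test_fun_LP(1)[OF u p0]])
    also have "\<dots> \<le> B" unfolding B_def by (intro mult_left_mono C) auto
    finally show ?thesis .
  qed
  \<comment> \<open>Seven contributions are balanced: one from the residual, two from
    \<open>F\<close>, two from the nonlocal energies and two from Young's inequality for the
    replacement error.\<close>
  define \<delta> where "\<delta> = \<eta> / 7"
  have \<delta>: "\<delta> > 0" using \<eta> by (simp add: \<delta>_def)
  define e where "e = \<delta> / (B + 1)"
  have e: "e > 0" "e * B \<le> \<delta>" using \<delta> B0 by (auto simp: e_def field_simps)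
  obtain K where K: "0 < K" "\<And>s t. 0 \<le> s \<Longrightarrow> 0 \<le> t \<Longrightarrow> s * t \<le> e * s powr q + K * t powr p"
    using young_right[OF p e(1)] by blast
  have vg: "(\<lambda>k. NP p lebesgue (\<lambda>x. grad (v k) x - snd (w x))) \<longlonglongrightarrow> 0"
  proof (rule tendsto_sandwich[OF _ _ tendsto_const v(2)])
    show "\<forall>\<^sub>F k in sequentially. NP p lebesgue (\<lambda>x. grad (v k) x - snd (w x)) \<le> NP p lebesgue (\<lambda>x. jet (v k) x - w x)"
      using LP_fst_snd(4)[OF p0 LP_diff(1)[OF p0 test_fun_LP(1)[OF v(1) p0] w]] by (intro always_eventually allI) (simp add: jet_def)
  qed simp
  have vf: "(\<lambda>k. NP p lebesgue (\<lambda>x. v k x - fst (w x))) \<longlonglongrightarrow> 0"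
  proof (rule tendsto_sandwich[OF _ _ tendsto_const v(2)])
    show "\<forall>\<^sub>F k in sequentially. NP p lebesgue (\<lambda>x. v k x - fst (w x)) \<le> NP p lebesgue (\<lambda>x. jet (v k) x - w x)"
      using LP_fst_snd(3)[OF p0 LP_diff(1)[OF p0 test_fun_LP(1)[OF v(1) p0] w]] by (intro always_eventually allI) (simp add: jet_def)
  qed simp
  note LPd = LP_diff(1)[OF p0 test_fun_LP(2)[OF v(1) p0] LP_fst_snd(1)[OF p0 w]]
    LP_diff(1)[OF p0 test_fun_LP(2)[OF u p0] LP_fst_snd(1)[OF p0 w]]
  have "(\<lambda>k. \<integral>x. norm (f x) * norm (v k x - fst (w x)) \<partial>lebesgue) \<longlonglongrightarrow> 0"
    by (rule LP_pair_tendsto_right(1)[OF p f_LP order_refl LPd(1) vf])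
  hence ev1: "eventually (\<lambda>k. (\<integral>x. norm (f x) * norm (v k x - fst (w x)) \<partial>lebesgue) < \<delta>) sequentially"
    using \<delta> by (rule order_tendstoD(2))
  have "(\<lambda>k. NP p \<nu> (wincr (jet (v k)))) \<longlonglongrightarrow> NP p \<nu> (wincr w)"
    by (rule NP_tendsto[OF p0 XW_incr[OF XW_jet[OF v(1)]] XW_incr[OF W] XW_incr_tendsto[OF W XW_jet[OF v(1)] v(2)]])
  hence ev2: "eventually (\<lambda>k. NP p \<nu> (wincr (jet (v k))) < NP p \<nu> (wincr w) + p * \<delta>) sequentially"
    using \<delta> p0 by (intro order_tendstoD(2)) auto
  have "(\<lambda>k. K * NP p lebesgue (\<lambda>x. grad (v k) x - snd (w x))) \<longlonglongrightarrow> K * 0" by (intro tendsto_mult tendsto_const vg)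
  hence ev3: "eventually (\<lambda>k. K * NP p lebesgue (\<lambda>x. grad (v k) x - snd (w x)) < \<delta>) sequentially"
    using \<delta> by (intro order_tendstoD(2)) auto
  \<comment> \<open>The approximant is frozen here; only afterwards does \<open>m\<close> tend to
    infinity, since the residual vanishes for each fixed \<open>k\<close> without
    uniformity.\<close>
  obtain k where k: "(\<integral>x. norm (f x) * norm (v k x - fst (w x)) \<partial>lebesgue) < \<delta>"
    "NP p \<nu> (wincr (jet (v k))) < NP p \<nu> (wincr w) + p * \<delta>" "K * NP p lebesgue (\<lambda>x. grad (v k) x - snd (w x)) < \<delta>"
    using eventually_happens'[OF sequentially_bot eventually_conj[OF ev1 eventually_conj[OF ev2 ev3]]] by blast
  have ev4: "eventually (\<lambda>m. - \<delta> < pairing (jet (u m)) (jet (v k))) sequentially"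
    using \<delta> by (intro order_tendstoD(1)[OF uv]) auto
  have "(\<lambda>m. \<integral>x. norm (f x) * norm (u m x - fst (w x)) \<partial>lebesgue) \<longlonglongrightarrow> 0"
    by (rule LP_pair_tendsto_right(1)[OF p f_LP order_refl LPd(2) lim])
  hence ev5: "eventually (\<lambda>m. (\<integral>x. norm (f x) * norm (u m x - fst (w x)) \<partial>lebesgue) < \<delta>) sequentially"
    using \<delta> by (rule order_tendstoD(2))
  have ev6: "eventually (\<lambda>m. NP p \<nu> (wincr w) - p * \<delta> \<le> NP p \<nu> (wincr (jet (u m)))) sequentially"
  proof (rule NP_eventually_ge[OF p0 XW_incr[OF XW_jet[OF u]]])
    show "wincr w \<in> borel_measurable \<nu>" by (rule LP_measurable[OF XW_incr[OF W]])
    show "AE z in \<nu>. (\<lambda>m. wincr (jet (u m)) z) \<longlonglongrightarrow> wincr w z"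
      using AE_frac_measure[OF ae] by eventually_elim (auto simp: wincr_def incr_def jet_def intro!: tendsto_diff)
    show "0 < p * \<delta>" using p0 \<delta> by simp
  qed
  have main: "(\<integral>x. a x (jet (u m) x) \<bullet> (grad (u m) x - snd (w x)) \<partial>lebesgue) \<le>
      - pairing (jet (u m)) (jet (v k)) + ((\<integral>x. norm (f x) * norm (u m x - fst (w x)) \<partial>lebesgue) + (\<integral>x. norm (f x) * norm (v k x - fst (w x)) \<partial>lebesgue))
      + (NP p \<nu> (wincr (jet (v k))) - NP p \<nu> (wincr (jet (u m)))) / p + (e * B + K * NP p lebesgue (\<lambda>x. grad (v k) x - snd (w x)))" for m
  proof -
    note jLP = test_fun_LP(1)[OF u p0, of m] test_fun_LP(1)[OF v(1) p0, of k]
    note gLP = test_fun_LP(3)[OF u p0, of m] test_fun_LP(3)[OF v(1) p0, of k] LP_fst_snd(2)[OF p0 w]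
    define A1 where "A1 = (\<integral>x. a x (jet (u m) x) \<bullet> (grad (u m) x - grad (v k) x) \<partial>lebesgue)"
    define A2 where "A2 = (\<integral>x. a x (jet (u m) x) \<bullet> (grad (v k) x - snd (w x)) \<partial>lebesgue)"
    define Ju where "Ju = (\<integral>z. signed_powr p (wincr (jet (u m)) z) \<bullet> wincr (\<lambda>x. jet (u m) x - jet (v k) x) z \<partial>\<nu>)"
    define Bu where "Bu = (\<integral>x. b x (jet (u m) x) \<bullet> (jet (u m) x - jet (v k) x) \<partial>lebesgue)"
    have split: "(\<integral>x. a x (jet (u m) x) \<bullet> (grad (u m) x - snd (w x)) \<partial>lebesgue) = A1 + A2"
    proof -
      have "(\<integral>x. a x (jet (u m) x) \<bullet> (grad (u m) x - snd (w x)) \<partial>lebesgue) =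
         (\<integral>x. a x (jet (u m) x) \<bullet> (grad (u m) x - grad (v k) x) + a x (jet (u m) x) \<bullet> (grad (v k) x - snd (w x)) \<partial>lebesgue)"
        by (simp flip: inner_add_right)
      also have "\<dots> = A1 + A2" unfolding A1_def A2_def
        by (intro Bochner_Integration.integral_add LP_pair_integrable[OF p aLP] LP_diff(1)[OF p0] gLP)
      finally show ?thesis .
    qed
    have A2: "A2 \<le> e * B + K * NP p lebesgue (\<lambda>x. grad (v k) x - snd (w x))"
    proof -
      have "A2 \<le> e * NP q lebesgue (\<lambda>x. a x (jet (u m) x)) + K * NP p lebesgue (\<lambda>x. grad (v k) x - snd (w x))"
        unfolding A2_def using LP_pair_le[OF p aLP LP_diff(1)[OF p0 gLP(2,3)] K(2), of m] by (simp add: abs_le_iff)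
      also have "e * NP q lebesgue (\<lambda>x. a x (jet (u m) x)) \<le> e * B" using e(1) by (intro mult_left_mono aB) auto
      finally show ?thesis by simp
    qed
    have "pairing (jet (u m)) (jet (\<lambda>x. 1 * u m x + (- 1) * v k x)) = 1 * pairing (jet (u m)) (jet (u m)) + (- 1) * pairing (jet (u m)) (jet (v k))"
      by (rule pairing_jet_lincomb[OF XW_jet[OF u] u v(1)])
    moreover have "jet (\<lambda>x. 1 * u m x + (- 1) * v k x) = (\<lambda>x. jet (u m) x - jet (v k) x)"
      using test_fun_diff(2)[OF u v(1), of m k] by simp
    ultimately have P: "Bu + Ju \<le> - pairing (jet (u m)) (jet (v k))"
      using uu[of m] by (simp add: pairing_def Bu_def Ju_def)
    have J: "(NP p \<nu> (wincr (jet (u m))) - NP p \<nu> (wincr (jet (v k)))) / p \<le> Ju"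
    proof -
      note ULP = XW_incr[OF XW_jet[OF u], of m] XW_incr[OF XW_jet[OF v(1)], of k]
      have wd: "wincr (\<lambda>x. jet (u m) x - jet (v k) x) = (\<lambda>z. wincr (jet (u m)) z - wincr (jet (v k)) z)"
        by (auto simp: wincr_def incr_def)
      have "(NP p \<nu> (wincr (jet (u m))) - NP p \<nu> (wincr (jet (v k)))) / p =
         (\<integral>z. (norm (wincr (jet (u m)) z) powr p - norm (wincr (jet (v k)) z) powr p) / p \<partial>\<nu>)"
        using LP_integrable[OF ULP(1)] LP_integrable[OF ULP(2)] by (simp add: NP_def)
      also have "\<dots> \<le> Ju"
        unfolding Ju_def wd
      proof (rule integral_mono)
        show "integrable \<nu> (\<lambda>z. (norm (wincr (jet (u m)) z) powr p - norm (wincr (jet (v k)) z) powr p) / p)"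
          using LP_integrable[OF ULP(1)] LP_integrable[OF ULP(2)] by auto
        show "integrable \<nu> (\<lambda>z. signed_powr p (wincr (jet (u m)) z) \<bullet> (wincr (jet (u m)) z - wincr (jet (v k)) z))"
          by (rule LP_pair_integrable[OF p J_nemytskii(1)[OF ULP(1)] LP_diff(1)[OF p0 ULP]])
      qed (use signed_powr_convexity[OF p] in simp)
      finally show ?thesis .
    qed
    have Bb: "A1 - ((\<integral>x. norm (f x) * norm (u m x - fst (w x)) \<partial>lebesgue) + (\<integral>x. norm (f x) * norm (v k x - fst (w x)) \<partial>lebesgue)) \<le> Bu"
    proof -
      note I = LP_pair_integrable[OF p aLP LP_diff(1)[OF p0 gLP(1,2)], of m]
        LP_pair_norm_integrable[OF p f_LP LPd(2), of m] LP_pair_norm_integrable[OF p f_LP LPd(1), of k]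
      have "A1 - ((\<integral>x. norm (f x) * norm (u m x - fst (w x)) \<partial>lebesgue) + (\<integral>x. norm (f x) * norm (v k x - fst (w x)) \<partial>lebesgue)) =
        (\<integral>x. a x (jet (u m) x) \<bullet> (grad (u m) x - grad (v k) x) - (norm (f x) * norm (u m x - fst (w x)) + norm (f x) * norm (v k x - fst (w x))) \<partial>lebesgue)"
        unfolding A1_def using I by simp
      also have "\<dots> \<le> Bu"
        unfolding Bu_def
      proof (rule integral_mono)
        show "integrable lebesgue (\<lambda>x. a x (jet (u m) x) \<bullet> (grad (u m) x - grad (v k) x) - (norm (f x) * norm (u m x - fst (w x)) + norm (f x) * norm (v k x - fst (w x))))"
          using I by auto
        show "integrable lebesgue (\<lambda>x. b x (jet (u m) x) \<bullet> (jet (u m) x - jet (v k) x))"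
          by (rule LP_pair_integrable[OF p b_nemytskii(1)[OF jLP(1)] LP_diff(1)[OF p0 jLP]])
        fix x
        have "F x (jet (u m) x) * (u m x - v k x) \<le> norm (f x) * norm (u m x - v k x)"
        proof -
          have "F x (jet (u m) x) * (u m x - v k x) \<le> \<bar>F x (jet (u m) x)\<bar> * \<bar>u m x - v k x\<bar>" by (metis abs_ge_self abs_mult)
          also have "\<dots> \<le> norm (f x) * norm (u m x - v k x)"
            using F_bound[of x "jet (u m) x"] f_nonneg[of x] by (intro mult_mono) auto
          finally show ?thesis .
        qed
        also have "\<dots> \<le> norm (f x) * (norm (u m x - fst (w x)) + norm (v k x - fst (w x)))"
          by (intro mult_left_mono) auto
        finally have "F x (jet (u m) x) * (u m x - v k x) \<le> norm (f x) * norm (u m x - fst (w x)) + norm (f x) * norm (v k x - fst (w x))"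
          by (simp add: distrib_left)
        moreover have "b x (jet (u m) x) \<bullet> (jet (u m) x - jet (v k) x) =
           a x (jet (u m) x) \<bullet> (grad (u m) x - grad (v k) x) - F x (jet (u m) x) * (u m x - v k x)"
          by (simp add: b_def jet_def)
        ultimately show "a x (jet (u m) x) \<bullet> (grad (u m) x - grad (v k) x) - (norm (f x) * norm (u m x - fst (w x)) + norm (f x) * norm (v k x - fst (w x)))
            \<le> b x (jet (u m) x) \<bullet> (jet (u m) x - jet (v k) x)" by linarith
      qed
      finally show ?thesis .
    qed
    have neg: "(NP p \<nu> (wincr (jet (u m))) - NP p \<nu> (wincr (jet (v k)))) / p = - ((NP p \<nu> (wincr (jet (v k))) - NP p \<nu> (wincr (jet (u m)))) / p)"
      by (simp add: diff_divide_distrib)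
    show ?thesis using split A2 P J[unfolded neg] Bb by linarith
  qed
  show ?thesis
    using ev4 ev5 ev6
  proof eventually_elim
    case (elim m)
    have "NP p \<nu> (wincr (jet (v k))) - NP p \<nu> (wincr (jet (u m))) \<le> 2 * \<delta> * p"
      using elim(3) k(2) by (simp add: algebra_simps)
    hence "(NP p \<nu> (wincr (jet (v k))) - NP p \<nu> (wincr (jet (u m)))) / p \<le> 2 * \<delta>"
      using p0 by (simp add: pos_divide_le_eq)
    with main[of m] elim(1,2) k(1,3) e(2)
    have "(\<integral>x. a x (jet (u m) x) \<bullet> (grad (u m) x - snd (w x)) \<partial>lebesgue) < 7 * \<delta>" by linarith
    thus ?case by (simp add: \<delta>_def)
  qed
qed

end

section \<open>Strong convergence and the solution\<close>

context leray_lions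
begin

text \<open>The nonnegative monotonicity expressions \<open>D m\<close> have integrals tending to 0:
  the energy estimate bounds one half from above, and weak convergence of the gradients disposes of
  the other. A subsequence of \<open>D m\<close> is therefore dominated and tends to 0 almost
  everywhere. Strict monotonicity turns this into pointwise convergence of the gradients, and
  \<open>gradient_growth_bound\<close> turns the majorant of \<open>D m\<close> into one for the
  gradients.\<close>

lemma strong_convergence:
  assumes u: "\<And>m. test_fun \<Omega> (u m)" and C: "\<And>m. NP p lebesgue (jet (u m)) \<le> C" and w: "LP p lebesgue w"
    and v: "\<And>k. test_fun \<Omega> (v k)" "(\<lambda>k. NP p lebesgue (\<lambda>x. jet (v k) x - w x)) \<longlonglongrightarrow> 0"
    and lim: "(\<lambda>m. NP p lebesgue (\<lambda>x. u m x - fst (w x))) \<longlonglongrightarrow> 0"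
    and uu: "\<And>m. pairing (jet (u m)) (jet (u m)) \<le> 0"
    and uv: "\<And>k. (\<lambda>m. pairing (jet (u m)) (jet (v k))) \<longlonglongrightarrow> 0"
  shows "\<exists>r. strict_mono (r :: nat \<Rightarrow> nat) \<and> (\<lambda>k. NP p lebesgue (\<lambda>x. jet (u (r k)) x - w x)) \<longlonglongrightarrow> 0"
proof -
  note LPu = test_fun_LP(1-3)[OF u p0]
  note wf = LP_fst_snd(1)[OF p0 w] and ws = LP_fst_snd(2)[OF p0 w]
  have q0: "0 < q" using p by simp
  \<comment> \<open>Coercivity and strict monotonicity are available only on \<open>E\<close>. Off
    the domain all jets vanish, and so does the limit, which settles convergence there
    directly.\<close>
  have out: "AE x in lebesgue. x \<notin> \<Omega> \<longrightarrow> w x = 0"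
  proof -
    obtain r H where "AE x in lebesgue. (\<forall>k. norm (jet (v (r k)) x) powr p \<le> H x) \<and> (\<lambda>k. jet (v (r k)) x) \<longlonglongrightarrow> w x"
      by (rule LP_dominated_subseq[OF p0 test_fun_LP(1)[OF v(1) p0] w v(2)])
    thus ?thesis
    proof eventually_elim
      case (elim x)
      show ?case
      proof
        assume "x \<notin> \<Omega>"
        hence "(\<lambda>k. jet (v (r k)) x) = (\<lambda>k. 0)" using test_fun_jet_outside(1)[OF v(1)] by blast
        thus "w x = 0" using elim by (simp add: LIMSEQ_const_iff)
      qed
    qed
  qed
  have "\<exists>r H. strict_mono (r :: nat \<Rightarrow> nat) \<and> integrable lebesgue H \<and>
     (AE x in lebesgue. (\<forall>k. norm (u (r k) x) powr p \<le> H x) \<and> (\<lambda>k. u (r k) x) \<longlonglongrightarrow> fst (w x))"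
    by (rule LP_dominated_subseq[OF p0 LPu(2) wf lim]) blast
  then obtain r1 H1 where r1: "strict_mono (r1 :: nat \<Rightarrow> nat)" and H1: "integrable lebesgue H1"
    and ae1: "AE x in lebesgue. (\<forall>k. norm (u (r1 k) x) powr p \<le> H1 x) \<and> (\<lambda>k. u (r1 k) x) \<longlonglongrightarrow> fst (w x)" by blast
  define us where "us k = u (r1 k)" for k
  have us: "test_fun \<Omega> (us k)" and usC: "NP p lebesgue (jet (us k)) \<le> C" for k using u C by (simp_all add: us_def)
  have uslim: "(\<lambda>m. NP p lebesgue (\<lambda>x. us m x - fst (w x))) \<longlonglongrightarrow> 0"
    unfolding us_def using LIMSEQ_subseq_LIMSEQ[OF lim r1] by (simp add: o_def)
  have usuv: "(\<lambda>m. pairing (jet (us m)) (jet (v k))) \<longlonglongrightarrow> 0" for k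
    unfolding us_def using LIMSEQ_subseq_LIMSEQ[OF uv[of k] r1] by (simp add: o_def)
  have usuu: "pairing (jet (us m)) (jet (us m)) \<le> 0" for m using uu by (simp add: us_def)
  have usae: "AE x in lebesgue. (\<lambda>m. us m x) \<longlonglongrightarrow> fst (w x)" using ae1 by eventually_elim (simp add: us_def)
  note LPus = test_fun_LP(1-3)[OF us p0]
  define d where "d m x = grad (us m) x - snd (w x)" for m x
  have dLP: "LP p lebesgue (d m)" for m unfolding d_def by (intro LP_diff(1)[OF p0] LPus ws)
  have dB: "NP p lebesgue (d m) \<le> 2 powr p * (C + NP p lebesgue (\<lambda>x. snd (w x)))" for m
  proof -
    have "NP p lebesgue (grad (us m)) \<le> NP p lebesgue (jet (us m))"
      using LP_fst_snd(4)[OF p0 LPus(1), of m] by (simp add: jet_def)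
    hence "NP p lebesgue (grad (us m)) \<le> C" using usC[of m] by linarith
    hence "2 powr p * (NP p lebesgue (grad (us m)) + NP p lebesgue (\<lambda>x. snd (w x))) \<le> 2 powr p * (C + NP p lebesgue (\<lambda>x. snd (w x)))"
      by (intro mult_left_mono add_right_mono) auto
    with LP_diff(2)[OF p0 LPus(3) ws, of m] show ?thesis unfolding d_def by linarith
  qed
  define w' where "w' m x = (us m x, snd (w x))" for m x
  have w'LP: "LP p lebesgue (w' m)" for m unfolding w'_def LP_Pair(1)[OF p0] using LPus(2) ws by blast
  have w'lim: "(\<lambda>m. NP p lebesgue (\<lambda>x. w' m x - w x)) \<longlonglongrightarrow> 0"
  proof -
    have e: "(\<lambda>x. w' m x - w x) = (\<lambda>x. (us m x - fst (w x), 0))" for m by (auto simp: w'_def prod_eq_iff)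
    have L: "LP p lebesgue (\<lambda>x. (us m x - fst (w x), 0 :: real^'n))" for m
      using LP_diff(1)[OF p0 w'LP w, of m] unfolding e .
    have "(\<lambda>m. 2 powr p * (NP p lebesgue (\<lambda>x. us m x - fst (w x)) + NP p lebesgue (\<lambda>x. 0 :: real^'n))) \<longlonglongrightarrow> 2 powr p * (0 + 0)"
      by (intro tendsto_intros uslim) simp
    hence R: "(\<lambda>m. 2 powr p * (NP p lebesgue (\<lambda>x. us m x - fst (w x)) + NP p lebesgue (\<lambda>x. 0 :: real^'n))) \<longlonglongrightarrow> 0" by simp
    show ?thesis unfolding e by (rule tendsto_sandwich[OF _ _ tendsto_const R]) (use LP_Pair(4)[OF p0 L] in auto)
  qed
  define D where "D m x = (a x (jet (us m) x) - a x (w' m x)) \<bullet> d m x" for m x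
  have mono0: "0 \<le> (a x (\<sigma>, \<xi>) - a x (\<sigma>, \<eta>)) \<bullet> (\<xi> - \<eta>)" for x \<sigma> \<xi> \<eta>
  proof (cases "x \<in> E \<and> \<xi> \<noteq> \<eta>")
    case True
    thus ?thesis using a_mono[of x \<xi> \<eta> \<sigma>] by simp
  next
    case False
    thus ?thesis using a_out[of x] by auto
  qed
  have D0: "0 \<le> D m x" for m x unfolding D_def d_def w'_def jet_def by (rule mono0)
  note aLP = a_nemytskii(1)[OF LPus(1)] and awLP = a_nemytskii(1)[OF w'LP] and awL = a_nemytskii(1)[OF w]
  note I1 = LP_pair_integrable[OF p aLP dLP] and I2 = LP_pair_integrable[OF p awLP dLP]
  have Dint: "integrable lebesgue (D m)" for m
    unfolding D_def inner_diff_left using I1[of m m] I2[of m m] by simp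
  have Dlim: "(\<lambda>m. \<integral>x. D m x \<partial>lebesgue) \<longlonglongrightarrow> 0"
  proof -
    have l1: "(\<lambda>m. \<integral>x. (a x (w' m x) - a x (w x)) \<bullet> d m x \<partial>lebesgue) \<longlonglongrightarrow> 0"
      by (rule LP_pair_tendsto_left[OF p LP_diff(1)[OF q0 awLP awL] a_nemytskii(3)[OF w'LP w w'lim] dLP dB])
    have "(\<lambda>m. (\<integral>x. a x (w x) \<bullet> grad (us m) x \<partial>lebesgue) - (\<integral>x. a x (w x) \<bullet> snd (w x) \<partial>lebesgue)) \<longlonglongrightarrow>
        (\<integral>x. a x (w x) \<bullet> snd (w x) \<partial>lebesgue) - (\<integral>x. a x (w x) \<bullet> snd (w x) \<partial>lebesgue)"
      by (intro tendsto_diff tendsto_const grad_weak_tendsto[OF us usC w v uslim awL])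
    moreover have "(\<integral>x. a x (w x) \<bullet> d m x \<partial>lebesgue) = (\<integral>x. a x (w x) \<bullet> grad (us m) x \<partial>lebesgue) - (\<integral>x. a x (w x) \<bullet> snd (w x) \<partial>lebesgue)" for m
      unfolding d_def inner_diff_right using LP_pair_integrable[OF p awL LPus(3)] LP_pair_integrable[OF p awL ws] by simp
    ultimately have l2: "(\<lambda>m. \<integral>x. a x (w x) \<bullet> d m x \<partial>lebesgue) \<longlonglongrightarrow> 0" by simp
    have "(\<integral>x. a x (w' m x) \<bullet> d m x \<partial>lebesgue) = (\<integral>x. (a x (w' m x) - a x (w x)) \<bullet> d m x \<partial>lebesgue) + (\<integral>x. a x (w x) \<bullet> d m x \<partial>lebesgue)" for m
      unfolding inner_diff_left using I2[of m m] LP_pair_integrable[OF p awL dLP[of m]] by simp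
    hence l3: "(\<lambda>m. \<integral>x. a x (w' m x) \<bullet> d m x \<partial>lebesgue) \<longlonglongrightarrow> 0" using tendsto_add[OF l1 l2] by simp
    have Deq: "(\<integral>x. D m x \<partial>lebesgue) = (\<integral>x. a x (jet (us m) x) \<bullet> d m x \<partial>lebesgue) - (\<integral>x. a x (w' m x) \<bullet> d m x \<partial>lebesgue)" for m
      unfolding D_def inner_diff_left using I1[of m m] I2[of m m] by simp
    show ?thesis
    proof (rule LIMSEQ_I)
      fix e :: real assume e: "0 < e"
      have "eventually (\<lambda>m. (\<integral>x. a x (jet (us m) x) \<bullet> d m x \<partial>lebesgue) < e / 2) sequentially"
        unfolding d_def using e by (intro energy_limsup[OF us usC w v uslim usae usuu usuv]) auto
      moreover have "eventually (\<lambda>m. - (e / 2) < (\<integral>x. a x (w' m x) \<bullet> d m x \<partial>lebesgue)) sequentially"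
        using e by (intro order_tendstoD(1)[OF l3]) auto
      ultimately have "eventually (\<lambda>m. norm ((\<integral>x. D m x \<partial>lebesgue) - 0) < e) sequentially"
      proof eventually_elim
        case (elim m)
        have "0 \<le> (\<integral>x. D m x \<partial>lebesgue)" by (rule Bochner_Integration.integral_nonneg[OF D0])
        thus ?case using elim Deq[of m] by simp
      qed
      thus "\<exists>no. \<forall>n\<ge>no. norm ((\<integral>x. D n x \<partial>lebesgue) - 0) < e" by (simp add: eventually_sequentially)
    qed
  qed
  have "\<exists>r H. strict_mono (r :: nat \<Rightarrow> nat) \<and> integrable lebesgue H \<and>
     (AE x in lebesgue. (\<forall>k. D (r k) x \<le> H x) \<and> (\<lambda>k. D (r k) x) \<longlonglongrightarrow> 0)"
    by (rule L1_dominated_subseq[OF Dint D0 Dlim]) blast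
  then obtain r2 H2 where r2: "strict_mono (r2 :: nat \<Rightarrow> nat)" and H2: "integrable lebesgue H2"
    and ae2: "AE x in lebesgue. (\<forall>k. D (r2 k) x \<le> H2 x) \<and> (\<lambda>k. D (r2 k) x) \<longlonglongrightarrow> 0" by blast
  obtain K where K: "0 \<le> K" "\<And>h :: real \<times> (real^'n) \<Rightarrow> real^'n.
     (\<forall>\<sigma> \<xi>. norm (h (\<sigma>, \<xi>)) \<le> \<beta> * (\<bar>\<sigma>\<bar> powr (p - 1) + norm \<xi> powr (p - 1))) \<Longrightarrow>
     (\<forall>\<sigma> \<xi>. \<alpha> * norm \<xi> powr p \<le> h (\<sigma>, \<xi>) \<bullet> \<xi>) \<Longrightarrow>
     (\<forall>\<sigma> \<xi> \<eta>. 0 \<le> (h (\<sigma>, \<xi>) - h (\<sigma>, \<eta>)) \<bullet> (\<xi> - \<eta>)) \<Longrightarrow>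
     (\<forall>\<sigma> \<xi> \<eta>. norm \<xi> powr p \<le> K * ((h (\<sigma>, \<xi>) - h (\<sigma>, \<eta>)) \<bullet> (\<xi> - \<eta>) + \<bar>\<sigma>\<bar> powr p + norm \<eta> powr p))"
    using gradient_growth_bound[OF p \<alpha> \<beta>] by blast
  \<comment> \<open>The right-hand side of \<open>gradient_growth_bound\<close> with its three terms
    replaced by majorants: \<open>H2\<close> for the monotonicity expression, \<open>H1\<close> for
    the functions and the fixed limiting gradient for \<open>\<eta>\<close>.\<close>
  define Gd where "Gd x = K * (\<bar>H2 x\<bar> + \<bar>H1 x\<bar> + norm (snd (w x)) powr p)" for x
  have GdI: "integrable lebesgue Gd" unfolding Gd_def using H1 H2 LP_integrable[OF ws] by auto
  have Gd0: "0 \<le> Gd x" for x unfolding Gd_def using K(1) by simp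
  have ae: "AE x in lebesgue. (\<forall>k. norm (jet (us (r2 k)) x) powr p \<le> 2 powr p * (\<bar>H1 x\<bar> + Gd x)) \<and> (\<lambda>k. jet (us (r2 k)) x) \<longlonglongrightarrow> w x"
    using ae1 ae2 out AE_E
  proof eventually_elim
    case (elim x)
    have ub: "norm (us (r2 k) x) powr p \<le> \<bar>H1 x\<bar>" for k
      using elim(1) unfolding us_def by (meson abs_ge_self order_trans)
    have ulim: "(\<lambda>k. us (r2 k) x) \<longlonglongrightarrow> fst (w x)"
      using LIMSEQ_subseq_LIMSEQ[OF conjunct2[OF elim(1)] r2] by (simp add: o_def us_def)
    have g: "norm (grad (us (r2 k)) x) powr p \<le> Gd x \<and> (\<lambda>k. grad (us (r2 k)) x) \<longlonglongrightarrow> snd (w x)" for k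
    proof (cases "x \<in> \<Omega>")
      case False
      hence "grad (us (r2 k)) x = 0" for k using test_fun_jet_outside(3)[OF us] by blast
      thus ?thesis using elim(3) False Gd0[of x] by simp
    next
      case True
      hence xE: "x \<in> E" using elim(4) by blast
      have Dx: "D (r2 k) x = (a x (us (r2 k) x, grad (us (r2 k)) x) - a x (us (r2 k) x, snd (w x))) \<bullet> (grad (us (r2 k)) x - snd (w x))" for k
        by (simp add: D_def d_def w'_def jet_def)
      have "(\<lambda>k. grad (us (r2 k)) x) \<longlonglongrightarrow> snd (w x)"
        by (rule monotone_limit[OF a_cont a_mono[OF xE] ulim]) (use elim(2) in \<open>simp_all add: Dx\<close>)
      moreover have "norm (grad (us (r2 k)) x) powr p \<le> Gd x"
      proof -
        have "norm (grad (us (r2 k)) x) powr p \<le> K * (D (r2 k) x + \<bar>us (r2 k) x\<bar> powr p + norm (snd (w x)) powr p)"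
          unfolding Dx using K(2)[of "a x"] a_growth a_coercive[OF xE] mono0 by blast
        also have "\<dots> \<le> Gd x"
        proof -
          have "D (r2 k) x \<le> \<bar>H2 x\<bar>" using elim(2) by (meson abs_ge_self order_trans)
          thus ?thesis unfolding Gd_def using K(1) ub[of k] by (intro mult_left_mono add_mono) auto
        qed
        finally show ?thesis .
      qed
      ultimately show ?thesis by blast
    qed
    have "norm (jet (us (r2 k)) x) powr p \<le> 2 powr p * (\<bar>H1 x\<bar> + Gd x)" for k
    proof -
      have "norm (jet (us (r2 k)) x) powr p \<le> 2 powr p * (norm (us (r2 k) x) powr p + norm (grad (us (r2 k)) x) powr p)"
        unfolding jet_def by (rule norm_Pair_powr(3)[OF p0])
      also have "\<dots> \<le> 2 powr p * (\<bar>H1 x\<bar> + Gd x)" using ub[of k] g[of k] by (intro mult_left_mono add_mono) auto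
      finally show ?thesis .
    qed
    moreover have "(\<lambda>k. jet (us (r2 k)) x) \<longlonglongrightarrow> w x"
      using tendsto_Pair[OF ulim conjunct2[OF g]] by (simp add: jet_def)
    ultimately show ?case by blast
  qed
  have "(\<lambda>k. \<integral>x. norm (jet (us (r2 k)) x - w x) powr p \<partial>lebesgue) \<longlonglongrightarrow> (\<integral>x. 0 \<partial>(lebesgue :: (real^'n) measure))"
  proof (rule integral_dominated_convergence)
    show "integrable lebesgue (\<lambda>x. 2 powr p * (2 powr p * (\<bar>H1 x\<bar> + Gd x) + norm (w x) powr p))"
      using H1 GdI LP_integrable[OF w] by auto
    show "(\<lambda>x. norm (jet (us (r2 k)) x - w x) powr p) \<in> borel_measurable lebesgue" for k
      using LP_integrable[OF LP_diff(1)[OF p0 LPus(1) w]] by (rule borel_measurable_integrable)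
    show "AE x in lebesgue. (\<lambda>k. norm (jet (us (r2 k)) x - w x) powr p) \<longlonglongrightarrow> 0"
      using ae
    proof eventually_elim
      case (elim x)
      hence "(\<lambda>k. jet (us (r2 k)) x - w x) \<longlonglongrightarrow> 0" by (simp add: LIM_zero_iff)
      thus ?case by (rule iffD2[OF norm_powr_tendsto_zero_iff[OF p0]])
    qed
    show "AE x in lebesgue. norm (norm (jet (us (r2 k)) x - w x) powr p) \<le> 2 powr p * (2 powr p * (\<bar>H1 x\<bar> + Gd x) + norm (w x) powr p)" for k
      using ae
    proof eventually_elim
      case (elim x)
      have "norm (jet (us (r2 k)) x - w x) powr p \<le> 2 powr p * (norm (jet (us (r2 k)) x) powr p + norm (w x) powr p)"
        by (rule norm_diff_powr_le[OF p0])
      also have "\<dots> \<le> 2 powr p * (2 powr p * (\<bar>H1 x\<bar> + Gd x) + norm (w x) powr p)"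
        using elim by (intro mult_left_mono add_right_mono) auto
      finally show ?case by simp
    qed
  qed auto
  hence "(\<lambda>k. NP p lebesgue (\<lambda>x. jet (u (r1 (r2 k))) x - w x)) \<longlonglongrightarrow> 0" by (simp add: NP_def us_def)
  moreover have "strict_mono (\<lambda>k. r1 (r2 k))" using strict_mono_o[OF r1 r2] by (simp add: o_def)
  ultimately show ?thesis by (intro exI[of _ "\<lambda>k. r1 (r2 k)"] conjI)
qed

lemma exists_solution: "\<exists>w. XW w \<and> (\<forall>\<phi>. XW \<phi> \<longrightarrow> pairing w \<phi> = 0)"
proof -
  obtain \<omega> :: "nat \<Rightarrow> real^'n \<Rightarrow> real" where \<omega>: "\<And>j. test_fun \<Omega> (\<omega> j)"
    and dense: "\<And>\<phi> e. test_fun \<Omega> \<phi> \<Longrightarrow> 0 < e \<Longrightarrow> \<exists>j. NP p lebesgue (\<lambda>x. jet (\<omega> j) x - jet \<phi> x) < e"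
    using test_fun_separable[OF bounded_\<Omega> p] by blast
  obtain u G where u: "\<And>m. test_fun \<Omega> (u m)" and G: "\<And>m. NP p lebesgue (grad (u m)) \<le> G"
    and uu: "\<And>m. pairing (jet (u m)) (jet (u m)) \<le> 0"
    and u\<omega>: "\<And>j. (\<lambda>m. pairing (jet (u m)) (jet (\<omega> j))) \<longlonglongrightarrow> 0"
    and ul: "\<And>l. (\<lambda>m. pairing (jet (u m)) (jet (u l))) \<longlonglongrightarrow> 0"
    using galerkin_sequence[of \<omega>, OF \<omega>] by blast
  obtain P where P: "P \<ge> 0" "\<And>v. test_fun \<Omega> v \<Longrightarrow> NP p lebesgue v \<le> P * NP p lebesgue (grad v)"
    using test_fun_norm_bounds by blast
  define C where "C = 2 powr p * (P * G + G)"
  have C: "NP p lebesgue (jet (u m)) \<le> C" for m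
  proof -
    have j: "jet (u m) = (\<lambda>x. (u m x, grad (u m) x))" by (simp add: jet_def[abs_def])
    have "NP p lebesgue (jet (u m)) \<le> 2 powr p * (NP p lebesgue (u m) + NP p lebesgue (grad (u m)))"
      using LP_Pair(4)[OF p0 test_fun_LP(1)[OF u p0, of m, unfolded j]] by (simp add: j)
    also have "\<dots> \<le> C"
    proof -
      have "NP p lebesgue (u m) \<le> P * G" using P(2)[OF u, of m] mult_left_mono[OF G[of m] P(1)] by linarith
      thus ?thesis unfolding C_def using G[of m] by (intro mult_left_mono add_mono) auto
    qed
    finally show ?thesis .
  qed
  obtain r u0 where r: "strict_mono (r :: nat \<Rightarrow> nat)" and u0: "LP p lebesgue u0"
    and lim: "(\<lambda>m. NP p lebesgue (\<lambda>x. u (r m) x - u0 x)) \<longlonglongrightarrow> 0"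
    using rellich[where v = u, OF u p bounded_\<Omega> G] by (elim exE conjE) (rule that)
  \<comment> \<open>Each \<open>u (r l)\<close> has this property and residuals are linear in the
    test function, so the Mazur sequence may be drawn from the test functions with vanishing
    residual, even where it leaves the Galerkin spaces.\<close>
  define Q where "Q v \<longleftrightarrow> (\<lambda>m. pairing (jet (u (r m))) (jet v)) \<longlonglongrightarrow> 0" for v
  have Qmid: "Q (\<lambda>x. 1/2 * v x + 1/2 * v' x)" if t: "test_fun \<Omega> v" "test_fun \<Omega> v'" and "Q v" "Q v'" for v v'
  proof -
    have "(\<lambda>m. 1/2 * pairing (jet (u (r m))) (jet v) + 1/2 * pairing (jet (u (r m))) (jet v')) \<longlonglongrightarrow> 1/2 * 0 + 1/2 * 0"
      using that(3,4) unfolding Q_def by (intro tendsto_intros)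
    thus ?thesis unfolding Q_def pairing_jet_lincomb[OF XW_jet[OF u] t] by simp
  qed
  have "Q (u (r l))" for l
    unfolding Q_def using LIMSEQ_subseq_LIMSEQ[OF ul[of "r l"] r] by (simp add: o_def)
  hence fr: "frequently (\<lambda>l. Q (u (r l))) sequentially" by (simp add: frequently_const)
  obtain v w where v: "\<And>k. test_fun \<Omega> (v k)" "\<And>k. Q (v k)" and w: "LP p lebesgue w"
    and vw: "(\<lambda>k. NP p lebesgue (\<lambda>x. jet (v k) x - w x)) \<longlonglongrightarrow> 0" and fw: "AE x in lebesgue. fst (w x) = u0 x"
    using mazur_jets[OF u C u0 lim Qmid fr] by blast
  have W: "XW w" by (rule XW_of_limit[OF v(1) w vw])
  have "NP p lebesgue (\<lambda>x. u (r m) x - fst (w x)) = NP p lebesgue (\<lambda>x. u (r m) x - u0 x)" for m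
  proof (rule NP_cong_AE)
    show "AE x in lebesgue. u (r m) x - fst (w x) = u (r m) x - u0 x" using fw by eventually_elim simp
  qed (intro LP_measurable[OF LP_diff(1)[OF p0 test_fun_LP(2)[OF u p0] LP_fst_snd(1)[OF p0 w]]]
      LP_measurable[OF LP_diff(1)[OF p0 test_fun_LP(2)[OF u p0] u0]])+
  hence lim': "(\<lambda>m. NP p lebesgue (\<lambda>x. u (r m) x - fst (w x))) \<longlonglongrightarrow> 0" using lim by simp
  have uv: "(\<lambda>m. pairing (jet (u (r m))) (jet (v k))) \<longlonglongrightarrow> 0" for k using v(2) by (simp add: Q_def)
  obtain r2 where r2: "strict_mono (r2 :: nat \<Rightarrow> nat)" "(\<lambda>k. NP p lebesgue (\<lambda>x. jet (u (r (r2 k))) x - w x)) \<longlonglongrightarrow> 0"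
    using strong_convergence[where u = "\<lambda>m. u (r m)", OF u C w v(1) vw lim' uu uv] by (elim exE conjE) (rule that)
  \<comment> \<open>The equation is extended in three stages: to the generating functions by strong
    convergence, to all test functions by density of the \<open>\<omega> j\<close>, and to the whole
    space by its definition as a closure.\<close>
  have z\<omega>: "pairing w (jet (\<omega> j)) = 0" for j
  proof -
    have "(\<lambda>k. pairing (jet (u (r (r2 k)))) (jet (\<omega> j))) \<longlonglongrightarrow> pairing w (jet (\<omega> j))"
      by (rule pairing_tendsto_left[OF W XW_jet[OF u] r2(2) XW_jet[OF \<omega>]])
    moreover have "(\<lambda>k. pairing (jet (u (r (r2 k)))) (jet (\<omega> j))) \<longlonglongrightarrow> 0"
      using LIMSEQ_subseq_LIMSEQ[OF u\<omega>[of j] strict_mono_o[OF r r2(1)]] by (simp add: o_def)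
    ultimately show ?thesis by (rule LIMSEQ_unique)
  qed
  have zt: "pairing w (jet \<phi>) = 0" if \<phi>: "test_fun \<Omega> \<phi>" for \<phi>
  proof -
    have "\<forall>k. \<exists>j. NP p lebesgue (\<lambda>x. jet (\<omega> j) x - jet \<phi> x) < inverse (real (Suc k))"
      by (intro allI dense[OF \<phi>]) simp
    from choice[OF this] obtain j where j: "\<forall>k. NP p lebesgue (\<lambda>x. jet (\<omega> (j k)) x - jet \<phi> x) < inverse (real (Suc k))" ..
    have "(\<lambda>k. NP p lebesgue (\<lambda>x. jet (\<omega> (j k)) x - jet \<phi> x)) \<longlonglongrightarrow> 0"
    proof (rule tendsto_sandwich[OF _ _ tendsto_const LIMSEQ_inverse_real_of_nat])
      show "\<forall>\<^sub>F k in sequentially. NP p lebesgue (\<lambda>x. jet (\<omega> (j k)) x - jet \<phi> x) \<le> inverse (real (Suc k))"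
        by (intro always_eventually allI less_imp_le[OF spec[OF j]])
    qed simp
    from pairing_tendsto_right[OF W XW_jet[OF \<phi>] XW_jet[OF \<omega>] this] show ?thesis by (simp add: z\<omega> LIMSEQ_const_iff)
  qed
  have "pairing w \<phi> = 0" if \<phi>: "XW \<phi>" for \<phi>
  proof -
    obtain t where t: "\<And>k. test_fun \<Omega> (t k)" "(\<lambda>k. NP p lebesgue (\<lambda>x. jet (t k) x - (fst (\<phi> x), snd (\<phi> x)))) \<longlonglongrightarrow> 0"
      using X1pD(2)[OF p \<phi>[unfolded XW_def]] by blast
    have "(\<lambda>k. NP p lebesgue (\<lambda>x. jet (t k) x - \<phi> x)) \<longlonglongrightarrow> 0" using t(2) by simp
    from pairing_tendsto_right[OF W \<phi> XW_jet[OF t(1)] this] show ?thesis by (simp add: zt[OF t(1)] LIMSEQ_const_iff)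
  qed
  with W show ?thesis by blast
qed

end

text \<open>A function almost everywhere equal to a measurable one is measurable for the completed
  measure. The original coefficients thereby inherit measurability and integrability from the
  cut-off ones.\<close>

lemma integral_lebesgue_cong_AE':
  fixes f g :: "'a::euclidean_space \<Rightarrow> 'b::euclidean_space"
  assumes f: "integrable lebesgue f" and ae: "AE x in lebesgue. f x = g x"
  shows "integrable lebesgue g" "(\<integral>x. g x \<partial>lebesgue) = (\<integral>x. f x \<partial>lebesgue)"
proof -
  have fm: "f \<in> borel_measurable lebesgue" using f by (rule borel_measurable_integrable)
  have gm: "g \<in> borel_measurable lebesgue" by (rule borel_measurable_AE[OF fm ae])
  show "integrable lebesgue g" using integrable_cong_AE_imp[OF f gm] ae by (simp add: eq_commute)
  show "(\<integral>x. g x \<partial>lebesgue) = (\<integral>x. f x \<partial>lebesgue)" by (rule integral_cong_AE[OF gm fm]) (use ae in eventually_elim, simp)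
qed

text \<open>Moves the kernel from the measure back into the integrand, the form in which the
  equation is stated.\<close>

lemma frac_integrand_integral:
  fixes u \<phi> :: "real^'n \<Rightarrow> real"
  assumes "u \<in> borel_measurable lebesgue" "\<phi> \<in> borel_measurable lebesgue"
    and I: "integrable (frac_measure p s) (\<lambda>z. signed_powr p (incr u z) * incr \<phi> z)" and p: "1 < p"
  shows "integrable (lebesgue \<Otimes>\<^sub>M lebesgue) (frac_integrand p s u \<phi>)"
    "integral\<^sup>L (lebesgue \<Otimes>\<^sub>M lebesgue) (frac_integrand p s u \<phi>) = (\<integral>z. signed_powr p (incr u z) * incr \<phi> z \<partial>frac_measure p s)"
proof -
  have e: "frac_integrand p s u \<phi> = (\<lambda>z. (1 / norm (fst z - snd z) powr (real CARD('n) + p * s)) *\<^sub>R (signed_powr p (incr u z) * incr \<phi> z))"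
    by (auto simp: frac_integrand_def incr_def signed_powr_def Let_def)
  have m: "(\<lambda>z. signed_powr p (incr u z) * incr \<phi> z) \<in> borel_measurable (lebesgue \<Otimes>\<^sub>M (lebesgue :: (real^'n) measure))"
    by (intro borel_measurable_times incr_measurable(2) assms(1,2)
        measurable_compose[OF incr_measurable(2)[OF assms(1)] borel_measurable_continuous_onI[OF signed_powr_continuous[OF p]]])
  show "integrable (lebesgue \<Otimes>\<^sub>M lebesgue) (frac_integrand p s u \<phi>)"
    using I unfolding e frac_measure_def by (subst (asm) integrable_density[OF m]) auto
  show "integral\<^sup>L (lebesgue \<Otimes>\<^sub>M lebesgue) (frac_integrand p s u \<phi>) = (\<integral>z. signed_powr p (incr u z) * incr \<phi> z \<partial>frac_measure p s)"
    unfolding e frac_measure_def by (subst integral_density[OF m]) auto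
qed

theorem theorem2p6:
  fixes \<Omega> :: "(real^'n) set"
    and p s :: real
    and a :: "real^'n \<Rightarrow> real \<Rightarrow> real^'n \<Rightarrow> real^'n"
    and F :: "real^'n \<Rightarrow> real \<Rightarrow> real^'n \<Rightarrow> real"
  assumes p: "1 < p" and s: "0 < s" "s < 1"
    and \<Omega>: "open \<Omega>" "bounded \<Omega>"
    and car_a: "caratheodory \<Omega> a" and car_F: "caratheodory \<Omega> F"
    and growth: "\<exists>\<beta>>0. AE x in lebesgue. x \<in> \<Omega> \<longrightarrow>
        (\<forall>\<sigma> \<xi>. norm (a x \<sigma> \<xi>) \<le> \<beta> * (\<bar>\<sigma>\<bar> powr (p - 1) + norm \<xi> powr (p - 1)))"
    and coercive: "\<exists>\<alpha>>0. AE x in lebesgue. x \<in> \<Omega> \<longrightarrow>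
        (\<forall>\<sigma> \<xi>. a x \<sigma> \<xi> \<bullet> \<xi> \<ge> \<alpha> * norm \<xi> powr p)"
    and monotone: "AE x in lebesgue. x \<in> \<Omega> \<longrightarrow>
        (\<forall>\<sigma> \<xi> \<eta>. \<xi> \<noteq> \<eta> \<longrightarrow> (a x \<sigma> \<xi> - a x \<sigma> \<eta>) \<bullet> (\<xi> - \<eta>) > 0)"
    and bound_F: "\<exists>f :: real^'n \<Rightarrow> real.
        set_borel_measurable lebesgue \<Omega> f
        \<and> set_integrable lebesgue \<Omega> (\<lambda>x. \<bar>f x\<bar> powr (p / (p - 1)))
        \<and> (AE x in lebesgue. x \<in> \<Omega> \<longrightarrow> (\<forall>\<sigma> \<eta>. \<bar>F x \<sigma> \<eta>\<bar> \<le> f x))"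
  shows "\<exists>u g. X1p p \<Omega> u g \<and>
     (\<forall>\<phi> \<psi>. X1p p \<Omega> \<phi> \<psi> \<longrightarrow>
        set_integrable lebesgue \<Omega> (\<lambda>x. a x (u x) (g x) \<bullet> \<psi> x)
        \<and> integrable (lebesgue \<Otimes>\<^sub>M lebesgue) (frac_integrand p s u \<phi>)
        \<and> set_integrable lebesgue \<Omega> (\<lambda>x. F x (u x) (g x) * \<phi> x)
        \<and> (LINT x:\<Omega>|lebesgue. a x (u x) (g x) \<bullet> \<psi> x)
            + integral\<^sup>L (lebesgue \<Otimes>\<^sub>M lebesgue) (frac_integrand p s u \<phi>)
          = (LINT x:\<Omega>|lebesgue. F x (u x) (g x) * \<phi> x))"
proof -
  obtain \<beta> where \<beta>: "\<beta> > 0" and ae_g: "AE x in lebesgue. x \<in> \<Omega> \<longrightarrow>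
        (\<forall>\<sigma> \<xi>. norm (a x \<sigma> \<xi>) \<le> \<beta> * (\<bar>\<sigma>\<bar> powr (p - 1) + norm \<xi> powr (p - 1)))" using growth by blast
  obtain \<alpha> where \<alpha>: "\<alpha> > 0" and ae_c: "AE x in lebesgue. x \<in> \<Omega> \<longrightarrow> (\<forall>\<sigma> \<xi>. a x \<sigma> \<xi> \<bullet> \<xi> \<ge> \<alpha> * norm \<xi> powr p)"
    using coercive by blast
  obtain f where fm: "set_borel_measurable lebesgue \<Omega> f" and fi: "set_integrable lebesgue \<Omega> (\<lambda>x. \<bar>f x\<bar> powr (p / (p - 1)))"
    and ae_f: "AE x in lebesgue. x \<in> \<Omega> \<longrightarrow> (\<forall>\<sigma> \<eta>. \<bar>F x \<sigma> \<eta>\<bar> \<le> f x)" using bound_F by blast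
  define good where "good x \<longleftrightarrow> continuous_on UNIV (\<lambda>z. a x (fst z) (snd z)) \<and> continuous_on UNIV (\<lambda>z. F x (fst z) (snd z)) \<and>
     (\<forall>\<sigma> \<xi>. norm (a x \<sigma> \<xi>) \<le> \<beta> * (\<bar>\<sigma>\<bar> powr (p - 1) + norm \<xi> powr (p - 1))) \<and>
     (\<forall>\<sigma> \<xi>. \<alpha> * norm \<xi> powr p \<le> a x \<sigma> \<xi> \<bullet> \<xi>) \<and>
     (\<forall>\<sigma> \<xi> \<eta>. \<xi> \<noteq> \<eta> \<longrightarrow> 0 < (a x \<sigma> \<xi> - a x \<sigma> \<eta>) \<bullet> (\<xi> - \<eta>)) \<and> (\<forall>\<sigma> \<eta>. \<bar>F x \<sigma> \<eta>\<bar> \<le> f x)" for x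
  have ca: "AE x in lebesgue. x \<in> \<Omega> \<longrightarrow> continuous_on UNIV (\<lambda>z. a x (fst z) (snd z))"
    and cF: "AE x in lebesgue. x \<in> \<Omega> \<longrightarrow> continuous_on UNIV (\<lambda>z. F x (fst z) (snd z))"
    using car_a car_F by (simp_all add: caratheodory_def)
  have "AE x in lebesgue. x \<in> \<Omega> \<longrightarrow> good x"
    using ca cF ae_g ae_c monotone ae_f by eventually_elim (simp add: good_def)
  then obtain N where "{x \<in> space lebesgue. \<not> (x \<in> \<Omega> \<longrightarrow> good x)} \<subseteq> N" "emeasure lebesgue N = 0" "N \<in> sets (lebesgue :: (real^'n) measure)"
    by (rule AE_E)
  hence N: "N \<in> null_sets lebesgue" "\<And>x. x \<in> \<Omega> \<Longrightarrow> x \<notin> N \<Longrightarrow> good x" by (auto intro: null_setsI)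
  \<comment> \<open>A single null set collects the exceptional points of all structure conditions.
    Since it is measurable, so is \<open>E\<close>, and multiplying the coefficients by its
    indicator preserves measurability.\<close>
  define E where "E = \<Omega> - N"
  have Em: "E \<in> sets lebesgue" unfolding E_def using \<Omega>(1) N(1) by auto
  have E\<Omega>: "E \<subseteq> \<Omega>" and Eg: "\<And>x. x \<in> E \<Longrightarrow> good x" using N(2) by (auto simp: E_def)
  have aeE: "AE x in lebesgue. x \<in> \<Omega> \<longrightarrow> x \<in> E" using AE_not_in[OF N(1)] by eventually_elim (simp add: E_def)
  define a' where "a' x z = indicator E x *\<^sub>R a x (fst z) (snd z)" for x z
  define F' where "F' x z = indicator E x * F x (fst z) (snd z)" for x z
  define f' where "f' x = indicator E x * f x" for x
  have restr: "(\<lambda>x. indicator E x *\<^sub>R h x) \<in> borel_measurable lebesgue" if "set_borel_measurable lebesgue \<Omega> h" for h :: "real^'n \<Rightarrow> 'c::euclidean_space"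
  proof -
    have "(\<lambda>x. indicator E x *\<^sub>R (indicator \<Omega> x *\<^sub>R h x)) \<in> borel_measurable lebesgue"
      by (rule borel_measurable_scaleR[OF borel_measurable_indicator[OF Em] that[unfolded set_borel_measurable_def]])
    moreover have "(\<lambda>x. indicator E x *\<^sub>R (indicator \<Omega> x *\<^sub>R h x)) = (\<lambda>x. indicator E x *\<^sub>R h x)"
      using E\<Omega> by (auto simp: fun_eq_iff split: split_indicator)
    ultimately show ?thesis by simp
  qed
  interpret LL: leray_lions \<Omega> E p s \<alpha> \<beta> a' F' f'
  proof
    show "AE x in lebesgue. x \<in> \<Omega> \<longrightarrow> x \<in> E" by (rule aeE)
    show "(\<lambda>x. a' x z) \<in> borel_measurable lebesgue" for z
      unfolding a'_def using car_a by (intro restr) (simp add: caratheodory_def)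
    show "(\<lambda>x. F' x z) \<in> borel_measurable lebesgue" for z
      unfolding F'_def using restr[of "\<lambda>x. F x (fst z) (snd z)"] car_F by (simp add: caratheodory_def)
    show "continuous_on UNIV (a' x)" for x
      unfolding a'_def[abs_def] using Eg[of x] by (cases "x \<in> E") (auto simp: good_def)
    show "continuous_on UNIV (F' x)" for x
      unfolding F'_def[abs_def] using Eg[of x] by (cases "x \<in> E") (auto simp: good_def)
    show "norm (a' x (\<sigma>, \<xi>)) \<le> \<beta> * (\<bar>\<sigma>\<bar> powr (p - 1) + norm \<xi> powr (p - 1))" for x \<sigma> \<xi>
      using Eg[of x] \<beta> by (cases "x \<in> E") (auto simp: a'_def good_def)
    show "\<alpha> * norm \<xi> powr p \<le> a' x (\<sigma>, \<xi>) \<bullet> \<xi>" if "x \<in> E" for x \<sigma> \<xi>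
      using Eg[OF that] that by (simp add: a'_def good_def)
    show "0 < (a' x (\<sigma>, \<xi>) - a' x (\<sigma>, \<eta>)) \<bullet> (\<xi> - \<eta>)" if "x \<in> E" "\<xi> \<noteq> \<eta>" for x \<sigma> \<xi> \<eta>
      using Eg[OF that(1)] that by (simp add: a'_def good_def)
    show "a' x z = 0" if "x \<notin> E" for x z using that by (simp add: a'_def)
    show "\<bar>F' x z\<bar> \<le> f' x" for x z
      using Eg[of x] by (cases "x \<in> E") (auto simp: F'_def f'_def good_def)
    show "LP (p / (p - 1)) lebesgue f'"
    proof (rule LP_minorant)
      show "f' \<in> borel_measurable lebesgue" unfolding f'_def[abs_def] using restr[OF fm] by simp
      show "integrable lebesgue (\<lambda>x. indicator \<Omega> x *\<^sub>R \<bar>f x\<bar> powr (p / (p - 1)))" using fi by (simp add: set_integrable_def)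
      show "AE x in lebesgue. norm (f' x) powr (p / (p - 1)) \<le> indicator \<Omega> x *\<^sub>R \<bar>f x\<bar> powr (p / (p - 1))"
        using E\<Omega> by (intro AE_I2) (auto simp: f'_def split: split_indicator)
    qed
  qed (use p s \<Omega> \<alpha> \<beta> in auto)
  obtain w where w: "LL.XW w" and sol: "\<And>\<phi>. LL.XW \<phi> \<Longrightarrow> LL.pairing w \<phi> = 0" using LL.exists_solution by blast
  define u where "u x = fst (w x)" for x
  define g where "g x = snd (w x)" for x
  have wug: "w x = (u x, g x)" for x by (simp add: u_def g_def)
  have X: "X1p p \<Omega> u g" using w unfolding LL.XW_def u_def[abs_def] g_def[abs_def] .
  have q0: "0 < p / (p - 1)" using p by simp
  show ?thesis
  proof (intro exI[of _ u] exI[of _ g] conjI X allI impI)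
    fix \<phi> \<psi> assume \<phi>\<psi>: "X1p p \<Omega> \<phi> \<psi>"
    define \<Phi> where "\<Phi> x = (\<phi> x, \<psi> x)" for x
    have \<Phi>: "LL.XW \<Phi>" using \<phi>\<psi> by (simp add: LL.XW_def \<Phi>_def)
    have \<Phi>LP: "LP p lebesgue \<phi>" "LP p lebesgue \<psi>"
      using LP_fst_snd(1,2)[OF LL.p0 LL.XW_LP[OF \<Phi>]] by (simp_all add: \<Phi>_def)
    have bLP: "LP (p / (p - 1)) lebesgue (\<lambda>x. LL.b x (w x))" by (rule LL.b_nemytskii(1)[OF LL.XW_LP[OF w]])
    have IF: "integrable lebesgue (\<lambda>x. F' x (w x) * \<phi> x)"
      using LP_pair_integrable[OF p LP_minus[OF LP_fst_snd(1)[OF q0 bLP]] \<Phi>LP(1)] by (simp add: LL.b_def)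
    have Ia: "integrable lebesgue (\<lambda>x. a' x (w x) \<bullet> \<psi> x)"
      using LP_pair_integrable[OF p LP_fst_snd(2)[OF q0 bLP] \<Phi>LP(2)] by (simp add: LL.b_def)
    \<comment> \<open>Outside the domain both sides vanish, and inside they can differ only off
      \<open>E\<close>, which is a null set.\<close>
    have aea: "AE x in lebesgue. a' x (w x) \<bullet> \<psi> x = indicator \<Omega> x *\<^sub>R (a x (u x) (g x) \<bullet> \<psi> x)"
      using aeE by eventually_elim (use E\<Omega> in \<open>auto simp: a'_def u_def g_def split: split_indicator\<close>)
    have aeF: "AE x in lebesgue. F' x (w x) * \<phi> x = indicator \<Omega> x *\<^sub>R (F x (u x) (g x) * \<phi> x)"
      using aeE by eventually_elim (use E\<Omega> in \<open>auto simp: F'_def u_def g_def split: split_indicator\<close>)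
    note ta = integral_lebesgue_cong_AE'[OF Ia aea] and tF = integral_lebesgue_cong_AE'[OF IF aeF]
    show "set_integrable lebesgue \<Omega> (\<lambda>x. a x (u x) (g x) \<bullet> \<psi> x)" unfolding set_integrable_def by (rule ta(1))
    show "set_integrable lebesgue \<Omega> (\<lambda>x. F x (u x) (g x) * \<phi> x)" unfolding set_integrable_def by (rule tF(1))
    have inc: "LL.wincr w = incr u" "LL.wincr \<Phi> = incr \<phi>" by (simp_all add: LL.wincr_def u_def[abs_def] \<Phi>_def)
    have I\<nu>: "integrable (frac_measure p s) (\<lambda>z. signed_powr p (incr u z) * incr \<phi> z)"
      using LP_pair_integrable[OF p LL.J_nemytskii(1)[OF LL.XW_incr[OF w]] LL.XW_incr[OF \<Phi>]] by (simp add: inc)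
    have um: "u \<in> borel_measurable lebesgue"
      using LP_measurable[OF LP_fst_snd(1)[OF LL.p0 LL.XW_LP[OF w]]] by (simp add: u_def[abs_def])
    note fr = frac_integrand_integral[OF um LP_measurable[OF \<Phi>LP(1)] I\<nu> p]
    show "integrable (lebesgue \<Otimes>\<^sub>M lebesgue) (frac_integrand p s u \<phi>)" by (rule fr(1))
    have "(\<integral>x. LL.b x (w x) \<bullet> \<Phi> x \<partial>lebesgue) = (\<integral>x. a' x (w x) \<bullet> \<psi> x \<partial>lebesgue) - (\<integral>x. F' x (w x) * \<phi> x \<partial>lebesgue)"
      using Ia IF by (simp add: LL.b_def \<Phi>_def)
    moreover have "LL.pairing w \<Phi> = 0" by (rule sol[OF \<Phi>])
    ultimately show "(LINT x:\<Omega>|lebesgue. a x (u x) (g x) \<bullet> \<psi> x) + integral\<^sup>L (lebesgue \<Otimes>\<^sub>M lebesgue) (frac_integrand p s u \<phi>)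
          = (LINT x:\<Omega>|lebesgue. F x (u x) (g x) * \<phi> x)"
      unfolding set_lebesgue_integral_def ta(2) tF(2) fr(2) by (simp add: LL.pairing_def inc)
  qed
qed

end
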